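(* Let $\mathcal{A}$ be any skeletally small abelian category for which $\mathcal{D}^b(\mathcal{A})$ is well-defined, i.e. it has $\mathrm{Hom}$ sets as opposed to proper classes, and identify $\mathcal{A}$ with the subcategory of $\mathcal{D}^b(\mathcal{A})$ consisting of the objects $X$ such that $H^i(X)=0$ for $i\neq0$. The following assertions hold: (1) If $Y\leq_{\Delta+\mathrm{nil}}X$ in $\mathcal{D}^b(\mathcal{A})$ and $X\in\mathcal{A}$, then $Y\in\mathcal{A}$. (2) If there is an object in $\mathcal{A}$ which has a monomorphic endomorphism which is not an isomorphism, then there is an object $X$ in $\mathcal{T}:=\mathcal{D}^b(\mathcal{A})$ such that $0\leq_{\Delta}X$ (and hence $[X]=0$ in $K_0(\mathcal{T})$), but $0\not\preceq_{\Delta+\mathrm{nil}}X$. Assertion (2) includes in particular the case of the category $\mathcal{A}=R\text{-}\mathrm{mod}$ of finitely generated $R$-modules, when $K$ is an integral domain and $R$ is a noetherian $K$-algebra which is torsion-free as a $K$-module and does not contain the field of fractions of $K$ as a subalgebra.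
   Context: $\mathcal{D}^b(\mathcal{A})$ is the bounded derived category of $\mathcal{A}$, and $H^i$ denotes the $i$-th homology. For objects $M,N$ of a skeletally small triangulated category $\mathcal{T}$ with shift $[1]$: $M\leq_{\Delta}N$ means that there are an object $Z$ and a distinguished triangle $Z\xrightarrow{\begin{pmatrix}v\\ u\end{pmatrix}}Z\oplus M\to N\to Z[1]$; $M\leq_{\Delta+\mathrm{nil}}N$ means that there is such a triangle with the endomorphism $v$ of $Z$ nilpotent. The relation $\preceq_{\Delta+\mathrm{nil}}$ is the smallest transitive relation on the set of isomorphism classes of objects of $\mathcal{T}$ containing $\leq_{\Delta+\mathrm{nil}}$. $K_0(\mathcal{T})$ is the Grothendieck group of $\mathcal{T}$ and $[X]$ is the class of $X$ in it. *)

theory Defs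
  imports Complex_Main "HOL-Algebra.Free_Abelian_Groups" "HOL-Algebra.Module" "HOL-Computational_Algebra.Fraction_Field"
begin

section \<open>Abelian categories\<close>

text \<open>Hom sets are pairwise disjoint (see the locale \<open>category\<close>), so composition and addition
  need no object arguments. The composite \<open>g \<cdot>\<^bsub>C\<^esub> f\<close> means first \<open>f\<close>, then \<open>g\<close>.\<close>

record ('o, 'a) cat =
  Ob :: "'o set"
  Hom :: "'o \<Rightarrow> 'o \<Rightarrow> 'a set"
  Idn :: "'o \<Rightarrow> 'a"
  Cmp :: "'a \<Rightarrow> 'a \<Rightarrow> 'a" (infixr \<open>\<cdot>\<index>\<close> 70)
  Add :: "'a \<Rightarrow> 'a \<Rightarrow> 'a" (infixl \<open>\<boxplus>\<index>\<close> 65)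
  Nul :: "'o \<Rightarrow> 'o \<Rightarrow> 'a"

definition hom_group :: "('o, 'a, 'z) cat_scheme \<Rightarrow> 'o \<Rightarrow> 'o \<Rightarrow> 'a monoid" where
  "hom_group C X Y = \<lparr>carrier = Hom C X Y, monoid.mult = Add C, one = Nul C X Y\<rparr>"

definition neg :: "('o, 'a, 'z) cat_scheme \<Rightarrow> 'o \<Rightarrow> 'o \<Rightarrow> 'a \<Rightarrow> 'a" where
  "neg C X Y f = inv\<^bsub>hom_group C X Y\<^esub> f"

locale category =
  fixes C :: "('o, 'a, 'z) cat_scheme" (structure)
  assumes hom_ob: "f \<in> Hom C X Y \<Longrightarrow> X \<in> Ob C \<and> Y \<in> Ob C"
    and hom_disjoint: "f \<in> Hom C X Y \<Longrightarrow> f \<in> Hom C X' Y' \<Longrightarrow> X = X' \<and> Y = Y'"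
    and idn_hom: "X \<in> Ob C \<Longrightarrow> Idn C X \<in> Hom C X X"
    and cmp_hom: "f \<in> Hom C X Y \<Longrightarrow> g \<in> Hom C Y Z \<Longrightarrow> g \<cdot> f \<in> Hom C X Z"
    and cmp_idn: "f \<in> Hom C X Y \<Longrightarrow> f \<cdot> Idn C X = f"
    and idn_cmp: "f \<in> Hom C X Y \<Longrightarrow> Idn C Y \<cdot> f = f"
    and cmp_assoc: "f \<in> Hom C W X \<Longrightarrow> g \<in> Hom C X Y \<Longrightarrow> h \<in> Hom C Y Z \<Longrightarrow>
                      (h \<cdot> g) \<cdot> f = h \<cdot> (g \<cdot> f)"

locale preadditive_category = category C for C :: "('o, 'a, 'z) cat_scheme" (structure) +
  assumes hom_comm_group: "X \<in> Ob C \<Longrightarrow> Y \<in> Ob C \<Longrightarrow> comm_group (hom_group C X Y)"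
    and cmp_add: "f \<in> Hom C X Y \<Longrightarrow> g \<in> Hom C Y Z \<Longrightarrow> g' \<in> Hom C Y Z \<Longrightarrow>
                    (g \<boxplus> g') \<cdot> f = g \<cdot> f \<boxplus> g' \<cdot> f"
    and add_cmp: "f \<in> Hom C X Y \<Longrightarrow> f' \<in> Hom C X Y \<Longrightarrow> g \<in> Hom C Y Z \<Longrightarrow>
                    g \<cdot> (f \<boxplus> f') = g \<cdot> f \<boxplus> g \<cdot> f'"

definition is_mono :: "('o, 'a, 'z) cat_scheme \<Rightarrow> 'o \<Rightarrow> 'o \<Rightarrow> 'a \<Rightarrow> bool" where
  "is_mono C X Y m \<longleftrightarrow> m \<in> Hom C X Y \<and>
     (\<forall>W. \<forall>g\<in>Hom C W X. \<forall>h\<in>Hom C W X. m \<cdot>\<^bsub>C\<^esub> g = m \<cdot>\<^bsub>C\<^esub> h \<longrightarrow> g = h)"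

definition is_epi :: "('o, 'a, 'z) cat_scheme \<Rightarrow> 'o \<Rightarrow> 'o \<Rightarrow> 'a \<Rightarrow> bool" where
  "is_epi C X Y e \<longleftrightarrow> e \<in> Hom C X Y \<and>
     (\<forall>W. \<forall>g\<in>Hom C Y W. \<forall>h\<in>Hom C Y W. g \<cdot>\<^bsub>C\<^esub> e = h \<cdot>\<^bsub>C\<^esub> e \<longrightarrow> g = h)"

definition is_isomorphism :: "('o, 'a, 'z) cat_scheme \<Rightarrow> 'o \<Rightarrow> 'o \<Rightarrow> 'a \<Rightarrow> bool" where
  "is_isomorphism C X Y f \<longleftrightarrow> f \<in> Hom C X Y \<and>
     (\<exists>g\<in>Hom C Y X. g \<cdot>\<^bsub>C\<^esub> f = Idn C X \<and> f \<cdot>\<^bsub>C\<^esub> g = Idn C Y)"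

definition zero_object :: "('o, 'a, 'z) cat_scheme \<Rightarrow> 'o \<Rightarrow> bool" where
  "zero_object C Z \<longleftrightarrow> Z \<in> Ob C \<and>
     (\<forall>X\<in>Ob C. (\<exists>!f. f \<in> Hom C X Z) \<and> (\<exists>!f. f \<in> Hom C Z X))"

definition is_biproduct ::
  "('o, 'a, 'z) cat_scheme \<Rightarrow> 'o \<Rightarrow> 'o \<Rightarrow> 'o \<Rightarrow> 'a \<Rightarrow> 'a \<Rightarrow> 'a \<Rightarrow> 'a \<Rightarrow> bool" where
  "is_biproduct C X Y W i1 i2 p1 p2 \<longleftrightarrow>
     i1 \<in> Hom C X W \<and> i2 \<in> Hom C Y W \<and> p1 \<in> Hom C W X \<and> p2 \<in> Hom C W Y \<and>
     p1 \<cdot>\<^bsub>C\<^esub> i1 = Idn C X \<and> p2 \<cdot>\<^bsub>C\<^esub> i2 = Idn C Y \<and>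
     p1 \<cdot>\<^bsub>C\<^esub> i2 = Nul C Y X \<and> p2 \<cdot>\<^bsub>C\<^esub> i1 = Nul C X Y \<and>
     (i1 \<cdot>\<^bsub>C\<^esub> p1) \<boxplus>\<^bsub>C\<^esub> (i2 \<cdot>\<^bsub>C\<^esub> p2) = Idn C W"

definition is_kernel :: "('o, 'a, 'z) cat_scheme \<Rightarrow> 'o \<Rightarrow> 'o \<Rightarrow> 'a \<Rightarrow> 'o \<Rightarrow> 'a \<Rightarrow> bool" where
  "is_kernel C X Y f K k \<longleftrightarrow> k \<in> Hom C K X \<and> f \<cdot>\<^bsub>C\<^esub> k = Nul C K Y \<and>
     (\<forall>W. \<forall>g\<in>Hom C W X. f \<cdot>\<^bsub>C\<^esub> g = Nul C W Y \<longrightarrow> (\<exists>!h. h \<in> Hom C W K \<and> k \<cdot>\<^bsub>C\<^esub> h = g))"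

definition is_cokernel :: "('o, 'a, 'z) cat_scheme \<Rightarrow> 'o \<Rightarrow> 'o \<Rightarrow> 'a \<Rightarrow> 'o \<Rightarrow> 'a \<Rightarrow> bool" where
  "is_cokernel C X Y f Q q \<longleftrightarrow> q \<in> Hom C Y Q \<and> q \<cdot>\<^bsub>C\<^esub> f = Nul C X Q \<and>
     (\<forall>W. \<forall>g\<in>Hom C Y W. g \<cdot>\<^bsub>C\<^esub> f = Nul C X W \<longrightarrow> (\<exists>!h. h \<in> Hom C Q W \<and> h \<cdot>\<^bsub>C\<^esub> q = g))"

locale abelian_category = preadditive_category C
  for C :: "('o, 'a, 'z) cat_scheme" (structure) +
  assumes ex_zero: "\<exists>Z. zero_object C Z"
    and ex_biproduct: "X \<in> Ob C \<Longrightarrow> Y \<in> Ob C \<Longrightarrow> \<exists>W i1 i2 p1 p2. is_biproduct C X Y W i1 i2 p1 p2"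
    and ex_kernel: "f \<in> Hom C X Y \<Longrightarrow> \<exists>K k. is_kernel C X Y f K k"
    and ex_cokernel: "f \<in> Hom C X Y \<Longrightarrow> \<exists>Q q. is_cokernel C X Y f Q q"
    and mono_normal: "is_mono C X Y m \<Longrightarrow> \<exists>Z. \<exists>f\<in>Hom C Y Z. is_kernel C Y Z f X m"
    and epi_normal: "is_epi C X Y e \<Longrightarrow> \<exists>W. \<exists>f\<in>Hom C W X. is_cokernel C W X f Y e"


section \<open>Bounded complexes, homology, homotopy\<close>

text \<open>Complexes are cohomologically graded: the differential \<open>Df X i\<close> goes from degree
  \<open>i\<close> to degree \<open>i + 1\<close>.\<close>

record ('o, 'a) cplx =
  Cob :: "int \<Rightarrow> 'o"
  Df :: "int \<Rightarrow> 'a"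

definition bounded_complex :: "('o, 'a) cat \<Rightarrow> ('o, 'a) cplx \<Rightarrow> bool" where
  "bounded_complex A X \<longleftrightarrow>
     (\<forall>i. Cob X i \<in> Ob A) \<and>
     (\<forall>i. Df X i \<in> Hom A (Cob X i) (Cob X (i + 1))) \<and>
     (\<forall>i. Df X (i + 1) \<cdot>\<^bsub>A\<^esub> Df X i = Nul A (Cob X i) (Cob X (i + 2))) \<and>
     (\<exists>n. \<forall>i. \<bar>i\<bar> > n \<longrightarrow> zero_object A (Cob X i))"

definition chain_map ::
  "('o, 'a) cat \<Rightarrow> ('o, 'a) cplx \<Rightarrow> ('o, 'a) cplx \<Rightarrow> (int \<Rightarrow> 'a) \<Rightarrow> bool" where
  "chain_map A X Y f \<longleftrightarrow> bounded_complex A X \<and> bounded_complex A Y \<and>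
     (\<forall>i. f i \<in> Hom A (Cob X i) (Cob Y i)) \<and>
     (\<forall>i. f (i + 1) \<cdot>\<^bsub>A\<^esub> Df X i = Df Y i \<cdot>\<^bsub>A\<^esub> f i)"

text \<open>\<open>k : K \<rightarrow> X\<^sup>i\<close> is the inclusion of the cycles, and \<open>q : K \<rightarrow> H\<close> the quotient of
  the cycles by the boundaries.\<close>

definition homology_presentation ::
  "('o, 'a) cat \<Rightarrow> ('o, 'a) cplx \<Rightarrow> int \<Rightarrow> 'o \<times> 'a \<times> 'o \<times> 'a \<Rightarrow> bool" where
  "homology_presentation A X i = (\<lambda>(K, k, H, q).
     is_kernel A (Cob X i) (Cob X (i + 1)) (Df X i) K k \<and>
     (\<exists>e\<in>Hom A (Cob X (i - 1)) K. k \<cdot>\<^bsub>A\<^esub> e = Df X (i - 1) \<and>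
        is_cokernel A (Cob X (i - 1)) K e H q))"

definition chosen_homology ::
  "('o, 'a) cat \<Rightarrow> ('o, 'a) cplx \<Rightarrow> int \<Rightarrow> 'o \<times> 'a \<times> 'o \<times> 'a" where
  "chosen_homology A X i = (SOME p. homology_presentation A X i p)"

definition homology :: "('o, 'a) cat \<Rightarrow> ('o, 'a) cplx \<Rightarrow> int \<Rightarrow> 'o" where
  "homology A X i = (case chosen_homology A X i of (K, k, H, q) \<Rightarrow> H)"

definition homology_map ::
  "('o, 'a) cat \<Rightarrow> ('o, 'a) cplx \<Rightarrow> ('o, 'a) cplx \<Rightarrow> (int \<Rightarrow> 'a) \<Rightarrow> int \<Rightarrow> 'a" where
  "homology_map A X Y f i =
     (case chosen_homology A X i of (K, k, H, q) \<Rightarrow>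
      case chosen_homology A Y i of (K', k', H', q') \<Rightarrow>
        THE h. h \<in> Hom A H H' \<and> (\<exists>g\<in>Hom A K K'. k' \<cdot>\<^bsub>A\<^esub> g = f i \<cdot>\<^bsub>A\<^esub> k \<and> h \<cdot>\<^bsub>A\<^esub> q = q' \<cdot>\<^bsub>A\<^esub> g))"

definition quasi_iso ::
  "('o, 'a) cat \<Rightarrow> ('o, 'a) cplx \<Rightarrow> ('o, 'a) cplx \<Rightarrow> (int \<Rightarrow> 'a) \<Rightarrow> bool" where
  "quasi_iso A X Y f \<longleftrightarrow> chain_map A X Y f \<and>
     (\<forall>i. is_isomorphism A (homology A X i) (homology A Y i) (homology_map A X Y f i))"

definition homotopic ::
  "('o, 'a) cat \<Rightarrow> ('o, 'a) cplx \<Rightarrow> ('o, 'a) cplx \<Rightarrow> (int \<Rightarrow> 'a) \<Rightarrow> (int \<Rightarrow> 'a) \<Rightarrow> bool" where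
  "homotopic A X Y f g \<longleftrightarrow> chain_map A X Y f \<and> chain_map A X Y g \<and>
     (\<exists>h. (\<forall>i. h i \<in> Hom A (Cob X i) (Cob Y (i - 1))) \<and>
          (\<forall>i. f i = g i \<boxplus>\<^bsub>A\<^esub> ((Df Y (i - 1) \<cdot>\<^bsub>A\<^esub> h i) \<boxplus>\<^bsub>A\<^esub> (h (i + 1) \<cdot>\<^bsub>A\<^esub> Df X i))))"


section \<open>The bounded homotopy category\<close>

text \<open>A homotopy class carries its source and target, so that hom sets are disjoint.\<close>

type_synonym ('o, 'a) htp_class = "('o, 'a) cplx \<times> ('o, 'a) cplx \<times> (int \<Rightarrow> 'a) set"

definition htp_class ::
  "('o, 'a) cat \<Rightarrow> ('o, 'a) cplx \<Rightarrow> ('o, 'a) cplx \<Rightarrow> (int \<Rightarrow> 'a) \<Rightarrow> ('o, 'a) htp_class" where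
  "htp_class A X Y f = (X, Y, {g. homotopic A X Y f g})"

definition Kb :: "('o, 'a) cat \<Rightarrow> (('o, 'a) cplx, ('o, 'a) htp_class) cat" where
  "Kb A = \<lparr>
     Ob = {X. bounded_complex A X},
     Hom = (\<lambda>X Y. {htp_class A X Y f | f. chain_map A X Y f}),
     Idn = (\<lambda>X. htp_class A X X (\<lambda>i. Idn A (Cob X i))),
     Cmp = (\<lambda>(_, Z, G) (X, _, F). (X, Z, \<Union>f\<in>F. \<Union>g\<in>G. {h. homotopic A X Z (\<lambda>i. g i \<cdot>\<^bsub>A\<^esub> f i) h})),
     Add = (\<lambda>(_, _, F) (X, Y, G). (X, Y, \<Union>f\<in>F. \<Union>g\<in>G. {h. homotopic A X Y (\<lambda>i. f i \<boxplus>\<^bsub>A\<^esub> g i) h})),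
     Nul = (\<lambda>X Y. htp_class A X Y (\<lambda>i. Nul A (Cob X i) (Cob Y i)))\<rparr>"

definition quasi_isos :: "('o, 'a) cat \<Rightarrow> ('o, 'a) htp_class set" where
  "quasi_isos A = {htp_class A X Y f | X Y f. quasi_iso A X Y f}"


section \<open>Localization by a calculus of fractions\<close>

text \<open>A roof \<open>(s, f)\<close> stands for the fraction \<open>f \<circ> s\<^sup>-\<^sup>1\<close>, where \<open>s : Z \<rightarrow> X\<close> lies in
  \<open>S\<close> and \<open>f : Z \<rightarrow> Y\<close>. A morphism is the set of all roofs equivalent to a given one. Sums are
  formed from roofs with a common denominator.\<close>

definition roofs :: "('o, 'a) cat \<Rightarrow> 'a set \<Rightarrow> 'o \<Rightarrow> 'o \<Rightarrow> ('a \<times> 'a) set" where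
  "roofs C S X Y = {(s, f). \<exists>Z\<in>Ob C. s \<in> Hom C Z X \<inter> S \<and> f \<in> Hom C Z Y}"

definition roof_class :: "('o, 'a) cat \<Rightarrow> 'a set \<Rightarrow> 'o \<Rightarrow> 'o \<Rightarrow> 'a \<times> 'a \<Rightarrow> ('a \<times> 'a) set" where
  "roof_class C S X Y = (\<lambda>(s, f). {(t, g). (s, f) \<in> roofs C S X Y \<and> (t, g) \<in> roofs C S X Y \<and>
     (\<exists>W Z Z'. \<exists>u\<in>Hom C W Z. \<exists>w\<in>Hom C W Z'.
        s \<in> Hom C Z X \<and> t \<in> Hom C Z' X \<and>
        s \<cdot>\<^bsub>C\<^esub> u = t \<cdot>\<^bsub>C\<^esub> w \<and> s \<cdot>\<^bsub>C\<^esub> u \<in> S \<and> f \<cdot>\<^bsub>C\<^esub> u = g \<cdot>\<^bsub>C\<^esub> w)})"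

definition localization :: "('o, 'a) cat \<Rightarrow> 'a set \<Rightarrow> ('o, ('a \<times> 'a) set) cat" where
  "localization C S = \<lparr>
     Ob = Ob C,
     Hom = (\<lambda>X Y. roof_class C S X Y ` roofs C S X Y),
     Idn = (\<lambda>X. roof_class C S X X (Idn C X, Idn C X)),
     Cmp = (\<lambda>G F. \<Union>{roof_class C S X Z (s \<cdot>\<^bsub>C\<^esub> w, g \<cdot>\<^bsub>C\<^esub> h) | X Y Z U V W s f t g w h.
        (s, f) \<in> F \<and> s \<in> Hom C U X \<and> f \<in> Hom C U Y \<and>
        (t, g) \<in> G \<and> t \<in> Hom C V Y \<and> g \<in> Hom C V Z \<and>
        w \<in> Hom C W U \<inter> S \<and> h \<in> Hom C W V \<and> f \<cdot>\<^bsub>C\<^esub> w = t \<cdot>\<^bsub>C\<^esub> h}),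
     Add = (\<lambda>F G. \<Union>{roof_class C S X Y (s, f \<boxplus>\<^bsub>C\<^esub> g) | X Y U s f g.
        (s, f) \<in> F \<and> (s, g) \<in> G \<and> s \<in> Hom C U X \<and> f \<in> Hom C U Y \<and> g \<in> Hom C U Y}),
     Nul = (\<lambda>X Y. roof_class C S X Y (Idn C X, Nul C X Y))\<rparr>"

definition loc_map :: "('o, 'a) cat \<Rightarrow> 'a set \<Rightarrow> 'o \<Rightarrow> 'o \<Rightarrow> 'a \<Rightarrow> ('a \<times> 'a) set" where
  "loc_map C S X Y f = roof_class C S X Y (Idn C X, f)"


section \<open>Categories with shift and distinguished triangles\<close>

text \<open>A triangle \<open>X \<rightarrow> Y \<rightarrow> Z \<rightarrow> X[1]\<close> is represented by its three morphisms.\<close>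

record ('o, 'a) tcat = "('o, 'a) cat" +
  Shift :: "'o \<Rightarrow> 'o"
  Shift_map :: "'a \<Rightarrow> 'a"
  Dist :: "('a \<times> 'a \<times> 'a) set"

definition distinguished :: "('o, 'a) tcat \<Rightarrow> 'o \<Rightarrow> 'o \<Rightarrow> 'o \<Rightarrow> 'a \<Rightarrow> 'a \<Rightarrow> 'a \<Rightarrow> bool" where
  "distinguished T X Y Z a b c \<longleftrightarrow>
     a \<in> Hom T X Y \<and> b \<in> Hom T Y Z \<and> c \<in> Hom T Z (Shift T X) \<and> (a, b, c) \<in> Dist T"

definition nilpotent_endo :: "('o, 'a, 'z) cat_scheme \<Rightarrow> 'o \<Rightarrow> 'a \<Rightarrow> bool" where
  "nilpotent_endo C X v \<longleftrightarrow> v \<in> Hom C X X \<and>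
     (\<exists>n. ((\<lambda>g. v \<cdot>\<^bsub>C\<^esub> g) ^^ n) (Idn C X) = Nul C X X)"

text \<open>The first component \<open>v\<close> of \<open>a : Z \<rightarrow> Z \<oplus> M\<close> is \<open>p1 \<cdot>\<^bsub>T\<^esub> a\<close>, for \<open>W\<close> a biproduct of
  \<open>Z\<close> and \<open>M\<close>.\<close>

definition le_Delta :: "('o, 'a) tcat \<Rightarrow> 'o \<Rightarrow> 'o \<Rightarrow> bool" where
  "le_Delta T M N \<longleftrightarrow> (\<exists>Z W i1 i2 p1 p2 a b c.
     is_biproduct T Z M W i1 i2 p1 p2 \<and> distinguished T Z W N a b c)"

definition le_Delta_nil :: "('o, 'a) tcat \<Rightarrow> 'o \<Rightarrow> 'o \<Rightarrow> bool" where
  "le_Delta_nil T M N \<longleftrightarrow> (\<exists>Z W i1 i2 p1 p2 a b c.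
     is_biproduct T Z M W i1 i2 p1 p2 \<and> distinguished T Z W N a b c \<and>
     nilpotent_endo T Z (p1 \<cdot>\<^bsub>T\<^esub> a))"

definition iso_class :: "('o, 'a, 'z) cat_scheme \<Rightarrow> 'o \<Rightarrow> 'o set" where
  "iso_class C X = {Y \<in> Ob C. \<exists>f. is_isomorphism C X Y f}"

definition prec_Delta_nil :: "('o, 'a) tcat \<Rightarrow> 'o \<Rightarrow> 'o \<Rightarrow> bool" where
  "prec_Delta_nil T M N \<longleftrightarrow> (iso_class T M, iso_class T N) \<in>
     {(iso_class T X, iso_class T Y) | X Y. X \<in> Ob T \<and> Y \<in> Ob T \<and> le_Delta_nil T X Y}\<^sup>+"

definition K0_relations :: "('o, 'a) tcat \<Rightarrow> ('o set \<Rightarrow>\<^sub>0 int) set" where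
  "K0_relations T = {frag_of (iso_class T Y) - frag_of (iso_class T X) - frag_of (iso_class T Z) |
     X Y Z a b c. distinguished T X Y Z a b c}"

definition K0_subgroup :: "('o, 'a) tcat \<Rightarrow> ('o set \<Rightarrow>\<^sub>0 int) set" where
  "K0_subgroup T = generate (free_Abelian_group (iso_class T ` Ob T)) (K0_relations T)"

text \<open>The group \<open>K0 T\<close> is written multiplicatively, so its neutral element is \<open>\<one>\<^bsub>K0 T\<^esub>\<close>.\<close>

definition K0 :: "('o, 'a) tcat \<Rightarrow> ('o set \<Rightarrow>\<^sub>0 int) set monoid" where
  "K0 T = free_Abelian_group (iso_class T ` Ob T) Mod K0_subgroup T"

definition K0_class :: "('o, 'a) tcat \<Rightarrow> 'o \<Rightarrow> ('o set \<Rightarrow>\<^sub>0 int) set" where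
  "K0_class T X =
     K0_subgroup T #>\<^bsub>free_Abelian_group (iso_class T ` Ob T)\<^esub> frag_of (iso_class T X)"


section \<open>The bounded derived category\<close>

definition shift_cplx :: "('o, 'a) cat \<Rightarrow> ('o, 'a) cplx \<Rightarrow> ('o, 'a) cplx" where
  "shift_cplx A X = \<lparr>Cob = (\<lambda>i. Cob X (i + 1)),
     Df = (\<lambda>i. neg A (Cob X (i + 1)) (Cob X (i + 2)) (Df X (i + 1)))\<rparr>"

definition shift_htp :: "('o, 'a) cat \<Rightarrow> ('o, 'a) htp_class \<Rightarrow> ('o, 'a) htp_class" where
  "shift_htp A = (\<lambda>(X, Y, F). (shift_cplx A X, shift_cplx A Y, (\<lambda>f i. f (i + 1)) ` F))"

text \<open>\<open>C\<close> is a mapping cone of \<open>f : X \<rightarrow> Y\<close>: in degree \<open>i\<close> it is \<open>X\<^sup>i\<^sup>+\<^sup>1 \<oplus> Y\<^sup>i\<close>, with differential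
  \<open>(x, y) \<mapsto> (- d x, f x + d y)\<close>. The chain maps \<open>\<iota> : Y \<rightarrow> C\<close> and \<open>\<pi> : C \<rightarrow> X[1]\<close> are the
  canonical inclusion and projection.\<close>

definition is_cone ::
  "('o, 'a) cat \<Rightarrow> ('o, 'a) cplx \<Rightarrow> ('o, 'a) cplx \<Rightarrow> (int \<Rightarrow> 'a) \<Rightarrow>
   ('o, 'a) cplx \<Rightarrow> (int \<Rightarrow> 'a) \<Rightarrow> (int \<Rightarrow> 'a) \<Rightarrow> bool" where
  "is_cone A X Y f C \<iota> \<pi> \<longleftrightarrow> chain_map A X Y f \<and>
     (\<exists>j p. \<forall>i. is_biproduct A (Cob X (i + 1)) (Cob Y i) (Cob C i) (j i) (\<iota> i) (\<pi> i) (p i) \<and>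
       Df C i =
         (j (i + 1) \<cdot>\<^bsub>A\<^esub> neg A (Cob X (i + 1)) (Cob X (i + 2)) (Df X (i + 1)) \<cdot>\<^bsub>A\<^esub> \<pi> i)
         \<boxplus>\<^bsub>A\<^esub> (\<iota> (i + 1) \<cdot>\<^bsub>A\<^esub> f (i + 1) \<cdot>\<^bsub>A\<^esub> \<pi> i)
         \<boxplus>\<^bsub>A\<^esub> (\<iota> (i + 1) \<cdot>\<^bsub>A\<^esub> Df Y i \<cdot>\<^bsub>A\<^esub> p i))"

type_synonym ('o, 'a) db_arr = "(('o, 'a) htp_class \<times> ('o, 'a) htp_class) set"

definition shift_db :: "('o, 'a) cat \<Rightarrow> ('o, 'a) db_arr \<Rightarrow> ('o, 'a) db_arr" where
  "shift_db A F = map_prod (shift_htp A) (shift_htp A) ` F"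

definition db_map ::
  "('o, 'a) cat \<Rightarrow> ('o, 'a) cplx \<Rightarrow> ('o, 'a) cplx \<Rightarrow> (int \<Rightarrow> 'a) \<Rightarrow> ('o, 'a) db_arr" where
  "db_map A X Y f = loc_map (Kb A) (quasi_isos A) X Y (htp_class A X Y f)"

text \<open>The distinguished triangles are those isomorphic to the triangle
  \<open>P \<rightarrow> Q \<rightarrow> C \<rightarrow> P[1]\<close> of a mapping cone.\<close>

definition db_triangles ::
  "('o, 'a) cat \<Rightarrow> (('o, 'a) db_arr \<times> ('o, 'a) db_arr \<times> ('o, 'a) db_arr) set" where
  "db_triangles A = (let L = localization (Kb A) (quasi_isos A) in
     {(a, b, c). \<exists>X Y Z P Q C f \<iota> \<pi> x y z.
        a \<in> Hom L X Y \<and> b \<in> Hom L Y Z \<and> c \<in> Hom L Z (shift_cplx A X) \<and>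
        is_cone A P Q f C \<iota> \<pi> \<and>
        is_isomorphism L X P x \<and> is_isomorphism L Y Q y \<and> is_isomorphism L Z C z \<and>
        y \<cdot>\<^bsub>L\<^esub> a = db_map A P Q f \<cdot>\<^bsub>L\<^esub> x \<and>
        z \<cdot>\<^bsub>L\<^esub> b = db_map A Q C \<iota> \<cdot>\<^bsub>L\<^esub> y \<and>
        shift_db A x \<cdot>\<^bsub>L\<^esub> c = db_map A C (shift_cplx A P) \<pi> \<cdot>\<^bsub>L\<^esub> z})"

definition Db :: "('o, 'a) cat \<Rightarrow> (('o, 'a) cplx, ('o, 'a) db_arr) tcat" where
  "Db A = cat.extend (localization (Kb A) (quasi_isos A))
            (tcat.fields (shift_cplx A) (shift_db A) (db_triangles A))"

text \<open>The subcategory of the derived category that is identified with \<open>A\<close>.\<close>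

definition heart :: "('o, 'a) cat \<Rightarrow> ('o, 'a) cplx set" where
  "heart A = {X \<in> Ob (Db A). \<forall>i. i \<noteq> 0 \<longrightarrow> zero_object A (homology A X i)}"


section \<open>Finitely generated left modules\<close>

text \<open>The scalars are a whole type \<open>'r\<close>, while modules have carriers inside a type \<open>'m\<close>. The
  record type \<^typ>\<open>('r, 'm) module\<close> also has fields for a ring structure on the module, which play
  no role here.\<close>

definition left_module :: "('r::ring_1, 'm) module \<Rightarrow> bool" where
  "left_module M \<longleftrightarrow> abelian_group M \<and>
     (\<forall>r. \<forall>x\<in>carrier M. r \<odot>\<^bsub>M\<^esub> x \<in> carrier M) \<and>
     (\<forall>r s. \<forall>x\<in>carrier M. (r + s) \<odot>\<^bsub>M\<^esub> x = r \<odot>\<^bsub>M\<^esub> x \<oplus>\<^bsub>M\<^esub> s \<odot>\<^bsub>M\<^esub> x) \<and>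
     (\<forall>r. \<forall>x\<in>carrier M. \<forall>y\<in>carrier M. r \<odot>\<^bsub>M\<^esub> (x \<oplus>\<^bsub>M\<^esub> y) = r \<odot>\<^bsub>M\<^esub> x \<oplus>\<^bsub>M\<^esub> r \<odot>\<^bsub>M\<^esub> y) \<and>
     (\<forall>r s. \<forall>x\<in>carrier M. (r * s) \<odot>\<^bsub>M\<^esub> x = r \<odot>\<^bsub>M\<^esub> (s \<odot>\<^bsub>M\<^esub> x)) \<and>
     (\<forall>x\<in>carrier M. 1 \<odot>\<^bsub>M\<^esub> x = x)"

definition left_submodule :: "('r::ring_1, 'm) module \<Rightarrow> 'm set \<Rightarrow> bool" where
  "left_submodule M N \<longleftrightarrow> N \<subseteq> carrier M \<and> \<zero>\<^bsub>M\<^esub> \<in> N \<and>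
     (\<forall>x\<in>N. \<forall>y\<in>N. x \<oplus>\<^bsub>M\<^esub> y \<in> N) \<and> (\<forall>r. \<forall>x\<in>N. r \<odot>\<^bsub>M\<^esub> x \<in> N)"

definition fg_module :: "('r::ring_1, 'm) module \<Rightarrow> bool" where
  "fg_module M \<longleftrightarrow> left_module M \<and>
     (\<exists>B\<subseteq>carrier M. finite B \<and> left_submodule M hull B = carrier M)"

definition module_homs ::
  "('r::ring_1, 'm) module \<Rightarrow> ('r, 'm) module \<Rightarrow> ('m \<Rightarrow> 'm) set" where
  "module_homs M N = {f \<in> carrier M \<rightarrow>\<^sub>E carrier N.
     (\<forall>x\<in>carrier M. \<forall>y\<in>carrier M. f (x \<oplus>\<^bsub>M\<^esub> y) = f x \<oplus>\<^bsub>N\<^esub> f y) \<and>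
     (\<forall>r. \<forall>x\<in>carrier M. f (r \<odot>\<^bsub>M\<^esub> x) = r \<odot>\<^bsub>N\<^esub> f x)}"

type_synonym ('r, 'm) module_arr = "('r, 'm) module \<times> ('r, 'm) module \<times> ('m \<Rightarrow> 'm)"

definition fg_modules :: "(('r::ring_1, 'm) module, ('r, 'm) module_arr) cat" where
  "fg_modules = \<lparr>
     Ob = {M. fg_module M},
     Hom = (\<lambda>M N. {(M, N, f) | f. fg_module M \<and> fg_module N \<and> f \<in> module_homs M N}),
     Idn = (\<lambda>M. (M, M, \<lambda>x\<in>carrier M. x)),
     Cmp = (\<lambda>(_, P, g) (M, _, f). (M, P, compose (carrier M) g f)),
     Add = (\<lambda>(_, _, f) (M, N, g). (M, N, \<lambda>x\<in>carrier M. f x \<oplus>\<^bsub>N\<^esub> g x)),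
     Nul = (\<lambda>M N. (M, N, \<lambda>x\<in>carrier M. \<zero>\<^bsub>N\<^esub>))\<rparr>"

text \<open>Every finitely generated \<open>'r\<close>-module is a quotient of some \<open>'r\<^sup>n\<close>, hence has at most as many
  elements as \<^typ>\<open>'r list\<close>. Under the following condition the objects of \<^const>\<open>fg_modules\<close>
  therefore represent every isomorphism class of finitely generated modules.\<close>

definition large_enough :: "'r::ring_1 itself \<Rightarrow> 'm itself \<Rightarrow> bool" where
  "large_enough _ _ \<longleftrightarrow> (\<exists>e :: 'r list \<Rightarrow> 'm. inj e)"


section \<open>Algebras over an integral domain\<close>

definition left_ideal :: "'r::ring_1 set \<Rightarrow> bool" where
  "left_ideal I \<longleftrightarrow> 0 \<in> I \<and> (\<forall>x\<in>I. \<forall>y\<in>I. x + y \<in> I) \<and> (\<forall>r. \<forall>x\<in>I. r * x \<in> I)"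

definition left_noetherian :: "'r::ring_1 itself \<Rightarrow> bool" where
  "left_noetherian _ \<longleftrightarrow> (\<forall>I :: 'r set. left_ideal I \<longrightarrow> (\<exists>B. finite B \<and> I = left_ideal hull B))"

definition algebra_over :: "('k::comm_ring_1 \<Rightarrow> 'r::ring_1 \<Rightarrow> 'r) \<Rightarrow> bool" where
  "algebra_over scale \<longleftrightarrow> Modules.module scale \<and>
     (\<forall>k x y. scale k (x * y) = scale k x * y \<and> scale k (x * y) = x * scale k y)"

definition torsion_free :: "('k::idom \<Rightarrow> 'r::ring_1 \<Rightarrow> 'r) \<Rightarrow> bool" where
  "torsion_free scale \<longleftrightarrow> (\<forall>k x. scale k x = 0 \<longrightarrow> k = 0 \<or> x = 0)"

definition contains_fraction_field :: "('k::idom \<Rightarrow> 'r::ring_1 \<Rightarrow> 'r) \<Rightarrow> bool" where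
  "contains_fraction_field scale \<longleftrightarrow> (\<exists>\<phi> :: 'k fract \<Rightarrow> 'r. inj \<phi> \<and> \<phi> 1 = 1 \<and>
     (\<forall>x y. \<phi> (x + y) = \<phi> x + \<phi> y) \<and> (\<forall>x y. \<phi> (x * y) = \<phi> x * \<phi> y) \<and>
     (\<forall>k x. \<phi> (Fract k 1 * x) = scale k (\<phi> x)))"

end

theory Submission
  imports Defs
begin

text \<open>
  Call an arrow of the derived category surjective (injective) in degree \<open>i\<close> if it is an epimorphism
  (a monomorphism) on \<open>H\<^sup>i\<close>. Let \<open>Z \<rightarrow> Z \<oplus> M \<rightarrow> N \<rightarrow> Z[1]\<close> be a triangle with first arrow \<open>a\<close>, and let
  the component \<open>v = p\<^sub>1 a\<close> be nilpotent. If \<open>H\<^sup>i(N) = 0\<close>, then \<open>a\<close> is surjective in degree \<open>i\<close> by the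
  long exact sequence, hence so are \<open>v\<close>, all powers of \<open>v\<close>, and finally the zero endomorphism of \<open>Z\<close>.
  So \<open>H\<^sup>i(Z) = 0\<close>, then \<open>H\<^sup>i(Z \<oplus> M) = 0\<close> because \<open>a\<close> is surjective, and \<open>H\<^sup>i(M) = 0\<close> because \<open>M\<close> is a
  direct summand. With all \<open>i \<noteq> 0\<close> this is the first assertion (\<open>heart_closed_le_Delta_nil\<close>).

  For the second one, let \<open>f : M \<rightarrow> M\<close> be a monomorphism that is not an isomorphism, and \<open>X\<close> its cone,
  whose homology is the nonzero cokernel of \<open>f\<close>, in degree \<open>0\<close>. The triangle \<open>M \<rightarrow> M \<rightarrow> X \<rightarrow> M[1]\<close> shows
  \<open>0 \<le> X\<close> for the degeneration order without nilpotence, and \<open>[X] = [M] - [M] = 0\<close>. A chain of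
  nilpotent degenerations from \<open>0\<close> to \<open>X\<close> would stay inside the heart by the first assertion, and
  each step leads from an acyclic object to an acyclic object (\<open>le_Delta_nil_zero\<close>): if \<open>M\<close> is acyclic,
  then \<open>p\<^sub>1\<close> is injective in every degree, and \<open>a\<close> is injective in degree \<open>0\<close> because \<open>H\<^sup>-\<^sup>1(N) = 0\<close>;
  so the nilpotent \<open>v\<close> is injective in degree \<open>0\<close>, and \<open>H\<^sup>0(Z) = 0\<close>. As also \<open>H\<^sup>1(Z) = 0\<close>, the
  long exact sequence gives \<open>H\<^sup>0(N) = 0\<close>. Then \<open>X\<close> would be acyclic, which it is not.

  The functors \<open>H\<^sup>i\<close> on the derived category enter only through the two predicates above, and these are
  expressed by generalised elements: an element of \<open>X\<^sup>i\<close> is an arrow \<open>T \<rightarrow> X\<^sup>i\<close>, and whenever an element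
  has to be chosen, one may first pass to a cover, that is, compose with an epimorphism \<open>T' \<rightarrow> T\<close>. This
  is sound because epimorphisms in an abelian category are stable under pullback (\<open>epi_pullback\<close>).
  With this convention diagram chases read as in a category of modules; in particular the predicates
  obey the laws of surjective and injective maps, and the quasi-isomorphisms are the arrows that
  satisfy both in every degree (\<open>quasi_iso_iff\<close>). A fraction is surjective or injective when its
  numerator is, and this can be tested on any roof that represents it. To form composites one needs to
  complete an arrow and a quasi-isomorphism to a square (\<open>quasi_iso_ore\<close>), which is done
  by a homotopy fibre product; it and the mapping cone are both instances of one construction, the
  twisted extension of two complexes.

  For modules over a noetherian ring, kernels are finitely generated, and coordinate vectors embed each
  finitely generated module into lists of scalars, which makes room for direct sums in the given
  type of elements. If every nonzero element of the domain \<open>K\<close> became invertible in the algebra \<open>R\<close>, then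
  \<open>R\<close> would contain the fraction field; so some nonzero \<open>k\<close> is not invertible, and multiplication by \<open>k\<close>
  on \<open>R\<close> is the required monomorphism.
\<close>

section \<open>Arrow calculus in preadditive and abelian categories\<close>


context category begin

text \<open>The simplifier can compute the source and the target of a composite, whereas a side condition
  \<open>f \<in> Hom C X Y\<close> would make it guess \<open>X\<close> and \<open>Y\<close>. Hence the rules below are conditional on equations between
  sources and targets, and \<open>hom_iff\<close> translates.\<close>

definition arr :: "'a \<Rightarrow> bool" where "arr f \<longleftrightarrow> (\<exists>X Y. f \<in> Hom C X Y)"
definition src :: "'a \<Rightarrow> 'o" where "src f = (THE X. \<exists>Y. f \<in> Hom C X Y)"
definition tgt :: "'a \<Rightarrow> 'o" where "tgt f = (THE Y. \<exists>X. f \<in> Hom C X Y)"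

lemma hom_iff: "f \<in> Hom C X Y \<longleftrightarrow> arr f \<and> src f = X \<and> tgt f = Y"
proof
  assume f: "f \<in> Hom C X Y"
  have "src f = X" unfolding src_def using f hom_disjoint by (intro the_equality) blast+
  moreover have "tgt f = Y" unfolding tgt_def using f hom_disjoint by (intro the_equality) blast+
  ultimately show "arr f \<and> src f = X \<and> tgt f = Y" using f arr_def by blast
next
  assume a: "arr f \<and> src f = X \<and> tgt f = Y"
  then obtain X' Y' where f: "f \<in> Hom C X' Y'" unfolding arr_def by blast
  have "src f = X'" unfolding src_def using f hom_disjoint by (intro the_equality) blast+
  moreover have "tgt f = Y'" unfolding tgt_def using f hom_disjoint by (intro the_equality) blast+
  ultimately show "f \<in> Hom C X Y" using f a by simp
qed

lemma arr_homI: "arr f \<Longrightarrow> f \<in> Hom C (src f) (tgt f)"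
  by (simp add: hom_iff)

lemma src_tgt_Ob [simp]: "arr f \<Longrightarrow> src f \<in> Ob C" "arr f \<Longrightarrow> tgt f \<in> Ob C"
  using hom_ob arr_homI by blast+

lemma idn_arr [simp]:
  assumes "X \<in> Ob C" shows "arr (Idn C X)" "src (Idn C X) = X" "tgt (Idn C X) = X"
  using idn_hom[OF assms] by (simp_all add: hom_iff)

lemma cmp_arr [simp]:
  assumes "arr f" "arr g" "src g = tgt f"
  shows "arr (g \<cdot> f)" "src (g \<cdot> f) = src f" "tgt (g \<cdot> f) = tgt g"
  using cmp_hom[of f "src f" "tgt f" g "tgt g"] assms by (simp_all add: hom_iff)

lemma cmp_idn_arr [simp]: "arr f \<Longrightarrow> src f = X \<Longrightarrow> f \<cdot> Idn C X = f"
  using cmp_idn arr_homI by blast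

lemma idn_cmp_arr [simp]: "arr f \<Longrightarrow> tgt f = X \<Longrightarrow> Idn C X \<cdot> f = f"
  using idn_cmp arr_homI by blast

lemma assoc_arr [simp]:
  "arr f \<Longrightarrow> arr g \<Longrightarrow> arr h \<Longrightarrow> src g = tgt f \<Longrightarrow> src h = tgt g \<Longrightarrow> (h \<cdot> g) \<cdot> f = h \<cdot> (g \<cdot> f)"
  using cmp_assoc[of f "src f" "tgt f" g "tgt g" h "tgt h"] by (simp add: hom_iff)

lemma mono_arr:
  assumes "is_mono C X Y m" shows "arr m" "src m = X" "tgt m = Y"
  using assms by (simp_all add: is_mono_def hom_iff)

lemma epi_arr:
  assumes "is_epi C X Y e" shows "arr e" "src e = X" "tgt e = Y"
  using assms by (simp_all add: is_epi_def hom_iff)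

lemma mono_cancel:
  assumes "is_mono C X Y m" "arr g" "arr h" "src g = src h" "tgt g = X" "tgt h = X" "m \<cdot> g = m \<cdot> h"
  shows "g = h"
proof -
  have "g \<in> Hom C (src h) X" "h \<in> Hom C (src h) X" using assms by (simp_all add: hom_iff)
  then show ?thesis using assms(1,7) unfolding is_mono_def by blast
qed

lemma epi_cancel:
  assumes "is_epi C X Y e" "arr g" "arr h" "tgt g = tgt h" "src g = Y" "src h = Y" "g \<cdot> e = h \<cdot> e"
  shows "g = h"
proof -
  have "g \<in> Hom C Y (tgt h)" "h \<in> Hom C Y (tgt h)" using assms by (simp_all add: hom_iff)
  then show ?thesis using assms(1,7) unfolding is_epi_def by blast
qed

lemma epi_comp: "is_epi C X Y e \<Longrightarrow> is_epi C Y Z e' \<Longrightarrow> is_epi C X Z (e' \<cdot> e)"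
proof -
  assume e: "is_epi C X Y e" and e': "is_epi C Y Z e'"
  note [simp] = epi_arr[OF e] epi_arr[OF e']
  have "g = h" if gh: "g \<in> Hom C Z W" "h \<in> Hom C Z W" "g \<cdot> (e' \<cdot> e) = h \<cdot> (e' \<cdot> e)" for g h W
  proof -
    have g: "arr g" "src g = Z" "tgt g = W" and h: "arr h" "src h = Z" "tgt h = W"
      using gh by (simp_all add: hom_iff)
    have "(g \<cdot> e') \<cdot> e = (h \<cdot> e') \<cdot> e" using gh(3) g h by simp
    then have "g \<cdot> e' = h \<cdot> e'" using g h by - (rule epi_cancel[OF e], simp_all)
    then show ?thesis using g h by - (rule epi_cancel[OF e'], simp_all)
  qed
  then show ?thesis unfolding is_epi_def by (simp add: hom_iff)
qed

lemma epi_idn: "X \<in> Ob C \<Longrightarrow> is_epi C X X (Idn C X)"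
  unfolding is_epi_def by (metis cmp_idn idn_hom)

end

context preadditive_category begin

definition mns :: "'a \<Rightarrow> 'a" where "mns f = neg C (src f) (tgt f) f"

lemma hom_group_simps [simp]:
  "carrier (hom_group C X Y) = Hom C X Y" "monoid.mult (hom_group C X Y) = Add C"
  "one (hom_group C X Y) = Nul C X Y"
  by (simp_all add: hom_group_def)

lemma nul_arr [simp]:
  assumes "X \<in> Ob C" "Y \<in> Ob C"
  shows "arr (Nul C X Y)" "src (Nul C X Y) = X" "tgt (Nul C X Y) = Y"
proof -
  interpret G: comm_group "hom_group C X Y" using hom_comm_group assms .
  show "arr (Nul C X Y)" "src (Nul C X Y) = X" "tgt (Nul C X Y) = Y"
    using G.one_closed by (simp_all add: hom_iff)
qed

context
  fixes f g :: 'a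
  assumes fg: "arr f" "arr g" "src g = src f" "tgt g = tgt f"
begin

interpretation G: comm_group "hom_group C (src f) (tgt f)"
  using hom_comm_group fg by simp

lemma add_arr: "arr (f \<boxplus> g)" "src (f \<boxplus> g) = src f" "tgt (f \<boxplus> g) = tgt f"
  using G.m_closed[of f g] fg by (simp_all add: hom_iff)

lemma add_comm: "f \<boxplus> g = g \<boxplus> f"
  using G.m_comm[of f g] fg by (simp add: hom_iff)

lemma add_assoc: "arr h \<Longrightarrow> src h = src f \<Longrightarrow> tgt h = tgt f \<Longrightarrow> (f \<boxplus> g) \<boxplus> h = f \<boxplus> (g \<boxplus> h)"
  using G.m_assoc[of f g h] fg by (simp add: hom_iff)

lemma add_lcomm: "arr h \<Longrightarrow> src h = src f \<Longrightarrow> tgt h = tgt f \<Longrightarrow> g \<boxplus> (f \<boxplus> h) = f \<boxplus> (g \<boxplus> h)"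
  using G.m_lcomm[of g f h] fg by (simp add: hom_iff)

lemma add_left_cancel: "arr h \<Longrightarrow> src h = src f \<Longrightarrow> tgt h = tgt f \<Longrightarrow> h \<boxplus> f = h \<boxplus> g \<longleftrightarrow> f = g"
  using G.Units_l_cancel[of h f g] fg by (simp add: hom_iff)

lemma mns_add: "mns (f \<boxplus> g) = mns f \<boxplus> mns g"
  using G.inv_mult[of f g] fg add_arr by (simp add: hom_iff mns_def neg_def)

end

lemma mns_arr [simp]:
  assumes "arr f"
  shows "arr (mns f)" "src (mns f) = src f" "tgt (mns f) = tgt f"
    and mns_mns [simp]: "mns (mns f) = f"
    and add_mns [simp]: "f \<boxplus> mns f = Nul C (src f) (tgt f)"
proof -
  interpret G: comm_group "hom_group C (src f) (tgt f)" using hom_comm_group assms by simp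
  show *: "arr (mns f)" "src (mns f) = src f" "tgt (mns f) = tgt f"
    using G.inv_closed[of f] assms by (simp_all add: hom_iff mns_def neg_def)
  show "mns (mns f) = f" unfolding mns_def[of "mns f"] *
    using G.inv_inv[of f] assms by (simp add: hom_iff mns_def neg_def)
  show "f \<boxplus> mns f = Nul C (src f) (tgt f)"
    using G.r_inv[of f] assms by (simp add: hom_iff mns_def neg_def)
qed

lemmas add_arr' [simp] = add_arr

lemma mns_add' [simp]: "arr f \<Longrightarrow> arr g \<Longrightarrow> src g = src f \<Longrightarrow> tgt g = tgt f \<Longrightarrow> mns (f \<boxplus> g) = mns f \<boxplus> mns g"
  by (rule mns_add)

lemma add_nul [simp]: "arr f \<Longrightarrow> src f = X \<Longrightarrow> tgt f = Y \<Longrightarrow> f \<boxplus> Nul C X Y = f"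
proof -
  assume f: "arr f" "src f = X" "tgt f = Y"
  interpret G: comm_group "hom_group C (src f) (tgt f)" using hom_comm_group f(1) by simp
  show ?thesis using G.r_one[of f] f by (simp add: hom_iff)
qed

lemma nul_add [simp]: "arr f \<Longrightarrow> src f = X \<Longrightarrow> tgt f = Y \<Longrightarrow> Nul C X Y \<boxplus> f = f"
  using add_nul[of f X Y] add_comm[of f "Nul C X Y"] by auto

lemma mns_add_self [simp]: "arr f \<Longrightarrow> mns f \<boxplus> f = Nul C (src f) (tgt f)"
  using add_comm[of f "mns f"] by simp

lemma add_mns_cancel [simp]:
  "arr f \<Longrightarrow> arr g \<Longrightarrow> src g = src f \<Longrightarrow> tgt g = tgt f \<Longrightarrow> f \<boxplus> (mns f \<boxplus> g) = g"
  "arr f \<Longrightarrow> arr g \<Longrightarrow> src g = src f \<Longrightarrow> tgt g = tgt f \<Longrightarrow> mns f \<boxplus> (f \<boxplus> g) = g"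
  using add_assoc[of f "mns f" g] add_assoc[of "mns f" f g] by auto

lemmas add_ac = add_assoc add_comm add_lcomm

lemma distrib_right [simp]:
  "arr f \<Longrightarrow> arr g \<Longrightarrow> arr h \<Longrightarrow> src h = src g \<Longrightarrow> tgt h = tgt g \<Longrightarrow> src g = tgt f \<Longrightarrow>
   (g \<boxplus> h) \<cdot> f = g \<cdot> f \<boxplus> h \<cdot> f"
  using cmp_add[of f "src f" "tgt f" g "tgt g" h] by (simp add: hom_iff)

lemma distrib_left [simp]:
  "arr f \<Longrightarrow> arr g \<Longrightarrow> arr h \<Longrightarrow> src h = src g \<Longrightarrow> tgt h = tgt g \<Longrightarrow> src f = tgt g \<Longrightarrow>
   f \<cdot> (g \<boxplus> h) = f \<cdot> g \<boxplus> f \<cdot> h"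
  using add_cmp[of g "src g" "tgt g" h f "tgt f"] by (simp add: hom_iff)

lemma idem_nul: "arr f \<Longrightarrow> f \<boxplus> f = f \<Longrightarrow> f = Nul C (src f) (tgt f)"
  using add_left_cancel[of f "Nul C (src f) (tgt f)" f] by auto

lemma nul_cmp [simp]:
  assumes "arr f" "tgt f = Y" "Z \<in> Ob C"
  shows "Nul C Y Z \<cdot> f = Nul C (src f) Z"
proof -
  have Y: "Y \<in> Ob C" using assms by auto
  have "Nul C Y Z \<cdot> f \<boxplus> Nul C Y Z \<cdot> f = Nul C Y Z \<cdot> f"
    using distrib_right[of f "Nul C Y Z" "Nul C Y Z"] assms Y by simp
  from idem_nul[OF _ this] show ?thesis using assms Y by simp
qed

lemma cmp_nul [simp]:
  assumes "arr f" "src f = Y" "X \<in> Ob C"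
  shows "f \<cdot> Nul C X Y = Nul C X (tgt f)"
proof -
  have Y: "Y \<in> Ob C" using assms by auto
  have "f \<cdot> Nul C X Y \<boxplus> f \<cdot> Nul C X Y = f \<cdot> Nul C X Y"
    using distrib_left[of f "Nul C X Y" "Nul C X Y"] assms Y by simp
  from idem_nul[OF _ this] show ?thesis using assms Y by simp
qed

lemma mns_unique: "arr f \<Longrightarrow> arr g \<Longrightarrow> src g = src f \<Longrightarrow> tgt g = tgt f \<Longrightarrow>
    f \<boxplus> g = Nul C (src f) (tgt f) \<Longrightarrow> g = mns f"
  using add_left_cancel[of g "mns f" f] add_mns[of f] mns_arr[of f] by metis

lemma add_mns_eq_nul: "arr f \<Longrightarrow> arr g \<Longrightarrow> src g = src f \<Longrightarrow> tgt g = tgt f \<Longrightarrow> src f = X \<Longrightarrow> tgt f = Y \<Longrightarrow>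
    f \<boxplus> mns g = Nul C X Y \<longleftrightarrow> f = g"
  using mns_unique[of f "mns g"] mns_mns by (metis add_mns mns_arr)

lemma mns_cmp [simp]: "arr f \<Longrightarrow> arr g \<Longrightarrow> src g = tgt f \<Longrightarrow> mns g \<cdot> f = mns (g \<cdot> f)"
  using distrib_right[of f g "mns g"] by (intro mns_unique) (simp_all del: distrib_right)

lemma cmp_mns [simp]: "arr f \<Longrightarrow> arr g \<Longrightarrow> src g = tgt f \<Longrightarrow> g \<cdot> mns f = mns (g \<cdot> f)"
  using distrib_left[of g f "mns f"] by (intro mns_unique) (simp_all del: distrib_left)

lemma mns_nul [simp]: "X \<in> Ob C \<Longrightarrow> Y \<in> Ob C \<Longrightarrow> mns (Nul C X Y) = Nul C X Y"
  using mns_unique[of "Nul C X Y" "Nul C X Y"] by simp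

lemma mns_eq_nul [simp]: "arr f \<Longrightarrow> src f = X \<Longrightarrow> tgt f = Y \<Longrightarrow> mns f = Nul C X Y \<longleftrightarrow> f = Nul C X Y"
  using mns_mns[of f] mns_nul[of X Y] src_tgt_Ob[of f] by metis

lemma neg_mns: "arr f \<Longrightarrow> src f = X \<Longrightarrow> tgt f = Y \<Longrightarrow> neg C X Y f = mns f"
  by (auto simp: mns_def)

lemma epiI:
  assumes e: "arr e" "src e = X" "tgt e = Y"
    and z: "\<And>g. arr g \<Longrightarrow> src g = Y \<Longrightarrow> g \<cdot> e = Nul C X (tgt g) \<Longrightarrow> g = Nul C Y (tgt g)"
  shows "is_epi C X Y e"
  unfolding is_epi_def
proof (intro conjI allI impI ballI)
  fix W g h assume "g \<in> Hom C Y W" "h \<in> Hom C Y W" and eq: "g \<cdot> e = h \<cdot> e"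
  then have a: "arr g" "arr h" "src g = Y" "src h = Y" "tgt g = W" "tgt h = W" by (simp_all add: hom_iff)
  have "(g \<boxplus> mns h) \<cdot> e = Nul C X W" using a e by (simp add: eq)
  with z[of "g \<boxplus> mns h"] a have "g \<boxplus> mns h = Nul C Y W" by simp
  then show "g = h" using a add_mns_eq_nul by blast
qed (use e in \<open>simp add: hom_iff\<close>)

lemma monoI:
  assumes e: "arr e" "src e = X" "tgt e = Y"
    and z: "\<And>g. arr g \<Longrightarrow> tgt g = X \<Longrightarrow> e \<cdot> g = Nul C (src g) Y \<Longrightarrow> g = Nul C (src g) X"
  shows "is_mono C X Y e"
  unfolding is_mono_def
proof (intro conjI allI impI ballI)
  fix W g h assume "g \<in> Hom C W X" "h \<in> Hom C W X" and eq: "e \<cdot> g = e \<cdot> h"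
  then have a: "arr g" "arr h" "src g = W" "src h = W" "tgt g = X" "tgt h = X" by (simp_all add: hom_iff)
  have "e \<cdot> (g \<boxplus> mns h) = Nul C W Y" using a e by (simp add: eq)
  with z[of "g \<boxplus> mns h"] a have "g \<boxplus> mns h = Nul C W X" by simp
  then show "g = h" using a add_mns_eq_nul by blast
qed (use e in \<open>simp add: hom_iff\<close>)

lemma epi_nul:
  assumes e: "is_epi C X Y e" and g: "arr g" "src g = Y" "tgt g = Z" "g \<cdot> e = Nul C X Z"
  shows "g = Nul C Y Z"
proof -
  have "Y \<in> Ob C" "Z \<in> Ob C" using g(1-3) by auto
  then show ?thesis using epi_cancel[OF e, of g "Nul C Y Z"] g epi_arr[OF e] by simp
qed

lemma mono_nul:
  assumes e: "is_mono C X Y e" and g: "arr g" "tgt g = X" "src g = Z" "e \<cdot> g = Nul C Z Y"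
  shows "g = Nul C Z X"
proof -
  have "X \<in> Ob C" "Z \<in> Ob C" using g(1-3) by auto
  then show ?thesis using mono_cancel[OF e, of g "Nul C Z X"] g mono_arr[OF e] by simp
qed

text \<open>If the identity of \<open>Z\<close> is zero, every arrow into or out of \<open>Z\<close> is zero, as it factors through
  this identity.\<close>

lemma zero_object_iff: "zero_object C Z \<longleftrightarrow> Z \<in> Ob C \<and> Idn C Z = Nul C Z Z"
proof
  assume Z: "zero_object C Z"
  then have "\<exists>!f. f \<in> Hom C Z Z" "Z \<in> Ob C" unfolding zero_object_def by auto
  moreover have "Idn C Z \<in> Hom C Z Z" "Nul C Z Z \<in> Hom C Z Z" using \<open>Z \<in> Ob C\<close> by (simp_all add: hom_iff)
  ultimately show "Z \<in> Ob C \<and> Idn C Z = Nul C Z Z" by blast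
next
  assume Z: "Z \<in> Ob C \<and> Idn C Z = Nul C Z Z"
  show "zero_object C Z" unfolding zero_object_def hom_iff
  proof (intro conjI ballI)
    fix X assume X: "X \<in> Ob C"
    have "f = Nul C X Z" if f: "arr f \<and> src f = X \<and> tgt f = Z" for f
    proof -
      have "f = Idn C Z \<cdot> f" using f by simp
      also have "\<dots> = Nul C X Z" using f Z by simp
      finally show ?thesis .
    qed
    then show "\<exists>!f. arr f \<and> src f = X \<and> tgt f = Z" using X Z by (intro ex1I[of _ "Nul C X Z"]) simp_all
    have "f = Nul C Z X" if f: "arr f \<and> src f = Z \<and> tgt f = X" for f
    proof -
      have "f = f \<cdot> Idn C Z" using f by simp
      also have "\<dots> = Nul C Z X" using f Z by simp
      finally show ?thesis .
    qed
    then show "\<exists>!f. arr f \<and> src f = Z \<and> tgt f = X" using X Z by (intro ex1I[of _ "Nul C Z X"]) simp_all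
  qed (use Z in auto)
qed

lemma zero_arr_tgt: "zero_object C Z \<Longrightarrow> arr f \<Longrightarrow> tgt f = Z \<Longrightarrow> f = Nul C (src f) Z"
  using idn_cmp_arr[of f Z] nul_cmp[of f Z Z] unfolding zero_object_iff by metis

lemma zero_arr_src: "zero_object C Z \<Longrightarrow> arr f \<Longrightarrow> src f = Z \<Longrightarrow> f = Nul C Z (tgt f)"
  using cmp_idn_arr[of f Z] cmp_nul[of f Z Z] unfolding zero_object_iff by metis

lemma kernel_arr:
  assumes "is_kernel C X Y f K k" shows "arr k" "src k = K" "tgt k = X" "f \<cdot> k = Nul C K Y"
  using assms by (simp_all add: is_kernel_def hom_iff)

lemma cokernel_arr:
  assumes "is_cokernel C X Y f Q q" shows "arr q" "src q = Y" "tgt q = Q" "q \<cdot> f = Nul C X Q"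
  using assms by (simp_all add: is_cokernel_def hom_iff)

lemma kernel_factor:
  assumes k: "is_kernel C X Y f K k" and g: "arr g" "tgt g = X" "f \<cdot> g = Nul C (src g) Y"
  obtains h where "arr h" "src h = src g" "tgt h = K" "k \<cdot> h = g"
proof -
  have "g \<in> Hom C (src g) X" using g by (simp add: hom_iff)
  then obtain h where "h \<in> Hom C (src g) K" "k \<cdot> h = g" using k g(3) unfolding is_kernel_def by blast
  then show ?thesis by (intro that[of h]) (simp_all add: hom_iff)
qed

lemma cokernel_factor:
  assumes q: "is_cokernel C X Y f Q q" and g: "arr g" "src g = Y" "g \<cdot> f = Nul C X (tgt g)"
  obtains h where "arr h" "src h = Q" "tgt h = tgt g" "h \<cdot> q = g"
proof -
  have "g \<in> Hom C Y (tgt g)" using g by (simp add: hom_iff)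
  then obtain h where "h \<in> Hom C Q (tgt g)" "h \<cdot> q = g" using q g(3) unfolding is_cokernel_def by blast
  then show ?thesis by (intro that[of h]) (simp_all add: hom_iff)
qed

lemma kernel_mono: 
  assumes f: "arr f" "src f = X" "tgt f = Y" and K: "is_kernel C X Y f K k" shows "is_mono C K X k"
proof (rule monoI)
  note k = kernel_arr[OF K]
  show "arr k" "src k = K" "tgt k = X" using k by auto
  fix g assume g: "arr g" "tgt g = K" "k \<cdot> g = Nul C (src g) X"
  have "Nul C (src g) X \<in> Hom C (src g) X" using g(1) f by (auto simp: hom_iff)
  moreover have "f \<cdot> Nul C (src g) X = Nul C (src g) Y" using g(1) f by auto
  ultimately have "\<exists>!h. h \<in> Hom C (src g) K \<and> k \<cdot> h = Nul C (src g) X"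
    using K unfolding is_kernel_def by blast
  moreover have "g \<in> Hom C (src g) K" "Nul C (src g) K \<in> Hom C (src g) K" "k \<cdot> Nul C (src g) K = Nul C (src g) X"
    using g(1,2) k(1-3) by (auto simp: hom_iff)
  ultimately show "g = Nul C (src g) K" using g(3) by blast
qed

lemma cokernel_epi: 
  assumes f: "arr f" "src f = X" "tgt f = Y" and Q: "is_cokernel C X Y f Q q" shows "is_epi C Y Q q"
proof (rule epiI)
  note q = cokernel_arr[OF Q]
  show "arr q" "src q = Y" "tgt q = Q" using q by auto
  fix g assume g: "arr g" "src g = Q" "g \<cdot> q = Nul C Y (tgt g)"
  have "Nul C Y (tgt g) \<in> Hom C Y (tgt g)" using g(1) f by (auto simp: hom_iff)
  moreover have "Nul C Y (tgt g) \<cdot> f = Nul C X (tgt g)" using g(1) f by auto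
  ultimately have "\<exists>!h. h \<in> Hom C Q (tgt g) \<and> h \<cdot> q = Nul C Y (tgt g)"
    using Q unfolding is_cokernel_def by blast
  moreover have "g \<in> Hom C Q (tgt g)" "Nul C Q (tgt g) \<in> Hom C Q (tgt g)" "Nul C Q (tgt g) \<cdot> q = Nul C Y (tgt g)"
    using g(1,2) q(1-3) by (auto simp: hom_iff)
  ultimately show "g = Nul C Q (tgt g)" using g(3) by blast
qed

end

locale abcat = abelian_category A for A :: "('o, 'a) cat" (structure)
begin

text \<open>A monomorphism is the kernel of some \<open>f\<close>; if it is also epic then \<open>f = 0\<close>, so the identity
  factors through it.\<close>

lemma mono_epi_iso:
  assumes mono: "is_mono A X Y m" and epi: "is_epi A X Y m" shows "is_isomorphism A X Y m"
proof -
  note m = mono_arr[OF mono]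
  obtain Z f where f: "f \<in> Hom A Y Z" "is_kernel A Y Z f X m" using mono_normal[OF mono] by blast
  have f': "arr f" "src f = Y" "tgt f = Z" using f(1) by (auto simp: hom_iff)
  have YZ: "Y \<in> Ob A" "Z \<in> Ob A" using f' by auto
  have "f = Nul A Y Z" using epi_nul[OF epi f'] kernel_arr(4)[OF f(2)] .
  then have "f \<cdot> Idn A Y = Nul A (src (Idn A Y)) Z" using f' YZ by simp
  then obtain t where t: "arr t" "src t = Y" "tgt t = X" "m \<cdot> t = Idn A Y"
    using kernel_factor[OF f(2), of "Idn A Y"] YZ by auto
  have "m \<cdot> (t \<cdot> m) = (m \<cdot> t) \<cdot> m" using t(1-3) m by simp
  also have "\<dots> = m \<cdot> Idn A X" unfolding t(4) using m by simp
  finally have "t \<cdot> m = Idn A X" using m t(1-3) by - (rule mono_cancel[OF mono], auto)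
  then show ?thesis unfolding is_isomorphism_def hom_iff using m t by (intro conjI bexI[of _ t]) (simp_all add: hom_iff)
qed

lemma iso_mono_epi:
  assumes "is_isomorphism A X Y m" shows "is_mono A X Y m" "is_epi A X Y m"
proof -
  obtain n where m: "m \<in> Hom A X Y" and n: "n \<in> Hom A Y X" "n \<cdot> m = Idn A X" "m \<cdot> n = Idn A Y"
    using assms unfolding is_isomorphism_def by blast
  have "g = h" if "g \<in> Hom A W X" "h \<in> Hom A W X" "m \<cdot> g = m \<cdot> h" for g h W
  proof -
    have "g = (n \<cdot> m) \<cdot> g" using n that by (simp add: hom_iff)
    also have "\<dots> = n \<cdot> (m \<cdot> h)" using that m n(1) by (simp add: cmp_assoc)
    also have "\<dots> = (n \<cdot> m) \<cdot> h" using that m n(1) by (simp add: cmp_assoc)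
    finally show ?thesis using n that by (simp add: hom_iff)
  qed
  then show "is_mono A X Y m" unfolding is_mono_def using m by blast
  have "g = h" if "g \<in> Hom A Y W" "h \<in> Hom A Y W" "g \<cdot> m = h \<cdot> m" for g h W
  proof -
    have "g = g \<cdot> (m \<cdot> n)" using n that by (simp add: hom_iff)
    also have "\<dots> = (h \<cdot> m) \<cdot> n" using that m n(1) by (simp add: cmp_assoc[symmetric])
    also have "\<dots> = h \<cdot> (m \<cdot> n)" using that m n(1) by (simp add: cmp_assoc)
    finally show ?thesis using n that by (simp add: hom_iff)
  qed
  then show "is_epi A X Y m" unfolding is_epi_def using m by blast
qed

text \<open>An epimorphism is the cokernel of some arrow. That arrow factors through the kernel, so whatever
  kills the kernel kills it as well.\<close>

lemma epi_coker_of_kernel: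
  assumes e: "is_epi A X Y e" and k: "is_kernel A X Y e K k"
    and g: "arr g" "src g = X" "g \<cdot> k = Nul A K (tgt g)"
  obtains u where "arr u" "src u = Y" "tgt u = tgt g" "u \<cdot> e = g"
proof -
  obtain W f where f: "f \<in> Hom A W X" "is_cokernel A W X f Y e" using epi_normal[OF e] by blast
  have k': "arr k" "src k = K" "tgt k = X" using kernel_arr[OF k] by auto
  have f': "arr f" "src f = W" "tgt f = X" using f hom_iff by auto
  have "e \<cdot> f = Nul A W Y" using cokernel_arr[OF f(2)] by auto
  then obtain t where t: "arr t" "src t = W" "tgt t = K" "k \<cdot> t = f"
    using kernel_factor[OF k, of f] f' by auto
  have "g \<cdot> f = (g \<cdot> k) \<cdot> t" unfolding t(4)[symmetric] using t(1-3) g(1,2) k' by simp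
  also have "\<dots> = Nul A W (tgt g)" unfolding g(3) using t g by auto
  finally show ?thesis using cokernel_factor[OF f(2) g(1,2)] that by blast
qed

lemma biproduct_arr:
  assumes "is_biproduct A X Y W i1 i2 p1 p2"
  shows "arr i1" "src i1 = X" "tgt i1 = W" "arr i2" "src i2 = Y" "tgt i2 = W"
    "arr p1" "src p1 = W" "tgt p1 = X" "arr p2" "src p2 = W" "tgt p2 = Y"
    "p1 \<cdot> i1 = Idn A X" "p2 \<cdot> i2 = Idn A Y" "p1 \<cdot> i2 = Nul A Y X" "p2 \<cdot> i1 = Nul A X Y"
    "i1 \<cdot> p1 \<boxplus> i2 \<cdot> p2 = Idn A W"
  using assms unfolding is_biproduct_def hom_iff by auto

text \<open>The pullback \<open>W\<close> is the kernel of \<open>g = (e, - f) : X \<oplus> Y \<rightarrow> Z\<close>. Since \<open>g\<close> is epic, an arrow out of \<open>Y\<close>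
  that vanishes on \<open>W\<close> comes from an arrow \<open>u\<close> out of \<open>Z\<close> with \<open>u e = 0\<close>; hence \<open>u = 0\<close>, and the projection
  of \<open>W\<close> to \<open>Y\<close> is epic.\<close>

lemma epi_pullback:
  assumes e: "is_epi A X Z e" and f: "arr f" "tgt f = Z"
  obtains W e' f' where "is_epi A W (src f) e'" "arr f'" "src f' = W" "tgt f' = X" "e \<cdot> f' = f \<cdot> e'"
proof -
  have e': "arr e" "src e = X" "tgt e = Z" using epi_arr[OF e] by auto
  define Y where "Y = src f"
  obtain B i1 i2 p1 p2 where B: "is_biproduct A X Y B i1 i2 p1 p2"
    using ex_biproduct[of X Y] e' f Y_def by auto
  note b = biproduct_arr[OF B]
  define g where "g = e \<cdot> p1 \<boxplus> mns (f \<cdot> p2)"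
  have g: "arr g" "src g = B" "tgt g = Z" using b e' f by (auto simp: g_def Y_def)
  have gi: "g \<cdot> i1 = e" "g \<cdot> i2 = mns f" using b e' f by (auto simp: g_def Y_def)
  obtain K k where k: "is_kernel A B Z g K k" using ex_kernel[of g B Z] g hom_iff by auto
  have k': "arr k" "src k = K" "tgt k = B" "g \<cdot> k = Nul A K Z" using kernel_arr[OF k] by auto
  \<comment> \<open>\<open>g\<close> restricts to \<open>e\<close> on the first summand.\<close>
  have epig: "is_epi A B Z g"
  proof (rule epiI[OF g])
    fix u assume u: "arr u" "src u = Z" "u \<cdot> g = Nul A B (tgt u)"
    have "u \<cdot> e = (u \<cdot> g) \<cdot> i1" unfolding gi(1)[symmetric] using u(1,2) g b(1-3) by simp
    also have "\<dots> = Nul A X (tgt u)" unfolding u(3) using u b by auto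
    finally show "u = Nul A Z (tgt u)" using epi_nul[OF e] u by auto
  qed
  have "is_epi A K Y (p2 \<cdot> k)"
  proof (rule epiI)
    show "arr (p2 \<cdot> k)" "src (p2 \<cdot> k) = K" "tgt (p2 \<cdot> k) = Y" using b k' by auto
    fix h assume h: "arr h" "src h = Y" "h \<cdot> (p2 \<cdot> k) = Nul A K (tgt h)"
    have "(h \<cdot> p2) \<cdot> k = Nul A K (tgt (h \<cdot> p2))" using h b k' by auto
    then obtain u where u: "arr u" "src u = Z" "tgt u = tgt (h \<cdot> p2)" "u \<cdot> g = h \<cdot> p2"
      using epi_coker_of_kernel[OF epig k, of "h \<cdot> p2"] h b by auto
    have "u \<cdot> e = (u \<cdot> g) \<cdot> i1" unfolding gi(1)[symmetric] using u(1,2) g b(1-3) by simp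
    also have "\<dots> = Nul A X (tgt u)" using u h b e' by auto
    finally have "u = Nul A Z (tgt u)" using epi_nul[OF e] u by auto
    then have "h \<cdot> p2 = Nul A B (tgt h)" using u g h b by (metis cmp_arr(3) nul_cmp src_tgt_Ob(2))
    then have "(h \<cdot> p2) \<cdot> i2 = Nul A Y (tgt h)" using h b by auto
    then show "h = Nul A Y (tgt h)" using h b by auto
  qed
  moreover have "e \<cdot> (p1 \<cdot> k) = f \<cdot> (p2 \<cdot> k)"
  proof -
    have "e \<cdot> (p1 \<cdot> k) \<boxplus> mns (f \<cdot> (p2 \<cdot> k)) = Nul A K Z"
      using k' b e' f by (auto simp: g_def Y_def)
    then show ?thesis using k' b e' f by (subst (asm) add_mns_eq_nul) (auto simp: Y_def)
  qed
  ultimately show ?thesis using that[of K "p2 \<cdot> k" "p1 \<cdot> k"] b k' by (auto simp: Y_def)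
qed

text \<open>Exactness of \<open>X \<rightarrow> Y \<rightarrow> Q\<close> at \<open>Y\<close> for generalised elements. The arrow \<open>e\<close> factors as \<open>m \<epsilon>\<close> through the
  kernel \<open>m\<close> of \<open>q\<close>, and it suffices that \<open>\<epsilon>\<close> is epic, for then \<open>\<epsilon>\<close> can be pulled back. If \<open>g \<epsilon> = 0\<close>, the
  kernel \<open>n\<close> of \<open>g\<close> gives a subobject \<open>m n\<close> of \<open>Y\<close> containing the image of \<open>e\<close>. It is the kernel of some \<open>r\<close>,
  which kills \<open>e\<close>, hence factors through \<open>q\<close>, hence kills \<open>m\<close>; so \<open>n\<close> is invertible and \<open>g = 0\<close>.\<close>

lemma cokernel_exact:
  assumes e: "arr e" "src e = X" "tgt e = Y" and q: "is_cokernel A X Y e Q q"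
    and x: "arr x" "tgt x = Y" "q \<cdot> x = Nul A (src x) Q"
  obtains W e' y where "is_epi A W (src x) e'" "arr y" "src y = W" "tgt y = X" "e \<cdot> y = x \<cdot> e'"
proof -
  have q': "arr q" "src q = Y" "tgt q = Q" "q \<cdot> e = Nul A X Q" using cokernel_arr[OF q] by auto
  obtain I m where m: "is_kernel A Y Q q I m" using ex_kernel[of q Y Q] q' hom_iff by auto
  have m': "arr m" "src m = I" "tgt m = Y" "q \<cdot> m = Nul A I Q" using kernel_arr[OF m] by auto
  have mm: "is_mono A I Y m" using kernel_mono[OF q'(1-3) m] .
  obtain \<epsilon> where \<epsilon>: "arr \<epsilon>" "src \<epsilon> = X" "tgt \<epsilon> = I" "m \<cdot> \<epsilon> = e"
    using kernel_factor[OF m, of e] e q' by auto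
  have "is_epi A X I \<epsilon>"
  proof (rule epiI[OF \<epsilon>(1-3)])
    fix g assume g: "arr g" "src g = I" "g \<cdot> \<epsilon> = Nul A X (tgt g)"
    obtain N n where n: "is_kernel A I (tgt g) g N n" using ex_kernel[of g I] g hom_iff by auto
    have n': "arr n" "src n = N" "tgt n = I" "g \<cdot> n = Nul A N (tgt g)" using kernel_arr[OF n] by auto
    have nm: "is_mono A N I n" using kernel_mono[OF g(1,2) _ n] by auto
    obtain \<epsilon>' where \<epsilon>': "arr \<epsilon>'" "src \<epsilon>' = X" "tgt \<epsilon>' = N" "n \<cdot> \<epsilon>' = \<epsilon>"
      using kernel_factor[OF n, of \<epsilon>] \<epsilon> g by auto
    have "is_mono A N Y (m \<cdot> n)"
    proof (rule monoI)
      fix h assume h: "arr h" "tgt h = N" "(m \<cdot> n) \<cdot> h = Nul A (src h) Y"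
      then have "m \<cdot> (n \<cdot> h) = Nul A (src h) Y" using m' n' by auto
      then have "n \<cdot> h = Nul A (src h) I" using mono_nul[OF mm, of "n \<cdot> h"] h n' by auto
      then show "h = Nul A (src h) N" using mono_nul[OF nm, of h] h by auto
    qed (use m' n' in auto)
    then obtain Z r where r: "r \<in> Hom A Y Z" "is_kernel A Y Z r N (m \<cdot> n)" using mono_normal by blast
    have r': "arr r" "src r = Y" "tgt r = Z" "r \<cdot> (m \<cdot> n) = Nul A N Z"
      using kernel_arr[OF r(2)] r(1) by (auto simp: hom_iff)
    have "r \<cdot> e = (r \<cdot> (m \<cdot> n)) \<cdot> \<epsilon>'" using r'(1-3) m' n' \<epsilon>' \<epsilon> by auto
    also have "\<dots> = Nul A X Z" unfolding r'(4) using r' \<epsilon>' by auto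
    finally obtain r2 where r2: "arr r2" "src r2 = Q" "tgt r2 = Z" "r2 \<cdot> q = r"
      using cokernel_factor[OF q, of r] r' by auto
    have "r \<cdot> m = r2 \<cdot> (q \<cdot> m)" using r2(1-3) q'(1-3) m'(1-3) unfolding r2(4)[symmetric] by auto
    also have "\<dots> = Nul A I Z" using r2 m' by auto
    finally obtain t where t: "arr t" "src t = I" "tgt t = N" "(m \<cdot> n) \<cdot> t = m"
      using kernel_factor[OF r(2), of m] m' by auto
    have "m \<cdot> (n \<cdot> t) = (m \<cdot> n) \<cdot> t" using t(1-3) m'(1-3) n'(1-3) by simp
    also have "\<dots> = m \<cdot> Idn A I" unfolding t(4) using m' by auto
    finally have nt: "n \<cdot> t = Idn A I" using t(1-3) m' n' by - (rule mono_cancel[OF mm], auto)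
    have "g = g \<cdot> (n \<cdot> t)" unfolding nt using g(1,2) by simp
    also have "\<dots> = (g \<cdot> n) \<cdot> t" using g(1,2) t(1-3) n'(1-3) by simp
    also have "\<dots> = Nul A I (tgt g)" unfolding n'(4) using t g by auto
    finally show "g = Nul A I (tgt g)" .
  qed
  moreover obtain x' where x': "arr x'" "src x' = src x" "tgt x' = I" "m \<cdot> x' = x"
    using kernel_factor[OF m, of x] x by auto
  ultimately obtain W e' f' where w: "is_epi A W (src x) e'" "arr f'" "src f' = W" "tgt f' = X" "\<epsilon> \<cdot> f' = x' \<cdot> e'"
    using epi_pullback[of X I \<epsilon> x'] by metis
  have w': "arr e'" "src e' = W" "tgt e' = src x" using epi_arr[OF w(1)] by auto
  have "e \<cdot> f' = m \<cdot> (\<epsilon> \<cdot> f')" using \<epsilon> m' w by auto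
  also have "\<dots> = x \<cdot> e'" unfolding w(5) using m' x'(1-3) w' unfolding x'(4)[symmetric] by auto
  finally show ?thesis using that w by blast
qed

end

section \<open>Cycles, boundaries and homology through generalised elements\<close>


context abcat begin

lemma int_index [simp]: "(i::int) + 1 + 1 = i + 2" "i - 1 + 2 = i + 1" "i - 1 - 1 = i - 2" "i + 1 - 2 = i - 1" "i - 2 + 1 = i - 1"
  by simp_all

lemma complex_arr [simp]:
  assumes "bounded_complex A X"
  shows "arr (Df X i)" "src (Df X i) = Cob X i" "tgt (Df X i) = Cob X (i + 1)" "Cob X i \<in> Ob A"
  using assms unfolding bounded_complex_def by (simp_all add: hom_iff)

text \<open>The degree \<open>j\<close> is a separate variable, so that the rule also fires on terms such as
  \<open>Df X i \<cdot> Df X (i - 1)\<close>.\<close>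

lemma diff_diff [simp]:
  assumes "bounded_complex A X" "j = i + 1"
  shows "Df X j \<cdot> Df X i = Nul A (Cob X i) (Cob X (j + 1))"
  using assms unfolding bounded_complex_def by simp

lemma diff_diff_cmp [simp]:
  assumes "bounded_complex A X" "j = i + 1" "arr x" "tgt x = Cob X i"
  shows "Df X j \<cdot> (Df X i \<cdot> x) = Nul A (src x) (Cob X (j + 1))"
proof -
  have "Df X j \<cdot> (Df X i \<cdot> x) = (Df X j \<cdot> Df X i) \<cdot> x" using assms by (simp del: diff_diff)
  also have "\<dots> = Nul A (src x) (Cob X (j + 1))" using assms by simp
  finally show ?thesis .
qed

lemma chain_mapD:
  assumes "chain_map A X Y f"
  shows "bounded_complex A X" "bounded_complex A Y"
    "arr (f i)" "src (f i) = Cob X i" "tgt (f i) = Cob Y i" "f (i + 1) \<cdot> Df X i = Df Y i \<cdot> f i"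
  using assms unfolding chain_map_def by (simp_all add: hom_iff)

lemma chain_map_cmp:
  assumes f: "chain_map A X Y f" and "arr x" "tgt x = Cob X i" "j = i + 1"
  shows "f j \<cdot> (Df X i \<cdot> x) = Df Y i \<cdot> (f i \<cdot> x)"
proof -
  note [simp] = chain_mapD(1-5)[OF f]
  have "f j \<cdot> (Df X i \<cdot> x) = (f j \<cdot> Df X i) \<cdot> x" using assms(2-4) by simp
  also have "\<dots> = (Df Y i \<cdot> f i) \<cdot> x" using chain_mapD(6)[OF f] assms(4) by simp
  also have "\<dots> = Df Y i \<cdot> (f i \<cdot> x)" using assms(2-4) by simp
  finally show ?thesis .
qed

definition cycle :: "('o, 'a) cplx \<Rightarrow> int \<Rightarrow> 'a \<Rightarrow> bool" where
  "cycle X i z \<longleftrightarrow> arr z \<and> tgt z = Cob X i \<and> Df X i \<cdot> z = Nul A (src z) (Cob X (i + 1))"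

text \<open>This has to be a local condition: an element of the image of \<open>d\<close> can be lifted along \<open>d\<close> only on
  a cover.\<close>

definition bound :: "('o, 'a) cplx \<Rightarrow> int \<Rightarrow> 'a \<Rightarrow> bool" where
  "bound X i z \<longleftrightarrow> arr z \<and> tgt z = Cob X i \<and>
     (\<exists>e y. is_epi A (src e) (src z) e \<and> arr y \<and> src y = src e \<and> tgt y = Cob X (i - 1) \<and>
        Df X (i - 1) \<cdot> y = z \<cdot> e)"

lemma cycleD: "cycle X i z \<Longrightarrow> arr z" "cycle X i z \<Longrightarrow> tgt z = Cob X i"
    "cycle X i z \<Longrightarrow> Df X i \<cdot> z = Nul A (src z) (Cob X (i + 1))"
  unfolding cycle_def by auto

lemma boundD: "bound X i z \<Longrightarrow> arr z" "bound X i z \<Longrightarrow> tgt z = Cob X i"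
  unfolding bound_def by auto

lemma boundE:
  assumes "bound X i z"
  obtains T e y where "is_epi A T (src z) e" "arr e" "src e = T" "tgt e = src z"
    "arr y" "src y = T" "tgt y = Cob X (i - 1)" "Df X (i - 1) \<cdot> y = z \<cdot> e"
proof -
  obtain e y where e: "is_epi A (src e) (src z) e" "arr y" "src y = src e" "tgt y = Cob X (i - 1)"
    "Df X (i - 1) \<cdot> y = z \<cdot> e" using assms unfolding bound_def by blast
  show ?thesis by (rule that[OF e(1) _ _ _ e(2-5)]) (use epi_arr[OF e(1)] in auto)
qed

lemma boundI:
  assumes "arr z" "tgt z = Cob X i" "is_epi A T (src z) e" "arr y" "src y = T" "tgt y = Cob X (i - 1)"
    "Df X (i - 1) \<cdot> y = z \<cdot> e"
  shows "bound X i z"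
  using assms epi_arr(2)[OF assms(3)] unfolding bound_def by metis

lemma bound_diff:
  assumes "bounded_complex A X" "arr y" "tgt y = Cob X (i - 1)"
  shows "bound X i (Df X (i - 1) \<cdot> y)"
proof -
  have "is_epi A (src y) (src y) (Idn A (src y))" using assms epi_idn by simp
  then show ?thesis using assms by (intro boundI[of _ X i "src y" "Idn A (src y)" y]) simp_all
qed

text \<open>The cover that exhibits \<open>z\<close> as a boundary is pulled back along \<open>t\<close>.\<close>

lemma bound_cmp:
  assumes X: "bounded_complex A X" and z: "bound X i z" and t: "arr t" "tgt t = src z"
  shows "bound X i (z \<cdot> t)"
proof -
  note z' = boundD[OF z]
  obtain T e y where e: "is_epi A T (src z) e" "arr e" "src e = T" "tgt e = src z"
    and y: "arr y" "src y = T" "tgt y = Cob X (i - 1)" and eq: "Df X (i - 1) \<cdot> y = z \<cdot> e"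
    by (rule boundE[OF z])
  obtain W e' f' where w: "is_epi A W (src t) e'" "arr f'" "src f' = W" "tgt f' = T" "e \<cdot> f' = t \<cdot> e'"
    using epi_pullback[OF e(1) t] .
  note e' = epi_arr[OF w(1)]
  have "Df X (i - 1) \<cdot> (y \<cdot> f') = (Df X (i - 1) \<cdot> y) \<cdot> f'" using X y w(2-4) by simp
  also have "\<dots> = z \<cdot> (e \<cdot> f')" unfolding eq using z' e w(2-4) by simp
  also have "\<dots> = (z \<cdot> t) \<cdot> e'" unfolding w(5) using z' t e' by simp
  finally show ?thesis using w(1-4) y z' t e' by (intro boundI[of _ X i W e' "y \<cdot> f'"]) simp_all
qed

lemma bound_local:
  assumes e: "is_epi A T (src z) e" and z: "arr z" "tgt z = Cob X i" and b: "bound X i (z \<cdot> e)"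
  shows "bound X i z"
proof -
  note e' = epi_arr[OF e]
  obtain T' e2 y where e2: "is_epi A T' (src (z \<cdot> e)) e2" "arr e2" "src e2 = T'" "tgt e2 = src (z \<cdot> e)"
    and y: "arr y" "src y = T'" "tgt y = Cob X (i - 1)" and eq: "Df X (i - 1) \<cdot> y = (z \<cdot> e) \<cdot> e2"
    by (rule boundE[OF b])
  have s: "src (z \<cdot> e) = T" using e' z by simp
  have "is_epi A T' (src z) (e \<cdot> e2)" using epi_comp[of T' T e2 "src z" e] e2(1) e s by simp
  moreover have "Df X (i - 1) \<cdot> y = z \<cdot> (e \<cdot> e2)" unfolding eq using z e' e2(2-4) s by simp
  ultimately show ?thesis using boundI[OF z _ y] by simp
qed

lemma bound_nul:
  assumes "bounded_complex A X" "T \<in> Ob A" shows "bound X i (Nul A T (Cob X i))"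
  using bound_diff[of X "Nul A T (Cob X (i - 1))" i] assms by simp

lemma bound_mns:
  assumes X: "bounded_complex A X" and z: "bound X i z" shows "bound X i (mns z)"
proof -
  note z' = boundD[OF z]
  obtain T e y where e: "is_epi A T (src z) e" "arr e" "src e = T" "tgt e = src z"
    and y: "arr y" "src y = T" "tgt y = Cob X (i - 1)" and eq: "Df X (i - 1) \<cdot> y = z \<cdot> e"
    by (rule boundE[OF z])
  show ?thesis using z' e y eq X by (intro boundI[of _ X i T e "mns y"]) simp_all
qed

lemma bound_add:
  assumes X: "bounded_complex A X" and z: "bound X i z" and w: "bound X i w" and s: "src w = src z"
  shows "bound X i (z \<boxplus> w)"
proof -
  note z' = boundD[OF z] and w' = boundD[OF w]
  obtain T e y where e: "is_epi A T (src z) e" "arr e" "src e = T" "tgt e = src z"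
    and y: "arr y" "src y = T" "tgt y = Cob X (i - 1)" and eq: "Df X (i - 1) \<cdot> y = z \<cdot> e"
    by (rule boundE[OF z])
  have we: "bound X i (w \<cdot> e)" using bound_cmp[OF X w e(2)] e s by simp
  have swe: "src (w \<cdot> e) = T" using w' e s by simp
  obtain T' e' y' where e2: "is_epi A T' T e'" "arr e'" "src e' = T'" "tgt e' = T"
    and y2: "arr y'" "src y' = T'" "tgt y' = Cob X (i - 1)" and eq2: "Df X (i - 1) \<cdot> y' = (w \<cdot> e) \<cdot> e'"
    using boundE[OF we] swe by metis
  have epi: "is_epi A T' (src (z \<boxplus> w)) (e \<cdot> e')" using epi_comp[OF e2(1) e(1)] z' w' s by simp
  have "Df X (i - 1) \<cdot> (y \<cdot> e') = (Df X (i - 1) \<cdot> y) \<cdot> e'" using X y e2 by simp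
  also have "\<dots> = z \<cdot> (e \<cdot> e')" unfolding eq using z' e e2 by simp
  finally have "Df X (i - 1) \<cdot> (y \<cdot> e' \<boxplus> y') = (z \<boxplus> w) \<cdot> (e \<cdot> e')"
    using X y y2 e e2 z' w' s eq2 by simp
  then show ?thesis using z' w' s y y2 e e2 by (intro boundI[OF _ _ epi, of X i "y \<cdot> e' \<boxplus> y'"]) simp_all
qed

lemma bound_map:
  assumes f: "chain_map A X Y f" and z: "bound X i z" shows "bound Y i (f i \<cdot> z)"
proof -
  note [simp] = chain_mapD(1-5)[OF f]
  note z' = boundD[OF z]
  obtain T e y where e: "is_epi A T (src z) e" "arr e" "src e = T" "tgt e = src z"
    and y: "arr y" "src y = T" "tgt y = Cob X (i - 1)" and eq: "Df X (i - 1) \<cdot> y = z \<cdot> e"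
    by (rule boundE[OF z])
  have "Df Y (i - 1) \<cdot> (f (i - 1) \<cdot> y) = f i \<cdot> (Df X (i - 1) \<cdot> y)"
    using chain_map_cmp[OF f y(1,3), of i] by simp
  also have "\<dots> = (f i \<cdot> z) \<cdot> e" unfolding eq using z' e by simp
  finally show ?thesis using z' e y by (intro boundI[of _ Y i T e "f (i - 1) \<cdot> y"]) simp_all
qed

lemma cycle_cmp: "bounded_complex A X \<Longrightarrow> cycle X i z \<Longrightarrow> arr t \<Longrightarrow> tgt t = src z \<Longrightarrow> cycle X i (z \<cdot> t)"
proof -
  assume X: "bounded_complex A X" and z: "cycle X i z" and t: "arr t" "tgt t = src z"
  note z' = cycleD[OF z]
  have "Df X i \<cdot> (z \<cdot> t) = (Df X i \<cdot> z) \<cdot> t" using X z'(1,2) t by simp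
  also have "\<dots> = Nul A (src t) (Cob X (i + 1))" unfolding z'(3) using X t by simp
  finally show ?thesis unfolding cycle_def using z'(1,2) t by simp
qed

lemma cycle_add: "bounded_complex A X \<Longrightarrow> cycle X i z \<Longrightarrow> cycle X i w \<Longrightarrow> src w = src z \<Longrightarrow> cycle X i (z \<boxplus> w)"
  unfolding cycle_def by simp

lemma cycle_mns: "bounded_complex A X \<Longrightarrow> cycle X i z \<Longrightarrow> cycle X i (mns z)"
  unfolding cycle_def by simp

lemma cycle_map:
  assumes f: "chain_map A X Y f" and z: "cycle X i z" shows "cycle Y i (f i \<cdot> z)"
proof -
  note [simp] = chain_mapD(1-5)[OF f]
  note z' = cycleD[OF z]
  have "Df Y i \<cdot> (f i \<cdot> z) = f (i + 1) \<cdot> (Df X i \<cdot> z)"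
    using chain_map_cmp[OF f z'(1,2), of "i + 1"] by simp
  also have "\<dots> = Nul A (src z) (Cob Y (i + 1))" unfolding z'(3) using z'(1) by simp
  finally show ?thesis using z' by (simp add: cycle_def)
qed

definition homologous :: "('o, 'a) cplx \<Rightarrow> int \<Rightarrow> 'a \<Rightarrow> 'a \<Rightarrow> bool" where
  "homologous X i a b \<longleftrightarrow> arr a \<and> arr b \<and> src a = src b \<and> tgt a = Cob X i \<and> tgt b = Cob X i \<and>
     bound X i (a \<boxplus> mns b)"

lemma homologousD:
  assumes "homologous X i a b"
  shows "arr a" "arr b" "src a = src b" "tgt a = Cob X i" "tgt b = Cob X i" "bound X i (a \<boxplus> mns b)"
  using assms unfolding homologous_def by auto

lemma homologous_refl: "bounded_complex A X \<Longrightarrow> arr a \<Longrightarrow> tgt a = Cob X i \<Longrightarrow> homologous X i a a"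
  unfolding homologous_def by (simp add: bound_nul)

lemma homologous_sym: 
  assumes X: "bounded_complex A X" and h: "homologous X i a b" shows "homologous X i b a"
proof -
  note h' = homologousD[OF h]
  have "bound X i (mns (a \<boxplus> mns b))" using bound_mns[OF X] h' by blast
  then show ?thesis using h' unfolding homologous_def by (simp add: add_comm)
qed

lemma homologous_bound: 
  assumes X: "bounded_complex A X" and h: "homologous X i a b" and b: "bound X i b" shows "bound X i a"
proof -
  note h' = homologousD[OF h]
  have "bound X i ((a \<boxplus> mns b) \<boxplus> b)" using bound_add[OF X h'(6) b] h'(1-5) by simp
  then show ?thesis using h'(1-5) by (simp add: add_assoc)
qed

lemma homologous_trans: 
  assumes X: "bounded_complex A X" and h: "homologous X i a b" and k: "homologous X i b c" shows "homologous X i a c"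
proof -
  note h' = homologousD[OF h] and k' = homologousD[OF k]
  have "bound X i ((a \<boxplus> mns b) \<boxplus> (b \<boxplus> mns c))" using bound_add[OF X h'(6) k'(6)] h'(1-5) k'(1-5) by simp
  also have "(a \<boxplus> mns b) \<boxplus> (b \<boxplus> mns c) = a \<boxplus> mns c" using h'(1-5) k'(1-5) by (simp add: add_assoc)
  finally show ?thesis using h' k' unfolding homologous_def by simp
qed

lemma homologous_cmp:
  assumes X: "bounded_complex A X" and h: "homologous X i a b" and t: "arr t" "tgt t = src b"
  shows "homologous X i (a \<cdot> t) (b \<cdot> t)"
proof -
  note h' = homologousD[OF h]
  have "bound X i ((a \<boxplus> mns b) \<cdot> t)" using bound_cmp[OF X h'(6) t(1)] t h' by simp
  then show ?thesis using h'(1-5) t unfolding homologous_def by simp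
qed

lemma homologous_map:
  assumes f: "chain_map A X Y f" and h: "homologous X i a b"
  shows "homologous Y i (f i \<cdot> a) (f i \<cdot> b)"
proof -
  note h' = homologousD[OF h]
  have "bound Y i (f i \<cdot> (a \<boxplus> mns b))" using bound_map[OF f h'(6)] .
  then show ?thesis using h'(1-5) chain_mapD[OF f] unfolding homologous_def by simp
qed

text \<open>\<open>H_surj\<close>, \<open>H_inj\<close> and \<open>H_zero\<close> say that \<open>H\<^sup>i(f)\<close> is epic, that \<open>H\<^sup>i(f)\<close> is monic and that \<open>H\<^sup>i(X) = 0\<close>. They
  avoid the chosen homology objects, and are linked to them by \<open>homology_iso_iff\<close> and
  \<open>homology_zero_iff\<close>.\<close>

definition H_surj :: "('o, 'a) cplx \<Rightarrow> ('o, 'a) cplx \<Rightarrow> (int \<Rightarrow> 'a) \<Rightarrow> int \<Rightarrow> bool" where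
  "H_surj X Y f i \<longleftrightarrow> (\<forall>z. cycle Y i z \<longrightarrow>
     (\<exists>e x. is_epi A (src e) (src z) e \<and> cycle X i x \<and> src x = src e \<and> homologous Y i (f i \<cdot> x) (z \<cdot> e)))"

definition H_inj :: "('o, 'a) cplx \<Rightarrow> ('o, 'a) cplx \<Rightarrow> (int \<Rightarrow> 'a) \<Rightarrow> int \<Rightarrow> bool" where
  "H_inj X Y f i \<longleftrightarrow> (\<forall>z. cycle X i z \<and> bound Y i (f i \<cdot> z) \<longrightarrow> bound X i z)"

definition H_zero :: "('o, 'a) cplx \<Rightarrow> int \<Rightarrow> bool" where
  "H_zero X i \<longleftrightarrow> (\<forall>z. cycle X i z \<longrightarrow> bound X i z)"

lemma H_surjE:
  assumes "H_surj X Y f i" "cycle Y i z"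
  obtains T e x where "is_epi A T (src z) e" "arr e" "src e = T" "tgt e = src z" "cycle X i x" "src x = T"
    "homologous Y i (f i \<cdot> x) (z \<cdot> e)"
proof -
  obtain e x where *: "is_epi A (src e) (src z) e" "cycle X i x" "src x = src e" "homologous Y i (f i \<cdot> x) (z \<cdot> e)"
    using assms unfolding H_surj_def by blast
  show ?thesis by (rule that[OF *(1) _ _ _ *(2-4)]) (use epi_arr[OF *(1)] in auto)
qed

lemma H_surjI:
  assumes "\<And>z. cycle Y i z \<Longrightarrow> \<exists>T e x. is_epi A T (src z) e \<and> cycle X i x \<and> src x = T \<and> homologous Y i (f i \<cdot> x) (z \<cdot> e)"
  shows "H_surj X Y f i"
  unfolding H_surj_def using assms epi_arr(2) by metis

text \<open>The next lemmas are the laws that surjective and injective maps of sets obey under composition. The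
  two cancellation rules contain the two-out-of-three property of quasi-isomorphisms.\<close>

lemma H_surj_comp:
  assumes f: "chain_map A X Y f" and g: "chain_map A Y Z g" and Sf: "H_surj X Y f i" and Sg: "H_surj Y Z g i"
  shows "H_surj X Z (\<lambda>i. g i \<cdot> f i) i"
proof (rule H_surjI)
  fix z assume z: "cycle Z i z"
  note [simp] = chain_mapD(1-5)[OF f] chain_mapD(1-5)[OF g]
  note z' = cycleD[OF z]
  obtain T e y where e: "is_epi A T (src z) e" "arr e" "src e = T" "tgt e = src z"
    and y: "cycle Y i y" "src y = T" "homologous Z i (g i \<cdot> y) (z \<cdot> e)" by (rule H_surjE[OF Sg z])
  obtain T' e' x where e2: "is_epi A T' (src y) e'" "arr e'" "src e' = T'" "tgt e' = src y"
    and x: "cycle X i x" "src x = T'" "homologous Y i (f i \<cdot> x) (y \<cdot> e')" by (rule H_surjE[OF Sf y(1)])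
  note y' = cycleD[OF y(1)] and x' = cycleD[OF x(1)]
  have h1: "homologous Z i (g i \<cdot> (f i \<cdot> x)) (g i \<cdot> (y \<cdot> e'))" using homologous_map[OF g x(3)] .
  have "homologous Z i ((g i \<cdot> y) \<cdot> e') ((z \<cdot> e) \<cdot> e')"
    using homologous_cmp[OF _ y(3) e2(2)] e2 e y(2) z' by simp
  then have h2: "homologous Z i (g i \<cdot> (y \<cdot> e')) (z \<cdot> (e \<cdot> e'))"
    using y'(1,2) e2(2-4) z'(1,2) e(2-4) y(2) by simp
  have "homologous Z i (g i \<cdot> (f i \<cdot> x)) (z \<cdot> (e \<cdot> e'))"
    by (rule homologous_trans[OF _ h1 h2]) simp
  moreover have "is_epi A T' (src z) (e \<cdot> e')" using epi_comp e2(1) e(1) y(2) by simp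
  ultimately show "\<exists>T e x. is_epi A T (src z) e \<and> cycle X i x \<and> src x = T \<and> homologous Z i ((g i \<cdot> f i) \<cdot> x) (z \<cdot> e)"
    using x(1,2) x' by (intro exI[of _ T'] exI[of _ "e \<cdot> e'"] exI[of _ x]) simp
qed

lemma H_surj_of_comp:
  assumes f: "chain_map A X Y f" and g: "chain_map A Y Z g" and S: "H_surj X Z (\<lambda>i. g i \<cdot> f i) i"
  shows "H_surj Y Z g i"
proof (rule H_surjI)
  fix z assume z: "cycle Z i z"
  note [simp] = chain_mapD(1-5)[OF f] chain_mapD(1-5)[OF g]
  obtain T e x where e: "is_epi A T (src z) e" "arr e" "src e = T" "tgt e = src z"
    and x: "cycle X i x" "src x = T" "homologous Z i ((g i \<cdot> f i) \<cdot> x) (z \<cdot> e)" by (rule H_surjE[OF S z])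
  note x' = cycleD[OF x(1)]
  show "\<exists>T e x. is_epi A T (src z) e \<and> cycle Y i x \<and> src x = T \<and> homologous Z i (g i \<cdot> x) (z \<cdot> e)"
    using e cycle_map[OF f x(1)] x(2,3) x'
    by (intro exI[of _ T] exI[of _ e] exI[of _ "f i \<cdot> x"]) simp
qed

lemma H_inj_comp:
  assumes f: "chain_map A X Y f" and g: "chain_map A Y Z g" and If: "H_inj X Y f i" and Ig: "H_inj Y Z g i"
  shows "H_inj X Z (\<lambda>i. g i \<cdot> f i) i"
  unfolding H_inj_def
proof (intro allI impI, elim conjE)
  fix z assume z: "cycle X i z" "bound Z i ((g i \<cdot> f i) \<cdot> z)"
  note [simp] = chain_mapD(1-5)[OF f] chain_mapD(1-5)[OF g]
  have "bound Z i (g i \<cdot> (f i \<cdot> z))" using z(2) cycleD[OF z(1)] by simp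
  then have "bound Y i (f i \<cdot> z)" using Ig cycle_map[OF f z(1)] unfolding H_inj_def by blast
  then show "bound X i z" using If z(1) unfolding H_inj_def by blast
qed

lemma H_inj_of_comp:
  assumes f: "chain_map A X Y f" and g: "chain_map A Y Z g" and I: "H_inj X Z (\<lambda>i. g i \<cdot> f i) i"
  shows "H_inj X Y f i"
  unfolding H_inj_def
proof (intro allI impI, elim conjE)
  fix z assume z: "cycle X i z" "bound Y i (f i \<cdot> z)"
  note [simp] = chain_mapD(1-5)[OF f] chain_mapD(1-5)[OF g]
  have "bound Z i ((g i \<cdot> f i) \<cdot> z)" using bound_map[OF g z(2)] cycleD[OF z(1)] by simp
  then show "bound X i z" using I z(1) unfolding H_inj_def by blast
qed

lemma H_surj_cancel:
  assumes f: "chain_map A X Y f" and g: "chain_map A Y Z g"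
    and S: "H_surj X Z (\<lambda>i. g i \<cdot> f i) i" and I: "H_inj Y Z g i"
  shows "H_surj X Y f i"
proof (rule H_surjI)
  fix z assume z: "cycle Y i z"
  note [simp] = chain_mapD(1-5)[OF f] chain_mapD(1-5)[OF g]
  have gz: "cycle Z i (g i \<cdot> z)" using cycle_map[OF g z] .
  note z' = cycleD[OF z]
  have s: "src (g i \<cdot> z) = src z" using z' by simp
  obtain T e x where e: "is_epi A T (src z) e" "arr e" "src e = T" "tgt e = src z"
    and x: "cycle X i x" "src x = T" "homologous Z i ((g i \<cdot> f i) \<cdot> x) ((g i \<cdot> z) \<cdot> e)"
    using H_surjE[OF S gz] unfolding s by metis
  note x' = cycleD[OF x(1)]
  have "bound Z i (g i \<cdot> (f i \<cdot> x \<boxplus> mns (z \<cdot> e)))"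
    using homologousD(6)[OF x(3)] x' z' e x(2) by simp
  moreover have "cycle Y i (f i \<cdot> x \<boxplus> mns (z \<cdot> e))"
    using cycle_map[OF f x(1)] cycle_cmp[OF _ z, of e] e x(2) x' z' by (intro cycle_add cycle_mns) simp_all
  ultimately have "bound Y i (f i \<cdot> x \<boxplus> mns (z \<cdot> e))" using I unfolding H_inj_def by blast
  then have "homologous Y i (f i \<cdot> x) (z \<cdot> e)" unfolding homologous_def using x' x(2) z' e by simp
  then show "\<exists>T e x. is_epi A T (src z) e \<and> cycle X i x \<and> src x = T \<and> homologous Y i (f i \<cdot> x) (z \<cdot> e)"
    using e(1) x(1,2) by blast
qed

lemma H_inj_cancel:
  assumes f: "chain_map A X Y f" and g: "chain_map A Y Z g"
    and I: "H_inj X Z (\<lambda>i. g i \<cdot> f i) i" and S: "H_surj X Y f i"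
  shows "H_inj Y Z g i"
  unfolding H_inj_def
proof (intro allI impI, elim conjE)
  fix z assume z: "cycle Y i z" and b: "bound Z i (g i \<cdot> z)"
  note [simp] = chain_mapD(1-5)[OF f] chain_mapD(1-5)[OF g]
  note z' = cycleD[OF z]
  obtain T e x where e: "is_epi A T (src z) e" "arr e" "src e = T" "tgt e = src z"
    and x: "cycle X i x" "src x = T" "homologous Y i (f i \<cdot> x) (z \<cdot> e)" by (rule H_surjE[OF S z])
  note x' = cycleD[OF x(1)]
  have "bound Z i ((g i \<cdot> z) \<cdot> e)" using bound_cmp[OF _ b e(2)] e z' by simp
  then have "bound Z i (g i \<cdot> (z \<cdot> e))" using e z' by simp
  with homologous_bound[OF _ homologous_map[OF g x(3)]] have "bound Z i (g i \<cdot> (f i \<cdot> x))" by simp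
  then have "bound Z i ((g i \<cdot> f i) \<cdot> x)" using x' by simp
  then have "bound X i x" using I x(1) unfolding H_inj_def by blast
  then have "bound Y i (f i \<cdot> x)" by (rule bound_map[OF f])
  then have "bound Y i (z \<cdot> e)" using homologous_bound[OF _ homologous_sym[OF _ x(3)]] by simp
  then show "bound Y i z" using bound_local[OF e(1) z'(1,2)] by simp
qed

lemma H_inj_zero:
  assumes "chain_map A X Y f" "H_inj X Y f i" "H_zero Y i" shows "H_zero X i"
  using assms cycle_map unfolding H_inj_def H_zero_def by blast

lemma H_surj_zero:
  assumes f: "chain_map A X Y f" and S: "H_surj X Y f i" and Z: "H_zero X i" shows "H_zero Y i"
  unfolding H_zero_def
proof (intro allI impI)
  fix z assume z: "cycle Y i z"
  note [simp] = chain_mapD(1-5)[OF f]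
  obtain T e x where e: "is_epi A T (src z) e" "arr e" "src e = T" "tgt e = src z"
    and x: "cycle X i x" "src x = T" "homologous Y i (f i \<cdot> x) (z \<cdot> e)" by (rule H_surjE[OF S z])
  have "bound Y i (f i \<cdot> x)" using Z x(1) bound_map[OF f] unfolding H_zero_def by blast
  then have "bound Y i (z \<cdot> e)" using homologous_bound[OF _ homologous_sym[OF _ x(3)]] by simp
  then show "bound Y i z" using bound_local[OF e(1)] cycleD[OF z] by simp
qed

lemma H_zero_inj: "H_zero X i \<Longrightarrow> H_inj X Y f i"
  unfolding H_inj_def H_zero_def by blast

lemma H_zero_surj:
  assumes f: "chain_map A X Y f" and Z: "H_zero Y i" shows "H_surj X Y f i"
proof (rule H_surjI)
  fix z assume z: "cycle Y i z"
  note [simp] = chain_mapD(1-5)[OF f]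
  note z' = cycleD[OF z]
  have sz: "src z \<in> Ob A" using z' by simp
  have "bound Y i (mns z)" using bound_mns[of Y i z] Z z unfolding H_zero_def by simp
  then have "homologous Y i (f i \<cdot> Nul A (src z) (Cob X i)) (z \<cdot> Idn A (src z))"
    unfolding homologous_def using z' sz by simp
  moreover have "cycle X i (Nul A (src z) (Cob X i))" unfolding cycle_def using sz by simp
  ultimately show "\<exists>T e x. is_epi A T (src z) e \<and> cycle X i x \<and> src x = T \<and> homologous Y i (f i \<cdot> x) (z \<cdot> e)"
    using epi_idn[OF sz] sz by (intro exI[of _ "src z"] exI[of _ "Idn A (src z)"] exI[of _ "Nul A (src z) (Cob X i)"]) simp
qed


text \<open>The dictionary between generalised elements and a presentation \<open>K \<rightarrow> H\<close> of the homology: cycles are the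
  elements of \<open>K\<close>, a cycle is a boundary if and only if it vanishes in \<open>H\<close> (by \<open>cokernel_exact\<close>), and an arrow out
  of \<open>K\<close> that kills all boundaries factors through \<open>H\<close>.\<close>

lemma presentation:
  assumes X: "bounded_complex A X" and P: "homology_presentation A X i (K, k, H, q)"
  shows "arr k" "src k = K" "tgt k = Cob X i" "Df X i \<cdot> k = Nul A K (Cob X (i + 1))" "is_mono A K (Cob X i) k"
    and "arr q" "src q = K" "tgt q = H" "is_epi A K H q"
    and presentation_cycle: "\<And>z. cycle X i z \<Longrightarrow> \<exists>x. arr x \<and> src x = src z \<and> tgt x = K \<and> k \<cdot> x = z"
    and presentation_bound: "\<And>x. arr x \<Longrightarrow> tgt x = K \<Longrightarrow> bound X i (k \<cdot> x) \<longleftrightarrow> q \<cdot> x = Nul A (src x) H"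
    and presentation_factor: "\<And>g. arr g \<Longrightarrow> src g = K \<Longrightarrow>
        (\<And>x. arr x \<Longrightarrow> tgt x = K \<Longrightarrow> bound X i (k \<cdot> x) \<Longrightarrow> g \<cdot> x = Nul A (src x) (tgt g)) \<Longrightarrow>
        \<exists>h. arr h \<and> src h = H \<and> tgt h = tgt g \<and> h \<cdot> q = g"
proof -
  obtain \<epsilon> where k: "is_kernel A (Cob X i) (Cob X (i + 1)) (Df X i) K k"
    and eps: "\<epsilon> \<in> Hom A (Cob X (i - 1)) K" "k \<cdot> \<epsilon> = Df X (i - 1)"
    and q: "is_cokernel A (Cob X (i - 1)) K \<epsilon> H q"
    using P unfolding homology_presentation_def by auto
  note k' = kernel_arr[OF k] and q' = cokernel_arr[OF q]
  have e': "arr \<epsilon>" "src \<epsilon> = Cob X (i - 1)" "tgt \<epsilon> = K" using eps by (simp_all add: hom_iff)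
  show "arr k" "src k = K" "tgt k = Cob X i" "Df X i \<cdot> k = Nul A K (Cob X (i + 1))" "arr q" "src q = K" "tgt q = H"
    by (fact k' q')+
  show km: "is_mono A K (Cob X i) k" using kernel_mono[OF _ _ _ k] X by simp
  show qe: "is_epi A K H q" using cokernel_epi[OF _ _ _ q] e' by simp
  show "\<exists>x. arr x \<and> src x = src z \<and> tgt x = K \<and> k \<cdot> x = z" if z: "cycle X i z" for z
    using kernel_factor[OF k cycleD[OF z]] by blast
  show b: "bound X i (k \<cdot> x) \<longleftrightarrow> q \<cdot> x = Nul A (src x) H" if x: "arr x" "tgt x = K" for x
  proof
    assume B: "bound X i (k \<cdot> x)"
    have s: "src (k \<cdot> x) = src x" using x k' by simp
    obtain T e y where e: "is_epi A T (src x) e" "arr e" "src e = T" "tgt e = src x"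
      and y: "arr y" "src y = T" "tgt y = Cob X (i - 1)" "Df X (i - 1) \<cdot> y = (k \<cdot> x) \<cdot> e"
      using boundE[OF B] unfolding s by metis
    have "k \<cdot> (\<epsilon> \<cdot> y) = (k \<cdot> \<epsilon>) \<cdot> y" using k'(1-3) e' y(1-3) by simp
    also have "\<dots> = k \<cdot> (x \<cdot> e)" unfolding eps(2) y(4) using k'(1-3) x e by simp
    finally have "\<epsilon> \<cdot> y = x \<cdot> e" using k'(1-3) e' y(1-3) x e by - (rule mono_cancel[OF km], simp_all)
    then have "(q \<cdot> x) \<cdot> e = q \<cdot> (\<epsilon> \<cdot> y)" using q'(1-3) x e by simp
    also have "\<dots> = (q \<cdot> \<epsilon>) \<cdot> y" using q'(1-3) e' y(1-3) by simp
    also have "\<dots> = Nul A T H" unfolding q'(4) using q'(1,3) e' y(1-3) by auto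
    finally show "q \<cdot> x = Nul A (src x) H" using q'(1-3) x e by - (rule epi_nul[OF e(1)], simp_all)
  next
    assume Q: "q \<cdot> x = Nul A (src x) H"
    obtain W e y where e: "is_epi A W (src x) e" and y: "arr y" "src y = W" "tgt y = Cob X (i - 1)" "\<epsilon> \<cdot> y = x \<cdot> e"
      using cokernel_exact[OF e' q x Q] .
    note e2 = epi_arr[OF e]
    have "Df X (i - 1) \<cdot> y = k \<cdot> (\<epsilon> \<cdot> y)" unfolding eps(2)[symmetric] using k'(1-3) e' y(1-3) by simp
    also have "\<dots> = (k \<cdot> x) \<cdot> e" unfolding y(4) using k'(1-3) x e2 by simp
    finally show "bound X i (k \<cdot> x)" using x k'(1-3) e y(1-3) by (intro boundI) simp_all
  qed
  show "\<exists>h. arr h \<and> src h = H \<and> tgt h = tgt g \<and> h \<cdot> q = g"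
    if g: "arr g" "src g = K" "\<And>x. arr x \<Longrightarrow> tgt x = K \<Longrightarrow> bound X i (k \<cdot> x) \<Longrightarrow> g \<cdot> x = Nul A (src x) (tgt g)" for g
  proof -
    have "bound X i (k \<cdot> \<epsilon>)" using b[OF e'(1,3)] q'(4) e' by simp
    then have "g \<cdot> \<epsilon> = Nul A (Cob X (i - 1)) (tgt g)" using g(3)[OF e'(1,3)] e' by simp
    then show ?thesis using cokernel_factor[OF q g(1,2)] by blast
  qed
qed

lemma ex_presentation:
  assumes X: "bounded_complex A X" shows "\<exists>p. homology_presentation A X i p"
proof -
  obtain K k where k: "is_kernel A (Cob X i) (Cob X (i + 1)) (Df X i) K k"
    using ex_kernel[of "Df X i" "Cob X i" "Cob X (i + 1)"] X by (auto simp: hom_iff)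
  obtain \<epsilon> where e: "arr \<epsilon>" "src \<epsilon> = src (Df X (i - 1))" "tgt \<epsilon> = K" "k \<cdot> \<epsilon> = Df X (i - 1)"
    using kernel_factor[OF k, of "Df X (i - 1)"] X by auto
  then have e': "\<epsilon> \<in> Hom A (Cob X (i - 1)) K" using X by (simp add: hom_iff)
  obtain H q where "is_cokernel A (Cob X (i - 1)) K \<epsilon> H q" using ex_cokernel[OF e'] by blast
  then have "homology_presentation A X i (K, k, H, q)" unfolding homology_presentation_def using k e' e(4) by auto
  then show ?thesis by blast
qed

lemma chosen_presentation:
  assumes X: "bounded_complex A X"
  obtains K k q where "chosen_homology A X i = (K, k, homology A X i, q)"
    "homology_presentation A X i (K, k, homology A X i, q)"
proof -
  obtain K k H q where c: "chosen_homology A X i = (K, k, H, q)" by (metis prod_cases4)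
  then have "H = homology A X i" unfolding homology_def by simp
  moreover have "homology_presentation A X i (chosen_homology A X i)"
    unfolding chosen_homology_def using someI_ex[OF ex_presentation[OF X]] .
  ultimately show ?thesis using that c by simp
qed

text \<open>Since \<open>q : K \<rightarrow> H\<close> is epic, \<open>H = 0\<close> amounts to \<open>q = 0\<close>, which is tested on the universal cycle \<open>k\<close>.\<close>

lemma homology_zero_iff:
  assumes X: "bounded_complex A X" shows "zero_object A (homology A X i) \<longleftrightarrow> H_zero X i"
proof -
  obtain K k q where P: "homology_presentation A X i (K, k, homology A X i, q)"
    using chosen_presentation[OF X] by metis
  let ?H = "homology A X i"
  note p = presentation(1-9)[OF X P] and pc = presentation_cycle[OF X P] and pb = presentation_bound[OF X P]
  have H: "?H \<in> Ob A" using src_tgt_Ob(2)[OF p(6)] p(8) by simp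
  have K: "K \<in> Ob A" using p by auto
  show ?thesis
  proof
    assume Z: "zero_object A ?H"
    show "H_zero X i" unfolding H_zero_def
    proof (intro allI impI)
      fix z assume z: "cycle X i z"
      obtain x where x: "arr x" "src x = src z" "tgt x = K" "k \<cdot> x = z" using pc[OF z] by blast
      have "q \<cdot> x = Nul A (src x) ?H" using zero_arr_tgt[OF Z, of "q \<cdot> x"] p x(1-3) by simp
      then show "bound X i z" using pb[OF x(1,3)] x(4) by simp
    qed
  next
    assume Z: "H_zero X i"
    have "cycle X i k" unfolding cycle_def using p by simp
    then have "bound X i (k \<cdot> Idn A K)" using Z p unfolding H_zero_def by simp
    then have "q = Nul A K ?H" using pb[of "Idn A K"] K p by simp
    then have "Idn A ?H = Nul A ?H ?H" using p H by - (rule epi_nul[OF p(9)], simp_all)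
    then show "zero_object A ?H" using zero_object_iff H by blast
  qed
qed

lemma homology_map_char:
  assumes f: "chain_map A X Y f"
    and X: "chosen_homology A X i = (K, k, H, q)" "homology_presentation A X i (K, k, H, q)"
    and Y: "chosen_homology A Y i = (K', k', H', q')" "homology_presentation A Y i (K', k', H', q')"
  obtains g h where "homology_map A X Y f i = h" "arr h" "src h = H" "tgt h = H'"
    "arr g" "src g = K" "tgt g = K'" "k' \<cdot> g = f i \<cdot> k" "h \<cdot> q = q' \<cdot> g"
proof -
  note [simp] = chain_mapD(1-5)[OF f]
  note p = presentation(1-9)[OF chain_mapD(1)[OF f] X(2)] and p' = presentation(1-9)[OF chain_mapD(2)[OF f] Y(2)]
  note pf = presentation_factor[OF chain_mapD(1)[OF f] X(2)]
  note pb' = presentation_bound[OF chain_mapD(2)[OF f] Y(2)]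
  have "cycle X i k" unfolding cycle_def using p by simp
  then have "cycle Y i (f i \<cdot> k)" by (rule cycle_map[OF f])
  then obtain g where g0: "arr g" "src g = src (f i \<cdot> k)" "tgt g = K'" "k' \<cdot> g = f i \<cdot> k"
    using presentation_cycle[OF chain_mapD(2)[OF f] Y(2)] by blast
  have g: "arr g" "src g = K" "tgt g = K'" using g0 p by simp_all
  have "(q' \<cdot> g) \<cdot> x = Nul A (src x) (tgt (q' \<cdot> g))" if x: "arr x" "tgt x = K" "bound X i (k \<cdot> x)" for x
  proof -
    have "k' \<cdot> (g \<cdot> x) = (f i \<cdot> k) \<cdot> x" unfolding g0(4)[symmetric] using g x p' by simp
    also have "\<dots> = f i \<cdot> (k \<cdot> x)" using x p by simp
    finally have "bound Y i (k' \<cdot> (g \<cdot> x))" using bound_map[OF f x(3)] by simp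
    then have "q' \<cdot> (g \<cdot> x) = Nul A (src x) H'" using pb'[of "g \<cdot> x"] g x by simp
    then show ?thesis using g x p' by simp
  qed
  then obtain h where h: "arr h" "src h = H" "tgt h = H'" "h \<cdot> q = q' \<cdot> g"
    using pf[of "q' \<cdot> g"] g p' by auto
  have "homology_map A X Y f i = (THE h. h \<in> Hom A H H' \<and> (\<exists>g\<in>Hom A K K'. k' \<cdot> g = f i \<cdot> k \<and> h \<cdot> q = q' \<cdot> g))"
    unfolding homology_map_def X(1) Y(1) by simp
  also have "\<dots> = h"
  proof (rule the_equality)
    show "h \<in> Hom A H H' \<and> (\<exists>g\<in>Hom A K K'. k' \<cdot> g = f i \<cdot> k \<and> h \<cdot> q = q' \<cdot> g)"
      unfolding hom_iff Bex_def using g g0(4) h by (intro conjI exI[of _ g])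
    fix h2 assume "h2 \<in> Hom A H H' \<and> (\<exists>g\<in>Hom A K K'. k' \<cdot> g = f i \<cdot> k \<and> h2 \<cdot> q = q' \<cdot> g)"
    then obtain g2 where "g2 \<in> Hom A K K'" and kg2: "k' \<cdot> g2 = f i \<cdot> k" "h2 \<cdot> q = q' \<cdot> g2"
      and "h2 \<in> Hom A H H'"
      by (elim conjE bexE) (rule that)
    then have g2: "arr g2" "src g2 = K" "tgt g2 = K'" and h2: "arr h2" "src h2 = H" "tgt h2 = H'"
      by (simp_all add: hom_iff)
    have "g2 = g" by (rule mono_cancel[OF p'(5)]) (use g g2 kg2(1) g0(4) in simp_all)
    then have "h2 \<cdot> q = h \<cdot> q" using kg2(2) h(4) by simp
    then show "h2 = h" using h(1-3) h2 by - (rule epi_cancel[OF p(9)], simp_all)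
  qed
  finally show ?thesis using that h g g0(4) by blast
qed

text \<open>In an abelian category isomorphisms are the arrows that are both monic and epic, and the two
  properties of \<open>h = H\<^sup>i(f)\<close> translate separately. For the directions from \<open>h\<close> to elements, classes are lifted to
  cycles along the epimorphism \<open>q\<close>; conversely surjectivity is applied to the universal cycle \<open>k'\<close>.\<close>

lemma homology_iso_iff:
  assumes f: "chain_map A X Y f"
  shows "is_isomorphism A (homology A X i) (homology A Y i) (homology_map A X Y f i) \<longleftrightarrow> H_surj X Y f i \<and> H_inj X Y f i"
proof -
  note [simp] = chain_mapD(1-5)[OF f]
  obtain K k q where X: "chosen_homology A X i = (K, k, homology A X i, q)" "homology_presentation A X i (K, k, homology A X i, q)"
    using chosen_presentation[OF chain_mapD(1)[OF f]] .
  obtain K' k' q' where Y: "chosen_homology A Y i = (K', k', homology A Y i, q')" "homology_presentation A Y i (K', k', homology A Y i, q')"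
    using chosen_presentation[OF chain_mapD(2)[OF f]] .
  define H H' where "H = homology A X i" and "H' = homology A Y i"
  note p = presentation(1-9)[OF chain_mapD(1)[OF f] X(2), folded H_def]
    and p' = presentation(1-9)[OF chain_mapD(2)[OF f] Y(2), folded H'_def]
  note pb = presentation_bound[OF chain_mapD(1)[OF f] X(2), folded H_def]
    and pb' = presentation_bound[OF chain_mapD(2)[OF f] Y(2), folded H'_def]
  note pc = presentation_cycle[OF chain_mapD(1)[OF f] X(2)]
    and pc' = presentation_cycle[OF chain_mapD(2)[OF f] Y(2)]
  obtain g h where hm: "homology_map A X Y f i = h" and h: "arr h" "src h = H" "tgt h = H'"
    and g: "arr g" "src g = K" "tgt g = K'" and kg: "k' \<cdot> g = f i \<cdot> k" and hq: "h \<cdot> q = q' \<cdot> g"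
    using homology_map_char[OF f X Y, folded H_def H'_def] .
  have cyc: "cycle X i (k \<cdot> x)" if x: "arr x" "tgt x = K" for x
  proof -
    have "cycle X i k" unfolding cycle_def using p by simp
    then show ?thesis using cycle_cmp[of X i k x] x p by simp
  qed
  have cyc': "cycle Y i (k' \<cdot> x)" if x: "arr x" "tgt x = K'" for x
  proof -
    have "cycle Y i k'" unfolding cycle_def using p' by simp
    then show ?thesis using cycle_cmp[of Y i k' x] x p' by simp
  qed
  have fk: "f i \<cdot> (k \<cdot> x) = k' \<cdot> (g \<cdot> x)" if x: "arr x" "tgt x = K" for x
  proof -
    have "f i \<cdot> (k \<cdot> x) = (f i \<cdot> k) \<cdot> x" using x p by simp
    also have "\<dots> = k' \<cdot> (g \<cdot> x)" unfolding kg[symmetric] using x p' g by simp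
    finally show ?thesis .
  qed
  have hqx: "h \<cdot> (q \<cdot> x) = q' \<cdot> (g \<cdot> x)" if x: "arr x" "tgt x = K" for x
  proof -
    have "h \<cdot> (q \<cdot> x) = (h \<cdot> q) \<cdot> x" using x p h by simp
    also have "\<dots> = q' \<cdot> (g \<cdot> x)" unfolding hq using x p' g by simp
    finally show ?thesis .
  qed
  \<comment> \<open>Homologous cycles are those with equal classes in \<open>H\'\<close>.\<close>
  have hom: "homologous Y i (f i \<cdot> (k \<cdot> x)) (k' \<cdot> y) \<longleftrightarrow> h \<cdot> (q \<cdot> x) = q' \<cdot> y"
    if x: "arr x" "tgt x = K" and y: "arr y" "tgt y = K'" "src y = src x" for x y
  proof -
    have "homologous Y i (f i \<cdot> (k \<cdot> x)) (k' \<cdot> y) \<longleftrightarrow> bound Y i (k' \<cdot> (g \<cdot> x \<boxplus> mns y))"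
      unfolding fk[OF x] homologous_def using x y p' g by simp
    also have "\<dots> \<longleftrightarrow> q' \<cdot> (g \<cdot> x) \<boxplus> mns (q' \<cdot> y) = Nul A (src x) H'"
      using pb'[of "g \<cdot> x \<boxplus> mns y"] x y p' g by simp
    also have "\<dots> \<longleftrightarrow> q' \<cdot> (g \<cdot> x) = q' \<cdot> y"
      using x y p' g by (intro add_mns_eq_nul) simp_all
    finally show ?thesis unfolding hqx[OF x] .
  qed
  have "is_epi A H H' h \<longleftrightarrow> H_surj X Y f i"
  proof
    assume e: "is_epi A H H' h"
    have hqe: "is_epi A K H' (h \<cdot> q)" using epi_comp[OF p(9) e] .
    show "H_surj X Y f i"
    proof (rule H_surjI)
      fix z assume z: "cycle Y i z"
      obtain w where w: "arr w" "src w = src z" "tgt w = K'" "k' \<cdot> w = z" using pc'[OF z] by blast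
      have "arr (q' \<cdot> w)" "tgt (q' \<cdot> w) = H'" using w(1-3) p' by simp_all
      from epi_pullback[OF hqe this] obtain W e' x where e': "is_epi A W (src (q' \<cdot> w)) e'"
        and x: "arr x" "src x = W" "tgt x = K" "(h \<cdot> q) \<cdot> x = (q' \<cdot> w) \<cdot> e'" .
      have s: "src (q' \<cdot> w) = src z" using w(1-3) p' by simp
      note e'' = epi_arr[OF e'[unfolded s]]
      have "h \<cdot> (q \<cdot> x) = q' \<cdot> (w \<cdot> e')" using x h p w(1-3) p' e'' by simp
      then have "homologous Y i (f i \<cdot> (k \<cdot> x)) (k' \<cdot> (w \<cdot> e'))" using hom[of x "w \<cdot> e'"] x(1-3) w(1-3) e'' by simp
      moreover have "k' \<cdot> (w \<cdot> e') = z \<cdot> e'" unfolding w(4)[symmetric] using w(1-3) e'' p' by simp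
      ultimately show "\<exists>T e x. is_epi A T (src z) e \<and> cycle X i x \<and> src x = T \<and> homologous Y i (f i \<cdot> x) (z \<cdot> e)"
        using e'[unfolded s] cyc[OF x(1,3)] x(1-3) p by (intro exI[of _ W] exI[of _ e'] exI[of _ "k \<cdot> x"]) simp
    qed
  next
    assume S: "H_surj X Y f i"
    have K': "K' \<in> Ob A" using p' by auto
    have c: "cycle Y i k'" unfolding cycle_def using p' by simp
    obtain T e z where e: "is_epi A T K' e" "arr e" "src e = T" "tgt e = K'" and z: "cycle X i z" "src z = T"
      and hz: "homologous Y i (f i \<cdot> z) (k' \<cdot> e)" using H_surjE[OF S c] p'(2) by metis
    obtain x where x: "arr x" "src x = src z" "tgt x = K" "k \<cdot> x = z" using pc[OF z(1)] by blast
    have eq: "h \<cdot> (q \<cdot> x) = q' \<cdot> e"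
      using hom[OF x(1,3) e(2,4)] hz unfolding x(4) e(3) x(2) z(2) by blast
    show "is_epi A H H' h"
    proof (rule epiI[OF h])
      fix u assume u: "arr u" "src u = H'" "u \<cdot> h = Nul A H (tgt u)"
      have "u \<cdot> (q' \<cdot> e) = (u \<cdot> h) \<cdot> (q \<cdot> x)" unfolding eq[symmetric] using u(1,2) h p x(1-3) by simp
      also have "\<dots> = Nul A T (tgt u)" unfolding u(3) using u(1,2) h p x(1-3) z(2) by simp
      finally have "(u \<cdot> q') \<cdot> e = Nul A T (tgt u)" using u(1,2) p' e by simp
      then have "u \<cdot> q' = Nul A K' (tgt u)" using u(1,2) p' by - (rule epi_nul[OF e(1)], simp_all)
      then show "u = Nul A H' (tgt u)" by (intro epi_nul[OF p'(9)]) (use u(1,2) in simp_all)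
    qed
  qed
  moreover have "is_mono A H H' h \<longleftrightarrow> H_inj X Y f i"
  proof
    assume m: "is_mono A H H' h"
    show "H_inj X Y f i" unfolding H_inj_def
    proof (intro allI impI, elim conjE)
      fix z assume z: "cycle X i z" and b: "bound Y i (f i \<cdot> z)"
      obtain x where x: "arr x" "src x = src z" "tgt x = K" "k \<cdot> x = z" using pc[OF z] by blast
      have "bound Y i (k' \<cdot> (g \<cdot> x))" using b fk[OF x(1,3)] x(4) by simp
      then have "q' \<cdot> (g \<cdot> x) = Nul A (src x) H'" using pb'[of "g \<cdot> x"] x(1-3) g by simp
      then have "h \<cdot> (q \<cdot> x) = Nul A (src x) H'" using hqx[OF x(1,3)] by simp
      then have "q \<cdot> x = Nul A (src x) H" using x(1-3) p by - (rule mono_nul[OF m], simp_all)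
      then show "bound X i z" using pb[OF x(1,3)] x(4) by simp
    qed
  next
    assume I: "H_inj X Y f i"
    show "is_mono A H H' h"
    proof (rule monoI[OF h])
      fix u assume u: "arr u" "tgt u = H" "h \<cdot> u = Nul A (src u) H'"
      obtain W e x where e: "is_epi A W (src u) e" and x: "arr x" "src x = W" "tgt x = K" and qx: "q \<cdot> x = u \<cdot> e"
        using epi_pullback[OF p(9) u(1,2)] .
      note e' = epi_arr[OF e]
      have "q' \<cdot> (g \<cdot> x) = (h \<cdot> u) \<cdot> e" unfolding hqx[OF x(1,3), symmetric] qx using h u(1,2) e' by simp
      also have "\<dots> = Nul A W H'" unfolding u(3) using h u(1,2) e' by auto
      finally have "bound Y i (f i \<cdot> (k \<cdot> x))" unfolding fk[OF x(1,3)] using pb'[of "g \<cdot> x"] x g by simp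
      then have "bound X i (k \<cdot> x)" using I cyc[OF x(1,3)] unfolding H_inj_def by blast
      then have "u \<cdot> e = Nul A W H" unfolding qx[symmetric] using pb[OF x(1,3)] x by simp
      then show "u = Nul A (src u) H" using u(1,2) by - (rule epi_nul[OF e], simp_all)
    qed
  qed
  moreover have "is_isomorphism A H H' h \<longleftrightarrow> is_epi A H H' h \<and> is_mono A H H' h"
    using mono_epi_iso iso_mono_epi by blast
  ultimately show ?thesis unfolding hm H_def[symmetric] H'_def[symmetric] by blast
qed

lemma quasi_iso_iff:
  "quasi_iso A X Y f \<longleftrightarrow> chain_map A X Y f \<and> (\<forall>i. H_surj X Y f i \<and> H_inj X Y f i)"
  unfolding quasi_iso_def using homology_iso_iff by blast

end

section \<open>The homotopy category\<close>


context abcat begin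

lemma chain_mapI:
  assumes "bounded_complex A X" "bounded_complex A Y"
    "\<And>i. arr (f i)" "\<And>i. src (f i) = Cob X i" "\<And>i. tgt (f i) = Cob Y i"
    "\<And>i. f (i + 1) \<cdot> Df X i = Df Y i \<cdot> f i"
  shows "chain_map A X Y f"
  using assms unfolding chain_map_def by (simp add: hom_iff)

lemma chain_map_idn: "bounded_complex A X \<Longrightarrow> chain_map A X X (\<lambda>i. Idn A (Cob X i))"
  by (intro chain_mapI) simp_all

lemma chain_map_nul: "bounded_complex A X \<Longrightarrow> bounded_complex A Y \<Longrightarrow> chain_map A X Y (\<lambda>i. Nul A (Cob X i) (Cob Y i))"
  by (intro chain_mapI) simp_all

lemma chain_map_comp:
  assumes f: "chain_map A X Y f" and g: "chain_map A Y Z g" shows "chain_map A X Z (\<lambda>i. g i \<cdot> f i)"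
proof (rule chain_mapI)
  note [simp] = chain_mapD(1-5)[OF f] chain_mapD(1-5)[OF g]
  fix i
  have "(g (i + 1) \<cdot> f (i + 1)) \<cdot> Df X i = g (i + 1) \<cdot> (f (i + 1) \<cdot> Df X i)" by simp
  also have "\<dots> = g (i + 1) \<cdot> (Df Y i \<cdot> f i)" using chain_mapD(6)[OF f] by simp
  also have "\<dots> = Df Z i \<cdot> (g i \<cdot> f i)" using chain_map_cmp[OF g] by simp
  finally show "(g (i + 1) \<cdot> f (i + 1)) \<cdot> Df X i = Df Z i \<cdot> (g i \<cdot> f i)" .
qed (use chain_mapD[OF f] chain_mapD[OF g] in simp_all)

lemma chain_map_add:
  assumes f: "chain_map A X Y f" and g: "chain_map A X Y g" shows "chain_map A X Y (\<lambda>i. f i \<boxplus> g i)"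
  by (rule chain_mapI) (use chain_mapD[OF f] chain_mapD[OF g] in simp_all)

lemma homotopicE:
  assumes "homotopic A X Y f g"
  obtains h where "chain_map A X Y f" "chain_map A X Y g"
    "\<And>i. arr (h i)" "\<And>i. src (h i) = Cob X i" "\<And>i. tgt (h i) = Cob Y (i - 1)"
    "\<And>i. f i = g i \<boxplus> (Df Y (i - 1) \<cdot> h i \<boxplus> h (i + 1) \<cdot> Df X i)"
  using assms unfolding homotopic_def hom_iff by blast

lemma homotopicI:
  assumes "chain_map A X Y f" "chain_map A X Y g"
    "\<And>i. arr (h i)" "\<And>i. src (h i) = Cob X i" "\<And>i. tgt (h i) = Cob Y (i - 1)"
    "\<And>i. f i = g i \<boxplus> (Df Y (i - 1) \<cdot> h i \<boxplus> h (i + 1) \<cdot> Df X i)"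
  shows "homotopic A X Y f g"
  using assms unfolding homotopic_def hom_iff by blast

lemma homotopic_refl: 
  assumes f: "chain_map A X Y f" shows "homotopic A X Y f f"
  by (rule homotopicI[OF f f, of "\<lambda>i. Nul A (Cob X i) (Cob Y (i - 1))"]) (use chain_mapD[OF f] in simp_all)

lemma homotopic_sym: 
  assumes h: "homotopic A X Y f g" shows "homotopic A X Y g f"
proof -
  obtain h where f: "chain_map A X Y f" and g: "chain_map A X Y g" and
    h: "\<And>i. arr (h i)" "\<And>i. src (h i) = Cob X i" "\<And>i. tgt (h i) = Cob Y (i - 1)"
    and eq: "\<And>i. f i = g i \<boxplus> (Df Y (i - 1) \<cdot> h i \<boxplus> h (i + 1) \<cdot> Df X i)"
    using homotopicE[OF h] by metis
  note [simp] = chain_mapD(1-5)[OF f] chain_mapD(1-5)[OF g] h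
  show ?thesis
  proof (rule homotopicI[OF g f, of "\<lambda>i. mns (h i)"])
    fix i
    define k where "k = Df Y (i - 1) \<cdot> h i \<boxplus> h (i + 1) \<cdot> Df X i"
    have k: "arr k" "src k = Cob X i" "tgt k = Cob Y i" unfolding k_def by simp_all
    have "f i \<boxplus> mns k = g i" unfolding eq k_def[symmetric] using k by (simp add: add_assoc)
    then show "g i = f i \<boxplus> (Df Y (i - 1) \<cdot> mns (h i) \<boxplus> mns (h (i + 1)) \<cdot> Df X i)" by (simp add: k_def)
  qed simp_all
qed

lemma homotopic_trans: 
  assumes h: "homotopic A X Y f g" and k: "homotopic A X Y g l" shows "homotopic A X Y f l"
proof -
  obtain h where f: "chain_map A X Y f" and g: "chain_map A X Y g" and
    h: "\<And>i. arr (h i)" "\<And>i. src (h i) = Cob X i" "\<And>i. tgt (h i) = Cob Y (i - 1)"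
    and eq: "\<And>i. f i = g i \<boxplus> (Df Y (i - 1) \<cdot> h i \<boxplus> h (i + 1) \<cdot> Df X i)"
    using homotopicE[OF h] by metis
  obtain k where l: "chain_map A X Y l" and
    k: "\<And>i. arr (k i)" "\<And>i. src (k i) = Cob X i" "\<And>i. tgt (k i) = Cob Y (i - 1)"
    and eq2: "\<And>i. g i = l i \<boxplus> (Df Y (i - 1) \<cdot> k i \<boxplus> k (i + 1) \<cdot> Df X i)"
    using homotopicE[OF k] by metis
  note [simp] = chain_mapD(1-5)[OF f] chain_mapD(1-5)[OF g] h chain_mapD(1-5)[OF l] k
  show ?thesis
    by (rule homotopicI[OF f l, of "\<lambda>i. h i \<boxplus> k i"])
      (simp_all, simp add: eq, simp add: eq2 add_ac)
qed

lemma homotopic_cmp_left: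
  assumes h: "homotopic A X Y f f'" and g: "chain_map A Y Z g"
  shows "homotopic A X Z (\<lambda>i. g i \<cdot> f i) (\<lambda>i. g i \<cdot> f' i)"
proof -
  obtain h where f: "chain_map A X Y f" and f': "chain_map A X Y f'" and
    h: "\<And>i. arr (h i)" "\<And>i. src (h i) = Cob X i" "\<And>i. tgt (h i) = Cob Y (i - 1)"
    and eq: "\<And>i. f i = f' i \<boxplus> (Df Y (i - 1) \<cdot> h i \<boxplus> h (i + 1) \<cdot> Df X i)"
    using homotopicE[OF h] by metis
  note [simp] = chain_mapD(1-5)[OF f'] chain_mapD(1-5)[OF g] h
  show ?thesis
  proof (rule homotopicI[OF chain_map_comp[OF f g] chain_map_comp[OF f' g], of "\<lambda>i. g (i - 1) \<cdot> h i"])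
    fix i
    show "g i \<cdot> f i = g i \<cdot> f' i \<boxplus> (Df Z (i - 1) \<cdot> (g (i - 1) \<cdot> h i) \<boxplus> (g (i + 1 - 1) \<cdot> h (i + 1)) \<cdot> Df X i)"
      unfolding eq using chain_map_cmp[OF g, of "h i" "i - 1" i] by simp
  qed simp_all
qed

lemma homotopic_cmp_right:
  assumes h: "homotopic A Y Z g g'" and f: "chain_map A X Y f"
  shows "homotopic A X Z (\<lambda>i. g i \<cdot> f i) (\<lambda>i. g' i \<cdot> f i)"
proof -
  obtain h where g: "chain_map A Y Z g" and g': "chain_map A Y Z g'" and
    h: "\<And>i. arr (h i)" "\<And>i. src (h i) = Cob Y i" "\<And>i. tgt (h i) = Cob Z (i - 1)"
    and eq: "\<And>i. g i = g' i \<boxplus> (Df Z (i - 1) \<cdot> h i \<boxplus> h (i + 1) \<cdot> Df Y i)"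
    using homotopicE[OF h] by metis
  note [simp] = chain_mapD(1-5)[OF f] chain_mapD(1-5)[OF g'] h
  show ?thesis
  proof (rule homotopicI[OF chain_map_comp[OF f g] chain_map_comp[OF f g'], of "\<lambda>i. h i \<cdot> f i"])
    fix i
    show "g i \<cdot> f i = g' i \<cdot> f i \<boxplus> (Df Z (i - 1) \<cdot> (h i \<cdot> f i) \<boxplus> (h (i + 1) \<cdot> f (i + 1)) \<cdot> Df X i)"
      unfolding eq using chain_mapD(6)[OF f, of i] by simp
  qed simp_all
qed

lemma homotopic_add:
  assumes h: "homotopic A X Y f f'" and k: "homotopic A X Y g g'"
  shows "homotopic A X Y (\<lambda>i. f i \<boxplus> g i) (\<lambda>i. f' i \<boxplus> g' i)"
proof -
  obtain h where f: "chain_map A X Y f" and f': "chain_map A X Y f'" and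
    h: "\<And>i. arr (h i)" "\<And>i. src (h i) = Cob X i" "\<And>i. tgt (h i) = Cob Y (i - 1)"
    and eq: "\<And>i. f i = f' i \<boxplus> (Df Y (i - 1) \<cdot> h i \<boxplus> h (i + 1) \<cdot> Df X i)"
    using homotopicE[OF h] by metis
  obtain k where g: "chain_map A X Y g" and g': "chain_map A X Y g'" and
    k: "\<And>i. arr (k i)" "\<And>i. src (k i) = Cob X i" "\<And>i. tgt (k i) = Cob Y (i - 1)"
    and eq2: "\<And>i. g i = g' i \<boxplus> (Df Y (i - 1) \<cdot> k i \<boxplus> k (i + 1) \<cdot> Df X i)"
    using homotopicE[OF k] by metis
  note [simp] = chain_mapD(1-5)[OF f'] chain_mapD(1-5)[OF g'] h k
  show ?thesis
    by (rule homotopicI[OF chain_map_add[OF f g] chain_map_add[OF f' g'], of "\<lambda>i. h i \<boxplus> k i"])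
      (simp_all add: eq eq2 add_ac)
qed

lemma homotopic_comp:
  assumes f: "homotopic A X Y f f'" and g: "homotopic A Y Z g g'"
  shows "homotopic A X Z (\<lambda>i. g i \<cdot> f i) (\<lambda>i. g' i \<cdot> f' i)"
proof (rule homotopic_trans)
  show "homotopic A X Z (\<lambda>i. g i \<cdot> f i) (\<lambda>i. g i \<cdot> f' i)"
    using homotopic_cmp_left[OF f] g unfolding homotopic_def by blast
  show "homotopic A X Z (\<lambda>i. g i \<cdot> f' i) (\<lambda>i. g' i \<cdot> f' i)"
    using homotopic_cmp_right[OF g] f unfolding homotopic_def by blast
qed

text \<open>On a cycle \<open>z\<close> the homotopy term \<open>h d z\<close> vanishes, and \<open>d h z\<close> is a boundary.\<close>

lemma homotopic_homologous:
  assumes h: "homotopic A X Y f g" and z: "cycle X i z"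
  shows "homologous Y i (f i \<cdot> z) (g i \<cdot> z)"
proof -
  obtain h where f: "chain_map A X Y f" and g: "chain_map A X Y g" and
    h: "\<And>i. arr (h i)" "\<And>i. src (h i) = Cob X i" "\<And>i. tgt (h i) = Cob Y (i - 1)"
    and eq: "\<And>i. f i = g i \<boxplus> (Df Y (i - 1) \<cdot> h i \<boxplus> h (i + 1) \<cdot> Df X i)"
    using homotopicE[OF h] by metis
  note [simp] = chain_mapD(1-5)[OF g] chain_mapD(2)[OF f] h
  note z' = cycleD[OF z]
  have b: "bound Y i (Df Y (i - 1) \<cdot> (h i \<cdot> z))" using z' by (intro bound_diff) simp_all
  have "f i \<cdot> z = g i \<cdot> z \<boxplus> Df Y (i - 1) \<cdot> (h i \<cdot> z)" unfolding eq using z' by simp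
  moreover have "(g i \<cdot> z \<boxplus> Df Y (i - 1) \<cdot> (h i \<cdot> z)) \<boxplus> mns (g i \<cdot> z) = Df Y (i - 1) \<cdot> (h i \<cdot> z)"
    using z'(1,2) add_comm[of "g i \<cdot> z" "Df Y (i - 1) \<cdot> (h i \<cdot> z)"]
    by (simp add: add_assoc)
  ultimately show ?thesis unfolding homologous_def using b z'(1,2) by simp
qed

lemma homotopic_H_surj:
  assumes h: "homotopic A X Y f g" and S: "H_surj X Y f i" shows "H_surj X Y g i"
proof (rule H_surjI)
  fix z assume z: "cycle Y i z"
  obtain T e x where e: "is_epi A T (src z) e" "arr e" "src e = T" "tgt e = src z"
    and x: "cycle X i x" "src x = T" "homologous Y i (f i \<cdot> x) (z \<cdot> e)" by (rule H_surjE[OF S z])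
  have Y: "bounded_complex A Y" using h unfolding homotopic_def chain_map_def by blast
  have "homologous Y i (g i \<cdot> x) (z \<cdot> e)"
    using homologous_trans[OF Y homologous_sym[OF Y homotopic_homologous[OF h x(1)]] x(3)] .
  then show "\<exists>T e x. is_epi A T (src z) e \<and> cycle X i x \<and> src x = T \<and> homologous Y i (g i \<cdot> x) (z \<cdot> e)"
    using e x by blast
qed

lemma homotopic_H_inj:
  assumes h: "homotopic A X Y f g" and I: "H_inj X Y f i" shows "H_inj X Y g i"
  unfolding H_inj_def
proof (intro allI impI, elim conjE)
  fix z assume z: "cycle X i z" and b: "bound Y i (g i \<cdot> z)"
  have Y: "bounded_complex A Y" using h unfolding homotopic_def chain_map_def by blast
  have "bound Y i (f i \<cdot> z)" using homologous_bound[OF Y homotopic_homologous[OF h z] b] .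
  then show "bound X i z" using I z unfolding H_inj_def by blast
qed

lemma htp_class_eq: "homotopic A X Y f g \<Longrightarrow> htp_class A X Y f = htp_class A X Y g"
  unfolding htp_class_def using homotopic_sym homotopic_trans by blast

lemma Kb_cmp:
  assumes f: "chain_map A X Y f" and g: "chain_map A Y Z g"
  shows "htp_class A Y Z g \<cdot>\<^bsub>Kb A\<^esub> htp_class A X Y f = htp_class A X Z (\<lambda>i. g i \<cdot> f i)"
proof -
  have "(\<Union>f'\<in>{f'. homotopic A X Y f f'}. \<Union>g'\<in>{g'. homotopic A Y Z g g'}. {h. homotopic A X Z (\<lambda>i. g' i \<cdot> f' i) h})
      = {h. homotopic A X Z (\<lambda>i. g i \<cdot> f i) h}" (is "?L = ?R")
  proof
    show "?L \<subseteq> ?R" using homotopic_comp homotopic_trans by blast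
    show "?R \<subseteq> ?L" using homotopic_refl[OF f] homotopic_refl[OF g] by blast
  qed
  then show ?thesis unfolding Kb_def htp_class_def by simp
qed

lemma Kb_add:
  assumes f: "chain_map A X Y f" and g: "chain_map A X Y g"
  shows "htp_class A X Y f \<boxplus>\<^bsub>Kb A\<^esub> htp_class A X Y g = htp_class A X Y (\<lambda>i. f i \<boxplus> g i)"
proof -
  have "(\<Union>f'\<in>{f'. homotopic A X Y f f'}. \<Union>g'\<in>{g'. homotopic A X Y g g'}. {h. homotopic A X Y (\<lambda>i. f' i \<boxplus> g' i) h})
      = {h. homotopic A X Y (\<lambda>i. f i \<boxplus> g i) h}" (is "?L = ?R")
  proof
    show "?L \<subseteq> ?R" using homotopic_add homotopic_trans by blast
    show "?R \<subseteq> ?L" using homotopic_refl[OF f] homotopic_refl[OF g] by blast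
  qed
  then show ?thesis unfolding Kb_def htp_class_def by simp
qed

lemma Kb_Ob [simp]: "Ob (Kb A) = {X. bounded_complex A X}"
  and Kb_Idn: "Idn (Kb A) X = htp_class A X X (\<lambda>i. Idn A (Cob X i))"
  and Kb_Nul: "Nul (Kb A) X Y = htp_class A X Y (\<lambda>i. Nul A (Cob X i) (Cob Y i))"
  unfolding Kb_def by simp_all

lemma Kb_HomI: "chain_map A X Y f \<Longrightarrow> htp_class A X Y f \<in> Hom (Kb A) X Y"
  unfolding Kb_def by auto

lemma Kb_HomE:
  assumes "\<phi> \<in> Hom (Kb A) X Y" obtains f where "chain_map A X Y f" "\<phi> = htp_class A X Y f"
  using assms unfolding Kb_def by auto

lemma Kb_category: "category (Kb A)"
proof
  fix \<phi> X Y assume p: "\<phi> \<in> Hom (Kb A) X Y"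
  then obtain f where f: "chain_map A X Y f" and p': "\<phi> = htp_class A X Y f" by (rule Kb_HomE)
  note [simp] = chain_mapD(1-5)[OF f]
  show "X \<in> Ob (Kb A) \<and> Y \<in> Ob (Kb A)" by simp
  show "X = X' \<and> Y = Y'" if "\<phi> \<in> Hom (Kb A) X' Y'" for X' Y'
    using that p' unfolding Kb_def htp_class_def by auto
  have h: "homotopic A X Y (\<lambda>i. f i \<cdot> Idn A (Cob X i)) f" "homotopic A X Y (\<lambda>i. Idn A (Cob Y i) \<cdot> f i) f"
    using homotopic_refl[OF f] by simp_all
  show "\<phi> \<cdot>\<^bsub>Kb A\<^esub> Idn (Kb A) X = \<phi>"
    unfolding p' Kb_Idn Kb_cmp[OF chain_map_idn[OF chain_mapD(1)[OF f]] f] by (rule htp_class_eq[OF h(1)])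
  show "Idn (Kb A) Y \<cdot>\<^bsub>Kb A\<^esub> \<phi> = \<phi>"
    unfolding p' Kb_Idn Kb_cmp[OF f chain_map_idn[OF chain_mapD(2)[OF f]]] by (rule htp_class_eq[OF h(2)])
  fix \<psi> Z assume q: "\<psi> \<in> Hom (Kb A) Y Z"
  then obtain g where g: "chain_map A Y Z g" and q': "\<psi> = htp_class A Y Z g" by (rule Kb_HomE)
  note [simp] = chain_mapD(1-5)[OF g]
  show "\<psi> \<cdot>\<^bsub>Kb A\<^esub> \<phi> \<in> Hom (Kb A) X Z"
    unfolding p' q' Kb_cmp[OF f g] by (intro Kb_HomI chain_map_comp[OF f g])
  fix \<chi> W assume r: "\<chi> \<in> Hom (Kb A) Z W"
  then obtain h where h: "chain_map A Z W h" and r': "\<chi> = htp_class A Z W h" by (rule Kb_HomE)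
  note [simp] = chain_mapD(1-5)[OF h]
  show "(\<chi> \<cdot>\<^bsub>Kb A\<^esub> \<psi>) \<cdot>\<^bsub>Kb A\<^esub> \<phi> = \<chi> \<cdot>\<^bsub>Kb A\<^esub> (\<psi> \<cdot>\<^bsub>Kb A\<^esub> \<phi>)"
    unfolding p' q' r' using Kb_cmp[OF f g] Kb_cmp[OF g h] Kb_cmp[OF chain_map_comp[OF f g] h]
      Kb_cmp[OF f chain_map_comp[OF g h]] by simp
next
  fix X assume "X \<in> Ob (Kb A)"
  then show "Idn (Kb A) X \<in> Hom (Kb A) X X" unfolding Kb_Idn by (intro Kb_HomI chain_map_idn) simp
qed

text \<open>A homotopy class is tested on one member, which is as good as any other by \<open>homotopic_H_surj\<close> and
  \<open>homotopic_H_inj\<close>.\<close>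

definition K_surj :: "int \<Rightarrow> ('o, 'a) htp_class \<Rightarrow> bool" where
  "K_surj i = (\<lambda>(X, Y, F). \<exists>f\<in>F. H_surj X Y f i)"

definition K_inj :: "int \<Rightarrow> ('o, 'a) htp_class \<Rightarrow> bool" where
  "K_inj i = (\<lambda>(X, Y, F). \<exists>f\<in>F. H_inj X Y f i)"

lemma K_surj_class: "chain_map A X Y f \<Longrightarrow> K_surj i (htp_class A X Y f) \<longleftrightarrow> H_surj X Y f i"
  unfolding K_surj_def htp_class_def by (auto intro: homotopic_refl dest: homotopic_H_surj[OF homotopic_sym])

lemma K_inj_class: "chain_map A X Y f \<Longrightarrow> K_inj i (htp_class A X Y f) \<longleftrightarrow> H_inj X Y f i"
  unfolding K_inj_def htp_class_def by (auto intro: homotopic_refl dest: homotopic_H_inj[OF homotopic_sym])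

lemma quasi_isos_iff:
  assumes "\<phi> \<in> Hom (Kb A) X Y" shows "\<phi> \<in> quasi_isos A \<longleftrightarrow> (\<forall>i. K_surj i \<phi> \<and> K_inj i \<phi>)"
proof -
  obtain f where f: "chain_map A X Y f" "\<phi> = htp_class A X Y f" using assms by (rule Kb_HomE)
  show ?thesis
  proof
    assume "\<phi> \<in> quasi_isos A"
    then obtain X' Y' g where "quasi_iso A X' Y' g" "\<phi> = htp_class A X' Y' g" unfolding quasi_isos_def by blast
    then show "\<forall>i. K_surj i \<phi> \<and> K_inj i \<phi>" using K_surj_class K_inj_class unfolding quasi_iso_iff by blast
  next
    assume "\<forall>i. K_surj i \<phi> \<and> K_inj i \<phi>"
    then have "quasi_iso A X Y f" unfolding quasi_iso_iff f(2) using K_surj_class K_inj_class f(1) by blast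
    then show "\<phi> \<in> quasi_isos A" unfolding quasi_isos_def f(2) by blast
  qed
qed

context
  fixes \<phi> \<psi> :: "('o, 'a) htp_class" and X Y Z :: "('o, 'a) cplx" and i :: int
  assumes p: "\<phi> \<in> Hom (Kb A) X Y" and q: "\<psi> \<in> Hom (Kb A) Y Z"
begin

lemma K_comp:
  shows K_surj_comp: "K_surj i \<phi> \<Longrightarrow> K_surj i \<psi> \<Longrightarrow> K_surj i (\<psi> \<cdot>\<^bsub>Kb A\<^esub> \<phi>)"
    and K_inj_comp: "K_inj i \<phi> \<Longrightarrow> K_inj i \<psi> \<Longrightarrow> K_inj i (\<psi> \<cdot>\<^bsub>Kb A\<^esub> \<phi>)"
    and K_surj_of_comp: "K_surj i (\<psi> \<cdot>\<^bsub>Kb A\<^esub> \<phi>) \<Longrightarrow> K_surj i \<psi>"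
    and K_inj_of_comp: "K_inj i (\<psi> \<cdot>\<^bsub>Kb A\<^esub> \<phi>) \<Longrightarrow> K_inj i \<phi>"
    and K_surj_cancel: "K_surj i (\<psi> \<cdot>\<^bsub>Kb A\<^esub> \<phi>) \<Longrightarrow> K_inj i \<psi> \<Longrightarrow> K_surj i \<phi>"
    and K_inj_cancel: "K_inj i (\<psi> \<cdot>\<^bsub>Kb A\<^esub> \<phi>) \<Longrightarrow> K_surj i \<phi> \<Longrightarrow> K_inj i \<psi>"
proof -
  obtain f where f: "chain_map A X Y f" "\<phi> = htp_class A X Y f" using p by (rule Kb_HomE)
  obtain g where g: "chain_map A Y Z g" "\<psi> = htp_class A Y Z g" using q by (rule Kb_HomE)
  note c = chain_map_comp[OF f(1) g(1)]
  note [simp] = K_surj_class[OF f(1)] K_inj_class[OF f(1)] K_surj_class[OF g(1)] K_inj_class[OF g(1)]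
    K_surj_class[OF c] K_inj_class[OF c]
  show "K_surj i \<phi> \<Longrightarrow> K_surj i \<psi> \<Longrightarrow> K_surj i (\<psi> \<cdot>\<^bsub>Kb A\<^esub> \<phi>)"
    unfolding f(2) g(2) Kb_cmp[OF f(1) g(1)] using H_surj_comp[OF f(1) g(1)] by simp
  show "K_inj i \<phi> \<Longrightarrow> K_inj i \<psi> \<Longrightarrow> K_inj i (\<psi> \<cdot>\<^bsub>Kb A\<^esub> \<phi>)"
    unfolding f(2) g(2) Kb_cmp[OF f(1) g(1)] using H_inj_comp[OF f(1) g(1)] by simp
  show "K_surj i (\<psi> \<cdot>\<^bsub>Kb A\<^esub> \<phi>) \<Longrightarrow> K_surj i \<psi>"
    unfolding f(2) g(2) Kb_cmp[OF f(1) g(1)] using H_surj_of_comp[OF f(1) g(1)] by simp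
  show "K_inj i (\<psi> \<cdot>\<^bsub>Kb A\<^esub> \<phi>) \<Longrightarrow> K_inj i \<phi>"
    unfolding f(2) g(2) Kb_cmp[OF f(1) g(1)] using H_inj_of_comp[OF f(1) g(1)] by simp
  show "K_surj i (\<psi> \<cdot>\<^bsub>Kb A\<^esub> \<phi>) \<Longrightarrow> K_inj i \<psi> \<Longrightarrow> K_surj i \<phi>"
    unfolding f(2) g(2) Kb_cmp[OF f(1) g(1)] using H_surj_cancel[OF f(1) g(1)] by simp
  show "K_inj i (\<psi> \<cdot>\<^bsub>Kb A\<^esub> \<phi>) \<Longrightarrow> K_surj i \<phi> \<Longrightarrow> K_inj i \<psi>"
    unfolding f(2) g(2) Kb_cmp[OF f(1) g(1)] using H_inj_cancel[OF f(1) g(1)] by simp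
qed

end

lemma K_zero:
  assumes p: "\<phi> \<in> Hom (Kb A) X Y"
  shows K_surj_zero: "K_surj i \<phi> \<Longrightarrow> H_zero X i \<Longrightarrow> H_zero Y i"
    and K_inj_zero: "K_inj i \<phi> \<Longrightarrow> H_zero Y i \<Longrightarrow> H_zero X i"
    and K_zero_inj: "H_zero X i \<Longrightarrow> K_inj i \<phi>"
    and K_zero_surj: "H_zero Y i \<Longrightarrow> K_surj i \<phi>"
proof -
  obtain f where f: "chain_map A X Y f" "\<phi> = htp_class A X Y f" using p by (rule Kb_HomE)
  show "K_surj i \<phi> \<Longrightarrow> H_zero X i \<Longrightarrow> H_zero Y i" "K_inj i \<phi> \<Longrightarrow> H_zero Y i \<Longrightarrow> H_zero X i"
    "H_zero X i \<Longrightarrow> K_inj i \<phi>" "H_zero Y i \<Longrightarrow> K_surj i \<phi>"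
    unfolding f(2) K_surj_class[OF f(1)] K_inj_class[OF f(1)]
    using H_surj_zero[OF f(1)] H_inj_zero[OF f(1)] H_zero_inj H_zero_surj[OF f(1)] by blast+
qed

lemma K_nul:
  assumes "bounded_complex A X" "bounded_complex A Y"
  shows K_surj_nul: "K_surj i (Nul (Kb A) X Y) \<Longrightarrow> H_zero Y i"
    and K_inj_nul: "K_inj i (Nul (Kb A) X Y) \<Longrightarrow> H_zero X i"
proof -
  note n = chain_map_nul[OF assms]
  show "K_surj i (Nul (Kb A) X Y) \<Longrightarrow> H_zero Y i"
    unfolding Kb_Nul K_surj_class[OF n]
  proof -
    assume S: "H_surj X Y (\<lambda>i. Nul A (Cob X i) (Cob Y i)) i"
    show "H_zero Y i" unfolding H_zero_def
    proof (intro allI impI)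
      fix z assume z: "cycle Y i z"
      obtain T e x where e: "is_epi A T (src z) e" "arr e" "src e = T" "tgt e = src z"
        and x: "cycle X i x" "src x = T" "homologous Y i (Nul A (Cob X i) (Cob Y i) \<cdot> x) (z \<cdot> e)"
        by (rule H_surjE[OF S z])
      note x' = cycleD[OF x(1)]
      have "bound Y i (Nul A (Cob X i) (Cob Y i) \<cdot> x)" using x' assms by (simp add: bound_nul)
      then have "bound Y i (z \<cdot> e)" using homologous_bound[OF assms(2) homologous_sym[OF assms(2) x(3)]] by simp
      then show "bound Y i z" using bound_local[OF e(1)] cycleD[OF z] by simp
    qed
  qed
  show "K_inj i (Nul (Kb A) X Y) \<Longrightarrow> H_zero X i"
    unfolding Kb_Nul K_inj_class[OF n] H_inj_def H_zero_def
  proof (intro allI impI)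
    fix z assume *: "\<forall>z. cycle X i z \<and> bound Y i (Nul A (Cob X i) (Cob Y i) \<cdot> z) \<longrightarrow> bound X i z"
      and z: "cycle X i z"
    have "bound Y i (Nul A (Cob X i) (Cob Y i) \<cdot> z)" using cycleD[OF z] assms by (simp add: bound_nul)
    then show "bound X i z" using * z by blast
  qed
qed

text \<open>The second summand factors through \<open>V\<close> with \<open>H\<^sup>i(V) = 0\<close>, hence is zero on homology, so that \<open>\<phi>\<close> and the sum
  agree on homology. Stated in this form, additivity of \<open>H\<^sup>i\<close> can be used without a sum of arrows in
  the derived category.\<close>

lemma K_inj_add:
  assumes p: "\<phi> \<in> Hom (Kb A) X Y" and s: "\<sigma> \<in> Hom (Kb A) X V" and t: "\<tau> \<in> Hom (Kb A) V Y"
    and V: "H_zero V i" and I: "K_inj i (\<phi> \<boxplus>\<^bsub>Kb A\<^esub> (\<tau> \<cdot>\<^bsub>Kb A\<^esub> \<sigma>))"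
  shows "K_inj i \<phi>"
proof -
  obtain f where f: "chain_map A X Y f" "\<phi> = htp_class A X Y f" using p by (rule Kb_HomE)
  obtain g where g: "chain_map A X V g" "\<sigma> = htp_class A X V g" using s by (rule Kb_HomE)
  obtain h where h: "chain_map A V Y h" "\<tau> = htp_class A V Y h" using t by (rule Kb_HomE)
  note [simp] = chain_mapD(1-5)[OF f(1)] chain_mapD(1-5)[OF g(1)] chain_mapD(1-5)[OF h(1)]
  note c = chain_map_comp[OF g(1) h(1)]
  have "H_inj X Y (\<lambda>i. f i \<boxplus> h i \<cdot> g i) i"
    using I unfolding f(2) g(2) h(2) Kb_cmp[OF g(1) h(1)] Kb_add[OF f(1) c] K_inj_class[OF chain_map_add[OF f(1) c]] .
  then have *: "\<And>z. cycle X i z \<Longrightarrow> bound Y i ((f i \<boxplus> h i \<cdot> g i) \<cdot> z) \<Longrightarrow> bound X i z"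
    unfolding H_inj_def by blast
  have "H_inj X Y f i" unfolding H_inj_def
  proof (intro allI impI, elim conjE)
    fix z assume z: "cycle X i z" and b: "bound Y i (f i \<cdot> z)"
    note z' = cycleD[OF z]
    have "bound V i (g i \<cdot> z)" using V cycle_map[OF g(1) z] unfolding H_zero_def by blast
    then have "bound Y i (h i \<cdot> (g i \<cdot> z))" by (rule bound_map[OF h(1)])
    then have "bound Y i (f i \<cdot> z \<boxplus> h i \<cdot> (g i \<cdot> z))" using b z' by (intro bound_add) simp_all
    then show "bound X i z" using z' by (intro *[OF z]) simp
  qed
  then show ?thesis using f K_inj_class by blast
qed

end

section \<open>Mapping cones and the Ore condition\<close>


context abcat begin

text \<open>The sign that a shift puts on the differential changes neither cycles nor boundaries.\<close>

lemma cycle_bound_shift: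
  assumes X: "bounded_complex A X" and "\<And>i. Cob Y i = Cob X (i + k)" "\<And>i. Df Y i = mns (Df X (i + k))"
  shows cycle_shift: "cycle Y i z \<longleftrightarrow> cycle X (i + k) z"
    and bound_shift: "bound Y i z \<longleftrightarrow> bound X (i + k) z"
proof -
  have [simp]: "i + 1 + k = i + k + 1" "i - 1 + k = i + k - 1" for i by simp_all
  show "cycle Y i z \<longleftrightarrow> cycle X (i + k) z"
    by (cases "arr z \<and> tgt z = Cob X (i + k)") (use X in \<open>auto simp: cycle_def assms(2,3)\<close>)
  have *: "bound Y' i' z" if X: "bounded_complex A X" and b: "bound X i z"
    and "Cob Y' i' = Cob X i" "Cob Y' (i' - 1) = Cob X (i - 1)" and D: "Df Y' (i' - 1) = mns (Df X (i - 1)) "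
    for Y' i' i and X :: "('o, 'a) cplx"
  proof -
    obtain T e y where e: "is_epi A T (src z) e" "arr e" "src e = T" "tgt e = src z"
      and y: "arr y" "src y = T" "tgt y = Cob X (i - 1)" and eq: "Df X (i - 1) \<cdot> y = z \<cdot> e"
      by (rule boundE[OF b])
    have "Df Y' (i' - 1) \<cdot> mns y = z \<cdot> e" unfolding D eq[symmetric] using X y by simp
    then show ?thesis using boundD[OF b] e y that by (intro boundI[of _ _ _ T e "mns y"]) simp_all
  qed
  show "bound Y i z \<longleftrightarrow> bound X (i + k) z"
  proof
    assume "bound X (i + k) z" then show "bound Y i z" by (rule *[OF X]) (simp_all add: assms)
  next
    assume b: "bound Y i z"
    obtain T e y where e: "is_epi A T (src z) e" "arr e" "src e = T" "tgt e = src z"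
      and y: "arr y" "src y = T" "tgt y = Cob Y (i - 1)" and eq: "Df Y (i - 1) \<cdot> y = z \<cdot> e"
      by (rule boundE[OF b])
    have "Df X (i + k - 1) \<cdot> mns y = z \<cdot> e" unfolding eq[symmetric] using X y by (simp add: assms)
    then show "bound X (i + k) z" using boundD[OF b] e y assms
      by (intro boundI[of _ _ _ T e "mns y"]) simp_all
  qed
qed

lemma H_zero_shift:
  assumes "bounded_complex A X" "\<And>i. Cob Y i = Cob X (i + k)" "\<And>i. Df Y i = mns (Df X (i + k))"
  shows "H_zero Y i \<longleftrightarrow> H_zero X (i + k)"
  unfolding H_zero_def cycle_shift[OF assms] bound_shift[OF assms] ..

lemma shifted_complex:
  assumes X: "bounded_complex A X" and Y: "\<And>i. Cob Y i = Cob X (i + k)" "\<And>i. Df Y i = mns (Df X (i + k))"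
  shows "bounded_complex A Y"
proof -
  have [simp]: "i + 1 + k = i + k + 1" "i + 2 + k = i + k + 2" for i by simp_all
  obtain n where n: "\<And>i. \<bar>i\<bar> > n \<Longrightarrow> zero_object A (Cob X i)"
    using X unfolding bounded_complex_def by blast
  have "zero_object A (Cob Y i)" if "\<bar>i\<bar> > n + \<bar>k\<bar>" for i unfolding Y using that by (intro n) arith
  then have "\<exists>n. \<forall>i. \<bar>i\<bar> > n \<longrightarrow> zero_object A (Cob Y i)" by blast
  then show ?thesis unfolding bounded_complex_def hom_iff using X by (simp add: Y)
qed

definition unshift :: "('o, 'a) cplx \<Rightarrow> ('o, 'a) cplx" where
  "unshift X = \<lparr>Cob = (\<lambda>i. Cob X (i - 1)), Df = (\<lambda>i. mns (Df X (i - 1)))\<rparr>"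

lemma unshift_simps [simp]: "Cob (unshift X) i = Cob X (i - 1)" "Df (unshift X) i = mns (Df X (i - 1))"
  unfolding unshift_def by simp_all

lemma bounded_unshift: "bounded_complex A X \<Longrightarrow> bounded_complex A (unshift X)"
  by (rule shifted_complex[of X _ "-1"]) simp_all

lemma H_zero_unshift: "bounded_complex A X \<Longrightarrow> H_zero (unshift X) i \<longleftrightarrow> H_zero X (i - 1)"
  using H_zero_shift[of X "unshift X" "-1" i] by simp

lemma shift_cplx_simps [simp]:
  "Cob (shift_cplx A X) i = Cob X (i + 1)"
  "bounded_complex A X \<Longrightarrow> Df (shift_cplx A X) i = mns (Df X (i + 1))"
  unfolding shift_cplx_def by (simp_all add: neg_mns)

lemma bounded_shift: "bounded_complex A X \<Longrightarrow> bounded_complex A (shift_cplx A X)"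
  by (rule shifted_complex[of X _ 1]) simp_all

lemma shift_cplx_cycle: "bounded_complex A X \<Longrightarrow> cycle (shift_cplx A X) i z \<longleftrightarrow> cycle X (i + 1) z"
  using cycle_shift[of X "shift_cplx A X" 1] by simp

lemma shift_cplx_bound: "bounded_complex A X \<Longrightarrow> bound (shift_cplx A X) i z \<longleftrightarrow> bound X (i + 1) z"
  using bound_shift[of X "shift_cplx A X" 1] by simp

lemma biproduct_eqI:
  assumes B: "is_biproduct A X Y W i1 i2 p1 p2"
    and f: "arr f" "tgt f = W" and g: "arr g" "tgt g = W" and s: "src g = src f"
    and "p1 \<cdot> f = p1 \<cdot> g" "p2 \<cdot> f = p2 \<cdot> g"
  shows "f = g"
proof -
  note b = biproduct_arr[OF B]
  have *: "h = i1 \<cdot> (p1 \<cdot> h) \<boxplus> i2 \<cdot> (p2 \<cdot> h)" if h: "arr h" "tgt h = W" for h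
  proof -
    have "h = (i1 \<cdot> p1 \<boxplus> i2 \<cdot> p2) \<cdot> h" unfolding b(17) using h by simp
    also have "\<dots> = i1 \<cdot> (p1 \<cdot> h) \<boxplus> i2 \<cdot> (p2 \<cdot> h)" using h b(1-12) by simp
    finally show ?thesis .
  qed
  show ?thesis using *[OF f] *[OF g] assms(7,8) by simp
qed

end

text \<open>The complex \<open>W\<^sup>i = B\<^sup>i \<oplus> D\<^sup>i\<close> with differential \<open>(b, x) \<mapsto> (d b, \<phi> b + d x)\<close>; the condition \<open>phi_d\<close> says that
  this squares to zero. The mapping cone of \<open>f : X \<rightarrow> Y\<close> is the case \<open>B = X[1]\<close>, \<open>D = Y\<close>, \<open>\<phi> = f\<close>. The homotopy
  fibre product in \<open>quasi_iso_ore\<close> is another case, with \<open>D\<close> a cone shifted by \<open>-1\<close>.\<close>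

locale twisted_extension = abcat A for A :: "('o, 'a) cat" (structure) +
  fixes B D W :: "('o, 'a) cplx" and \<phi> jB jD pB pD :: "int \<Rightarrow> 'a"
  assumes B [simp]: "bounded_complex A B" and D [simp]: "bounded_complex A D"
    and phi [simp]: "arr (\<phi> i)" "src (\<phi> i) = Cob B i" "tgt (\<phi> i) = Cob D (i + 1)"
    and phi_d: "\<phi> (i + 1) \<cdot> Df B i = mns (Df D (i + 1) \<cdot> \<phi> i)"
    and biprod: "is_biproduct A (Cob B i) (Cob D i) (Cob W i) (jB i) (jD i) (pB i) (pD i)"
    and Df_W: "Df W i = jB (i + 1) \<cdot> (Df B i \<cdot> pB i) \<boxplus> jD (i + 1) \<cdot> (\<phi> i \<cdot> pB i) \<boxplus> jD (i + 1) \<cdot> (Df D i \<cdot> pD i)"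
begin

lemmas component_arrows [simp] = biproduct_arr(1-16)[OF biprod]

lemma component_cmp [simp]:
  "arr x \<Longrightarrow> tgt x = Cob B i \<Longrightarrow> pB i \<cdot> (jB i \<cdot> x) = x"
  "arr x \<Longrightarrow> tgt x = Cob D i \<Longrightarrow> pD i \<cdot> (jD i \<cdot> x) = x"
  "arr x \<Longrightarrow> tgt x = Cob D i \<Longrightarrow> pB i \<cdot> (jD i \<cdot> x) = Nul A (src x) (Cob B i)"
  "arr x \<Longrightarrow> tgt x = Cob B i \<Longrightarrow> pD i \<cdot> (jB i \<cdot> x) = Nul A (src x) (Cob D i)"
  using assoc_arr[of x "jB i" "pB i"] assoc_arr[of x "jD i" "pD i"]
    assoc_arr[of x "jD i" "pB i"] assoc_arr[of x "jB i" "pD i"] by simp_all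

lemma W_Ob [simp]: "Cob W i \<in> Ob A"
  using src_tgt_Ob(2)[OF component_arrows(1), of i] by simp

lemma Df_W_arr [simp]: "arr (Df W i)" "src (Df W i) = Cob W i" "tgt (Df W i) = Cob W (i + 1)"
  unfolding Df_W by simp_all

lemma pB_d [simp]:
  "j = i + 1 \<Longrightarrow> pB j \<cdot> Df W i = Df B i \<cdot> pB i"
  "j = i + 1 \<Longrightarrow> arr x \<Longrightarrow> tgt x = Cob W i \<Longrightarrow> pB j \<cdot> (Df W i \<cdot> x) = Df B i \<cdot> (pB i \<cdot> x)"
proof -
  show *: "pB j \<cdot> Df W i = Df B i \<cdot> pB i" if "j = i + 1" for j unfolding Df_W that by simp
  show "j = i + 1 \<Longrightarrow> arr x \<Longrightarrow> tgt x = Cob W i \<Longrightarrow> pB j \<cdot> (Df W i \<cdot> x) = Df B i \<cdot> (pB i \<cdot> x)"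
    using assoc_arr[of x "Df W i" "pB j"] by (simp add: *)
qed

lemma pD_d [simp]:
  "j = i + 1 \<Longrightarrow> pD j \<cdot> Df W i = \<phi> i \<cdot> pB i \<boxplus> Df D i \<cdot> pD i"
  "j = i + 1 \<Longrightarrow> arr x \<Longrightarrow> tgt x = Cob W i \<Longrightarrow> pD j \<cdot> (Df W i \<cdot> x) = \<phi> i \<cdot> (pB i \<cdot> x) \<boxplus> Df D i \<cdot> (pD i \<cdot> x)"
proof -
  show *: "pD j \<cdot> Df W i = \<phi> i \<cdot> pB i \<boxplus> Df D i \<cdot> pD i" if "j = i + 1" for j unfolding Df_W that by simp
  show "j = i + 1 \<Longrightarrow> arr x \<Longrightarrow> tgt x = Cob W i \<Longrightarrow> pD j \<cdot> (Df W i \<cdot> x) = \<phi> i \<cdot> (pB i \<cdot> x) \<boxplus> Df D i \<cdot> (pD i \<cdot> x)"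
    using assoc_arr[of x "Df W i" "pD j"] by (simp add: *)
qed

lemma phi_d_cmp [simp]:
  assumes "j = i + 1" "arr x" "tgt x = Cob B i"
  shows "\<phi> j \<cdot> (Df B i \<cdot> x) = mns (Df D j \<cdot> (\<phi> i \<cdot> x))"
proof -
  have "\<phi> j \<cdot> (Df B i \<cdot> x) = (\<phi> j \<cdot> Df B i) \<cdot> x" using assms by simp
  also have "\<dots> = mns (Df D j \<cdot> (\<phi> i \<cdot> x))" unfolding assms(1) phi_d using assms by simp
  finally show ?thesis .
qed

lemma W_eqI:
  assumes "arr f" "tgt f = Cob W i" "arr g" "tgt g = Cob W i" "src g = src f"
    "pB i \<cdot> f = pB i \<cdot> g" "pD i \<cdot> f = pD i \<cdot> g"
  shows "f = g"
  using biproduct_eqI[OF biprod] assms by blast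

lemma W_bounded [simp]: "bounded_complex A W"
proof -
  obtain m n where mn: "\<And>i. \<bar>i\<bar> > m \<Longrightarrow> zero_object A (Cob B i)" "\<And>i. \<bar>i\<bar> > n \<Longrightarrow> zero_object A (Cob D i)"
    using B D unfolding bounded_complex_def by metis
  have "zero_object A (Cob W i)" if "\<bar>i\<bar> > max m n" for i
  proof -
    have zB: "zero_object A (Cob B i)" and zD: "zero_object A (Cob D i)" using mn that by simp_all
    have "Idn A (Cob W i) = Nul A (Cob W i) (Cob W i)"
      using zero_arr_tgt[OF zB, of "pB i"] zero_arr_tgt[OF zD, of "pD i"]
      by - (rule W_eqI[of _ i], simp_all)
    then show ?thesis unfolding zero_object_iff by simp
  qed
  then have ex: "\<exists>n. \<forall>i. \<bar>i\<bar> > n \<longrightarrow> zero_object A (Cob W i)" by blast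
  have "Df W (i + 1) \<cdot> Df W i = Nul A (Cob W i) (Cob W (i + 2))" for i
  proof (rule W_eqI[of _ "i + 2"])
    show "pB (i + 2) \<cdot> (Df W (i + 1) \<cdot> Df W i) = pB (i + 2) \<cdot> Nul A (Cob W i) (Cob W (i + 2))" by simp
    show "pD (i + 2) \<cdot> (Df W (i + 1) \<cdot> Df W i) = pD (i + 2) \<cdot> Nul A (Cob W i) (Cob W (i + 2))"
      by (simp add: add_assoc)
  qed simp_all
  then show ?thesis unfolding bounded_complex_def hom_iff using ex by simp
qed

lemma pB_chain: "chain_map A W B pB"
  by (rule chain_mapI) simp_all

lemma jD_chain: "chain_map A D W jD"
proof (rule chain_mapI)
  fix i show "jD (i + 1) \<cdot> Df D i = Df W i \<cdot> jD i"
    by (rule W_eqI[of _ "i + 1"]) simp_all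
qed simp_all

lemma cycle_W_iff:
  "cycle W i x \<longleftrightarrow> arr x \<and> tgt x = Cob W i \<and> cycle B i (pB i \<cdot> x) \<and>
     \<phi> i \<cdot> (pB i \<cdot> x) \<boxplus> Df D i \<cdot> (pD i \<cdot> x) = Nul A (src x) (Cob D (i + 1))"
proof -
  have "Df W i \<cdot> x = Nul A (src x) (Cob W (i + 1)) \<longleftrightarrow>
      pB (i + 1) \<cdot> (Df W i \<cdot> x) = Nul A (src x) (Cob B (i + 1)) \<and>
      pD (i + 1) \<cdot> (Df W i \<cdot> x) = Nul A (src x) (Cob D (i + 1))" if x: "arr x" "tgt x = Cob W i"
  proof
    assume "Df W i \<cdot> x = Nul A (src x) (Cob W (i + 1))"
    then show "pB (i + 1) \<cdot> (Df W i \<cdot> x) = Nul A (src x) (Cob B (i + 1)) \<and>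
      pD (i + 1) \<cdot> (Df W i \<cdot> x) = Nul A (src x) (Cob D (i + 1))" using x by (simp del: pB_d pD_d)
  next
    assume *: "pB (i + 1) \<cdot> (Df W i \<cdot> x) = Nul A (src x) (Cob B (i + 1)) \<and>
      pD (i + 1) \<cdot> (Df W i \<cdot> x) = Nul A (src x) (Cob D (i + 1))"
    show "Df W i \<cdot> x = Nul A (src x) (Cob W (i + 1))"
      by (rule W_eqI[of _ "i + 1"]) (use * x in \<open>simp_all del: pB_d pD_d\<close>)
  qed
  note eq = this
  show ?thesis
  proof (cases "arr x \<and> tgt x = Cob W i")
    case True
    then have x: "arr x" "tgt x = Cob W i" by auto
    then show ?thesis using eq[OF x] by (simp add: cycle_def)
  qed (auto simp: cycle_def)
qed

text \<open>This and the next two lemmas are the exact sequence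
  \<open>H\<^sup>i\<^sup>-\<^sup>1(B) \<rightarrow> H\<^sup>i(D) \<rightarrow> H\<^sup>i(W) \<rightarrow> H\<^sup>i(B) \<rightarrow> H\<^sup>i\<^sup>+\<^sup>1(D)\<close>, whose outer maps are induced by \<open>\<phi>\<close>, in the form in which it is
  used: what \<open>H(W) = 0\<close> implies for \<open>\<phi>\<close>, and conversely.\<close>

lemma W_zero_surj:
  assumes Z: "H_zero W i" and z: "cycle D i z"
  shows "\<exists>T e x. is_epi A T (src z) e \<and> cycle B (i - 1) x \<and> src x = T \<and> homologous D i (\<phi> (i - 1) \<cdot> x) (z \<cdot> e)"
proof -
  note z' = cycleD[OF z]
  have "bound W i (jD i \<cdot> z)" using Z cycle_map[OF jD_chain z] unfolding H_zero_def by blast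
  moreover have s: "src (jD i \<cdot> z) = src z" using z' by simp
  ultimately obtain T e y where e: "is_epi A T (src z) e" "arr e" "src e = T" "tgt e = src z"
    and y: "arr y" "src y = T" "tgt y = Cob W (i - 1)" and eq: "Df W (i - 1) \<cdot> y = (jD i \<cdot> z) \<cdot> e"
    using boundE[of W i "jD i \<cdot> z"] by metis
  have "pB i \<cdot> (Df W (i - 1) \<cdot> y) = Nul A T (Cob B i)" unfolding eq using z' e by simp
  then have c: "cycle B (i - 1) (pB (i - 1) \<cdot> y)" unfolding cycle_def using y by simp
  let ?p = "\<phi> (i - 1) \<cdot> (pB (i - 1) \<cdot> y)" and ?d = "Df D (i - 1) \<cdot> (pD (i - 1) \<cdot> y)"
  have "pD i \<cdot> (Df W (i - 1) \<cdot> y) = z \<cdot> e" unfolding eq using z' e by simp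
  then have pd: "?p \<boxplus> ?d = z \<cdot> e" using y by simp
  have "?p \<boxplus> mns (z \<cdot> e) = mns ?d" unfolding pd[symmetric] using y by simp
  moreover have "bound D i (mns ?d)" using y by (intro bound_mns bound_diff) simp_all
  ultimately have "homologous D i ?p (z \<cdot> e)" unfolding homologous_def using y z' e by simp
  then show ?thesis using e c y by (intro exI[of _ T] exI[of _ e] exI[of _ "pB (i - 1) \<cdot> y"]) simp
qed

lemma W_zero_inj:
  assumes Z: "H_zero W i" and x: "cycle B i x" and bx: "bound D (i + 1) (\<phi> i \<cdot> x)"
  shows "bound B i x"
proof -
  note x' = cycleD[OF x]
  have s: "src (\<phi> i \<cdot> x) = src x" using x' by simp
  obtain T e y where e: "is_epi A T (src x) e" "arr e" "src e = T" "tgt e = src x"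
    and y: "arr y" "src y = T" "tgt y = Cob D i" and eq: "Df D i \<cdot> y = (\<phi> i \<cdot> x) \<cdot> e"
    using boundE[OF bx] unfolding s by (metis add_diff_cancel_right')
  let ?c = "jB i \<cdot> (x \<cdot> e) \<boxplus> mns (jD i \<cdot> y)"
  have "cycle B i (x \<cdot> e)" using cycle_cmp[OF B x e(2)] e by simp
  moreover have "\<phi> i \<cdot> (x \<cdot> e) = Df D i \<cdot> y" unfolding eq using x' e by simp
  moreover have "T \<in> Ob A" using src_tgt_Ob(1)[OF e(2)] e(3) by simp
  ultimately have "cycle W i ?c" unfolding cycle_W_iff using x'(1,2) e y by simp
  then have "bound B i (pB i \<cdot> ?c)" using bound_map[OF pB_chain] Z unfolding H_zero_def by blast
  then have "bound B i (x \<cdot> e)" using x'(1,2) e y src_tgt_Ob(1)[OF e(2)] by simp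
  then show ?thesis by (rule bound_local[OF e(1) x'(1,2)])
qed

text \<open>Let \<open>x\<close> be a cycle of \<open>W\<close>. Its component in \<open>B\<close> is mapped to a boundary by \<open>\<phi>\<close>, hence is itself some \<open>d y\<close>. Then
  \<open>c\<close>, the \<open>D\<close>-component of \<open>x - d (y, 0)\<close>, is a cycle of \<open>D\<close>, so it is homologous to some \<open>\<phi> w\<close> with \<open>w\<close> a cycle;
  and \<open>x\<close> differs from \<open>d (y + w, 0)\<close> by a boundary of \<open>D\<close>.\<close>

lemma W_zeroI:
  assumes S: "\<And>z. cycle D i z \<Longrightarrow>
      \<exists>T e x. is_epi A T (src z) e \<and> cycle B (i - 1) x \<and> src x = T \<and> homologous D i (\<phi> (i - 1) \<cdot> x) (z \<cdot> e)"
    and I: "\<And>x. cycle B i x \<Longrightarrow> bound D (i + 1) (\<phi> i \<cdot> x) \<Longrightarrow> bound B i x"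
  shows "H_zero W i"
  unfolding H_zero_def
proof (intro allI impI)
  fix x assume "cycle W i x"
  then have x: "arr x" "tgt x = Cob W i" and a: "cycle B i (pB i \<cdot> x)"
    and ab: "\<phi> i \<cdot> (pB i \<cdot> x) \<boxplus> Df D i \<cdot> (pD i \<cdot> x) = Nul A (src x) (Cob D (i + 1))"
    unfolding cycle_W_iff by blast+
  have db: "Df D i \<cdot> (pD i \<cdot> x) = mns (\<phi> i \<cdot> (pB i \<cdot> x))" by (rule mns_unique) (use ab x in simp_all)
  have "\<phi> i \<cdot> (pB i \<cdot> x) = Df D (i + 1 - 1) \<cdot> (mns (pD i \<cdot> x))" using x by (simp add: db)
  moreover have "bound D (i + 1) (Df D (i + 1 - 1) \<cdot> (mns (pD i \<cdot> x)))"
    using x by (intro bound_diff) simp_all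
  ultimately have "bound B i (pB i \<cdot> x)" using I[OF a] by simp
  moreover have "src (pB i \<cdot> x) = src x" using x by simp
  ultimately obtain T e y where e: "is_epi A T (src x) e" "arr e" "src e = T" "tgt e = src x"
    and y: "arr y" "src y = T" "tgt y = Cob B (i - 1)" and eq: "Df B (i - 1) \<cdot> y = (pB i \<cdot> x) \<cdot> e"
    using boundE[of B i "pB i \<cdot> x"] by metis
  define c where "c = pD i \<cdot> (x \<cdot> e) \<boxplus> mns (\<phi> (i - 1) \<cdot> y)"
  have c: "arr c" "src c = T" "tgt c = Cob D i" unfolding c_def using x e y by simp_all
  have eq': "\<phi> i \<cdot> (Df B (i - 1) \<cdot> y) = \<phi> i \<cdot> (pB i \<cdot> (x \<cdot> e))" unfolding eq using x e by simp
  have "Df D i \<cdot> (pD i \<cdot> (x \<cdot> e)) = (Df D i \<cdot> (pD i \<cdot> x)) \<cdot> e" using x e by simp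
  also have "\<dots> = mns (\<phi> i \<cdot> (Df B (i - 1) \<cdot> y))" unfolding db eq' using x e by simp
  also have "\<dots> = Df D i \<cdot> (\<phi> (i - 1) \<cdot> y)" using y by simp
  finally have "cycle D i c" unfolding cycle_def using c x e y by (simp add: c_def)
  then obtain T' e' w where e': "is_epi A T' T e'" and w: "cycle B (i - 1) w" "src w = T'"
    and h: "homologous D i (\<phi> (i - 1) \<cdot> w) (c \<cdot> e')" using S[of c] c(2) by metis
  note e2 = epi_arr[OF e'] and w' = cycleD[OF w(1)] and h' = homologousD(6)[OF homologous_sym[OF D h]]
  define v where "v = jB (i - 1) \<cdot> (y \<cdot> e' \<boxplus> w)"
  have v: "arr v" "src v = T'" "tgt v = Cob W (i - 1)" unfolding v_def using y e2 w w' by simp_all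
  have eqe: "Df B (i - 1) \<cdot> (y \<cdot> e') = pB i \<cdot> (x \<cdot> (e \<cdot> e'))"
  proof -
    have "Df B (i - 1) \<cdot> (y \<cdot> e') = (Df B (i - 1) \<cdot> y) \<cdot> e'" using y e2 by simp
    also have "\<dots> = pB i \<cdot> (x \<cdot> (e \<cdot> e'))" unfolding eq using x e e2 by simp
    finally show ?thesis .
  qed
  have dw: "Df B (i - 1) \<cdot> w = Nul A T' (Cob B i)" using w'(3) w(2) by simp
  have "x \<cdot> (e \<cdot> e') = Df W (i - 1) \<cdot> v \<boxplus> jD i \<cdot> (c \<cdot> e' \<boxplus> mns (\<phi> (i - 1) \<cdot> w))"
  proof (rule W_eqI[of _ i])
    show "pB i \<cdot> (x \<cdot> (e \<cdot> e')) = pB i \<cdot> (Df W (i - 1) \<cdot> v \<boxplus> jD i \<cdot> (c \<cdot> e' \<boxplus> mns (\<phi> (i - 1) \<cdot> w)))"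
      using v c e2 w(2) w'(1,2) y x e src_tgt_Ob(1)[OF e2(1)] by (simp add: v_def eqe dw)
    show "pD i \<cdot> (x \<cdot> (e \<cdot> e')) = pD i \<cdot> (Df W (i - 1) \<cdot> v \<boxplus> jD i \<cdot> (c \<cdot> e' \<boxplus> mns (\<phi> (i - 1) \<cdot> w)))"
    proof -
      let ?y = "\<phi> (i - 1) \<cdot> (y \<cdot> e')" and ?w = "\<phi> (i - 1) \<cdot> w" and ?x = "pD i \<cdot> (x \<cdot> (e \<cdot> e'))"
      have "pD i \<cdot> (Df W (i - 1) \<cdot> v \<boxplus> jD i \<cdot> (c \<cdot> e' \<boxplus> mns (\<phi> (i - 1) \<cdot> w)))
          = (?y \<boxplus> ?w) \<boxplus> ((?x \<boxplus> mns ?y) \<boxplus> mns ?w)"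
        using v c e2 w(2) w'(1,2) y x e src_tgt_Ob(1)[OF e2(1)] by (simp add: v_def c_def)
      also have "(?x \<boxplus> mns ?y) \<boxplus> mns ?w = ?x \<boxplus> mns (?y \<boxplus> ?w)"
        using e2 w(2) w'(1,2) y x e by (simp add: add_assoc)
      also have "(?y \<boxplus> ?w) \<boxplus> (?x \<boxplus> mns (?y \<boxplus> ?w)) = ?x \<boxplus> ((?y \<boxplus> ?w) \<boxplus> mns (?y \<boxplus> ?w))"
        by (rule add_lcomm) (use e2 w(2) w'(1,2) y x e in simp_all)
      also have "\<dots> = ?x" using e2 w(2) w'(1,2) y x e by (simp del: mns_add')
      finally show ?thesis by (rule sym)
    qed
  qed (use v c e2 w(2) w'(1,2) y x e in simp_all)
  moreover have "bound W i (Df W (i - 1) \<cdot> v)" using v by (intro bound_diff) simp_all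
  moreover have "bound W i (jD i \<cdot> (c \<cdot> e' \<boxplus> mns (\<phi> (i - 1) \<cdot> w)))" by (rule bound_map[OF jD_chain h'])
  ultimately have "bound W i (x \<cdot> (e \<cdot> e'))" using bound_add[of W i "Df W (i - 1) \<cdot> v" "jD i \<cdot> (c \<cdot> e' \<boxplus> mns (\<phi> (i - 1) \<cdot> w))"]
    v c e2 w(2) w'(1,2) by simp
  moreover have "is_epi A T' (src x) (e \<cdot> e')" by (rule epi_comp[OF e' e(1)])
  ultimately show "bound W i x" using bound_local x by blast
qed

text \<open>If \<open>D\<close> has no homology, the projection from \<open>W\<close> to \<open>B\<close> is a quasi-isomorphism; this and the next lemma
  separate the degrees.\<close>

lemma pB_surj:
  assumes Z: "H_zero D (i + 1)" shows "H_surj W B pB i"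
proof (rule H_surjI)
  fix z assume z: "cycle B i z"
  note z' = cycleD[OF z]
  have "\<phi> (i + 1) \<cdot> (Df B i \<cdot> z) = Nul A (src z) (Cob D (i + 2))" unfolding z'(3) using z'(1,2) by simp
  then have "cycle D (i + 1) (\<phi> i \<cdot> z)" unfolding cycle_def using z'(1,2) by simp
  then have "bound D (i + 1) (\<phi> i \<cdot> z)" using Z unfolding H_zero_def by blast
  moreover have "src (\<phi> i \<cdot> z) = src z" using z' by simp
  ultimately obtain T e y where e: "is_epi A T (src z) e" "arr e" "src e = T" "tgt e = src z"
    and y: "arr y" "src y = T" "tgt y = Cob D i" and eq: "Df D i \<cdot> y = (\<phi> i \<cdot> z) \<cdot> e"
    using boundE[of D "i + 1" "\<phi> i \<cdot> z"] by (metis add_diff_cancel_right')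
  let ?x = "jB i \<cdot> (z \<cdot> e) \<boxplus> mns (jD i \<cdot> y)"
  have "cycle B i (z \<cdot> e)" using cycle_cmp[OF B z e(2)] e by simp
  moreover have "\<phi> i \<cdot> (z \<cdot> e) = Df D i \<cdot> y" unfolding eq using z' e by simp
  moreover have "T \<in> Ob A" using src_tgt_Ob(1)[OF e(2)] e(3) by simp
  ultimately have "cycle W i ?x" unfolding cycle_W_iff using z'(1,2) e y by simp
  moreover have "homologous B i (pB i \<cdot> ?x) (z \<cdot> e)"
    using z' e y src_tgt_Ob(1)[OF e(2)] by (simp add: homologous_refl)
  moreover have "src ?x = T" using z' e y by simp
  ultimately show "\<exists>T e x. is_epi A T (src z) e \<and> cycle W i x \<and> src x = T \<and> homologous B i (pB i \<cdot> x) (z \<cdot> e)"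
    using e(1) by blast
qed

lemma pB_inj:
  assumes Z: "H_zero D i" shows "H_inj W B pB i"
  unfolding H_inj_def
proof (intro allI impI, elim conjE)
  fix x assume "cycle W i x" and bx: "bound B i (pB i \<cdot> x)"
  then have x: "arr x" "tgt x = Cob W i" and a: "cycle B i (pB i \<cdot> x)"
    and ab: "\<phi> i \<cdot> (pB i \<cdot> x) \<boxplus> Df D i \<cdot> (pD i \<cdot> x) = Nul A (src x) (Cob D (i + 1))"
    unfolding cycle_W_iff by blast+
  have db: "Df D i \<cdot> (pD i \<cdot> x) = mns (\<phi> i \<cdot> (pB i \<cdot> x))" by (rule mns_unique) (use ab x in simp_all)
  have s: "src (pB i \<cdot> x) = src x" using x by simp
  obtain T e y where e: "is_epi A T (src x) e" "arr e" "src e = T" "tgt e = src x"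
    and y: "arr y" "src y = T" "tgt y = Cob B (i - 1)" and eq: "Df B (i - 1) \<cdot> y = (pB i \<cdot> x) \<cdot> e"
    using boundE[OF bx] unfolding s by metis
  \<comment> \<open>\<open>c\<close> is the \<open>D\<close>-component of \<open>x - d (y, 0)\<close>, whose \<open>B\<close>-component vanishes.\<close>
  define c where "c = pD i \<cdot> (x \<cdot> e) \<boxplus> mns (\<phi> (i - 1) \<cdot> y)"
  have c: "arr c" "src c = T" "tgt c = Cob D i" unfolding c_def using x e y by simp_all
  have eq': "\<phi> i \<cdot> (Df B (i - 1) \<cdot> y) = \<phi> i \<cdot> (pB i \<cdot> (x \<cdot> e))" unfolding eq using x e by simp
  have "Df D i \<cdot> (pD i \<cdot> (x \<cdot> e)) = (Df D i \<cdot> (pD i \<cdot> x)) \<cdot> e" using x e by simp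
  also have "\<dots> = mns (\<phi> i \<cdot> (Df B (i - 1) \<cdot> y))" unfolding db eq' using x e by simp
  also have "\<dots> = Df D i \<cdot> (\<phi> (i - 1) \<cdot> y)" using y by simp
  finally have "cycle D i c" unfolding cycle_def using c x e y by (simp add: c_def)
  then have "bound D i c" using Z unfolding H_zero_def by blast
  then have "bound W i (jD i \<cdot> c)" by (rule bound_map[OF jD_chain])
  moreover have "bound W i (Df W (i - 1) \<cdot> (jB (i - 1) \<cdot> y))" using y by (intro bound_diff) simp_all
  moreover have "x \<cdot> e = jD i \<cdot> c \<boxplus> Df W (i - 1) \<cdot> (jB (i - 1) \<cdot> y)"
  proof (rule W_eqI[of _ i])
    show "pB i \<cdot> (x \<cdot> e) = pB i \<cdot> (jD i \<cdot> c \<boxplus> Df W (i - 1) \<cdot> (jB (i - 1) \<cdot> y))"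
      using c y x e by (simp add: eq)
    show "pD i \<cdot> (x \<cdot> e) = pD i \<cdot> (jD i \<cdot> c \<boxplus> Df W (i - 1) \<cdot> (jB (i - 1) \<cdot> y))"
      using c y x e src_tgt_Ob(1)[OF e(2)] by (simp add: c_def add_assoc)
  qed (use c y x e in simp_all)
  ultimately have "bound W i (x \<cdot> e)" using bound_add[of W i "jD i \<cdot> c" "Df W (i - 1) \<cdot> (jB (i - 1) \<cdot> y)"] c y by simp
  then show "bound W i x" by (rule bound_local[OF e(1) x])
qed

end

context abcat begin

lemma ex_twisted_extension:
  assumes B: "bounded_complex A B" and D: "bounded_complex A D"
    and "\<And>i. arr (\<phi> i)" "\<And>i. src (\<phi> i) = Cob B i" "\<And>i. tgt (\<phi> i) = Cob D (i + 1)"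
    and "\<And>i. \<phi> (i + 1) \<cdot> Df B i = mns (Df D (i + 1) \<cdot> \<phi> i)"
  obtains W jB jD pB pD where "twisted_extension A B D W \<phi> jB jD pB pD"
proof -
  have "\<forall>i. \<exists>V jB jD pB pD. is_biproduct A (Cob B i) (Cob D i) V jB jD pB pD"
    using ex_biproduct B D by simp
  then obtain V jB jD pB pD where b: "\<And>i. is_biproduct A (Cob B i) (Cob D i) (V i) (jB i) (jD i) (pB i) (pD i)"
    by metis
  let ?W = "\<lparr>Cob = V, Df = (\<lambda>i. jB (i + 1) \<cdot> (Df B i \<cdot> pB i) \<boxplus> jD (i + 1) \<cdot> (\<phi> i \<cdot> pB i) \<boxplus> jD (i + 1) \<cdot> (Df D i \<cdot> pD i))\<rparr>"
  have "twisted_extension A B D ?W \<phi> jB jD pB pD" by unfold_locales (use assms b in simp_all)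
  then show ?thesis by (rule that)
qed

lemma cone_condition:
  assumes f: "chain_map A X Y f"
  shows "f (i + 1 + 1) \<cdot> Df (shift_cplx A X) i = mns (Df Y (i + 1) \<cdot> f (i + 1))"
proof -
  note [simp] = chain_mapD(1-5)[OF f]
  have "f (i + 1 + 1) \<cdot> Df X (i + 1) = Df Y (i + 1) \<cdot> f (i + 1)" using chain_mapD(6)[OF f] .
  then show ?thesis by simp
qed

lemma ex_cone:
  assumes f: "chain_map A X Y f"
  obtains C \<iota> \<pi> where "is_cone A X Y f C \<iota> \<pi>"
proof -
  note f' = chain_mapD[OF f]
  obtain C jB jD pB pD where T: "twisted_extension A (shift_cplx A X) Y C (\<lambda>i. f (i + 1)) jB jD pB pD"
    by (rule ex_twisted_extension[of "shift_cplx A X" Y "\<lambda>i. f (i + 1)"])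
      (use f' bounded_shift cone_condition[OF f] in simp_all)
  interpret twisted_extension A "shift_cplx A X" Y C "\<lambda>i. f (i + 1)" jB jD pB pD by (rule T)
  have "is_cone A X Y f C jD pB" unfolding is_cone_def
    using f f' biprod Df_W by (intro conjI exI[of _ jB] exI[of _ pD] allI) (simp_all add: neg_mns)
  then show ?thesis by (rule that)
qed

lemma cone_twisted_extension:
  assumes C: "is_cone A X Y f C \<iota> \<pi>"
  obtains j p where "twisted_extension A (shift_cplx A X) Y C (\<lambda>i. f (i + 1)) j \<iota> \<pi> p"
proof -
  obtain j p where f: "chain_map A X Y f"
    and b: "\<And>i. is_biproduct A (Cob X (i + 1)) (Cob Y i) (Cob C i) (j i) (\<iota> i) (\<pi> i) (p i)"
    and d: "\<And>i. Df C i = (j (i + 1) \<cdot> neg A (Cob X (i + 1)) (Cob X (i + 2)) (Df X (i + 1)) \<cdot> \<pi> i)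
         \<boxplus> (\<iota> (i + 1) \<cdot> f (i + 1) \<cdot> \<pi> i) \<boxplus> (\<iota> (i + 1) \<cdot> Df Y i \<cdot> p i)"
    using C unfolding is_cone_def by metis
  note f' = chain_mapD[OF f]
  have "twisted_extension A (shift_cplx A X) Y C (\<lambda>i. f (i + 1)) j \<iota> \<pi> p"
    by unfold_locales (use f' bounded_shift cone_condition[OF f] b d in \<open>simp_all add: neg_mns\<close>)
  then show ?thesis by (rule that)
qed

lemma cone_maps:
  assumes C: "is_cone A X Y f C \<iota> \<pi>"
  shows "bounded_complex A C" "chain_map A Y C \<iota>" "chain_map A C (shift_cplx A X) \<pi>"
proof -
  obtain j p where T: "twisted_extension A (shift_cplx A X) Y C (\<lambda>i. f (i + 1)) j \<iota> \<pi> p"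
    using cone_twisted_extension[OF C] .
  interpret twisted_extension A "shift_cplx A X" Y C "\<lambda>i. f (i + 1)" j \<iota> \<pi> p by (rule T)
  show "bounded_complex A C" "chain_map A Y C \<iota>" "chain_map A C (shift_cplx A X) \<pi>"
    by (rule W_bounded jD_chain pB_chain)+
qed

text \<open>The long exact sequence of a cone, read off from that of the twisted extension. A cone has
  \<open>X[1]\<close> in the place of \<open>B\<close>, which accounts for the shifted degrees.\<close>

lemma cone_zero:
  assumes C: "is_cone A X Y f C \<iota> \<pi>"
  shows cone_zero_surj: "H_zero C i \<Longrightarrow> H_surj X Y f i"
    and cone_zero_inj: "H_zero C (i - 1) \<Longrightarrow> H_inj X Y f i"
    and cone_zeroI: "H_surj X Y f i \<Longrightarrow> H_inj X Y f (i + 1) \<Longrightarrow> H_zero C i"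
proof -
  obtain j p where T: "twisted_extension A (shift_cplx A X) Y C (\<lambda>i. f (i + 1)) j \<iota> \<pi> p"
    using cone_twisted_extension[OF C] .
  interpret twisted_extension A "shift_cplx A X" Y C "\<lambda>i. f (i + 1)" j \<iota> \<pi> p by (rule T)
  have f: "chain_map A X Y f" using C unfolding is_cone_def by blast
  note [simp] = shift_cplx_cycle[OF chain_mapD(1)[OF f]] shift_cplx_bound[OF chain_mapD(1)[OF f]]
  show "H_surj X Y f i" if "H_zero C i"
    by (rule H_surjI) (use W_zero_surj[OF that] in simp)
  show "H_inj X Y f i" if Z: "H_zero C (i - 1)"
    unfolding H_inj_def using W_zero_inj[OF Z] by simp
  show "H_zero C i" if S: "H_surj X Y f i" and I: "H_inj X Y f (i + 1)"
  proof (rule W_zeroI)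
    fix z assume "cycle Y i z"
    then show "\<exists>T e x. is_epi A T (src z) e \<and> cycle (shift_cplx A X) (i - 1) x \<and> src x = T \<and>
        homologous Y i (f (i - 1 + 1) \<cdot> x) (z \<cdot> e)"
      using S H_surjE by (metis diff_add_cancel shift_cplx_cycle[OF chain_mapD(1)[OF f]])
  next
    fix x assume "cycle (shift_cplx A X) i x" "bound Y (i + 1) (f (i + 1) \<cdot> x)"
    then show "bound (shift_cplx A X) i x" using I unfolding H_inj_def by simp
  qed
qed

lemma add_cancel3:
  assumes "arr a" "arr b" "arr c" "src b = src a" "src c = src a" "tgt b = tgt a" "tgt c = tgt a"
  shows "a \<boxplus> (b \<boxplus> (c \<boxplus> (mns a \<boxplus> mns b))) = c"
proof -
  have "a \<boxplus> (b \<boxplus> (c \<boxplus> (mns a \<boxplus> mns b))) = (a \<boxplus> b) \<boxplus> (c \<boxplus> mns (a \<boxplus> b))" using assms by (simp add: add_assoc)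
  also have "\<dots> = c \<boxplus> ((a \<boxplus> b) \<boxplus> mns (a \<boxplus> b))" by (rule add_lcomm) (use assms in simp_all)
  also have "\<dots> = c" using assms by (simp del: mns_add')
  finally show ?thesis .
qed

text \<open>Let \<open>C\<close> be the cone of \<open>t\<close>, which is acyclic, and \<open>W\<close> the twisted extension of \<open>U\<close> by \<open>C[-1]\<close> along
  \<open>U \<rightarrow> Y \<rightarrow> C\<close>. An element of \<open>W\<^sup>i\<close> is a triple \<open>(u, v, y)\<close> in \<open>U\<^sup>i \<oplus> V\<^sup>i \<oplus> Y\<^sup>i\<^sup>-\<^sup>1\<close>, with differential
  \<open>(d u, d v, f u - t v - d y)\<close>. Then \<open>w (u, v, y) = u\<close> is a quasi-isomorphism because \<open>C\<close> is acyclic,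
  \<open>h (u, v, y) = v\<close> is a chain map, and \<open>(u, v, y) \<mapsto> y\<close> is a homotopy from \<open>f w\<close> to \<open>t h\<close>.\<close>

lemma quasi_iso_ore:
  assumes f: "chain_map A U Y f" and t: "quasi_iso A V Y t"
  obtains W w h where "quasi_iso A W U w" "chain_map A W V h"
    "homotopic A W Y (\<lambda>i. f i \<cdot> w i) (\<lambda>i. t i \<cdot> h i)"
proof -
  have t': "chain_map A V Y t" "\<And>i. H_surj V Y t i" "\<And>i. H_inj V Y t i" using t unfolding quasi_iso_iff by blast+
  note [simp] = chain_mapD(1-5)[OF f] chain_mapD(1-5)[OF t'(1)]
  obtain C \<iota> \<pi> where C: "is_cone A V Y t C \<iota> \<pi>" using ex_cone[OF t'(1)] .
  obtain j p where TC: "twisted_extension A (shift_cplx A V) Y C (\<lambda>i. t (i + 1)) j \<iota> \<pi> p"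
    using cone_twisted_extension[OF C] .
  interpret C: twisted_extension A "shift_cplx A V" Y C "\<lambda>i. t (i + 1)" j \<iota> \<pi> p by (rule TC)
  have CZ: "H_zero C i" for i using cone_zeroI[OF C] t' by blast
  obtain W jB jD pB pD where TW: "twisted_extension A U (unshift C) W (\<lambda>i. \<iota> i \<cdot> f i) jB jD pB pD"
  proof (rule ex_twisted_extension[of U "unshift C" "\<lambda>i. \<iota> i \<cdot> f i"])
    fix i
    have "(\<iota> (i + 1) \<cdot> f (i + 1)) \<cdot> Df U i = \<iota> (i + 1) \<cdot> (f (i + 1) \<cdot> Df U i)" by simp
    also have "\<dots> = \<iota> (i + 1) \<cdot> (Df Y i \<cdot> f i)" using chain_mapD(6)[OF f] by simp
    also have "\<dots> = Df C i \<cdot> (\<iota> i \<cdot> f i)" using chain_map_cmp[OF C.jD_chain] by simp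
    finally show "(\<iota> (i + 1) \<cdot> f (i + 1)) \<cdot> Df U i = mns (Df (unshift C) (i + 1) \<cdot> (\<iota> i \<cdot> f i))" by simp
  qed (use bounded_unshift in simp_all)
  interpret W: twisted_extension A U "unshift C" W "\<lambda>i. \<iota> i \<cdot> f i" jB jD pB pD by (rule TW)
  have DZ: "H_zero (unshift C) i" for i using CZ by (simp add: H_zero_unshift)
  have w: "quasi_iso A W U pB"
    unfolding quasi_iso_iff using W.pB_chain W.pB_surj W.pB_inj DZ by blast
  have pi: "arr (\<pi> (i - 1))" "src (\<pi> (i - 1)) = Cob C (i - 1)" "tgt (\<pi> (i - 1)) = Cob V i" for i
    using C.component_arrows(7-9)[of "i - 1"] by simp_all
  have h: "chain_map A W V (\<lambda>i. \<pi> (i - 1) \<cdot> pD i)"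
  proof (rule chain_mapI)
    fix i
    have "\<pi> i \<cdot> (Df C (i - 1) \<cdot> pD i) = mns (Df V i \<cdot> (\<pi> (i - 1) \<cdot> pD i))"
      using C.pB_d(2)[of i "i - 1" "pD i"] by (simp add: pi)
    then show "(\<pi> (i + 1 - 1) \<cdot> pD (i + 1)) \<cdot> Df W i = Df V i \<cdot> (\<pi> (i - 1) \<cdot> pD i)"
      by (simp add: pi)
  qed (simp_all add: pi)
  have "homotopic A W Y (\<lambda>i. f i \<cdot> pB i) (\<lambda>i. t i \<cdot> (\<pi> (i - 1) \<cdot> pD i))"
  proof (rule homotopicI[OF chain_map_comp[OF W.pB_chain f] chain_map_comp[OF h t'(1)], of "\<lambda>i. p (i - 1) \<cdot> pD i"])
    fix i
    let ?a = "t i \<cdot> (\<pi> (i - 1) \<cdot> pD i)" and ?b = "Df Y (i - 1) \<cdot> (p (i - 1) \<cdot> pD i)" and ?c = "f i \<cdot> pB i"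
    have "p i \<cdot> (Df C (i - 1) \<cdot> pD i) = ?a \<boxplus> ?b"
      using C.pD_d(2)[of i "i - 1" "pD i"] by (simp add: pi)
    then have "(p (i + 1 - 1) \<cdot> pD (i + 1)) \<cdot> Df W i = ?c \<boxplus> (mns ?a \<boxplus> mns ?b)"
      by (simp add: pi)
    then have "?a \<boxplus> (?b \<boxplus> (p (i + 1 - 1) \<cdot> pD (i + 1)) \<cdot> Df W i) = ?a \<boxplus> (?b \<boxplus> (?c \<boxplus> (mns ?a \<boxplus> mns ?b)))" by simp
    also have "\<dots> = ?c" by (rule add_cancel3) (simp_all add: pi)
    finally show "?c = ?a \<boxplus> (?b \<boxplus> (p (i + 1 - 1) \<cdot> pD (i + 1)) \<cdot> Df W i)" by (rule sym)
  qed simp_all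
  with w h show ?thesis by (rule that)
qed

end

section \<open>Localization by right fractions\<close>


text \<open>Quasi-isomorphisms satisfy these axioms of a calculus of right fractions. The axiom \<open>S_cancel\<close> is part of
  two-out-of-three; it puts both arrows \<open>u\<close>, \<open>w\<close> that witness an equivalence of roofs into \<open>S\<close>.\<close>

locale right_ore = category C for C :: "('o, 'a) cat" (structure) +
  fixes S :: "'a set"
  assumes S_cmp: "s \<in> Hom C X Y \<Longrightarrow> t \<in> Hom C Y Z \<Longrightarrow> s \<in> S \<Longrightarrow> t \<in> S \<Longrightarrow> t \<cdot> s \<in> S"
    and S_idn: "X \<in> Ob C \<Longrightarrow> Idn C X \<in> S"
    and S_cancel: "s \<in> Hom C X Y \<Longrightarrow> t \<in> Hom C Y Z \<Longrightarrow> t \<in> S \<Longrightarrow> t \<cdot> s \<in> S \<Longrightarrow> s \<in> S"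
    and ore: "f \<in> Hom C U Y \<Longrightarrow> t \<in> Hom C V Y \<Longrightarrow> t \<in> S \<Longrightarrow>
      \<exists>W w h. w \<in> Hom C W U \<and> w \<in> S \<and> h \<in> Hom C W V \<and> f \<cdot> w = t \<cdot> h"
begin

abbreviation L where "L \<equiv> localization C S"

lemma loc_simps [simp]:
  "Ob L = Ob C" "Hom L X Y = roof_class C S X Y ` roofs C S X Y"
  "Idn L X = roof_class C S X X (Idn C X, Idn C X)" "Nul L X Y = roof_class C S X Y (Idn C X, Nul C X Y)"
  by (simp_all add: localization_def)

definition equivalent_roofs :: "'o \<Rightarrow> 'o \<Rightarrow> 'a \<times> 'a \<Rightarrow> 'a \<times> 'a \<Rightarrow> bool" where
  "equivalent_roofs X Y r r' \<longleftrightarrow> r' \<in> roof_class C S X Y r"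

lemma equivalent_roofsE:
  assumes "equivalent_roofs X Y (s, f) (t, g)"
  obtains W Z Z' u w where "u \<in> Hom C W Z" "w \<in> Hom C W Z'" "s \<in> Hom C Z X" "t \<in> Hom C Z' X"
    "f \<in> Hom C Z Y" "g \<in> Hom C Z' Y" "s \<in> S" "t \<in> S" "s \<cdot> u = t \<cdot> w" "s \<cdot> u \<in> S" "f \<cdot> u = g \<cdot> w" "u \<in> S" "w \<in> S"
proof -
  from assms obtain W Z Z' u w where r: "(s, f) \<in> roofs C S X Y" "(t, g) \<in> roofs C S X Y"
    and *: "u \<in> Hom C W Z" "w \<in> Hom C W Z'" "s \<in> Hom C Z X" "t \<in> Hom C Z' X"
    "s \<cdot> u = t \<cdot> w" "s \<cdot> u \<in> S" "f \<cdot> u = g \<cdot> w"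
    unfolding equivalent_roofs_def roof_class_def by auto
  have f: "f \<in> Hom C Z Y" "s \<in> S" using r(1) *(3) hom_disjoint unfolding roofs_def by blast+
  have g: "g \<in> Hom C Z' Y" "t \<in> S" using r(2) *(4) hom_disjoint unfolding roofs_def by blast+
  have "u \<in> S" using S_cancel[OF *(1,3)] f(2) *(6) by blast
  moreover have "w \<in> S" using S_cancel[OF *(2,4)] g(2) *(5,6) by simp
  ultimately show ?thesis using that[OF *(1-4) f(1) g(1) f(2) g(2) *(5-7)] by blast
qed

lemma roofsI: "s \<in> Hom C Z X \<Longrightarrow> s \<in> S \<Longrightarrow> f \<in> Hom C Z Y \<Longrightarrow> (s, f) \<in> roofs C S X Y"
  unfolding roofs_def using hom_ob by blast

lemma roofsE:
  assumes "(s, f) \<in> roofs C S X Y"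
  obtains Z where "s \<in> Hom C Z X" "s \<in> S" "f \<in> Hom C Z Y"
  using assms unfolding roofs_def by blast

lemma equivalent_roofsI:
  assumes "u \<in> Hom C W Z" "w \<in> Hom C W Z'" "s \<in> Hom C Z X" "t \<in> Hom C Z' X"
    "f \<in> Hom C Z Y" "g \<in> Hom C Z' Y" "s \<in> S" "t \<in> S" "s \<cdot> u = t \<cdot> w" "s \<cdot> u \<in> S" "f \<cdot> u = g \<cdot> w"
  shows "equivalent_roofs X Y (s, f) (t, g)"
proof -
  have "(s, f) \<in> roofs C S X Y" "(t, g) \<in> roofs C S X Y" using assms roofsI by blast+
  then show ?thesis unfolding equivalent_roofs_def roof_class_def prod.case mem_Collect_eq using assms by blast
qed

lemma equivalent_roofs_refl: "r \<in> roofs C S X Y \<Longrightarrow> equivalent_roofs X Y r r"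
proof (cases r)
  case (Pair s f)
  assume "r \<in> roofs C S X Y"
  then obtain Z where Z: "s \<in> Hom C Z X" "s \<in> S" "f \<in> Hom C Z Y" unfolding Pair by (rule roofsE)
  then have "Idn C Z \<in> Hom C Z Z" "s \<cdot> Idn C Z = s" using hom_ob idn_hom cmp_idn by blast+
  then show ?thesis unfolding Pair using Z by (intro equivalent_roofsI) auto
qed

lemma equivalent_roofs_sym: "equivalent_roofs X Y r r' \<Longrightarrow> equivalent_roofs X Y r' r"
proof (cases r; cases r')
  fix s f t g assume r: "r = (s, f)" "r' = (t, g)" "equivalent_roofs X Y r r'"
  obtain W Z Z' u w where *: "u \<in> Hom C W Z" "w \<in> Hom C W Z'" "s \<in> Hom C Z X" "t \<in> Hom C Z' X"
    "f \<in> Hom C Z Y" "g \<in> Hom C Z' Y" "s \<in> S" "t \<in> S" "s \<cdot> u = t \<cdot> w" "s \<cdot> u \<in> S" "f \<cdot> u = g \<cdot> w"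
    using r(3) unfolding r(1,2) by (rule equivalent_roofsE)
  show ?thesis unfolding r(1,2)
    by (rule equivalent_roofsI[OF *(2,1,4,3,6,5,8,7)]) (use * in simp_all)
qed

text \<open>Two witnesses meet over the middle roof, and an Ore square joins them.\<close>

lemma equivalent_roofs_trans:
  assumes "equivalent_roofs X Y r r'" "equivalent_roofs X Y r' r''"
  shows "equivalent_roofs X Y r r''"
proof -
  obtain s f t g v k where r: "r = (s, f)" "r' = (t, g)" "r'' = (v, k)" by (metis surj_pair)
  obtain W Z Z' u w where a: "u \<in> Hom C W Z" "w \<in> Hom C W Z'" "s \<in> Hom C Z X" "t \<in> Hom C Z' X"
    "f \<in> Hom C Z Y" "g \<in> Hom C Z' Y" "s \<in> S" "t \<in> S" "s \<cdot> u = t \<cdot> w" "s \<cdot> u \<in> S" "f \<cdot> u = g \<cdot> w" "u \<in> S" "w \<in> S"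
    using assms(1) unfolding r by (rule equivalent_roofsE)
  obtain W2 Z2 Z3 u2 w2 where b: "u2 \<in> Hom C W2 Z2" "w2 \<in> Hom C W2 Z3" "t \<in> Hom C Z2 X" "v \<in> Hom C Z3 X"
    "g \<in> Hom C Z2 Y" "k \<in> Hom C Z3 Y" "t \<in> S" "v \<in> S" "t \<cdot> u2 = v \<cdot> w2" "t \<cdot> u2 \<in> S" "g \<cdot> u2 = k \<cdot> w2" "u2 \<in> S" "w2 \<in> S"
    using assms(2) unfolding r by (rule equivalent_roofsE)
  have Z: "Z2 = Z'" using hom_disjoint a(4) b(3) by blast
  obtain V x y where v: "x \<in> Hom C V W" "x \<in> S" "y \<in> Hom C V W2" "w \<cdot> x = u2 \<cdot> y"
    using ore[OF a(2) b(1)[unfolded Z] b(12)] by blast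
  have "s \<cdot> (u \<cdot> x) = t \<cdot> (w \<cdot> x)"
    using cmp_assoc[OF v(1) a(1,3)] cmp_assoc[OF v(1) a(2,4)] a(9) by simp
  also have "\<dots> = v \<cdot> (w2 \<cdot> y)"
    unfolding v(4) using cmp_assoc[OF v(3) b(1,3)] cmp_assoc[OF v(3) b(2,4)] b(9) by simp
  finally have 1: "s \<cdot> (u \<cdot> x) = v \<cdot> (w2 \<cdot> y)" .
  have "f \<cdot> (u \<cdot> x) = g \<cdot> (w \<cdot> x)"
    using cmp_assoc[OF v(1) a(1,5)] cmp_assoc[OF v(1) a(2,6)] a(11) by simp
  also have "\<dots> = k \<cdot> (w2 \<cdot> y)"
    unfolding v(4) using cmp_assoc[OF v(3) b(1,5)] cmp_assoc[OF v(3) b(2,6)] b(11) by simp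
  finally have 2: "f \<cdot> (u \<cdot> x) = k \<cdot> (w2 \<cdot> y)" .
  have ux: "u \<cdot> x \<in> Hom C V Z" "u \<cdot> x \<in> S" using cmp_hom[OF v(1) a(1)] S_cmp[OF v(1) a(1) v(2) a(12)] by auto
  show ?thesis unfolding r
    by (rule equivalent_roofsI[OF ux(1) cmp_hom[OF v(3) b(2)] a(3) b(4) a(5) b(6) a(7) b(8) 1 _ 2])
      (rule S_cmp[OF ux(1) a(3) ux(2) a(7)])
qed

lemma equivalent_roofs_roofs: 
  "equivalent_roofs X Y r r' \<Longrightarrow> r \<in> roofs C S X Y"
  "equivalent_roofs X Y r r' \<Longrightarrow> r' \<in> roofs C S X Y"
  unfolding equivalent_roofs_def roof_class_def by (auto split: prod.splits)

lemma roof_class_eq: "equivalent_roofs X Y r r' \<Longrightarrow> roof_class C S X Y r = roof_class C S X Y r'"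
proof -
  assume e: "equivalent_roofs X Y r r'"
  have "x \<in> roof_class C S X Y r \<longleftrightarrow> x \<in> roof_class C S X Y r'" for x
    unfolding equivalent_roofs_def[symmetric] using e equivalent_roofs_sym equivalent_roofs_trans by blast
  then show ?thesis by blast
qed

text \<open>Restriction along \<open>u\<close> does not change the fraction. It brings two roofs to a common denominator.\<close>

lemma equivalent_roofs_restrict:
  assumes "s \<in> Hom C Z X" "s \<in> S" "f \<in> Hom C Z Y" "u \<in> Hom C W Z" "s \<cdot> u \<in> S"
  shows "equivalent_roofs X Y (s, f) (s \<cdot> u, f \<cdot> u)"
proof -
  have "W \<in> Ob C" using hom_ob assms by blast
  note i = idn_hom[OF this]
  show ?thesis
    by (rule equivalent_roofsI[OF assms(4) i assms(1) cmp_hom[OF assms(4,1)] assms(3) cmp_hom[OF assms(4,3)] assms(2,5)])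
      (use cmp_idn[OF cmp_hom[OF assms(4,1)]] cmp_idn[OF cmp_hom[OF assms(4,3)]] assms(5) in simp_all)
qed

lemma loc_homE:
  assumes "F \<in> Hom L X Y" obtains r where "r \<in> roofs C S X Y" "F = roof_class C S X Y r"
  using assms by auto

lemma loc_hom_class:
  assumes "F \<in> Hom L X Y" "r \<in> F" shows "r \<in> roofs C S X Y" "F = roof_class C S X Y r"
  using assms roof_class_eq equivalent_roofs_roofs unfolding loc_simps equivalent_roofs_def by blast+

lemma loc_hom_nonempty:
  assumes "F \<in> Hom L X Y" obtains s f Z where "(s, f) \<in> F" "s \<in> Hom C Z X" "s \<in> S" "f \<in> Hom C Z Y"
proof -
  obtain s f where "(s, f) \<in> roofs C S X Y" "F = roof_class C S X Y (s, f)" using assms by auto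
  then show ?thesis using that equivalent_roofs_refl unfolding equivalent_roofs_def by (metis roofsE)
qed

lemma loc_homI: "r \<in> roofs C S X Y \<Longrightarrow> roof_class C S X Y r \<in> Hom L X Y"
  by simp

lemma loc_hom_Ob: "F \<in> Hom L X Y \<Longrightarrow> X \<in> Ob C \<and> Y \<in> Ob C"
  using loc_hom_nonempty hom_ob by metis

lemma Idn_loc_hom: "X \<in> Ob C \<Longrightarrow> Idn L X \<in> Hom L X X"
  unfolding loc_simps by (intro imageI roofsI[of _ X]) (auto simp: idn_hom S_idn)

lemma loc_cmpI:
  assumes "(s, f) \<in> F" "(t, g) \<in> G" "s \<in> Hom C U X" "f \<in> Hom C U Y" "t \<in> Hom C V Y" "g \<in> Hom C V Z"
    "w \<in> Hom C W U" "w \<in> S" "h \<in> Hom C W V" "f \<cdot> w = t \<cdot> h" "s \<in> S"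
  shows "roof_class C S X Z (s \<cdot> w, g \<cdot> h) \<subseteq> G \<cdot>\<^bsub>L\<^esub> F" "(s \<cdot> w, g \<cdot> h) \<in> G \<cdot>\<^bsub>L\<^esub> F"
    "(s \<cdot> w, g \<cdot> h) \<in> roofs C S X Z"
proof -
  show 1: "roof_class C S X Z (s \<cdot> w, g \<cdot> h) \<subseteq> G \<cdot>\<^bsub>L\<^esub> F"
    unfolding localization_def cat.simps using assms by blast
  show 2: "(s \<cdot> w, g \<cdot> h) \<in> roofs C S X Z"
    using assms cmp_hom S_cmp by (intro roofsI) blast+
  show "(s \<cdot> w, g \<cdot> h) \<in> G \<cdot>\<^bsub>L\<^esub> F" using 1 equivalent_roofs_refl[OF 2] unfolding equivalent_roofs_def by blast
qed

lemma loc_cmp_ex: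
  assumes "(s, f) \<in> F" "(t, g) \<in> G" "s \<in> Hom C U X" "f \<in> Hom C U Y" "t \<in> Hom C V Y" "g \<in> Hom C V Z" "s \<in> S" "t \<in> S"
  obtains W w h where "w \<in> Hom C W U" "w \<in> S" "h \<in> Hom C W V" "f \<cdot> w = t \<cdot> h"
    "(s \<cdot> w, g \<cdot> h) \<in> G \<cdot>\<^bsub>L\<^esub> F" "roof_class C S X Z (s \<cdot> w, g \<cdot> h) \<subseteq> G \<cdot>\<^bsub>L\<^esub> F" "(s \<cdot> w, g \<cdot> h) \<in> roofs C S X Z"
proof -
  obtain W w h where "w \<in> Hom C W U" "w \<in> S" "h \<in> Hom C W V" "f \<cdot> w = t \<cdot> h"
    using ore[OF assms(4,5,8)] by blast
  with that loc_cmpI[OF assms(1-6) this assms(7)] show ?thesis by blast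
qed

lemma loc_cmpE:
  assumes "r \<in> G \<cdot>\<^bsub>L\<^esub> F"
  obtains X Y Z U V W w s f t g h where "(s, f) \<in> F" "(t, g) \<in> G" "s \<in> Hom C U X" "f \<in> Hom C U Y"
    "t \<in> Hom C V Y" "g \<in> Hom C V Z" "w \<in> Hom C W U" "w \<in> S" "h \<in> Hom C W V" "f \<cdot> w = t \<cdot> h"
    "equivalent_roofs X Z (s \<cdot> w, g \<cdot> h) r"
  using assms unfolding localization_def cat.simps equivalent_roofs_def by blast

text \<open>A composite in the localization is a union of classes, over all members of both factors and all
  Ore squares. It is the class of \<open>r\<close> once every roof obtained in this way is equivalent to \<open>r\<close>; the Ore
  condition makes the union nonempty.\<close>

lemma loc_cmp_eqI:
  assumes F: "F \<noteq> {} " "F \<subseteq> roofs C S X Y" and G: "G \<noteq> {}" "G \<subseteq> roofs C S Y Z"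
    and r: "\<And>s f t g U V W w h. (s, f) \<in> F \<Longrightarrow> (t, g) \<in> G \<Longrightarrow> s \<in> Hom C U X \<Longrightarrow> f \<in> Hom C U Y \<Longrightarrow>
      t \<in> Hom C V Y \<Longrightarrow> g \<in> Hom C V Z \<Longrightarrow> s \<in> S \<Longrightarrow> t \<in> S \<Longrightarrow>
      w \<in> Hom C W U \<Longrightarrow> w \<in> S \<Longrightarrow> h \<in> Hom C W V \<Longrightarrow> f \<cdot> w = t \<cdot> h \<Longrightarrow>
      equivalent_roofs X Z r (s \<cdot> w, g \<cdot> h)"
  shows "G \<cdot>\<^bsub>L\<^esub> F = roof_class C S X Z r"
proof
  obtain s f where sf: "(s, f) \<in> F" using F(1) by (metis equals0I surj_pair)
  obtain t g where tg: "(t, g) \<in> G" using G(1) by (metis equals0I surj_pair)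
  obtain U where U: "s \<in> Hom C U X" "s \<in> S" "f \<in> Hom C U Y" using sf F(2) by (meson roofsE subsetD)
  obtain V where V: "t \<in> Hom C V Y" "t \<in> S" "g \<in> Hom C V Z" using tg G(2) by (meson roofsE subsetD)
  obtain W w h where w: "w \<in> Hom C W U" "w \<in> S" "h \<in> Hom C W V" "f \<cdot> w = t \<cdot> h"
    "roof_class C S X Z (s \<cdot> w, g \<cdot> h) \<subseteq> G \<cdot>\<^bsub>L\<^esub> F"
    using loc_cmp_ex[OF sf tg U(1,3) V(1,3) U(2) V(2)] by metis
  have "roof_class C S X Z r = roof_class C S X Z (s \<cdot> w, g \<cdot> h)"
    by (rule roof_class_eq[OF r[OF sf tg U(1,3) V(1,3) U(2) V(2) w(1-4)]])
  with w(5) show "roof_class C S X Z r \<subseteq> G \<cdot>\<^bsub>L\<^esub> F" by simp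
  show "G \<cdot>\<^bsub>L\<^esub> F \<subseteq> roof_class C S X Z r"
  proof
    fix q assume "q \<in> G \<cdot>\<^bsub>L\<^esub> F"
    then obtain X' Y' Z' U V W w s f t g h where a: "(s, f) \<in> F" "(t, g) \<in> G" "s \<in> Hom C U X'" "f \<in> Hom C U Y'"
    "t \<in> Hom C V Y'" "g \<in> Hom C V Z'" "w \<in> Hom C W U" "w \<in> S" "h \<in> Hom C W V" "f \<cdot> w = t \<cdot> h"
    "equivalent_roofs X' Z' (s \<cdot> w, g \<cdot> h) q" by (rule loc_cmpE)
    have "(s, f) \<in> roofs C S X Y" "(t, g) \<in> roofs C S Y Z" using a(1,2) F(2) G(2) by auto
    then have e: "X' = X" "Y' = Y" "Z' = Z" and "s \<in> S" "t \<in> S"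
      using a(3-6) hom_disjoint unfolding roofs_def by blast+
    then have "equivalent_roofs X Z r (s \<cdot> w, g \<cdot> h)" using r[OF a(1,2) a(3-6)[unfolded e] _ _ a(7-10)] by blast
    then show "q \<in> roof_class C S X Z r"
      using equivalent_roofs_trans a(11) unfolding e equivalent_roofs_def[symmetric] by blast
  qed
qed

lemma Idn_memberD:
  assumes "(s, f) \<in> Idn L X"
  obtains W U u where "s \<in> Hom C U X" "f \<in> Hom C U X" "s \<in> S" "u \<in> Hom C W U" "u \<in> S" "s \<cdot> u = f \<cdot> u" "X \<in> Ob C"
proof -
  have "equivalent_roofs X X (Idn C X, Idn C X) (s, f)" using assms by (simp add: equivalent_roofs_def)
  then obtain W Z Z' u w where *: "u \<in> Hom C W Z" "w \<in> Hom C W Z'" "Idn C X \<in> Hom C Z X" "s \<in> Hom C Z' X"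
    "Idn C X \<in> Hom C Z X" "f \<in> Hom C Z' X" "Idn C X \<in> S" "s \<in> S" "Idn C X \<cdot> u = s \<cdot> w" "Idn C X \<cdot> u \<in> S"
    "Idn C X \<cdot> u = f \<cdot> w" "u \<in> S" "w \<in> S" by (rule equivalent_roofsE)
  show ?thesis using that[OF *(4,6,8,2,13)] *(9,11) hom_ob[OF *(3)] by simp
qed

lemma Idn_roofs: "X \<in> Ob C \<Longrightarrow> (Idn C X, Idn C X) \<in> roofs C S X X"
  using roofsI[of _ X X] idn_hom S_idn by blast

lemma Idn_member: "X \<in> Ob C \<Longrightarrow> (Idn C X, Idn C X) \<in> Idn L X"
  using equivalent_roofs_refl[OF Idn_roofs] by (simp add: equivalent_roofs_def)

lemma Idn_subset: "Idn L X \<subseteq> roofs C S X X"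
  using equivalent_roofs_roofs(2) by (auto simp: equivalent_roofs_def)

lemma hom_subset: "F \<in> Hom L X Y \<Longrightarrow> F \<subseteq> roofs C S X Y"
  using loc_hom_class by blast

lemma loc_addI:
  assumes "(s, f) \<in> F" "(s, g) \<in> G" "s \<in> Hom C U X" "f \<in> Hom C U Y" "g \<in> Hom C U Y"
  shows "roof_class C S X Y (s, f \<boxplus> g) \<subseteq> F \<boxplus>\<^bsub>L\<^esub> G"
  unfolding localization_def cat.simps using assms by blast

text \<open>This holds for every nonempty set \<open>G\<close> of roofs that represent the identity. In particular it applies to the
  image of an identity under the shift, which is a set of roofs contained in the identity of the
  shifted object.\<close>

lemma loc_idn_cmp:
  assumes F: "F \<in> Hom L X Y" and G: "G \<subseteq> Idn L Y" "G \<noteq> {}"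
  shows "G \<cdot>\<^bsub>L\<^esub> F = F"
proof -
  obtain r where r: "r \<in> roofs C S X Y" "F = roof_class C S X Y r" using F by (rule loc_homE)
  have "G \<cdot>\<^bsub>L\<^esub> F = roof_class C S X Y r"
  proof (rule loc_cmp_eqI[OF _ hom_subset[OF F] G(2)])
    show "F \<noteq> {}" using loc_hom_nonempty[OF F] by blast
    show "G \<subseteq> roofs C S Y Y" using G(1) Idn_subset by blast
    fix s f t g U V W w h assume a: "(s, f) \<in> F" "(t, g) \<in> G" "s \<in> Hom C U X" "f \<in> Hom C U Y"
      "t \<in> Hom C V Y" "g \<in> Hom C V Y" "s \<in> S" "t \<in> S" "w \<in> Hom C W U" "w \<in> S" "h \<in> Hom C W V" "f \<cdot> w = t \<cdot> h"
    obtain W2 V2 u where u: "t \<in> Hom C V2 Y" "u \<in> Hom C W2 V2" "u \<in> S" "t \<cdot> u = g \<cdot> u"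
      using a(2) G(1) Idn_memberD by (metis subsetD)
    have "V2 = V" using hom_disjoint u(1) a(5) by blast
    with u have u': "u \<in> Hom C W2 V" by simp
    obtain W3 e e' where e: "e \<in> Hom C W3 W" "e \<in> S" "e' \<in> Hom C W3 W2" "h \<cdot> e = u \<cdot> e'"
      using ore[OF a(11) u' u(3)] by blast
    have "(g \<cdot> h) \<cdot> e = g \<cdot> (u \<cdot> e')" using cmp_assoc[OF e(1) a(11,6)] e(4) by simp
    also have "\<dots> = t \<cdot> (u \<cdot> e')" using cmp_assoc[OF e(3) u' a(6)] cmp_assoc[OF e(3) u' a(5)] u(4) by simp
    also have "\<dots> = (t \<cdot> h) \<cdot> e" using cmp_assoc[OF e(1) a(11,5)] e(4) by simp
    also have "\<dots> = f \<cdot> (w \<cdot> e)" unfolding a(12)[symmetric] using cmp_assoc[OF e(1) a(9,4)] .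
    finally have gh: "(g \<cdot> h) \<cdot> e = f \<cdot> (w \<cdot> e)" .
    have we: "w \<cdot> e \<in> Hom C W3 U" "w \<cdot> e \<in> S" using cmp_hom[OF e(1) a(9)] S_cmp[OF e(1) a(9) e(2) a(10)] by auto
    have sw: "s \<cdot> w \<in> Hom C W X" "s \<cdot> w \<in> S" using cmp_hom[OF a(9,3)] S_cmp[OF a(9,3,10,7)] by auto
    have swe: "(s \<cdot> w) \<cdot> e = s \<cdot> (w \<cdot> e)" "s \<cdot> (w \<cdot> e) \<in> S"
      using cmp_assoc[OF e(1) a(9,3)] S_cmp[OF we(1) a(3) we(2) a(7)] by auto
    have "equivalent_roofs X Y (s, f) (s \<cdot> (w \<cdot> e), f \<cdot> (w \<cdot> e))"
      by (rule equivalent_roofs_restrict[OF a(3,7,4) we(1) swe(2)])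
    moreover have "equivalent_roofs X Y (s \<cdot> w, g \<cdot> h) (s \<cdot> (w \<cdot> e), f \<cdot> (w \<cdot> e))"
      using equivalent_roofs_restrict[OF sw cmp_hom[OF a(11,6)] e(1)] swe gh by simp
    moreover have "equivalent_roofs X Y r (s, f)" using a(1) r(2) by (simp add: equivalent_roofs_def)
    ultimately show "equivalent_roofs X Y r (s \<cdot> w, g \<cdot> h)"
      using equivalent_roofs_trans equivalent_roofs_sym by blast
  qed
  then show ?thesis using r(2) by simp
qed

lemma loc_cmp_idn:
  assumes F: "F \<in> Hom L X Y" shows "F \<cdot>\<^bsub>L\<^esub> Idn L X = F"
proof -
  obtain r where r: "r \<in> roofs C S X Y" "F = roof_class C S X Y r" using F by (rule loc_homE)
  have X: "X \<in> Ob C" using loc_hom_Ob[OF F] by blast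
  have "F \<cdot>\<^bsub>L\<^esub> Idn L X = roof_class C S X Y r"
  proof (rule loc_cmp_eqI[OF _ Idn_subset _ hom_subset[OF F]])
    show "F \<noteq> {}" using loc_hom_nonempty[OF F] by blast
    show "Idn L X \<noteq> {}" using Idn_member[OF X] by blast
    fix s f t g U V W w h assume a: "(s, f) \<in> Idn L X" "(t, g) \<in> F" "s \<in> Hom C U X" "f \<in> Hom C U X"
      "t \<in> Hom C V X" "g \<in> Hom C V Y" "s \<in> S" "t \<in> S" "w \<in> Hom C W U" "w \<in> S" "h \<in> Hom C W V" "f \<cdot> w = t \<cdot> h"
    obtain W2 U2 u where u: "s \<in> Hom C U2 X" "u \<in> Hom C W2 U2" "u \<in> S" "s \<cdot> u = f \<cdot> u"
      using Idn_memberD[OF a(1)] by metis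
    have "U2 = U" using hom_disjoint u(1) a(3) by blast
    with u have u': "u \<in> Hom C W2 U" by simp
    obtain W3 e e' where e: "e \<in> Hom C W3 W" "e \<in> S" "e' \<in> Hom C W3 W2" "w \<cdot> e = u \<cdot> e'"
      using ore[OF a(9) u' u(3)] by blast
    have we: "w \<cdot> e \<in> Hom C W3 U" "w \<cdot> e \<in> S" using cmp_hom[OF e(1) a(9)] S_cmp[OF e(1) a(9) e(2) a(10)] by auto
    have sw: "s \<cdot> w \<in> Hom C W X" "s \<cdot> w \<in> S" using cmp_hom[OF a(9,3)] S_cmp[OF a(9,3,10,7)] by auto
    have swe: "(s \<cdot> w) \<cdot> e = s \<cdot> (w \<cdot> e)" "s \<cdot> (w \<cdot> e) \<in> S"
      using cmp_assoc[OF e(1) a(9,3)] S_cmp[OF we(1) a(3) we(2) a(7)] by auto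
    have "s \<cdot> (w \<cdot> e) = f \<cdot> (w \<cdot> e)"
      unfolding e(4) using cmp_assoc[OF e(3) u' a(3)] cmp_assoc[OF e(3) u' a(4)] u(4) by simp
    also have "\<dots> = (t \<cdot> h) \<cdot> e" unfolding a(12)[symmetric] using cmp_assoc[OF e(1) a(9,4)] by simp
    also have "\<dots> = t \<cdot> (h \<cdot> e)" using cmp_assoc[OF e(1) a(11,5)] .
    finally have th: "s \<cdot> (w \<cdot> e) = t \<cdot> (h \<cdot> e)" .
    have he: "h \<cdot> e \<in> Hom C W3 V" using cmp_hom[OF e(1) a(11)] .
    have "equivalent_roofs X Y (t, g) (t \<cdot> (h \<cdot> e), g \<cdot> (h \<cdot> e))"
      using equivalent_roofs_restrict[OF a(5,8,6) he] th swe(2) by simp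
    moreover have "equivalent_roofs X Y (s \<cdot> w, g \<cdot> h) (t \<cdot> (h \<cdot> e), g \<cdot> (h \<cdot> e))"
      using equivalent_roofs_restrict[OF sw cmp_hom[OF a(11,6)] e(1)] swe th cmp_assoc[OF e(1) a(11,6)] by simp
    moreover have "equivalent_roofs X Y r (t, g)" using a(2) r(2) by (simp add: equivalent_roofs_def)
    ultimately show "equivalent_roofs X Y r (s \<cdot> w, g \<cdot> h)"
      using equivalent_roofs_trans equivalent_roofs_sym by blast
  qed
  then show ?thesis using r(2) by simp
qed

lemma loc_idn_iso: "X \<in> Ob C \<Longrightarrow> is_isomorphism L X X (Idn L X)"
  unfolding is_isomorphism_def using Idn_loc_hom loc_cmp_idn by blast

text \<open>All arrows of \<open>C\<close> out of \<open>N\<close> are unique, so two roofs agree after restriction along the arrows from \<open>N\<close> to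
  their vertices.\<close>

lemma roofs_from_zero:
  assumes N: "zero_object C N" and r: "r \<in> roofs C S N Y" "r' \<in> roofs C S N Y"
  shows "equivalent_roofs N Y r r'"
proof -
  obtain s f t g where e: "r = (s, f)" "r' = (t, g)" by (metis surj_pair)
  obtain Z where Z: "s \<in> Hom C Z N" "s \<in> S" "f \<in> Hom C Z Y" using r(1) unfolding e by (rule roofsE)
  obtain Z' where Z': "t \<in> Hom C Z' N" "t \<in> S" "g \<in> Hom C Z' Y" using r(2) unfolding e by (rule roofsE)
  have ob: "Z \<in> Ob C" "Z' \<in> Ob C" "N \<in> Ob C" "Y \<in> Ob C" using Z Z' hom_ob by blast+
  obtain u where u: "u \<in> Hom C N Z" using N ob unfolding zero_object_def by blast
  obtain w where w: "w \<in> Hom C N Z'" using N ob unfolding zero_object_def by blast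
  have un: "a = b" if "a \<in> Hom C N V" "b \<in> Hom C N V" for a b V
    using N hom_ob[OF that(1)] that unfolding zero_object_def by blast
  have "s \<cdot> u = Idn C N" using un cmp_hom[OF u Z(1)] idn_hom[OF ob(3)] by blast
  moreover have "s \<cdot> u = t \<cdot> w" using un cmp_hom[OF u Z(1)] cmp_hom[OF w Z'(1)] by blast
  moreover have "f \<cdot> u = g \<cdot> w" using un cmp_hom[OF u Z(3)] cmp_hom[OF w Z'(3)] by blast
  ultimately show ?thesis unfolding e using S_idn[OF ob(3)]
    by (intro equivalent_roofsI[OF u w Z(1) Z'(1) Z(3) Z'(3) Z(2) Z'(2)]) simp_all
qed

lemma roofs_to_zero:
  assumes N: "zero_object C N" and r: "r \<in> roofs C S X N" "r' \<in> roofs C S X N"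
  shows "equivalent_roofs X N r r'"
proof -
  obtain s f t g where e: "r = (s, f)" "r' = (t, g)" by (metis surj_pair)
  obtain Z where Z: "s \<in> Hom C Z X" "s \<in> S" "f \<in> Hom C Z N" using r(1) unfolding e by (rule roofsE)
  obtain Z' where Z': "t \<in> Hom C Z' X" "t \<in> S" "g \<in> Hom C Z' N" using r(2) unfolding e by (rule roofsE)
  obtain W w h where w: "w \<in> Hom C W Z" "w \<in> S" "h \<in> Hom C W Z'" "s \<cdot> w = t \<cdot> h"
    using ore[OF Z(1) Z'(1,2)] by blast
  have un: "a = b" if "a \<in> Hom C V N" "b \<in> Hom C V N" for a b V
    using N hom_ob[OF that(1)] that unfolding zero_object_def by blast
  have "f \<cdot> w = g \<cdot> h" using un cmp_hom[OF w(1) Z(3)] cmp_hom[OF w(3) Z'(3)] by blast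
  then show ?thesis unfolding e
    using S_cmp[OF w(1) Z(1) w(2) Z(2)] w(4)
    by (intro equivalent_roofsI[OF w(1,3) Z(1) Z'(1) Z(3) Z'(3) Z(2) Z'(2)]) simp_all
qed

lemma loc_zero_object:
  assumes N: "zero_object C N" shows "zero_object L N"
  unfolding zero_object_def
proof (intro conjI ballI)
  have NO: "N \<in> Ob C" using N unfolding zero_object_def by blast
  then show "N \<in> Ob L" by simp
  fix X assume X: "X \<in> Ob L"
  obtain a where a: "a \<in> Hom C X N" using N X unfolding zero_object_def by auto
  obtain b where b: "b \<in> Hom C N X" using N X unfolding zero_object_def by auto
  have "roof_class C S X N (Idn C X, a) \<in> Hom L X N"
    using X a idn_hom S_idn by (intro loc_homI roofsI[OF idn_hom]) auto
  moreover have "F = F'" if "F \<in> Hom L X N" "F' \<in> Hom L X N" for F F'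
    using loc_homE[OF that(1)] loc_homE[OF that(2)] roof_class_eq[OF roofs_to_zero[OF N]] by metis
  ultimately show "\<exists>!f. f \<in> Hom L X N" by blast
  have "roof_class C S N X (Idn C N, b) \<in> Hom L N X"
    using NO b idn_hom S_idn by (intro loc_homI roofsI[OF idn_hom]) auto
  moreover have "F = F'" if "F \<in> Hom L N X" "F' \<in> Hom L N X" for F F'
    using loc_homE[OF that(1)] loc_homE[OF that(2)] roof_class_eq[OF roofs_from_zero[OF N]] by metis
  ultimately show "\<exists>!f. f \<in> Hom L N X" by blast
qed

end

text \<open>The additive laws needed to recognise a biproduct of the form \<open>X \<oplus> 0\<close>.\<close>

locale right_ore_zero = right_ore C S for C :: "('o, 'a) cat" (structure) and S +
  assumes nul_hom: "X \<in> Ob C \<Longrightarrow> Y \<in> Ob C \<Longrightarrow> Nul C X Y \<in> Hom C X Y"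
    and nul_cmp_right: "f \<in> Hom C X Y \<Longrightarrow> Z \<in> Ob C \<Longrightarrow> Nul C Y Z \<cdot> f = Nul C X Z"
    and add_hom: "f \<in> Hom C X Y \<Longrightarrow> g \<in> Hom C X Y \<Longrightarrow> f \<boxplus> g \<in> Hom C X Y"
    and add_cmp_right: "f \<in> Hom C X Y \<Longrightarrow> g \<in> Hom C X Y \<Longrightarrow> u \<in> Hom C W X \<Longrightarrow> (f \<boxplus> g) \<cdot> u = f \<cdot> u \<boxplus> g \<cdot> u"
    and add_nul_right: "f \<in> Hom C X Y \<Longrightarrow> f \<boxplus> Nul C X Y = f"
begin

lemma Nul_roofs: "X \<in> Ob C \<Longrightarrow> Y \<in> Ob C \<Longrightarrow> (Idn C X, Nul C X Y) \<in> roofs C S X Y"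
  using roofsI[of _ X X] idn_hom S_idn nul_hom by blast

lemma Nul_memberD:
  assumes "(s, f) \<in> Nul L X Y"
  obtains W U u where "s \<in> Hom C U X" "f \<in> Hom C U Y" "s \<in> S" "u \<in> Hom C W U" "u \<in> S" "f \<cdot> u = Nul C W Y"
proof -
  have "equivalent_roofs X Y (Idn C X, Nul C X Y) (s, f)" using assms by (simp add: equivalent_roofs_def)
  then obtain W Z Z' u w where *: "u \<in> Hom C W Z" "w \<in> Hom C W Z'" "Idn C X \<in> Hom C Z X" "s \<in> Hom C Z' X"
    "Nul C X Y \<in> Hom C Z Y" "f \<in> Hom C Z' Y" "Idn C X \<in> S" "s \<in> S" "Idn C X \<cdot> u = s \<cdot> w" "Idn C X \<cdot> u \<in> S"
    "Nul C X Y \<cdot> u = f \<cdot> w" "u \<in> S" "w \<in> S" by (rule equivalent_roofsE)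
  have ob: "X \<in> Ob C" "Y \<in> Ob C" using hom_ob[OF *(3)] hom_ob[OF *(6)] by blast+
  have "Z = X" using hom_disjoint[OF *(5) nul_hom[OF ob]] by blast
  then have "f \<cdot> w = Nul C W Y" using *(11) nul_cmp_right[of u W X Y] *(1) ob by simp
  then show ?thesis using that[OF *(4,6,8,2,13)] by blast
qed

text \<open>Sums are unions over all common denominators. A roof \<open>(s, g)\<close> that represents zero has \<open>g u = 0\<close> for
  some \<open>u\<close> in \<open>S\<close>, and after restriction along \<open>u\<close> the summand \<open>g\<close> disappears.\<close>

lemma loc_add_nul:
  assumes F: "F \<in> Hom L X Y" and G: "G = Nul L X Y"
  shows "F \<boxplus>\<^bsub>L\<^esub> G = F"
proof -
  have ob: "X \<in> Ob C" "Y \<in> Ob C" using loc_hom_Ob[OF F] by auto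
  have *: "equivalent_roofs X Y (s, f) (s, f \<boxplus> g)"
    if a: "(s, f) \<in> F" "(s, g) \<in> G" "s \<in> Hom C U X" "f \<in> Hom C U Y" "g \<in> Hom C U Y" "s \<in> S" for s f g U
  proof -
    obtain W U' u where u: "s \<in> Hom C U' X" "u \<in> Hom C W U'" "u \<in> S" "g \<cdot> u = Nul C W Y"
      using a(2) Nul_memberD unfolding G by metis
    have "U' = U" using hom_disjoint u(1) a(3) by blast
    with u have u': "u \<in> Hom C W U" by simp
    have su: "s \<cdot> u \<in> S" by (rule S_cmp[OF u' a(3) u(3) a(6)])
    have "(f \<boxplus> g) \<cdot> u = f \<cdot> u"
      using add_cmp_right[OF a(4,5) u'] u(4) add_nul_right[OF cmp_hom[OF u' a(4)]] by simp
    then have "equivalent_roofs X Y (s, f \<boxplus> g) (s \<cdot> u, f \<cdot> u)"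
      using equivalent_roofs_restrict[OF a(3,6) add_hom[OF a(4,5)] u' su] by simp
    then show ?thesis using equivalent_roofs_restrict[OF a(3,6,4) u' su] equivalent_roofs_trans equivalent_roofs_sym by blast
  qed
  show ?thesis
  proof
    show "F \<boxplus>\<^bsub>L\<^esub> G \<subseteq> F"
    proof
      fix r assume "r \<in> F \<boxplus>\<^bsub>L\<^esub> G"
      then obtain X' Y' U s f g where a: "(s, f) \<in> F" "(s, g) \<in> G" "s \<in> Hom C U X'" "f \<in> Hom C U Y'" "g \<in> Hom C U Y'"
        and r: "r \<in> roof_class C S X' Y' (s, f \<boxplus> g)" unfolding localization_def cat.simps by blast
      have "(s, f) \<in> roofs C S X Y" using a(1) hom_subset[OF F] by blast
      then have e: "X' = X" "Y' = Y" "s \<in> S" using a(3,4) hom_disjoint unfolding roofs_def by blast+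
      have "F = roof_class C S X Y (s, f)" using loc_hom_class[OF F a(1)] by blast
      also have "\<dots> = roof_class C S X Y (s, f \<boxplus> g)"
        using roof_class_eq[OF *] a e by blast
      finally show "r \<in> F" using r e by simp
    qed
    obtain s f U where sf: "(s, f) \<in> F" "s \<in> Hom C U X" "s \<in> S" "f \<in> Hom C U Y" using loc_hom_nonempty[OF F] .
    have U: "U \<in> Ob C" using hom_ob sf by blast
    note n = nul_hom[OF U ob(2)]
    have "equivalent_roofs X Y (Idn C X, Nul C X Y) (s, Nul C U Y)"
      using equivalent_roofs_restrict[OF idn_hom[OF ob(1)] S_idn[OF ob(1)] nul_hom[OF ob] sf(2)]
        idn_cmp[OF sf(2)] nul_cmp_right[OF sf(2) ob(2)] sf(3) by simp
    then have g: "(s, Nul C U Y) \<in> G" unfolding G by (simp add: equivalent_roofs_def)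
    have "roof_class C S X Y (s, f \<boxplus> Nul C U Y) \<subseteq> F \<boxplus>\<^bsub>L\<^esub> G"
      unfolding localization_def cat.simps using sf g n by blast
    then show "F \<subseteq> F \<boxplus>\<^bsub>L\<^esub> G"
      using add_nul_right[OF sf(4)] loc_hom_class[OF F sf(1)] by simp
  qed
qed

text \<open>The object \<open>X\<close> is its own biproduct with a zero object \<open>N\<close>. In the composites through \<open>N\<close> every
  representative is equivalent to the zero roof.\<close>

lemma loc_biproduct_zero:
  assumes N: "zero_object C N" and X: "X \<in> Ob C"
  shows "is_biproduct L X N X (Idn L X) (Nul L N X) (Idn L X) (Nul L X N)"
proof -
  have NO: "N \<in> Ob C" using N unfolding zero_object_def by blast
  have h: "Nul L N X \<in> Hom L N X" "Nul L X N \<in> Hom L X N" "Idn L X \<in> Hom L X X" "Idn L N \<in> Hom L N N"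
    unfolding loc_simps using Nul_roofs X NO Idn_roofs by simp_all
  have "Nul L X N \<cdot>\<^bsub>L\<^esub> Nul L N X = Idn L N"
    unfolding loc_simps(3)
  proof (rule loc_cmp_eqI[OF _ hom_subset[OF h(1)] _ hom_subset[OF h(2)]])
    fix s f t g U V W w h assume "s \<in> Hom C U N" "f \<in> Hom C U X"
      "t \<in> Hom C V X" "g \<in> Hom C V N" "s \<in> S" "t \<in> S" "w \<in> Hom C W U" "w \<in> S" "h \<in> Hom C W V"
    then have "(s \<cdot> w, g \<cdot> h) \<in> roofs C S N N" by (intro roofsI[of _ W]) (auto intro: cmp_hom S_cmp)
    then show "equivalent_roofs N N (Idn C N, Idn C N) (s \<cdot> w, g \<cdot> h)"
      using roofs_from_zero[OF N] Idn_roofs[OF NO] by blast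
  qed (use loc_hom_nonempty h in blast)+
  moreover have "Nul L N X \<cdot>\<^bsub>L\<^esub> Nul L X N = Nul L X X"
    unfolding loc_simps(4)[of X X]
  proof (rule loc_cmp_eqI[OF _ hom_subset[OF h(2)] _ hom_subset[OF h(1)]])
    fix s f t g U V W w h assume a: "(t, g) \<in> Nul L N X" "s \<in> Hom C U X" "f \<in> Hom C U N"
      "t \<in> Hom C V N" "g \<in> Hom C V X" "s \<in> S" "t \<in> S" "w \<in> Hom C W U" "w \<in> S" "h \<in> Hom C W V"
    obtain W2 V2 u where u: "t \<in> Hom C V2 N" "u \<in> Hom C W2 V2" "u \<in> S" "g \<cdot> u = Nul C W2 X"
      using Nul_memberD[OF a(1)] by metis
    have "V2 = V" using hom_disjoint u(1) a(4) by blast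
    with u have u': "u \<in> Hom C W2 V" by simp
    obtain W3 e e' where e: "e \<in> Hom C W3 W" "e \<in> S" "e' \<in> Hom C W3 W2" "h \<cdot> e = u \<cdot> e'"
      using ore[OF a(10) u' u(3)] by blast
    have sw: "s \<cdot> w \<in> Hom C W X" "s \<cdot> w \<in> S" using cmp_hom[OF a(8,2)] S_cmp[OF a(8,2,9,6)] by auto
    have swe: "(s \<cdot> w) \<cdot> e \<in> Hom C W3 X" "(s \<cdot> w) \<cdot> e \<in> S" using cmp_hom[OF e(1) sw(1)] S_cmp[OF e(1) sw(1) e(2) sw(2)] by auto
    have "(g \<cdot> h) \<cdot> e = (g \<cdot> u) \<cdot> e'"
      using cmp_assoc[OF e(1) a(10,5)] cmp_assoc[OF e(3) u' a(5)] e(4) by simp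
    also have "\<dots> = Nul C W3 X" unfolding u(4) using nul_cmp_right[OF e(3) X] .
    finally have "equivalent_roofs X X (s \<cdot> w, g \<cdot> h) ((s \<cdot> w) \<cdot> e, Nul C W3 X)"
      using equivalent_roofs_restrict[OF sw cmp_hom[OF a(10,5)] e(1) swe(2)] by simp
    moreover have "equivalent_roofs X X (Idn C X, Nul C X X) ((s \<cdot> w) \<cdot> e, Nul C W3 X)"
      using equivalent_roofs_restrict[OF idn_hom[OF X] S_idn[OF X] nul_hom[OF X X] swe(1)]
        idn_cmp[OF swe(1)] nul_cmp_right[OF swe(1) X] swe(2) by simp
    ultimately show "equivalent_roofs X X (Idn C X, Nul C X X) (s \<cdot> w, g \<cdot> h)"
      using equivalent_roofs_trans equivalent_roofs_sym by blast
  qed (use loc_hom_nonempty h in blast)+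
  moreover have "Idn L X \<cdot>\<^bsub>L\<^esub> Idn L X = Idn L X" using loc_cmp_idn h by blast
  moreover have "Idn L X \<cdot>\<^bsub>L\<^esub> Nul L N X = Nul L N X" using loc_idn_cmp[OF h(1), of "Idn L X"] Idn_member[OF X] by blast
  moreover have "Nul L X N \<cdot>\<^bsub>L\<^esub> Idn L X = Nul L X N" using loc_cmp_idn h by blast
  moreover have "Idn L X \<boxplus>\<^bsub>L\<^esub> Nul L X X = Idn L X" using loc_add_nul h by blast
  ultimately show ?thesis unfolding is_biproduct_def using h by simp
qed

end

section \<open>Homology on the derived category\<close>


context abcat begin

lemma H_idn:
  assumes X: "bounded_complex A X"
  shows "H_surj X X (\<lambda>i. Idn A (Cob X i)) i" "H_inj X X (\<lambda>i. Idn A (Cob X i)) i"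
proof -
  show "H_surj X X (\<lambda>i. Idn A (Cob X i)) i"
  proof (rule H_surjI)
    fix z assume z: "cycle X i z"
    note z' = cycleD[OF z]
    have "is_epi A (src z) (src z) (Idn A (src z))" using z' by (intro epi_idn) simp
    moreover have "homologous X i (Idn A (Cob X i) \<cdot> z) (z \<cdot> Idn A (src z))"
      using z' X by (simp add: homologous_refl)
    ultimately show "\<exists>T e x. is_epi A T (src z) e \<and> cycle X i x \<and> src x = T \<and> homologous X i (Idn A (Cob X i) \<cdot> x) (z \<cdot> e)"
      using z by blast
  qed
  show "H_inj X X (\<lambda>i. Idn A (Cob X i)) i"
    unfolding H_inj_def using cycleD by (metis idn_cmp_arr)
qed

lemma quasi_isosD:
  assumes "\<phi> \<in> Hom (Kb A) X Y" "\<phi> \<in> quasi_isos A" shows "K_surj i \<phi>" "K_inj i \<phi>"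
  using assms quasi_isos_iff by blast+

end

text \<open>Two-out-of-three comes from the laws of \<open>K_surj\<close> and \<open>K_inj\<close>, and the squares come from
  \<open>quasi_iso_ore\<close>.\<close>

sublocale abcat \<subseteq> K: right_ore_zero "Kb A" "quasi_isos A"
proof -
  interpret KC: category "Kb A" by (rule Kb_category)
  show "right_ore_zero (Kb A) (quasi_isos A)"
  proof
    fix s t X Y Z assume st: "s \<in> Hom (Kb A) X Y" "t \<in> Hom (Kb A) Y Z"
    show "t \<cdot>\<^bsub>Kb A\<^esub> s \<in> quasi_isos A" if "s \<in> quasi_isos A" "t \<in> quasi_isos A"
      using that st K_surj_comp[OF st] K_inj_comp[OF st] quasi_isos_iff KC.cmp_hom[OF st] by blast
    show "s \<in> quasi_isos A" if "t \<in> quasi_isos A" "t \<cdot>\<^bsub>Kb A\<^esub> s \<in> quasi_isos A"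
      using that st K_surj_cancel[OF st] K_inj_of_comp[OF st] quasi_isos_iff KC.cmp_hom[OF st] by blast
  next
    fix X assume X: "X \<in> Ob (Kb A)"
    then have "bounded_complex A X" by simp
    then have "quasi_iso A X X (\<lambda>i. Idn A (Cob X i))" unfolding quasi_iso_iff using H_idn chain_map_idn by blast
    then show "Idn (Kb A) X \<in> quasi_isos A" unfolding Kb_Idn quasi_isos_def by blast
  next
    fix \<phi> \<tau> U V Y assume p: "\<phi> \<in> Hom (Kb A) U Y" and t: "\<tau> \<in> Hom (Kb A) V Y" "\<tau> \<in> quasi_isos A"
    obtain f where f: "chain_map A U Y f" "\<phi> = htp_class A U Y f" using p by (rule Kb_HomE)
    obtain g where g: "chain_map A V Y g" "\<tau> = htp_class A V Y g" using t(1) by (rule Kb_HomE)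
    have "quasi_iso A V Y g"
      unfolding quasi_iso_iff using g quasi_isosD[OF t] K_surj_class K_inj_class by blast
    then obtain W w h where w: "quasi_iso A W U w" and h: "chain_map A W V h"
      and e: "homotopic A W Y (\<lambda>i. f i \<cdot>\<^bsub>A\<^esub> w i) (\<lambda>i. g i \<cdot>\<^bsub>A\<^esub> h i)"
      using quasi_iso_ore[OF f(1)] by metis
    have w': "chain_map A W U w" using w unfolding quasi_iso_iff by blast
    have "\<phi> \<cdot>\<^bsub>Kb A\<^esub> htp_class A W U w = \<tau> \<cdot>\<^bsub>Kb A\<^esub> htp_class A W V h"
      unfolding f(2) g(2) Kb_cmp[OF w' f(1)] Kb_cmp[OF h g(1)] by (rule htp_class_eq[OF e])
    moreover have "htp_class A W U w \<in> quasi_isos A" using w unfolding quasi_isos_def by blast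
    ultimately show "\<exists>W w h. w \<in> Hom (Kb A) W U \<and> w \<in> quasi_isos A \<and> h \<in> Hom (Kb A) W V \<and>
        \<phi> \<cdot>\<^bsub>Kb A\<^esub> w = \<tau> \<cdot>\<^bsub>Kb A\<^esub> h"
      using Kb_HomI[OF w'] Kb_HomI[OF h] by blast
  next
    fix X Y assume "X \<in> Ob (Kb A)" "Y \<in> Ob (Kb A)"
    then show "Nul (Kb A) X Y \<in> Hom (Kb A) X Y" unfolding Kb_Nul by (intro Kb_HomI chain_map_nul) simp_all
  next
    fix \<phi> X Y assume p: "\<phi> \<in> Hom (Kb A) X Y"
    obtain f where f: "chain_map A X Y f" "\<phi> = htp_class A X Y f" using p by (rule Kb_HomE)
    note f' [simp] = chain_mapD(1-5)[OF f(1)]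
    note n = chain_map_nul[OF f'(1,2)]
    have e: "homotopic A X Y (\<lambda>i. f i \<boxplus>\<^bsub>A\<^esub> Nul A (Cob X i) (Cob Y i)) f" using homotopic_refl[OF f(1)] by simp
    show "\<phi> \<boxplus>\<^bsub>Kb A\<^esub> Nul (Kb A) X Y = \<phi>"
      unfolding f(2) Kb_Nul Kb_add[OF f(1) n] by (rule htp_class_eq[OF e])
    show "Nul (Kb A) Y Z \<cdot>\<^bsub>Kb A\<^esub> \<phi> = Nul (Kb A) X Z" if "Z \<in> Ob (Kb A)" for Z
    proof -
      have Z: "bounded_complex A Z" using that by simp
      have "homotopic A X Z (\<lambda>i. Nul A (Cob Y i) (Cob Z i) \<cdot>\<^bsub>A\<^esub> f i) (\<lambda>i. Nul A (Cob X i) (Cob Z i))"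
        using homotopic_refl[OF chain_map_nul[OF f'(1) Z]] Z by simp
      then show ?thesis unfolding f(2) Kb_Nul Kb_cmp[OF f(1) chain_map_nul[OF f'(2) Z]] by (rule htp_class_eq)
    qed
    fix \<psi> assume q: "\<psi> \<in> Hom (Kb A) X Y"
    obtain g where g: "chain_map A X Y g" "\<psi> = htp_class A X Y g" using q by (rule Kb_HomE)
    note [simp] = chain_mapD(1-5)[OF g(1)]
    show "\<phi> \<boxplus>\<^bsub>Kb A\<^esub> \<psi> \<in> Hom (Kb A) X Y"
      unfolding f(2) g(2) Kb_add[OF f(1) g(1)] by (intro Kb_HomI chain_map_add[OF f(1) g(1)])
    fix \<upsilon> W assume u: "\<upsilon> \<in> Hom (Kb A) W X"
    obtain u where u: "chain_map A W X u" "\<upsilon> = htp_class A W X u" using u by (rule Kb_HomE)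
    note [simp] = chain_mapD(1-5)[OF u(1)]
    have "homotopic A W Y (\<lambda>i. (f i \<boxplus>\<^bsub>A\<^esub> g i) \<cdot>\<^bsub>A\<^esub> u i) (\<lambda>i. f i \<cdot>\<^bsub>A\<^esub> u i \<boxplus>\<^bsub>A\<^esub> g i \<cdot>\<^bsub>A\<^esub> u i)"
      using homotopic_refl[OF chain_map_add[OF chain_map_comp[OF u(1) f(1)] chain_map_comp[OF u(1) g(1)]]] by simp
    then show "(\<phi> \<boxplus>\<^bsub>Kb A\<^esub> \<psi>) \<cdot>\<^bsub>Kb A\<^esub> \<upsilon> = \<phi> \<cdot>\<^bsub>Kb A\<^esub> \<upsilon> \<boxplus>\<^bsub>Kb A\<^esub> \<psi> \<cdot>\<^bsub>Kb A\<^esub> \<upsilon>"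
      unfolding f(2) g(2) u(2) Kb_add[OF f(1) g(1)] Kb_cmp[OF u(1) f(1)] Kb_cmp[OF u(1) g(1)]
        Kb_cmp[OF u(1) chain_map_add[OF f(1) g(1)]] Kb_add[OF chain_map_comp[OF u(1) f(1)] chain_map_comp[OF u(1) g(1)]]
      by (rule htp_class_eq)
  qed
qed

context abcat begin

abbreviation "qis \<equiv> quasi_isos A"
abbreviation "KRoofs \<equiv> roofs (Kb A) (quasi_isos A)"

lemma Db_simps [simp]:
  "Ob (Db A) = Ob K.L" "Hom (Db A) = Hom K.L" "Idn (Db A) = Idn K.L" "Cmp (Db A) = Cmp K.L"
  "Add (Db A) = Add K.L" "Nul (Db A) = Nul K.L"
  "Shift (Db A) = shift_cplx A" "Dist (Db A) = db_triangles A"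
  unfolding Db_def by (simp_all add: cat.extend_def tcat.fields_def)

text \<open>Denominators are isomorphisms on homology, so a fraction is tested on its numerator. The predicates
  are defined for arbitrary sets of roofs, because composites and powers are unions of classes.\<close>

definition D_surj :: "int \<Rightarrow> ('o, 'a) db_arr \<Rightarrow> bool" where
  "D_surj i F \<longleftrightarrow> (\<exists>r\<in>F. K_surj i (snd r))"

definition D_inj :: "int \<Rightarrow> ('o, 'a) db_arr \<Rightarrow> bool" where
  "D_inj i F \<longleftrightarrow> (\<exists>r\<in>F. K_inj i (snd r))"

lemma equivalent_roofs_K:
  assumes "K.equivalent_roofs X Y r r'"
  shows "K_surj i (snd r) \<longleftrightarrow> K_surj i (snd r')" "K_inj i (snd r) \<longleftrightarrow> K_inj i (snd r')"
proof -
  obtain s f t g where r: "r = (s, f)" "r' = (t, g)" by (metis surj_pair)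
  obtain W Z Z' u w where *: "u \<in> Hom (Kb A) W Z" "w \<in> Hom (Kb A) W Z'" "f \<in> Hom (Kb A) Z Y" "g \<in> Hom (Kb A) Z' Y"
    "f \<cdot>\<^bsub>Kb A\<^esub> u = g \<cdot>\<^bsub>Kb A\<^esub> w" "u \<in> qis" "w \<in> qis"
    using assms unfolding r by (rule K.equivalent_roofsE)
  have "K_surj i f \<longleftrightarrow> K_surj i (f \<cdot>\<^bsub>Kb A\<^esub> u)"
    using K_surj_comp[OF *(1,3)] K_surj_of_comp[OF *(1,3)] quasi_isosD[OF *(1,6)] by blast
  moreover have "K_surj i g \<longleftrightarrow> K_surj i (g \<cdot>\<^bsub>Kb A\<^esub> w)"
    using K_surj_comp[OF *(2,4)] K_surj_of_comp[OF *(2,4)] quasi_isosD[OF *(2,7)] by blast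
  ultimately show "K_surj i (snd r) \<longleftrightarrow> K_surj i (snd r')" unfolding r using *(5) by simp
  have "K_inj i f \<longleftrightarrow> K_inj i (f \<cdot>\<^bsub>Kb A\<^esub> u)"
    using K_inj_comp[OF *(1,3)] K_inj_cancel[OF *(1,3)] quasi_isosD[OF *(1,6)] by blast
  moreover have "K_inj i g \<longleftrightarrow> K_inj i (g \<cdot>\<^bsub>Kb A\<^esub> w)"
    using K_inj_comp[OF *(2,4)] K_inj_cancel[OF *(2,4)] quasi_isosD[OF *(2,7)] by blast
  ultimately show "K_inj i (snd r) \<longleftrightarrow> K_inj i (snd r')" unfolding r using *(5) by simp
qed

lemma D_class:
  assumes "r \<in> KRoofs X Y"
  shows "D_surj i (roof_class (Kb A) qis X Y r) \<longleftrightarrow> K_surj i (snd r)"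
    and "D_inj i (roof_class (Kb A) qis X Y r) \<longleftrightarrow> K_inj i (snd r)"
  using K.equivalent_roofs_refl[OF assms] equivalent_roofs_K
  unfolding D_surj_def D_inj_def K.equivalent_roofs_def by blast+

lemma D_hom:
  assumes F: "F \<in> Hom K.L X Y" and r: "r \<in> F"
  shows "D_surj i F \<longleftrightarrow> K_surj i (snd r)" "D_inj i F \<longleftrightarrow> K_inj i (snd r)"
  using D_class[OF K.loc_hom_class(1)[OF F r]] K.loc_hom_class(2)[OF F r] by simp_all

text \<open>In an Ore square both vertical arrows are quasi-isomorphisms, so \<open>h\<close> and \<open>f\<close> agree on homology.\<close>

lemma square_K:
  assumes f: "f \<in> Hom (Kb A) U Y" and t: "t \<in> Hom (Kb A) V Y" "t \<in> qis"
    and w: "w \<in> Hom (Kb A) W U" "w \<in> qis" and h: "h \<in> Hom (Kb A) W V" and e: "f \<cdot>\<^bsub>Kb A\<^esub> w = t \<cdot>\<^bsub>Kb A\<^esub> h"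
  shows square_surj: "K_surj i h \<longleftrightarrow> K_surj i f" and square_inj: "K_inj i h \<longleftrightarrow> K_inj i f"
proof -
  note T = quasi_isosD[OF t] and W = quasi_isosD[OF w]
  have "K_surj i h \<longleftrightarrow> K_surj i (t \<cdot>\<^bsub>Kb A\<^esub> h)"
    using K_surj_comp[OF h t(1)] K_surj_cancel[OF h t(1)] T by blast
  also have "\<dots> \<longleftrightarrow> K_surj i f" unfolding e[symmetric]
    using K_surj_comp[OF w(1) f] K_surj_of_comp[OF w(1) f] W by blast
  finally show "K_surj i h \<longleftrightarrow> K_surj i f" .
  have "K_inj i h \<longleftrightarrow> K_inj i (t \<cdot>\<^bsub>Kb A\<^esub> h)"
    using K_inj_comp[OF h t(1)] K_inj_of_comp[OF h t(1)] T by blast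
  also have "\<dots> \<longleftrightarrow> K_inj i f" unfolding e[symmetric]
    using K_inj_comp[OF w(1) f] K_inj_cancel[OF w(1) f] W by blast
  finally show "K_inj i h \<longleftrightarrow> K_inj i f" .
qed

context
  fixes X Y Z :: "('o, 'a) cplx" and F G :: "('o, 'a) db_arr"
  assumes F: "F \<subseteq> KRoofs X Y" and G: "G \<subseteq> KRoofs Y Z"
begin

text \<open>On homology a member \<open>r\<close> of a composite is the product of a numerator \<open>g\<close> of \<open>G\<close> with an arrow \<open>h\<close> that
  behaves as a numerator \<open>f\<close> of \<open>F\<close>. This lemma and its converse \<open>D_cmp_ex\<close> transfer the laws of
  surjective and injective maps from \<open>K_surj\<close> and \<open>K_inj\<close>.\<close>

lemma D_cmp_memberE:
  assumes "r \<in> G \<cdot>\<^bsub>K.L\<^esub> F"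
  obtains s f t g h V W where "r \<in> KRoofs X Z" "(s, f) \<in> F" "(t, g) \<in> G"
    "h \<in> Hom (Kb A) W V" "g \<in> Hom (Kb A) V Z"
    "\<And>i. K_surj i h \<longleftrightarrow> K_surj i f" "\<And>i. K_inj i h \<longleftrightarrow> K_inj i f"
    "\<And>i. K_surj i (g \<cdot>\<^bsub>Kb A\<^esub> h) \<longleftrightarrow> K_surj i (snd r)" "\<And>i. K_inj i (g \<cdot>\<^bsub>Kb A\<^esub> h) \<longleftrightarrow> K_inj i (snd r)"
proof -
  obtain X' Y' Z' U V W w s f t g h where a: "(s, f) \<in> F" "(t, g) \<in> G" "s \<in> Hom (Kb A) U X'" "f \<in> Hom (Kb A) U Y'"
    "t \<in> Hom (Kb A) V Y'" "g \<in> Hom (Kb A) V Z'" "w \<in> Hom (Kb A) W U" "w \<in> qis" "h \<in> Hom (Kb A) W V"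
    "f \<cdot>\<^bsub>Kb A\<^esub> w = t \<cdot>\<^bsub>Kb A\<^esub> h" "K.equivalent_roofs X' Z' (s \<cdot>\<^bsub>Kb A\<^esub> w, g \<cdot>\<^bsub>Kb A\<^esub> h) r"
    using assms by (rule K.loc_cmpE)
  have "(s, f) \<in> KRoofs X Y" "(t, g) \<in> KRoofs Y Z" using a(1,2) F G by auto
  then have e: "X' = X" "Y' = Y" "Z' = Z" and t: "t \<in> qis"
    using a(3-6) K.hom_disjoint unfolding roofs_def by blast+
  note eq = a(11)[unfolded e]
  show ?thesis
    by (rule that[OF K.equivalent_roofs_roofs(2)[OF eq] a(1,2,9) a(6)[unfolded e]
          square_surj[OF a(4,5) t a(7-10)] square_inj[OF a(4,5) t a(7-10)]])
      (use equivalent_roofs_K[OF eq] in simp_all)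
qed

lemma D_cmp_ex:
  assumes "(s, f) \<in> F" "(t, g) \<in> G"
  obtains r h V W where "r \<in> G \<cdot>\<^bsub>K.L\<^esub> F" "snd r = g \<cdot>\<^bsub>Kb A\<^esub> h" "h \<in> Hom (Kb A) W V" "g \<in> Hom (Kb A) V Z"
    "\<And>i. K_surj i h \<longleftrightarrow> K_surj i f" "\<And>i. K_inj i h \<longleftrightarrow> K_inj i f"
proof -
  obtain U where U: "s \<in> Hom (Kb A) U X" "s \<in> qis" "f \<in> Hom (Kb A) U Y" using assms(1) F by (meson K.roofsE subsetD)
  obtain V where V: "t \<in> Hom (Kb A) V Y" "t \<in> qis" "g \<in> Hom (Kb A) V Z" using assms(2) G by (meson K.roofsE subsetD)
  obtain W w h where w: "w \<in> Hom (Kb A) W U" "w \<in> qis" "h \<in> Hom (Kb A) W V" "f \<cdot>\<^bsub>Kb A\<^esub> w = t \<cdot>\<^bsub>Kb A\<^esub> h"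
    "(s \<cdot>\<^bsub>Kb A\<^esub> w, g \<cdot>\<^bsub>Kb A\<^esub> h) \<in> G \<cdot>\<^bsub>K.L\<^esub> F"
    using K.loc_cmp_ex[OF assms U(1,3) V(1,3) U(2) V(2)] by metis
  show ?thesis
    by (rule that[OF w(5) _ w(3) V(3) square_surj[OF U(3) V(1,2) w(1-4)] square_inj[OF U(3) V(1,2) w(1-4)]]) simp
qed

lemma D_cmp_subset: "G \<cdot>\<^bsub>K.L\<^esub> F \<subseteq> KRoofs X Z"
proof
  fix r assume "r \<in> G \<cdot>\<^bsub>K.L\<^esub> F"
  then show "r \<in> KRoofs X Z" by (rule D_cmp_memberE)
qed

lemma D_surj_cmp: "D_surj i F \<Longrightarrow> D_surj i G \<Longrightarrow> D_surj i (G \<cdot>\<^bsub>K.L\<^esub> F)"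
  unfolding D_surj_def by (elim bexE) (metis D_cmp_ex K_surj_comp prod.collapse)

lemma D_inj_cmp: "D_inj i F \<Longrightarrow> D_inj i G \<Longrightarrow> D_inj i (G \<cdot>\<^bsub>K.L\<^esub> F)"
  unfolding D_inj_def by (elim bexE) (metis D_cmp_ex K_inj_comp prod.collapse)

lemma D_surj_of_cmp: assumes "D_surj i (G \<cdot>\<^bsub>K.L\<^esub> F)" shows "D_surj i G"
proof -
  obtain r where r: "r \<in> G \<cdot>\<^bsub>K.L\<^esub> F" "K_surj i (snd r)" using assms unfolding D_surj_def by blast
  show ?thesis using r(1)
  proof (rule D_cmp_memberE)
    fix t g h V W assume a: "(t, g) \<in> G" "h \<in> Hom (Kb A) W V" "g \<in> Hom (Kb A) V Z"
      "\<And>i. K_surj i (g \<cdot>\<^bsub>Kb A\<^esub> h) \<longleftrightarrow> K_surj i (snd r)"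
    then have "K_surj i g" using K_surj_of_comp[OF a(2,3)] r(2) by blast
    then show ?thesis using a(1) unfolding D_surj_def by force
  qed
qed

lemma D_inj_of_cmp: assumes "D_inj i (G \<cdot>\<^bsub>K.L\<^esub> F)" shows "D_inj i F"
proof -
  obtain r where r: "r \<in> G \<cdot>\<^bsub>K.L\<^esub> F" "K_inj i (snd r)" using assms unfolding D_inj_def by blast
  show ?thesis using r(1)
  proof (rule D_cmp_memberE)
    fix s f g h V W assume a: "(s, f) \<in> F" "h \<in> Hom (Kb A) W V" "g \<in> Hom (Kb A) V Z"
      "\<And>i. K_inj i h \<longleftrightarrow> K_inj i f" "\<And>i. K_inj i (g \<cdot>\<^bsub>Kb A\<^esub> h) \<longleftrightarrow> K_inj i (snd r)"
    then have "K_inj i f" using K_inj_of_comp[OF a(2,3)] r(2) by blast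
    then show ?thesis using a(1) unfolding D_inj_def by force
  qed
qed

lemma D_surj_cancel:
  assumes "D_surj i (G \<cdot>\<^bsub>K.L\<^esub> F)" "G \<in> Hom K.L Y Z" "D_inj i G" shows "D_surj i F"
proof -
  obtain r where r: "r \<in> G \<cdot>\<^bsub>K.L\<^esub> F" "K_surj i (snd r)" using assms(1) unfolding D_surj_def by blast
  show ?thesis using r(1)
  proof (rule D_cmp_memberE)
    fix s f t g h V W assume a: "(s, f) \<in> F" "(t, g) \<in> G" "h \<in> Hom (Kb A) W V" "g \<in> Hom (Kb A) V Z"
      "\<And>i. K_surj i h \<longleftrightarrow> K_surj i f" "\<And>i. K_surj i (g \<cdot>\<^bsub>Kb A\<^esub> h) \<longleftrightarrow> K_surj i (snd r)"
    have "K_inj i g" using D_hom(2)[OF assms(2) a(2)] assms(3) by simp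
    then have "K_surj i f" using K_surj_cancel[OF a(3,4)] r(2) a(5,6) by blast
    then show ?thesis using a(1) unfolding D_surj_def by force
  qed
qed

lemma D_inj_cancel:
  assumes "D_inj i (G \<cdot>\<^bsub>K.L\<^esub> F)" "F \<in> Hom K.L X Y" "D_surj i F" shows "D_inj i G"
proof -
  obtain r where r: "r \<in> G \<cdot>\<^bsub>K.L\<^esub> F" "K_inj i (snd r)" using assms(1) unfolding D_inj_def by blast
  show ?thesis using r(1)
  proof (rule D_cmp_memberE)
    fix s f t g h V W assume a: "(s, f) \<in> F" "(t, g) \<in> G" "h \<in> Hom (Kb A) W V" "g \<in> Hom (Kb A) V Z"
      "\<And>i. K_surj i h \<longleftrightarrow> K_surj i f" "\<And>i. K_inj i (g \<cdot>\<^bsub>Kb A\<^esub> h) \<longleftrightarrow> K_inj i (snd r)"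
    have "K_surj i h" using D_hom(1)[OF assms(2) a(1)] assms(3) a(5) by simp
    then have "K_inj i g" using K_inj_cancel[OF a(3,4)] r(2) a(6) by blast
    then show ?thesis using a(2) unfolding D_inj_def by force
  qed
qed

end

lemma D_idn: assumes "bounded_complex A X" shows "D_surj i (Idn K.L X)" "D_inj i (Idn K.L X)"
proof -
  have X: "X \<in> Ob (Kb A)" using assms by simp
  note q = quasi_isosD[OF K.idn_hom[OF X] K.S_idn[OF X]]
  show "D_surj i (Idn K.L X)" "D_inj i (Idn K.L X)"
    using K.Idn_member[OF X] q unfolding D_surj_def D_inj_def by force+
qed

lemma loc_hom_bounded: "F \<in> Hom K.L X Y \<Longrightarrow> bounded_complex A X \<and> bounded_complex A Y"
  using K.loc_hom_Ob[of F X Y] by simp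

lemma D_iso:
  assumes "is_isomorphism K.L X Y F" shows "D_surj i F" "D_inj i F"
proof -
  obtain G where F: "F \<in> Hom K.L X Y" and G: "G \<in> Hom K.L Y X" and e: "G \<cdot>\<^bsub>K.L\<^esub> F = Idn K.L X" "F \<cdot>\<^bsub>K.L\<^esub> G = Idn K.L Y"
    using assms unfolding is_isomorphism_def by blast
  note b = loc_hom_bounded[OF F]
  show "D_inj i F" using D_inj_of_cmp[OF K.hom_subset[OF F] K.hom_subset[OF G]] D_idn b unfolding e by blast
  show "D_surj i F" using D_surj_of_cmp[OF K.hom_subset[OF G] K.hom_subset[OF F]] D_idn b unfolding e by blast
qed

lemma D_zero:
  assumes F: "F \<in> Hom K.L X Y"
  shows D_surj_zero: "D_surj i F \<Longrightarrow> H_zero X i \<Longrightarrow> H_zero Y i"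
    and D_inj_zero: "D_inj i F \<Longrightarrow> H_zero Y i \<Longrightarrow> H_zero X i"
    and D_zero_surj: "H_zero Y i \<Longrightarrow> D_surj i F"
    and D_zero_inj: "H_zero X i \<Longrightarrow> D_inj i F"
proof -
  obtain s f Z where m: "(s, f) \<in> F" and s: "s \<in> Hom (Kb A) Z X" "s \<in> qis" and f: "f \<in> Hom (Kb A) Z Y"
    using K.loc_hom_nonempty[OF F] .
  note q = quasi_isosD[OF s] and d = D_hom[OF F m, simplified]
  have z: "H_zero X i \<longleftrightarrow> H_zero Z i" using K_surj_zero[OF s(1)] K_inj_zero[OF s(1)] q by blast
  show "D_surj i F \<Longrightarrow> H_zero X i \<Longrightarrow> H_zero Y i" unfolding d z by (rule K_surj_zero[OF f])
  show "D_inj i F \<Longrightarrow> H_zero Y i \<Longrightarrow> H_zero X i" unfolding d z by (rule K_inj_zero[OF f])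
  show "H_zero Y i \<Longrightarrow> D_surj i F" unfolding d by (rule K_zero_surj[OF f])
  show "H_zero X i \<Longrightarrow> D_inj i F" unfolding d z by (rule K_zero_inj[OF f])
qed

lemma D_nul:
  assumes "bounded_complex A X" "bounded_complex A Y"
  shows D_surj_nul: "D_surj i (Nul K.L X Y) \<Longrightarrow> H_zero Y i"
    and D_inj_nul: "D_inj i (Nul K.L X Y) \<Longrightarrow> H_zero X i"
proof -
  have "(Idn (Kb A) X, Nul (Kb A) X Y) \<in> KRoofs X Y" using assms by (intro K.Nul_roofs) simp_all
  from D_class[OF this] show "D_surj i (Nul K.L X Y) \<Longrightarrow> H_zero Y i" "D_inj i (Nul K.L X Y) \<Longrightarrow> H_zero X i"
    using K_surj_nul[OF assms] K_inj_nul[OF assms] by simp_all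
qed

text \<open>The zero arrow is a power of \<open>v\<close>, so it is surjective (injective) together with \<open>v\<close>.\<close>

lemma nilpotent_zero:
  assumes v: "nilpotent_endo (Db A) Z v"
  shows nilpotent_surj_zero: "D_surj i v \<Longrightarrow> H_zero Z i" and nilpotent_inj_zero: "D_inj i v \<Longrightarrow> H_zero Z i"
proof -
  obtain n where vh: "v \<in> Hom K.L Z Z" and n: "((\<lambda>g. v \<cdot>\<^bsub>K.L\<^esub> g) ^^ n) (Idn K.L Z) = Nul K.L Z Z"
    using v unfolding nilpotent_endo_def Db_simps by blast
  have b: "bounded_complex A Z" using loc_hom_bounded[OF vh] by blast
  have s: "((\<lambda>g. v \<cdot>\<^bsub>K.L\<^esub> g) ^^ n) (Idn K.L Z) \<subseteq> KRoofs Z Z" for n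
    by (induction n) (use K.Idn_subset D_cmp_subset[OF _ K.hom_subset[OF vh]] in simp_all)
  have "D_surj i (((\<lambda>g. v \<cdot>\<^bsub>K.L\<^esub> g) ^^ n) (Idn K.L Z))" if "D_surj i v" for n
    by (induction n) (use D_idn[OF b] D_surj_cmp[OF s K.hom_subset[OF vh]] that in \<open>simp_all del: K.loc_simps\<close>)
  then show "D_surj i v \<Longrightarrow> H_zero Z i" using D_surj_nul[OF b b] n by metis
  have "D_inj i (((\<lambda>g. v \<cdot>\<^bsub>K.L\<^esub> g) ^^ n) (Idn K.L Z))" if "D_inj i v" for n
    by (induction n) (use D_idn[OF b] D_inj_cmp[OF s K.hom_subset[OF vh]] that in \<open>simp_all del: K.loc_simps\<close>)
  then show "D_inj i v \<Longrightarrow> H_zero Z i" using D_inj_nul[OF b b] n by metis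
qed

lemma db_map_roof: "chain_map A X Y f \<Longrightarrow> (Idn (Kb A) X, htp_class A X Y f) \<in> KRoofs X Y"
  using K.roofsI[OF K.idn_hom K.S_idn Kb_HomI] chain_mapD(1) by simp

lemma db_map_hom: "chain_map A X Y f \<Longrightarrow> db_map A X Y f \<in> Hom K.L X Y"
  unfolding db_map_def loc_map_def by (intro K.loc_homI db_map_roof)

lemma D_db_map:
  assumes f: "chain_map A X Y f"
  shows "D_surj i (db_map A X Y f) \<longleftrightarrow> H_surj X Y f i" "D_inj i (db_map A X Y f) \<longleftrightarrow> H_inj X Y f i"
  unfolding db_map_def loc_map_def D_class[OF db_map_roof[OF f]] using K_surj_class[OF f] K_inj_class[OF f] by simp_all

text \<open>A distinguished triangle is isomorphic to that of a cone, and the predicates do not change under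
  isomorphisms; so \<open>cone_zero\<close> applies.\<close>

lemma triangle_zero:
  assumes T: "distinguished (Db A) X Y Z a b c"
  shows triangle_surj: "H_zero Z i \<Longrightarrow> D_surj i a"
    and triangle_inj: "H_zero Z (i - 1) \<Longrightarrow> D_inj i a"
    and triangle_zeroI: "D_surj i a \<Longrightarrow> D_inj (i + 1) a \<Longrightarrow> H_zero Z i"
proof -
  obtain X' Y' Z' P Q C f \<iota> \<pi> x y z where a': "a \<in> Hom K.L X' Y'" and b': "b \<in> Hom K.L Y' Z'"
    and C: "is_cone A P Q f C \<iota> \<pi>" and xyz: "is_isomorphism K.L X' P x" "is_isomorphism K.L Y' Q y" "is_isomorphism K.L Z' C z"
    and e: "y \<cdot>\<^bsub>K.L\<^esub> a = db_map A P Q f \<cdot>\<^bsub>K.L\<^esub> x"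
    using T unfolding distinguished_def Db_simps db_triangles_def Let_def by blast
  have a: "a \<in> Hom K.L X Y" and b: "b \<in> Hom K.L Y Z" using T unfolding distinguished_def Db_simps by blast+
  have loc_disj: "U = U' \<and> V = V'" if F: "F \<in> Hom K.L U V" "F \<in> Hom K.L U' V'" for F U V U' V'
  proof -
    obtain s k W where m: "(s, k) \<in> F" "s \<in> Hom (Kb A) W U" "k \<in> Hom (Kb A) W V" using K.loc_hom_nonempty[OF F(1)] by metis
    then show ?thesis using K.loc_hom_class(1)[OF F(2) m(1)] K.hom_disjoint by (metis K.roofsE)
  qed
  have XYZ: "X' = X" "Y' = Y" "Z' = Z" using loc_disj a a' b b' by blast+
  have x: "x \<in> Hom K.L X P" and y: "y \<in> Hom K.L Y Q" and z: "z \<in> Hom K.L Z C"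
    using xyz unfolding XYZ is_isomorphism_def by blast+
  have f: "chain_map A P Q f" using C unfolding is_cone_def by blast
  note fh = db_map_hom[OF f]
  note s = K.hom_subset[OF a] K.hom_subset[OF x] K.hom_subset[OF y] K.hom_subset[OF fh]
  note i = D_iso[OF xyz(1)] D_iso[OF xyz(2)] D_iso[OF xyz(3)]
  have surj: "D_surj i a \<longleftrightarrow> H_surj P Q f i" for i
  proof
    assume "D_surj i a"
    then have "D_surj i (y \<cdot>\<^bsub>K.L\<^esub> a)" using D_surj_cmp[OF s(1,3)] i by blast
    then show "H_surj P Q f i" unfolding e using D_surj_of_cmp[OF s(2,4)] D_db_map[OF f] by blast
  next
    assume "H_surj P Q f i"
    then have "D_surj i (y \<cdot>\<^bsub>K.L\<^esub> a)" unfolding e using D_surj_cmp[OF s(2,4)] i D_db_map[OF f] by blast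
    then show "D_surj i a" using D_surj_cancel[OF s(1,3) _ y] i by blast
  qed
  have inj: "D_inj i a \<longleftrightarrow> H_inj P Q f i" for i
  proof
    assume "D_inj i a"
    then have "D_inj i (y \<cdot>\<^bsub>K.L\<^esub> a)" using D_inj_cmp[OF s(1,3)] i by blast
    then show "H_inj P Q f i" unfolding e using D_inj_cancel[OF s(2,4) _ x] i D_db_map[OF f] by blast
  next
    assume "H_inj P Q f i"
    then have "D_inj i (y \<cdot>\<^bsub>K.L\<^esub> a)" unfolding e using D_inj_cmp[OF s(2,4)] i D_db_map[OF f] by blast
    then show "D_inj i a" using D_inj_of_cmp[OF s(1,3)] by blast
  qed
  have zero: "H_zero Z i \<longleftrightarrow> H_zero C i" for i
    using D_surj_zero[OF z] D_inj_zero[OF z] i by blast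
  show "H_zero Z i \<Longrightarrow> D_surj i a" unfolding zero surj by (rule cone_zero_surj[OF C])
  show "H_zero Z (i - 1) \<Longrightarrow> D_inj i a" unfolding zero inj by (rule cone_zero_inj[OF C])
  show "D_surj i a \<Longrightarrow> D_inj (i + 1) a \<Longrightarrow> H_zero Z i" unfolding zero surj inj by (rule cone_zeroI[OF C])
qed

lemma heart_iff: "X \<in> heart A \<longleftrightarrow> bounded_complex A X \<and> (\<forall>i. i \<noteq> 0 \<longrightarrow> H_zero X i)"
  unfolding heart_def using homology_zero_iff by auto

lemma le_Delta_nilE:
  assumes "le_Delta_nil (Db A) M N"
  obtains Z W i1 i2 p1 p2 a b c where
    "i1 \<in> Hom K.L Z W" "i2 \<in> Hom K.L M W" "p1 \<in> Hom K.L W Z" "p2 \<in> Hom K.L W M" "a \<in> Hom K.L Z W"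
    "p1 \<cdot>\<^bsub>K.L\<^esub> i1 = Idn K.L Z" "p2 \<cdot>\<^bsub>K.L\<^esub> i2 = Idn K.L M" "i1 \<cdot>\<^bsub>K.L\<^esub> p1 \<boxplus>\<^bsub>K.L\<^esub> i2 \<cdot>\<^bsub>K.L\<^esub> p2 = Idn K.L W"
    "distinguished (Db A) Z W N a b c" "nilpotent_endo (Db A) Z (p1 \<cdot>\<^bsub>K.L\<^esub> a)"
  using assms unfolding le_Delta_nil_def is_biproduct_def distinguished_def Db_simps by blast

text \<open>Both \<open>a\<close> and the split epimorphism \<open>p1\<close> are surjective in degree \<open>i\<close>, hence so is the nilpotent arrow
  \<open>p1 a\<close>, and therefore \<open>H\<^sup>i(Z) = 0\<close>.\<close>

lemma le_Delta_nil_middle_zero: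
  assumes N: "H_zero N i" and T: "distinguished (Db A) Z W N a b c"
    and h: "i1 \<in> Hom K.L Z W" "p1 \<in> Hom K.L W Z" "a \<in> Hom K.L Z W" "p1 \<cdot>\<^bsub>K.L\<^esub> i1 = Idn K.L Z"
    and v: "nilpotent_endo (Db A) Z (p1 \<cdot>\<^bsub>K.L\<^esub> a)"
  shows "H_zero Z i" "H_zero W i"
proof -
  have b: "bounded_complex A Z" using loc_hom_bounded[OF h(1)] by blast
  have "D_surj i p1" using D_surj_of_cmp[OF K.hom_subset[OF h(1)] K.hom_subset[OF h(2)]] D_idn[OF b] unfolding h(4) by blast
  moreover have a: "D_surj i a" using triangle_surj[OF T N] .
  ultimately have "D_surj i (p1 \<cdot>\<^bsub>K.L\<^esub> a)" using D_surj_cmp[OF K.hom_subset[OF h(3)] K.hom_subset[OF h(2)]] by blast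
  then show Z: "H_zero Z i" using nilpotent_surj_zero[OF v] by blast
  show "H_zero W i" using D_surj_zero[OF h(3) a Z] .
qed

text \<open>The object \<open>M\<close> is a direct summand of \<open>W\<close>, which has no homology in nonzero degrees.\<close>

theorem heart_closed_le_Delta_nil:
  assumes le: "le_Delta_nil (Db A) M N" and N: "N \<in> heart A" shows "M \<in> heart A"
proof -
  obtain Z W i1 i2 p1 p2 a b c where h: "i1 \<in> Hom K.L Z W" "i2 \<in> Hom K.L M W" "p1 \<in> Hom K.L W Z" "p2 \<in> Hom K.L W M" "a \<in> Hom K.L Z W"
    "p1 \<cdot>\<^bsub>K.L\<^esub> i1 = Idn K.L Z" "p2 \<cdot>\<^bsub>K.L\<^esub> i2 = Idn K.L M" "i1 \<cdot>\<^bsub>K.L\<^esub> p1 \<boxplus>\<^bsub>K.L\<^esub> i2 \<cdot>\<^bsub>K.L\<^esub> p2 = Idn K.L W"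
    and T: "distinguished (Db A) Z W N a b c" and v: "nilpotent_endo (Db A) Z (p1 \<cdot>\<^bsub>K.L\<^esub> a)"
    using le by (rule le_Delta_nilE)
  have M: "bounded_complex A M" using loc_hom_bounded[OF h(2)] by blast
  have "H_zero M i" if "i \<noteq> 0" for i
  proof -
    have "H_zero N i" using N that unfolding heart_iff by blast
    then have "H_zero W i" using le_Delta_nil_middle_zero(2)[OF _ T h(1,3,5,6) v] by blast
    moreover have "D_surj i p2"
      using D_surj_of_cmp[OF K.hom_subset[OF h(2)] K.hom_subset[OF h(4)]] D_idn[OF M] unfolding h(7) by blast
    ultimately show ?thesis using D_surj_zero[OF h(4)] by blast
  qed
  then show ?thesis unfolding heart_iff using M by blast
qed

text \<open>As \<open>M\<close> has no homology in degree \<open>i\<close>, the summand \<open>i2 p2\<close> is zero on \<open>H\<^sup>i\<close>, so \<open>i1 p1\<close> is the identity there.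
  To see this on representatives, the two composites are brought to a common denominator, and their sum is
  then a member of the identity of \<open>W\<close>.\<close>

lemma D_inj_of_sum:
  assumes h: "i1 \<in> Hom K.L Z W" "i2 \<in> Hom K.L M W" "p1 \<in> Hom K.L W Z" "p2 \<in> Hom K.L W M"
    and sum: "i1 \<cdot>\<^bsub>K.L\<^esub> p1 \<boxplus>\<^bsub>K.L\<^esub> i2 \<cdot>\<^bsub>K.L\<^esub> p2 = Idn K.L W" and M: "H_zero M i"
  shows "D_inj i p1"
proof -
  have W: "bounded_complex A W" using loc_hom_bounded[OF h(1)] by blast
  have WO: "W \<in> Ob (Kb A)" using W by simp
  obtain s1 f1 U1 where p1: "(s1, f1) \<in> p1" "s1 \<in> Hom (Kb A) U1 W" "s1 \<in> qis" "f1 \<in> Hom (Kb A) U1 Z" using K.loc_hom_nonempty[OF h(3)] .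
  obtain t1 g1 V1 where i1: "(t1, g1) \<in> i1" "t1 \<in> Hom (Kb A) V1 Z" "t1 \<in> qis" "g1 \<in> Hom (Kb A) V1 W" using K.loc_hom_nonempty[OF h(1)] .
  obtain s2 f2 U2 where p2: "(s2, f2) \<in> p2" "s2 \<in> Hom (Kb A) U2 W" "s2 \<in> qis" "f2 \<in> Hom (Kb A) U2 M" using K.loc_hom_nonempty[OF h(4)] .
  obtain t2 g2 V2 where i2: "(t2, g2) \<in> i2" "t2 \<in> Hom (Kb A) V2 M" "t2 \<in> qis" "g2 \<in> Hom (Kb A) V2 W" using K.loc_hom_nonempty[OF h(2)] .
  obtain W1 w1 h1 where w1: "w1 \<in> Hom (Kb A) W1 U1" "w1 \<in> qis" "h1 \<in> Hom (Kb A) W1 V1" "f1 \<cdot>\<^bsub>Kb A\<^esub> w1 = t1 \<cdot>\<^bsub>Kb A\<^esub> h1"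
    "roof_class (Kb A) qis W W (s1 \<cdot>\<^bsub>Kb A\<^esub> w1, g1 \<cdot>\<^bsub>Kb A\<^esub> h1) \<subseteq> i1 \<cdot>\<^bsub>K.L\<^esub> p1"
    using K.loc_cmp_ex[OF p1(1) i1(1) p1(2,4) i1(2,4) p1(3) i1(3)] by metis
  obtain W2 w2 h2 where w2: "w2 \<in> Hom (Kb A) W2 U2" "w2 \<in> qis" "h2 \<in> Hom (Kb A) W2 V2" "f2 \<cdot>\<^bsub>Kb A\<^esub> w2 = t2 \<cdot>\<^bsub>Kb A\<^esub> h2"
    "roof_class (Kb A) qis W W (s2 \<cdot>\<^bsub>Kb A\<^esub> w2, g2 \<cdot>\<^bsub>Kb A\<^esub> h2) \<subseteq> i2 \<cdot>\<^bsub>K.L\<^esub> p2"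
    using K.loc_cmp_ex[OF p2(1) i2(1) p2(2,4) i2(2,4) p2(3) i2(3)] by metis
  let ?\<sigma>1 = "s1 \<cdot>\<^bsub>Kb A\<^esub> w1" and ?\<sigma>2 = "s2 \<cdot>\<^bsub>Kb A\<^esub> w2" and ?k1 = "g1 \<cdot>\<^bsub>Kb A\<^esub> h1" and ?k2 = "g2 \<cdot>\<^bsub>Kb A\<^esub> h2"
  have s1: "?\<sigma>1 \<in> Hom (Kb A) W1 W" "?\<sigma>1 \<in> qis" using K.cmp_hom[OF w1(1) p1(2)] K.S_cmp[OF w1(1) p1(2) w1(2) p1(3)] by blast+
  have s2: "?\<sigma>2 \<in> Hom (Kb A) W2 W" "?\<sigma>2 \<in> qis" using K.cmp_hom[OF w2(1) p2(2)] K.S_cmp[OF w2(1) p2(2) w2(2) p2(3)] by blast+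
  have k1: "?k1 \<in> Hom (Kb A) W1 W" using K.cmp_hom[OF w1(3) i1(4)] .
  have k2: "?k2 \<in> Hom (Kb A) W2 W" using K.cmp_hom[OF w2(3) i2(4)] .
  \<comment> \<open>The two composites get the common denominator \<open>?\<tau>\<close>.\<close>
  obtain V e1 e2 where e: "e1 \<in> Hom (Kb A) V W1" "e1 \<in> qis" "e2 \<in> Hom (Kb A) V W2" "?\<sigma>1 \<cdot>\<^bsub>Kb A\<^esub> e1 = ?\<sigma>2 \<cdot>\<^bsub>Kb A\<^esub> e2"
    using K.ore[OF s1(1) s2] by blast
  let ?\<tau> = "?\<sigma>1 \<cdot>\<^bsub>Kb A\<^esub> e1"
  have tau: "?\<tau> \<in> Hom (Kb A) V W" "?\<tau> \<in> qis" using K.cmp_hom[OF e(1) s1(1)] K.S_cmp[OF e(1) s1(1) e(2) s1(2)] by blast+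
  have m1: "(?\<tau>, ?k1 \<cdot>\<^bsub>Kb A\<^esub> e1) \<in> i1 \<cdot>\<^bsub>K.L\<^esub> p1"
    using w1(5) K.equivalent_roofs_restrict[OF s1 k1 e(1) tau(2)] unfolding K.equivalent_roofs_def by blast
  have "?\<sigma>2 \<cdot>\<^bsub>Kb A\<^esub> e2 \<in> qis" using tau(2) e(4) by simp
  then have m2: "(?\<tau>, ?k2 \<cdot>\<^bsub>Kb A\<^esub> e2) \<in> i2 \<cdot>\<^bsub>K.L\<^esub> p2"
    using w2(5) K.equivalent_roofs_restrict[OF s2 k2 e(3)] unfolding K.equivalent_roofs_def e(4) by blast
  have ke: "?k1 \<cdot>\<^bsub>Kb A\<^esub> e1 \<in> Hom (Kb A) V W" "?k2 \<cdot>\<^bsub>Kb A\<^esub> e2 \<in> Hom (Kb A) V W" using K.cmp_hom[OF e(1) k1] K.cmp_hom[OF e(3) k2] .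
  note ks = K.add_hom[OF ke]
  have "roof_class (Kb A) qis W W (?\<tau>, ?k1 \<cdot>\<^bsub>Kb A\<^esub> e1 \<boxplus>\<^bsub>Kb A\<^esub> ?k2 \<cdot>\<^bsub>Kb A\<^esub> e2) \<subseteq> i1 \<cdot>\<^bsub>K.L\<^esub> p1 \<boxplus>\<^bsub>K.L\<^esub> i2 \<cdot>\<^bsub>K.L\<^esub> p2"
    by (rule K.loc_addI[OF m1 m2 tau(1) ke])
  then have mem: "(?\<tau>, ?k1 \<cdot>\<^bsub>Kb A\<^esub> e1 \<boxplus>\<^bsub>Kb A\<^esub> ?k2 \<cdot>\<^bsub>Kb A\<^esub> e2) \<in> Idn K.L W"
    unfolding sum using K.equivalent_roofs_refl[OF K.roofsI[OF tau ks]] unfolding K.equivalent_roofs_def by blast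
  have "K_inj i (?k1 \<cdot>\<^bsub>Kb A\<^esub> e1 \<boxplus>\<^bsub>Kb A\<^esub> ?k2 \<cdot>\<^bsub>Kb A\<^esub> e2)"
    using D_hom(2)[OF K.Idn_loc_hom[OF WO] mem] D_idn(2)[OF W] by simp
  then have "K_inj i (?k1 \<cdot>\<^bsub>Kb A\<^esub> e1 \<boxplus>\<^bsub>Kb A\<^esub> g2 \<cdot>\<^bsub>Kb A\<^esub> (h2 \<cdot>\<^bsub>Kb A\<^esub> e2))" using K.cmp_assoc[OF e(3) w2(3) i2(4)] by simp
  moreover have "H_zero V2 i" using K_inj_zero[OF i2(2)] quasi_isosD[OF i2(2,3)] M by blast
  ultimately have "K_inj i (?k1 \<cdot>\<^bsub>Kb A\<^esub> e1)" using K_inj_add[OF ke(1) K.cmp_hom[OF e(3) w2(3)] i2(4)] by blast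
  then have "K_inj i ?k1" using K_inj_cancel[OF e(1) k1] quasi_isosD[OF e(1,2)] by blast
  then have "K_inj i h1" using K_inj_of_comp[OF w1(3) i1(4)] by blast
  then have "K_inj i f1" using square_inj[OF p1(4) i1(2,3) w1(1-4)] by blast
  then show ?thesis using p1(1) unfolding D_inj_def by force
qed

text \<open>In degree \<open>0\<close> the nilpotent arrow \<open>p1 a\<close> is injective, since \<open>p1\<close> is (\<open>M\<close> is acyclic) and \<open>a\<close> is
  (\<open>H\<^sup>-\<^sup>1(N) = 0\<close>). So \<open>H\<^sup>0(Z) = 0\<close>, hence \<open>H\<^sup>0(W) = 0\<close>; and \<open>H\<^sup>1(Z) = 0\<close> by the argument for the heart.
  The object \<open>H\<^sup>0(N)\<close> lies between \<open>H\<^sup>0(W)\<close> and \<open>H\<^sup>1(Z)\<close> in the long exact sequence.\<close>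

theorem le_Delta_nil_zero:
  assumes le: "le_Delta_nil (Db A) M N" and N: "N \<in> heart A" and M: "\<And>i. H_zero M i" shows "H_zero N i"
proof -
  obtain Z W i1 i2 p1 p2 a b c where h: "i1 \<in> Hom K.L Z W" "i2 \<in> Hom K.L M W" "p1 \<in> Hom K.L W Z" "p2 \<in> Hom K.L W M" "a \<in> Hom K.L Z W"
    "p1 \<cdot>\<^bsub>K.L\<^esub> i1 = Idn K.L Z" "p2 \<cdot>\<^bsub>K.L\<^esub> i2 = Idn K.L M" "i1 \<cdot>\<^bsub>K.L\<^esub> p1 \<boxplus>\<^bsub>K.L\<^esub> i2 \<cdot>\<^bsub>K.L\<^esub> p2 = Idn K.L W"
    and T: "distinguished (Db A) Z W N a b c" and v: "nilpotent_endo (Db A) Z (p1 \<cdot>\<^bsub>K.L\<^esub> a)"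
    using le by (rule le_Delta_nilE)
  have N': "H_zero N i" if "i \<noteq> 0" for i using N that unfolding heart_iff by blast
  have p1: "D_inj 0 p1" using D_inj_of_sum[OF h(1-4,8) M] .
  have "D_inj 0 a" using triangle_inj[OF T, of 0] N'[of "-1"] by simp
  then have "D_inj 0 (p1 \<cdot>\<^bsub>K.L\<^esub> a)" using D_inj_cmp[OF K.hom_subset[OF h(5)] K.hom_subset[OF h(3)]] p1 by blast
  then have Z0: "H_zero Z 0" using nilpotent_inj_zero[OF v] by blast
  then have "H_zero W 0" using D_inj_zero[OF h(3) p1] by blast
  then have "D_surj 0 a" using D_zero_surj[OF h(5)] by blast
  moreover have "H_zero Z 1" using le_Delta_nil_middle_zero(1)[OF N'[of 1] T h(1,3,5,6) v] by simp
  then have "D_inj (0 + 1) a" using D_zero_inj[OF h(5), of 1] by simp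
  ultimately have "H_zero N 0" by (rule triangle_zeroI[OF T])
  then show ?thesis using N' by (cases "i = 0") auto
qed

lemma iso_class_zero:
  assumes X: "X \<in> Ob (Db A)" and Y: "Y \<in> iso_class (Db A) X"
  shows "bounded_complex A X" "bounded_complex A Y" "H_zero X i \<longleftrightarrow> H_zero Y i"
proof -
  obtain F where F: "is_isomorphism K.L X Y F" using Y unfolding iso_class_def is_isomorphism_def Db_simps by blast
  then have h: "F \<in> Hom K.L X Y" unfolding is_isomorphism_def by blast
  show "bounded_complex A X" "bounded_complex A Y" using loc_hom_bounded[OF h] by blast+
  show "H_zero X i \<longleftrightarrow> H_zero Y i" using D_surj_zero[OF h] D_inj_zero[OF h] D_iso[OF F] by blast
qed

lemma iso_class_self: assumes "X \<in> Ob (Db A)" shows "X \<in> iso_class (Db A) X"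
proof -
  have "is_isomorphism K.L X X (Idn K.L X)" using K.loc_idn_iso assms by simp
  then have "\<exists>f. is_isomorphism (Db A) X X f" unfolding is_isomorphism_def Db_simps by blast
  then show ?thesis using assms unfolding iso_class_def by blast
qed

text \<open>Along a chain of nilpotent degenerations, membership in the heart is inherited downwards from \<open>X\<close>, and
  then acyclicity is inherited upwards from \<open>N\<close>. Both properties are invariant under isomorphism, so they
  can be read off isomorphism classes.\<close>

theorem not_prec_Delta_nil:
  assumes N: "N \<in> Ob (Db A)" "\<And>i. H_zero N i" and X: "X \<in> heart A" "\<not> H_zero X 0"
  shows "\<not> prec_Delta_nil (Db A) N X"
proof
  let ?T = "Db A"
  let ?R = "{(iso_class ?T X, iso_class ?T Y) | X Y. X \<in> Ob ?T \<and> Y \<in> Ob ?T \<and> le_Delta_nil ?T X Y}"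
  let ?ac = "{X. \<forall>i. H_zero X i}"
  have heart_class: "iso_class ?T X \<subseteq> heart A" if X: "X \<in> Ob ?T" "X \<in> heart A" for X
  proof
    fix Y assume Y: "Y \<in> iso_class ?T X"
    show "Y \<in> heart A" using X(2) iso_class_zero(2,3)[OF X(1) Y] unfolding heart_iff by blast
  qed
  have zero_class: "iso_class ?T X \<subseteq> ?ac" if X: "X \<in> Ob ?T" "X \<in> ?ac" for X
  proof
    fix Y assume Y: "Y \<in> iso_class ?T X"
    show "Y \<in> ?ac" using X(2) iso_class_zero(3)[OF X(1) Y] by blast
  qed
  have single: "c \<subseteq> heart A \<and> (c \<subseteq> ?ac \<longrightarrow> d \<subseteq> ?ac)" if cd: "(c, d) \<in> ?R" "d \<subseteq> heart A" for c d
  proof -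
    obtain U V where UV: "c = iso_class ?T U" "d = iso_class ?T V" "U \<in> Ob ?T" "V \<in> Ob ?T" "le_Delta_nil ?T U V"
      using cd(1) by blast
    have V: "V \<in> heart A" using cd(2) iso_class_self[OF UV(4)] UV(2) by blast
    have U: "U \<in> heart A" by (rule heart_closed_le_Delta_nil[OF UV(5) V])
    have "d \<subseteq> ?ac" if c: "c \<subseteq> ?ac"
    proof -
      have "U \<in> ?ac" using c iso_class_self[OF UV(3)] UV(1) by blast
      then have "V \<in> ?ac" using le_Delta_nil_zero[OF UV(5) V] by blast
      then show ?thesis unfolding UV(2) by (rule zero_class[OF UV(4)])
    qed
    then show ?thesis using heart_class[OF UV(3) U] UV(1) by blast
  qed
  have chain: "c \<subseteq> heart A \<and> (c \<subseteq> ?ac \<longrightarrow> d \<subseteq> ?ac)" if cd: "(c, d) \<in> ?R\<^sup>+" "d \<subseteq> heart A" for c d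
    using cd(1)
  proof (induction rule: converse_trancl_induct)
    case (base y)
    show ?case by (rule single[OF base cd(2)])
  next
    case (step y z)
    then show ?case using single[OF step(1)] by blast
  qed
  assume "prec_Delta_nil ?T N X"
  then have r: "(iso_class ?T N, iso_class ?T X) \<in> ?R\<^sup>+" unfolding prec_Delta_nil_def .
  have XO: "X \<in> Ob ?T" using X unfolding heart_def by blast
  have "iso_class ?T X \<subseteq> ?ac" using chain[OF r heart_class[OF XO X(1)]] zero_class[OF N(1)] N(2) by blast
  then show False using iso_class_self[OF XO] X(2) by blast
qed

end

section \<open>A degeneration that is not a nilpotent one\<close>


context abcat begin

lemma shift_chain_map:
  assumes f: "chain_map A X Y f" shows "chain_map A (shift_cplx A X) (shift_cplx A Y) (\<lambda>i. f (i + 1))"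
proof -
  note [simp] = chain_mapD(1-5)[OF f]
  show ?thesis
  proof (rule chain_mapI)
    fix i show "f (i + 1 + 1) \<cdot> Df (shift_cplx A X) i = Df (shift_cplx A Y) i \<cdot> f (i + 1)"
      using chain_mapD(6)[OF f, of "i + 1"] by simp
  qed (simp_all add: bounded_shift)
qed

lemma unshift_chain_map:
  assumes X: "bounded_complex A X" and Y: "bounded_complex A Y"
    and g: "chain_map A (shift_cplx A X) (shift_cplx A Y) g" shows "chain_map A X Y (\<lambda>i. g (i - 1))"
proof -
  have g1: "arr (g (i - 1))" "src (g (i - 1)) = Cob X i" "tgt (g (i - 1)) = Cob Y i" for i
    using chain_mapD(3-5)[OF g, of "i - 1"] by simp_all
  note [simp] = X Y chain_mapD(3-5)[OF g] g1
  show ?thesis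
  proof (rule chain_mapI)
    fix i
    have "mns (g i \<cdot> Df X i) = mns (Df Y i \<cdot> g (i - 1))"
      using chain_mapD(6)[OF g, of "i - 1"] by simp
    then have "mns (mns (g i \<cdot> Df X i)) = mns (mns (Df Y i \<cdot> g (i - 1)))" by metis
    then show "g (i + 1 - 1) \<cdot> Df X i = Df Y i \<cdot> g (i - 1)" by simp
  qed simp_all
qed

lemma shift_homotopic:
  assumes X: "bounded_complex A X" and Y: "bounded_complex A Y"
  shows "homotopic A (shift_cplx A X) (shift_cplx A Y) (\<lambda>i. f (i + 1)) (\<lambda>i. g (i + 1)) \<longleftrightarrow> homotopic A X Y f g"
proof
  assume h: "homotopic A X Y f g"
  obtain h where f: "chain_map A X Y f" and g: "chain_map A X Y g" and
    h: "\<And>i. arr (h i)" "\<And>i. src (h i) = Cob X i" "\<And>i. tgt (h i) = Cob Y (i - 1)"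
    and eq: "\<And>i. f i = g i \<boxplus> (Df Y (i - 1) \<cdot> h i \<boxplus> h (i + 1) \<cdot> Df X i)"
    using homotopicE[OF h] by metis
  note [simp] = X Y chain_mapD(3-5)[OF g] h
  show "homotopic A (shift_cplx A X) (shift_cplx A Y) (\<lambda>i. f (i + 1)) (\<lambda>i. g (i + 1))"
  proof (rule homotopicI[OF shift_chain_map[OF f] shift_chain_map[OF g], of "\<lambda>i. mns (h (i + 1))"])
    fix i show "f (i + 1) = g (i + 1) \<boxplus> (Df (shift_cplx A Y) (i - 1) \<cdot> mns (h (i + 1)) \<boxplus>
        mns (h (i + 1 + 1)) \<cdot> Df (shift_cplx A X) i)"
      unfolding eq[of "i + 1"] by simp
  qed simp_all
next
  assume h: "homotopic A (shift_cplx A X) (shift_cplx A Y) (\<lambda>i. f (i + 1)) (\<lambda>i. g (i + 1))"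
  obtain h where f0: "chain_map A (shift_cplx A X) (shift_cplx A Y) (\<lambda>i. f (i + 1))"
    and g0: "chain_map A (shift_cplx A X) (shift_cplx A Y) (\<lambda>i. g (i + 1))" and
    h0: "\<And>i. arr (h i)" "\<And>i. src (h i) = Cob (shift_cplx A X) i" "\<And>i. tgt (h i) = Cob (shift_cplx A Y) (i - 1)"
    and eq: "\<And>i. f (i + 1) = g (i + 1) \<boxplus> (Df (shift_cplx A Y) (i - 1) \<cdot> h i \<boxplus> h (i + 1) \<cdot> Df (shift_cplx A X) i)"
    using homotopicE[OF h] by metis
  have f: "chain_map A X Y f" and g: "chain_map A X Y g"
    using unshift_chain_map[OF X Y f0] unshift_chain_map[OF X Y g0] by simp_all
  have h1: "arr (h (i - 1))" "src (h (i - 1)) = Cob X i" "tgt (h (i - 1)) = Cob Y (i - 1)" for i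
    using h0[of "i - 1"] by simp_all
  note [simp] = X Y chain_mapD(3-5)[OF g] h0 h1
  show "homotopic A X Y f g"
  proof (rule homotopicI[OF f g, of "\<lambda>i. mns (h (i - 1))"])
    fix i show "f i = g i \<boxplus> (Df Y (i - 1) \<cdot> mns (h (i - 1)) \<boxplus> mns (h (i + 1 - 1)) \<cdot> Df X i)"
      using eq[of "i - 1"] by simp
  qed simp_all
qed

text \<open>An equality of sets: every chain map homotopic to the shift of \<open>f\<close> is itself a shift.\<close>

lemma shift_htp_class:
  assumes f: "chain_map A X Y f"
  shows "shift_htp A (htp_class A X Y f) = htp_class A (shift_cplx A X) (shift_cplx A Y) (\<lambda>i. f (i + 1))"
proof -
  note b = chain_mapD(1,2)[OF f]
  have "(\<lambda>f i. f (i + 1)) ` {g. homotopic A X Y f g} =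
      {g. homotopic A (shift_cplx A X) (shift_cplx A Y) (\<lambda>i. f (i + 1)) g}"
  proof (intro equalityI subsetI)
    fix g assume "g \<in> (\<lambda>f i. f (i + 1)) ` {g. homotopic A X Y f g}"
    then show "g \<in> {g. homotopic A (shift_cplx A X) (shift_cplx A Y) (\<lambda>i. f (i + 1)) g}"
      using shift_homotopic[OF b] by auto
  next
    fix g assume g: "g \<in> {g. homotopic A (shift_cplx A X) (shift_cplx A Y) (\<lambda>i. f (i + 1)) g}"
    have e: "g = (\<lambda>i. (\<lambda>i. g (i - 1)) (i + 1))" by simp
    have "homotopic A X Y f (\<lambda>i. g (i - 1))"
      using g shift_homotopic[OF b, of f "\<lambda>i. g (i - 1)"] by simp
    then show "g \<in> (\<lambda>f i. f (i + 1)) ` {g. homotopic A X Y f g}" using e by (intro image_eqI[of _ _ "\<lambda>i. g (i - 1)"]) auto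
  qed
  then show ?thesis unfolding shift_htp_def htp_class_def by simp
qed

lemma shift_htp_hom: "\<phi> \<in> Hom (Kb A) X Y \<Longrightarrow> shift_htp A \<phi> \<in> Hom (Kb A) (shift_cplx A X) (shift_cplx A Y)"
  by (elim Kb_HomE) (simp add: shift_htp_class Kb_HomI shift_chain_map)

lemma shift_htp_cmp:
  assumes p: "\<phi> \<in> Hom (Kb A) X Y" and q: "\<psi> \<in> Hom (Kb A) Y Z"
  shows "shift_htp A (\<psi> \<cdot>\<^bsub>Kb A\<^esub> \<phi>) = shift_htp A \<psi> \<cdot>\<^bsub>Kb A\<^esub> shift_htp A \<phi>"
proof -
  obtain f where f: "chain_map A X Y f" "\<phi> = htp_class A X Y f" using p by (rule Kb_HomE)
  obtain g where g: "chain_map A Y Z g" "\<psi> = htp_class A Y Z g" using q by (rule Kb_HomE)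
  show ?thesis unfolding f(2) g(2) Kb_cmp[OF f(1) g(1)] shift_htp_class[OF f(1)] shift_htp_class[OF g(1)]
      shift_htp_class[OF chain_map_comp[OF f(1) g(1)]] Kb_cmp[OF shift_chain_map[OF f(1)] shift_chain_map[OF g(1)]] ..
qed

lemma shift_htp_quasi_iso:
  assumes p: "\<phi> \<in> Hom (Kb A) X Y" and q: "\<phi> \<in> qis" shows "shift_htp A \<phi> \<in> qis"
proof -
  obtain f where f: "chain_map A X Y f" "\<phi> = htp_class A X Y f" using p by (rule Kb_HomE)
  note b = chain_mapD(1,2)[OF f(1)]
  note k = quasi_isosD[OF p q]
  have hom: "homologous (shift_cplx A Y) i x y \<longleftrightarrow> homologous Y (i + 1) x y" for i x y
    unfolding homologous_def shift_cplx_bound[OF b(2)] by simp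
  have "H_surj (shift_cplx A X) (shift_cplx A Y) (\<lambda>i. f (i + 1)) i \<and> H_inj (shift_cplx A X) (shift_cplx A Y) (\<lambda>i. f (i + 1)) i" for i
    using k[of "i + 1"] unfolding f(2) K_surj_class[OF f(1)] K_inj_class[OF f(1)] H_surj_def H_inj_def
      shift_cplx_cycle[OF b(1)] shift_cplx_cycle[OF b(2)] shift_cplx_bound[OF b(1)] shift_cplx_bound[OF b(2)] hom by blast
  then show ?thesis unfolding f(2) shift_htp_class[OF f(1)] quasi_isos_def quasi_iso_iff
    using shift_chain_map[OF f(1)] by blast
qed

text \<open>This is what \<open>loc_idn_cmp\<close> asks of a set of representatives of the identity.\<close>

lemma shift_db_idn:
  assumes X: "bounded_complex A X"
  shows "shift_db A (Idn K.L X) \<subseteq> Idn K.L (shift_cplx A X)" "shift_db A (Idn K.L X) \<noteq> {}"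
proof -
  have XO: "X \<in> Ob (Kb A)" "shift_cplx A X \<in> Ob (Kb A)" using X bounded_shift by simp_all
  show "shift_db A (Idn K.L X) \<noteq> {}" unfolding shift_db_def using K.Idn_member[OF XO(1)] by blast
  show "shift_db A (Idn K.L X) \<subseteq> Idn K.L (shift_cplx A X)"
  proof
    fix r assume "r \<in> shift_db A (Idn K.L X)"
    then obtain t g where tg: "(t, g) \<in> Idn K.L X" "r = (shift_htp A t, shift_htp A g)" unfolding shift_db_def by force
    obtain W U u where u: "t \<in> Hom (Kb A) U X" "g \<in> Hom (Kb A) U X" "t \<in> qis" "u \<in> Hom (Kb A) W U" "u \<in> qis"
      "t \<cdot>\<^bsub>Kb A\<^esub> u = g \<cdot>\<^bsub>Kb A\<^esub> u" using K.Idn_memberD[OF tg(1)] .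
    let ?s = "shift_htp A" and ?X = "shift_cplx A X"
    note h = shift_htp_hom[OF u(1)] shift_htp_hom[OF u(2)] shift_htp_hom[OF u(4)]
    note q = shift_htp_quasi_iso[OF u(1,3)] shift_htp_quasi_iso[OF u(4,5)]
    have e: "?s t \<cdot>\<^bsub>Kb A\<^esub> ?s u = ?s g \<cdot>\<^bsub>Kb A\<^esub> ?s u" using shift_htp_cmp[OF u(4,1)] shift_htp_cmp[OF u(4,2)] u(6) by simp
    have tu: "?s t \<cdot>\<^bsub>Kb A\<^esub> ?s u \<in> Hom (Kb A) (shift_cplx A W) ?X" "?s t \<cdot>\<^bsub>Kb A\<^esub> ?s u \<in> qis"
      using K.cmp_hom[OF h(3,1)] K.S_cmp[OF h(3,1) q(2,1)] .
    note i = K.idn_hom[OF XO(2)]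
    have "K.equivalent_roofs ?X ?X (Idn (Kb A) ?X, Idn (Kb A) ?X) (?s t, ?s g)"
      by (rule K.equivalent_roofsI[OF tu(1) h(3) i h(1) i h(2) K.S_idn[OF XO(2)] q(1)])
        (simp_all only: K.idn_cmp[OF tu(1)] tu(2) e[symmetric])
    then show "r \<in> Idn K.L ?X" unfolding tg(2) K.equivalent_roofs_def by simp
  qed
qed

text \<open>The cone triangle is isomorphic to itself by identities, the last of which is shifted.\<close>

lemma cone_triangle:
  assumes C: "is_cone A P Q f C \<iota> \<pi>"
  shows "distinguished (Db A) P Q C (db_map A P Q f) (db_map A Q C \<iota>) (db_map A C (shift_cplx A P) \<pi>)"
proof -
  have f: "chain_map A P Q f" using C unfolding is_cone_def by blast
  note m = cone_maps[OF C] and b = chain_mapD(1,2)[OF f]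
  note h = db_map_hom[OF f] db_map_hom[OF m(2)] db_map_hom[OF m(3)]
  have ob: "P \<in> Ob (Kb A)" "Q \<in> Ob (Kb A)" "C \<in> Ob (Kb A)" using b m(1) by simp_all
  have ne: "Idn K.L Q \<noteq> {}" "Idn K.L C \<noteq> {}" using K.Idn_member ob by blast+
  have e: "Idn K.L Q \<cdot>\<^bsub>K.L\<^esub> db_map A P Q f = db_map A P Q f \<cdot>\<^bsub>K.L\<^esub> Idn K.L P"
    "Idn K.L C \<cdot>\<^bsub>K.L\<^esub> db_map A Q C \<iota> = db_map A Q C \<iota> \<cdot>\<^bsub>K.L\<^esub> Idn K.L Q"
    "shift_db A (Idn K.L P) \<cdot>\<^bsub>K.L\<^esub> db_map A C (shift_cplx A P) \<pi> = db_map A C (shift_cplx A P) \<pi> \<cdot>\<^bsub>K.L\<^esub> Idn K.L C"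
    unfolding K.loc_idn_cmp[OF h(1) subset_refl ne(1)] K.loc_idn_cmp[OF h(2) subset_refl ne(2)]
      K.loc_idn_cmp[OF h(3) shift_db_idn[OF b(1)]] K.loc_cmp_idn[OF h(1)] K.loc_cmp_idn[OF h(2)] K.loc_cmp_idn[OF h(3)]
    by (rule refl)+
  show ?thesis unfolding distinguished_def Db_simps db_triangles_def Let_def
    using h C K.loc_idn_iso[OF ob(1)] K.loc_idn_iso[OF ob(2)] K.loc_idn_iso[OF ob(3)] e by blast
qed

definition stalk :: "'o \<Rightarrow> 'o \<Rightarrow> ('o, 'a) cplx" where
  "stalk Z M = \<lparr>Cob = (\<lambda>i. if i = 0 then M else Z),
     Df = (\<lambda>i. Nul A (if i = 0 then M else Z) (if i + 1 = 0 then M else Z))\<rparr>"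

lemma stalk_simps [simp]:
  "Cob (stalk Z M) i = (if i = 0 then M else Z)"
  "Df (stalk Z M) i = Nul A (Cob (stalk Z M) i) (Cob (stalk Z M) (i + 1))"
  unfolding stalk_def by simp_all

lemma stalk_bounded: assumes Z: "zero_object A Z" and M: "M \<in> Ob A" shows "bounded_complex A (stalk Z M)"
proof -
  have ZO: "Z \<in> Ob A" using Z unfolding zero_object_iff by blast
  have "\<exists>n. \<forall>i. \<bar>i\<bar> > n \<longrightarrow> zero_object A (Cob (stalk Z M) i)" using Z by (intro exI[of _ 0]) simp
  then show ?thesis unfolding bounded_complex_def hom_iff using ZO M by simp
qed

lemma H_zero_of_zero_object:
  assumes X: "bounded_complex A X" and Z: "zero_object A (Cob X i)" shows "H_zero X i"
  unfolding H_zero_def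
proof (intro allI impI)
  fix z assume z: "cycle X i z"
  note z' = cycleD[OF z]
  have "z = Nul A (src z) (Cob X i)" using zero_arr_tgt[OF Z z'(1,2)] .
  moreover have "bound X i (Nul A (src z) (Cob X i))" using bound_nul[OF X] z'(1) by simp
  ultimately show "bound X i z" by metis
qed

lemma bound_zero_object:
  assumes X: "bounded_complex A X" and Z: "zero_object A (Cob X (i - 1))" and b: "bound X i z"
  shows "z = Nul A (src z) (Cob X i)"
proof -
  note z' = boundD[OF b]
  obtain T e y where e: "is_epi A T (src z) e" "arr e" "src e = T" "tgt e = src z"
    and y: "arr y" "src y = T" "tgt y = Cob X (i - 1)" and eq: "Df X (i - 1) \<cdot> y = z \<cdot> e"
    by (rule boundE[OF b])
  have "z \<cdot> e = Df X (i - 1) \<cdot> Nul A T (Cob X (i - 1))"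
    unfolding eq[symmetric] using zero_arr_tgt[OF Z y(1,3)] y(2) by simp
  then have "z \<cdot> e = Nul A T (Cob X i)" using X src_tgt_Ob(1)[OF e(2)] e(3) by simp
  then show ?thesis using z' by - (rule epi_nul[OF e(1)], simp_all)
qed

text \<open>The witness is the cone of \<open>f\<close> on \<open>M\<close> placed in degree \<open>0\<close>. Its homology in degree \<open>0\<close> is nonzero since
  otherwise \<open>f\<close> would be epic. The lower object is zero, so the triangle \<open>M \<rightarrow> M \<rightarrow> X \<rightarrow> M[1]\<close> has the form required
  with \<open>M \<oplus> 0\<close> in the middle.\<close>

theorem ex_le_Delta_not_prec:
  assumes M: "M \<in> Ob A" and mono: "is_mono A M M f" and niso: "\<not> is_isomorphism A M M f"
  shows "\<exists>N X. zero_object (Db A) N \<and> X \<in> Ob (Db A) \<and>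
              le_Delta (Db A) N X \<and> K0_class (Db A) X = \<one>\<^bsub>K0 (Db A)\<^esub> \<and>
              \<not> prec_Delta_nil (Db A) N X"
proof -
  obtain Z where Z: "zero_object A Z" using ex_zero by blast
  have ZO [simp]: "Z \<in> Ob A" and MO [simp]: "M \<in> Ob A" using Z M unfolding zero_object_iff by blast+
  note f [simp] = mono_arr[OF mono]
  define N where "N = stalk Z Z"
  define P where "P = stalk Z M"
  have N: "bounded_complex A N" and P [simp]: "bounded_complex A P" unfolding N_def P_def using stalk_bounded Z M by simp_all
  have Nz: "H_zero N i" for i using N Z by (intro H_zero_of_zero_object) (simp_all add: N_def)
  have Cob_P: "Cob P i = (if i = 0 then M else Z)" for i by (simp add: P_def)
  have Df_P: "Df P i = Nul A (Cob P i) (Cob P (i + 1))" for i by (simp add: P_def)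
  have Pz: "H_zero P i" if "i \<noteq> 0" for i using P Z that by (intro H_zero_of_zero_object) (simp_all add: Cob_P)
  define F where "F = (\<lambda>i::int. if i = 0 then f else Nul A Z Z)"
  have F: "chain_map A P P F"
  proof (rule chain_mapI)
    fix i
    have F': "arr (F i)" "src (F i) = Cob P i" "tgt (F i) = Cob P i" for i by (simp_all add: F_def Cob_P)
    then show "arr (F i)" "src (F i) = Cob P i" "tgt (F i) = Cob P i" by blast+
    show "F (i + 1) \<cdot> Df P i = Df P i \<cdot> F i" using F' complex_arr(4)[OF P] by (simp add: Df_P)
  qed simp_all
  have bound0: "z = Nul A (src z) M" if "bound P 0 z" for z
    using bound_zero_object[OF P _ that] Z by (simp add: Cob_P)
  have inj: "H_inj P P F i" for i
  proof (cases "i = 0")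
    case True
    show ?thesis unfolding True H_inj_def
    proof (intro allI impI, elim conjE)
      fix z assume z: "cycle P 0 z" "bound P 0 (F 0 \<cdot> z)"
      note z' = cycleD(1,2)[OF z(1), unfolded Cob_P, simplified]
      have "f \<cdot> z = Nul A (src z) M" using bound0[OF z(2)] z' by (simp add: F_def)
      then have e: "z = Nul A (src z) M" using z' by - (rule mono_nul[OF mono], simp_all)
      have "bound P 0 (Nul A (src z) (Cob P 0))" using bound_nul[OF P] z'(1) by simp
      then show "bound P 0 z" using e by (simp add: Cob_P)
    qed
  qed (use Pz H_zero_inj in blast)
  obtain X \<iota> \<pi> where X: "is_cone A P P F X \<iota> \<pi>" using ex_cone[OF F] .
  have Xb: "bounded_complex A X" using cone_maps(1)[OF X] .
  have surj: "H_surj P P F i" if "i \<noteq> 0" for i using H_zero_surj[OF F] Pz[OF that] by blast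
  have Xh: "X \<in> heart A" unfolding heart_iff using Xb cone_zeroI[OF X] surj inj by blast
  have X0: "\<not> H_zero X 0"
  proof
    assume "H_zero X 0"
    then have S: "H_surj P P F 0" by (rule cone_zero_surj[OF X])
    have "cycle P 0 (Idn A M)" unfolding cycle_def by (simp add: Df_P Cob_P)
    from H_surjE[OF S this] obtain T e x where e: "is_epi A T M e" "arr e" "src e = T" "tgt e = M" and x: "cycle P 0 x" "src x = T"
      and h: "homologous P 0 (F 0 \<cdot> x) (Idn A M \<cdot> e)" by (metis M idn_arr(2))
    note x' = cycleD(1,2)[OF x(1), unfolded Cob_P, simplified]
    have "f \<cdot> x \<boxplus> mns e = Nul A T M" using bound0[OF homologousD(6)[OF h]] x' x(2) e by (simp add: F_def)
    then have fx: "f \<cdot> x = e" using x' x(2) e by (subst (asm) add_mns_eq_nul) simp_all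
    have "is_epi A M M f"
    proof (rule epiI[OF f])
      fix g assume g: "arr g" "src g = M" "g \<cdot> f = Nul A M (tgt g)"
      have "g \<cdot> e = (g \<cdot> f) \<cdot> x" unfolding fx[symmetric] using g(1,2) x' by simp
      also have "\<dots> = Nul A T (tgt g)" unfolding g(3) using g(1) x' x(2) by simp
      finally show "g = Nul A M (tgt g)" using g(1,2) by - (rule epi_nul[OF e(1)], simp_all)
    qed
    then show False using mono_epi_iso[OF mono] niso by blast
  qed
  note T = cone_triangle[OF X]
  have KN: "zero_object (Kb A) N"
    unfolding zero_object_def
  proof (intro conjI ballI)
    show "N \<in> Ob (Kb A)" using N by simp
    fix Y assume "Y \<in> Ob (Kb A)"
    then have Y: "bounded_complex A Y" by simp
    have NZ: "zero_object A (Cob N i)" for i using Z by (simp add: N_def)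
    have "\<phi> = Nul (Kb A) Y N" if p: "\<phi> \<in> Hom (Kb A) Y N" for \<phi>
    proof -
      obtain g where g: "chain_map A Y N g" "\<phi> = htp_class A Y N g" using p by (rule Kb_HomE)
      have "g = (\<lambda>i. Nul A (Cob Y i) (Cob N i))"
        using zero_arr_tgt[OF NZ chain_mapD(3)[OF g(1)] chain_mapD(5)[OF g(1)]] chain_mapD(4)[OF g(1)] by auto
      then show ?thesis unfolding g(2) Kb_Nul by simp
    qed
    moreover have "Nul (Kb A) Y N \<in> Hom (Kb A) Y N" using K.nul_hom[of Y N] Y N by simp
    ultimately show "\<exists>!f. f \<in> Hom (Kb A) Y N" by blast
    have "\<phi> = Nul (Kb A) N Y" if p: "\<phi> \<in> Hom (Kb A) N Y" for \<phi>
    proof -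
      obtain g where g: "chain_map A N Y g" "\<phi> = htp_class A N Y g" using p by (rule Kb_HomE)
      have "g = (\<lambda>i. Nul A (Cob N i) (Cob Y i))"
        using zero_arr_src[OF NZ chain_mapD(3)[OF g(1)] chain_mapD(4)[OF g(1)]] chain_mapD(5)[OF g(1)] by auto
      then show ?thesis unfolding g(2) Kb_Nul by simp
    qed
    moreover have "Nul (Kb A) N Y \<in> Hom (Kb A) N Y" using K.nul_hom[of N Y] Y N by simp
    ultimately show "\<exists>!f. f \<in> Hom (Kb A) N Y" by blast
  qed
  have zN: "zero_object (Db A) N" using K.loc_zero_object[OF KN] unfolding zero_object_def Db_simps .
  have XO: "X \<in> Ob (Db A)" using Xb by simp
  have "is_biproduct K.L P N P (Idn K.L P) (Nul K.L N P) (Idn K.L P) (Nul K.L P N)"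
    using K.loc_biproduct_zero[OF KN] by simp
  then have "is_biproduct (Db A) P N P (Idn K.L P) (Nul K.L N P) (Idn K.L P) (Nul K.L P N)"
    unfolding is_biproduct_def Db_simps .
  then have le: "le_Delta (Db A) N X" unfolding le_Delta_def using T by blast
  have K0: "K0_class (Db A) X = \<one>\<^bsub>K0 (Db A)\<^esub>"
  proof -
    let ?T = "Db A"
    let ?G = "free_Abelian_group (iso_class ?T ` Ob ?T)"
    interpret G: comm_group ?G by (rule abelian_free_Abelian_group)
    have obs: "U \<in> Ob ?T \<and> V \<in> Ob ?T \<and> W \<in> Ob ?T" if "distinguished ?T U V W a b c" for U V W a b c
      using that loc_hom_bounded unfolding distinguished_def Db_simps by simp blast
    have sub: "K0_relations ?T \<subseteq> carrier ?G"
    proof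
      fix r assume "r \<in> K0_relations ?T"
      then obtain U V W a b c where r: "r = frag_of (iso_class ?T V) - frag_of (iso_class ?T U) - frag_of (iso_class ?T W)"
        and d: "distinguished ?T U V W a b c" unfolding K0_relations_def by blast
      have "Poly_Mapping.keys r \<subseteq> {iso_class ?T V, iso_class ?T U, iso_class ?T W}"
        unfolding r using keys_diff[of "frag_of (iso_class ?T V) - frag_of (iso_class ?T U)" "frag_of (iso_class ?T W)"]
          keys_diff[of "frag_of (iso_class ?T V)" "frag_of (iso_class ?T U)"] by auto
      then show "r \<in> carrier ?G" using obs[OF d] by auto
    qed
    have "frag_of (iso_class ?T P) - frag_of (iso_class ?T P) - frag_of (iso_class ?T X) \<in> K0_relations ?T"
      unfolding K0_relations_def using T by blast
    then have "- frag_of (iso_class ?T X) \<in> K0_relations ?T" by simp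
    then have m: "- frag_of (iso_class ?T X) \<in> K0_subgroup ?T" unfolding K0_subgroup_def by (rule generate.incl)
    have sg: "subgroup (K0_subgroup ?T) ?G" unfolding K0_subgroup_def by (rule G.generate_is_subgroup[OF sub])
    have fx: "frag_of (iso_class ?T X) \<in> carrier ?G" using XO by simp
    have "inv\<^bsub>?G\<^esub> (- frag_of (iso_class ?T X)) \<in> K0_subgroup ?T" using subgroup.m_inv_closed[OF sg m] .
    moreover have "inv\<^bsub>?G\<^esub> (- frag_of (iso_class ?T X)) = frag_of (iso_class ?T X)"
      using XO by simp
    ultimately have "frag_of (iso_class ?T X) \<in> K0_subgroup ?T" by simp
    then have "K0_class ?T X = K0_subgroup ?T" unfolding K0_class_def
      using G.coset_join2[OF fx sg] by blast
    then show ?thesis unfolding K0_def FactGroup_def by simp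
  qed
  have NO: "N \<in> Ob (Db A)" using N by simp
  show ?thesis using zN XO le K0 not_prec_Delta_nil[OF NO Nz Xh X0] by blast
qed

end



section \<open>Modules over a noetherian ring\<close>

text \<open>The module axioms as a locale, to have the library's rules for abelian groups at hand.\<close>

locale lmod = abelian_group M for M :: "('r::ring_1, 'm) module" (structure) +
  assumes smult_closed [simp]: "x \<in> carrier M \<Longrightarrow> r \<odot> x \<in> carrier M"
    and smult_l_distr: "x \<in> carrier M \<Longrightarrow> (r + s) \<odot> x = r \<odot> x \<oplus> s \<odot> x"
    and smult_r_distr: "x \<in> carrier M \<Longrightarrow> y \<in> carrier M \<Longrightarrow> r \<odot> (x \<oplus> y) = r \<odot> x \<oplus> r \<odot> y"
    and smult_assoc: "x \<in> carrier M \<Longrightarrow> (r * s) \<odot> x = r \<odot> (s \<odot> x)"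
    and smult_one [simp]: "x \<in> carrier M \<Longrightarrow> 1 \<odot> x = x"

lemma left_module_iff: "left_module M \<longleftrightarrow> lmod M"
  unfolding left_module_def lmod_def lmod_axioms_def by blast

text \<open>Additive inverses come from the scalar \<open>-1\<close>; the condition \<open>0 \<odot> x = \<zero>\<close> replaces them.\<close>

lemma left_moduleI:
  fixes M :: "('r::ring_1, 'm) module" (structure)
  assumes "\<And>x y. x \<in> carrier M \<Longrightarrow> y \<in> carrier M \<Longrightarrow> x \<oplus> y \<in> carrier M"
    "\<zero> \<in> carrier M"
    "\<And>x y z. x \<in> carrier M \<Longrightarrow> y \<in> carrier M \<Longrightarrow> z \<in> carrier M \<Longrightarrow> (x \<oplus> y) \<oplus> z = x \<oplus> (y \<oplus> z)"
    "\<And>x y. x \<in> carrier M \<Longrightarrow> y \<in> carrier M \<Longrightarrow> x \<oplus> y = y \<oplus> x"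
    "\<And>x. x \<in> carrier M \<Longrightarrow> \<zero> \<oplus> x = x"
    "\<And>x r. x \<in> carrier M \<Longrightarrow> r \<odot> x \<in> carrier M"
    "\<And>x r s. x \<in> carrier M \<Longrightarrow> (r + s) \<odot> x = r \<odot> x \<oplus> s \<odot> x"
    "\<And>x y r. x \<in> carrier M \<Longrightarrow> y \<in> carrier M \<Longrightarrow> r \<odot> (x \<oplus> y) = r \<odot> x \<oplus> r \<odot> y"
    "\<And>x r s. x \<in> carrier M \<Longrightarrow> (r * s) \<odot> x = r \<odot> (s \<odot> x)"
    "\<And>x. x \<in> carrier M \<Longrightarrow> 1 \<odot> x = x"
    "\<And>x. x \<in> carrier M \<Longrightarrow> 0 \<odot> x = \<zero>"
  shows "left_module M"
proof -
  have "\<exists>y\<in>carrier M. y \<oplus> x = \<zero>" if x: "x \<in> carrier M" for x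
  proof
    show "(-1) \<odot> x \<in> carrier M" using assms(6) x .
    have "(-1) \<odot> x \<oplus> x = (-1) \<odot> x \<oplus> 1 \<odot> x" using assms(10) x by simp
    also have "\<dots> = 0 \<odot> x" using assms(7)[OF x, of "-1" 1] by simp
    finally show "(-1) \<odot> x \<oplus> x = \<zero>" using assms(11) x by simp
  qed
  then have "abelian_group M" using assms(1-5) by (intro abelian_groupI) blast+
  then show ?thesis unfolding left_module_def using assms(6-10) by blast
qed

context lmod begin

lemma zero_smult [simp]: "x \<in> carrier M \<Longrightarrow> 0 \<odot> x = \<zero>"
  using smult_l_distr[of x 0 0] add.l_cancel_one'[of "0 \<odot> x" "0 \<odot> x"] by simp

lemma smult_zero [simp]: "r \<odot> \<zero> = \<zero>"
  using smult_r_distr[of \<zero> \<zero> r] add.l_cancel_one'[of "r \<odot> \<zero>" "r \<odot> \<zero>"] by simp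

lemma minus_one_smult: "x \<in> carrier M \<Longrightarrow> (-1) \<odot> x = \<ominus> x"
  using smult_l_distr[of x "-1" 1] by (simp add: add.inv_equality)

lemma smult_minus: "x \<in> carrier M \<Longrightarrow> r \<odot> (\<ominus> x) = \<ominus> (r \<odot> x)"
  using smult_r_distr[of "\<ominus> x" x r] by (simp add: l_neg add.inv_equality)

end

subsection \<open>Submodules\<close>

lemma left_submoduleD:
  assumes "left_submodule M N"
  shows "N \<subseteq> carrier M" "\<zero>\<^bsub>M\<^esub> \<in> N" "\<And>x y. x \<in> N \<Longrightarrow> y \<in> N \<Longrightarrow> x \<oplus>\<^bsub>M\<^esub> y \<in> N" "\<And>x r. x \<in> N \<Longrightarrow> r \<odot>\<^bsub>M\<^esub> x \<in> N"
  using assms unfolding left_submodule_def by blast+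

lemma left_submodule_Inter: "(\<And>N. N \<in> T \<Longrightarrow> left_submodule M N) \<Longrightarrow> T \<noteq> {} \<Longrightarrow> left_submodule M (\<Inter>T)"
proof -
  assume T: "\<And>N. N \<in> T \<Longrightarrow> left_submodule M N" "T \<noteq> {}"
  note t = left_submoduleD[OF T(1)]
  have "\<Inter>T \<subseteq> carrier M" using t(1) T(2) by blast
  moreover have "\<zero>\<^bsub>M\<^esub> \<in> \<Inter>T" using t(2) by blast
  moreover have "x \<oplus>\<^bsub>M\<^esub> y \<in> \<Inter>T" if "x \<in> \<Inter>T" "y \<in> \<Inter>T" for x y
    using t(3) that by (meson InterE InterI)
  moreover have "r \<odot>\<^bsub>M\<^esub> x \<in> \<Inter>T" if "x \<in> \<Inter>T" for x r
    using t(4) that by (meson InterE InterI)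
  ultimately show ?thesis unfolding left_submodule_def by blast
qed

context lmod begin

lemma carrier_submodule: "left_submodule M (carrier M)"
  unfolding left_submodule_def by simp

lemma hull_submodule:
  assumes "B \<subseteq> carrier M" shows "left_submodule M (left_submodule M hull B)"
  unfolding hull_def using assms carrier_submodule by (intro left_submodule_Inter) blast+

lemma hull_sub: "left_submodule M N \<Longrightarrow> B \<subseteq> N \<Longrightarrow> left_submodule M hull B \<subseteq> N"
  by (rule hull_minimal)

lemma submodule_minus:
  assumes N: "left_submodule M N" and "x \<in> N" "y \<in> N" shows "x \<ominus> y \<in> N"
proof -
  note n = left_submoduleD[OF N]
  have "x \<ominus> y = x \<oplus> (-1) \<odot> y" using assms n(1) minus_one_smult[of y] by (auto simp: a_minus_def)
  then show ?thesis using n assms by simp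
qed

lemma submodule_left_module:
  assumes N: "left_submodule M N" shows "left_module (M\<lparr>carrier := N\<rparr>)"
proof -
  note n = left_submoduleD[OF N]
  have c: "x \<in> N \<Longrightarrow> x \<in> carrier M" for x using n(1) by blast
  show ?thesis
    by (rule left_moduleI) (use n c in \<open>auto simp: a_assoc smult_l_distr smult_r_distr smult_assoc intro: a_comm\<close>)
qed

lemma hull_submodule_eq:
  assumes N: "left_submodule M N" and B: "B \<subseteq> N"
  shows "left_submodule (M\<lparr>carrier := N\<rparr>) hull B = left_submodule M hull B"
proof -
  have BM: "B \<subseteq> carrier M" using B left_submoduleD(1)[OF N] by blast
  have sub: "left_submodule (M\<lparr>carrier := N\<rparr>) P \<longleftrightarrow> left_submodule M P \<and> P \<subseteq> N" for P
    unfolding left_submodule_def using left_submoduleD(1)[OF N] by auto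
  let ?H = "left_submodule M hull B"
  have "left_submodule (M\<lparr>carrier := N\<rparr>) ?H" using sub hull_submodule[OF BM] hull_sub[OF N B] by blast
  then have "left_submodule (M\<lparr>carrier := N\<rparr>) hull B \<subseteq> ?H" by (intro hull_minimal hull_subset)
  moreover have "?H \<subseteq> left_submodule (M\<lparr>carrier := N\<rparr>) hull B"
    unfolding hull_def using sub by blast
  ultimately show ?thesis by blast
qed

end

subsection \<open>Linear combinations and coordinates\<close>

fun lincomb :: "('r, 'm) module \<Rightarrow> 'm list \<Rightarrow> 'r list \<Rightarrow> 'm" where
  "lincomb M (b # bs) (c # cs) = c \<odot>\<^bsub>M\<^esub> b \<oplus>\<^bsub>M\<^esub> lincomb M bs cs"
| "lincomb M _ _ = \<zero>\<^bsub>M\<^esub>"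

definition lspan :: "('r, 'm) module \<Rightarrow> 'm list \<Rightarrow> 'm set" where
  "lspan M bs = {lincomb M bs cs | cs. length cs = length bs}"

lemma lspan_Nil [simp]: "lspan M [] = {\<zero>\<^bsub>M\<^esub>}"
  unfolding lspan_def by auto

lemma lspan_Cons: "lspan M (b # bs) = {c \<odot>\<^bsub>M\<^esub> b \<oplus>\<^bsub>M\<^esub> y | c y. y \<in> lspan M bs}"
proof
  show "lspan M (b # bs) \<subseteq> {c \<odot>\<^bsub>M\<^esub> b \<oplus>\<^bsub>M\<^esub> y | c y. y \<in> lspan M bs}"
    unfolding lspan_def by (auto simp: length_Suc_conv) blast
  show "{c \<odot>\<^bsub>M\<^esub> b \<oplus>\<^bsub>M\<^esub> y | c y. y \<in> lspan M bs} \<subseteq> lspan M (b # bs)"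
  proof
    fix x assume "x \<in> {c \<odot>\<^bsub>M\<^esub> b \<oplus>\<^bsub>M\<^esub> y | c y. y \<in> lspan M bs}"
    then obtain c cs where "x = lincomb M (b # bs) (c # cs)" "length cs = length bs" unfolding lspan_def by auto
    then show "x \<in> lspan M (b # bs)" unfolding lspan_def by (intro CollectI exI[of _ "c # cs"]) simp
  qed
qed

context lmod begin

lemma lspan_submodule: "set bs \<subseteq> carrier M \<Longrightarrow> left_submodule M (lspan M bs) \<and> set bs \<subseteq> lspan M bs"
proof (induction bs)
  case Nil then show ?case unfolding left_submodule_def by simp
next
  case (Cons b bs)
  then have b: "b \<in> carrier M" and IH: "left_submodule M (lspan M bs)" "set bs \<subseteq> lspan M bs" by auto
  note n = left_submoduleD[OF IH(1)]
  have c: "y \<in> lspan M bs \<Longrightarrow> y \<in> carrier M" for y using n(1) by blast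
  let ?S = "{c \<odot> b \<oplus> y | c y. y \<in> lspan M bs}"
  have "left_submodule M ?S" unfolding left_submodule_def
  proof (intro conjI ballI allI)
    show "?S \<subseteq> carrier M" using b c by auto
    have "\<zero> = 0 \<odot> b \<oplus> \<zero>" using b by simp
    then show "\<zero> \<in> ?S" using n(2) by blast
    fix x assume "x \<in> ?S" then obtain r y where x: "x = r \<odot> b \<oplus> y" "y \<in> lspan M bs" by blast
    fix s :: 'r
    have "s \<odot> x = (s * r) \<odot> b \<oplus> s \<odot> y" unfolding x using b c[OF x(2)] by (simp add: smult_r_distr smult_assoc)
    then show "s \<odot> x \<in> ?S" using n(4)[OF x(2)] by blast
  next
    fix x x' assume "x \<in> ?S" "x' \<in> ?S"
    then obtain r y r' y' where x: "x = r \<odot> b \<oplus> y" "y \<in> lspan M bs" "x' = r' \<odot> b \<oplus> y'" "y' \<in> lspan M bs" by blast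
    have "x \<oplus> x' = (r + r') \<odot> b \<oplus> (y \<oplus> y')" unfolding x using b c[OF x(2)] c[OF x(4)]
      by (simp add: smult_l_distr a_ac)
    then show "x \<oplus> x' \<in> ?S" using n(3)[OF x(2,4)] by blast
  qed
  moreover have "b \<in> ?S"
  proof -
    have "b = 1 \<odot> b \<oplus> \<zero>" using b by simp
    then show ?thesis using n(2) by blast
  qed
  moreover have "set bs \<subseteq> ?S"
  proof
    fix y assume y: "y \<in> set bs"
    then have "y \<in> carrier M" using Cons.prems by auto
    then have "y = 0 \<odot> b \<oplus> y" using b by simp
    then show "y \<in> ?S" using y IH(2) by blast
  qed
  ultimately show ?case unfolding lspan_Cons by simp
qed

lemma fg_lspan:
  assumes "fg_module M" obtains bs where "set bs \<subseteq> carrier M" "lspan M bs = carrier M"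
proof -
  obtain B where B: "B \<subseteq> carrier M" "finite B" "left_submodule M hull B = carrier M"
    using assms unfolding fg_module_def by blast
  obtain bs where bs: "set bs = B" using finite_list[OF B(2)] by blast
  note s = lspan_submodule[of bs, unfolded bs, OF B(1)]
  have "carrier M \<subseteq> lspan M bs" using hull_sub[of "lspan M bs" B] s unfolding B(3) by blast
  then show ?thesis using that[of bs] B(1) bs s left_submoduleD(1) by blast
qed

text \<open>Coordinates with respect to a finite generating list; the fixed length lets the coordinates of two
  modules be concatenated injectively.\<close>

lemma fg_coordinates:
  assumes "fg_module M"
  obtains n and \<phi> :: "'m \<Rightarrow> 'r list" where "\<And>x. x \<in> carrier M \<Longrightarrow> length (\<phi> x) = n" "inj_on \<phi> (carrier M)"
proof -
  obtain bs where bs: "set bs \<subseteq> carrier M" "lspan M bs = carrier M" using fg_lspan[OF assms] .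
  have "\<forall>x\<in>carrier M. \<exists>cs. length cs = length bs \<and> lincomb M bs cs = x" 
  proof
    fix x assume "x \<in> carrier M"
    then have "x \<in> lspan M bs" using bs(2) by simp
    then show "\<exists>cs. length cs = length bs \<and> lincomb M bs cs = x" unfolding lspan_def by auto
  qed
  then obtain \<phi> where \<phi>: "\<forall>x\<in>carrier M. length (\<phi> x) = length bs \<and> lincomb M bs (\<phi> x) = x"
    by (rule bchoice[THEN exE])
  then have "inj_on \<phi> (carrier M)" by (intro inj_on_inverseI[of _ "lincomb M bs"]) simp
  then show ?thesis using that[of \<phi> "length bs"] \<phi> by simp
qed

text \<open>Induction on the generating list. The leading coefficients \<open>r\<close> of elements \<open>r b + y\<close> of \<open>N\<close> form a left ideal,
  generated by a finite set \<open>G\<close>. Elements of \<open>N\<close> with the leading coefficients \<open>G\<close>, together with finitely many generators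
  of \<open>N \<inter> lspan M bs\<close>, generate \<open>N\<close>: a suitable combination of them has the same leading coefficient as
  a given element of \<open>N\<close>, and the difference lies in the span of \<open>bs\<close>.\<close>

lemma submodule_of_lspan_fg:
  assumes noeth: "left_noetherian TYPE('r)"
  shows "set bs \<subseteq> carrier M \<Longrightarrow> left_submodule M N \<Longrightarrow> N \<subseteq> lspan M bs \<Longrightarrow>
    \<exists>B. finite B \<and> B \<subseteq> N \<and> N = left_submodule M hull B"
proof (induction bs arbitrary: N)
  case Nil
  then have "N = {\<zero>}" using left_submoduleD(2)[OF Nil(2)] by auto
  moreover have "left_submodule M hull {\<zero>} = {\<zero>}" using hull_same[of "left_submodule M" "{\<zero>}"] Nil(2) calculation by simp
  ultimately show ?case by (intro exI[of _ "{\<zero>}"]) simp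
next
  case (Cons b bs)
  have b: "b \<in> carrier M" and bs: "set bs \<subseteq> carrier M" using Cons.prems by auto
  note S = lspan_submodule[OF bs, THEN conjunct1] and s = left_submoduleD[OF lspan_submodule[OF bs, THEN conjunct1]]
  have sc: "y \<in> lspan M bs \<Longrightarrow> y \<in> carrier M" for y using s(1) by blast
  note n = left_submoduleD[OF Cons.prems(2)]
  have ideal: "left_ideal {r. \<exists>y\<in>lspan M bs. r \<odot> b \<oplus> y \<in> P}" if P: "left_submodule M P" for P
  proof -
    note p = left_submoduleD[OF P]
    show ?thesis unfolding left_ideal_def
    proof (intro conjI ballI allI)
      have "0 \<odot> b \<oplus> \<zero> \<in> P" using b p(2) by simp
      then show "0 \<in> {r. \<exists>y\<in>lspan M bs. r \<odot> b \<oplus> y \<in> P}" using s(2) by blast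
      fix x assume "x \<in> {r. \<exists>y\<in>lspan M bs. r \<odot> b \<oplus> y \<in> P}"
      then obtain y where y: "y \<in> lspan M bs" "x \<odot> b \<oplus> y \<in> P" by blast
      fix r
      have "(r * x) \<odot> b \<oplus> r \<odot> y = r \<odot> (x \<odot> b \<oplus> y)" using b sc[OF y(1)] by (simp add: smult_r_distr smult_assoc)
      then show "r * x \<in> {r. \<exists>y\<in>lspan M bs. r \<odot> b \<oplus> y \<in> P}"
        using p(4)[OF y(2), of r] s(4)[OF y(1), of r] by (intro CollectI bexI[of _ "r \<odot> y"]) simp_all
    next
      fix x x' assume "x \<in> {r. \<exists>y\<in>lspan M bs. r \<odot> b \<oplus> y \<in> P}" "x' \<in> {r. \<exists>y\<in>lspan M bs. r \<odot> b \<oplus> y \<in> P}"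
      then obtain y y' where y: "y \<in> lspan M bs" "x \<odot> b \<oplus> y \<in> P" "y' \<in> lspan M bs" "x' \<odot> b \<oplus> y' \<in> P" by blast
      have "(x + x') \<odot> b \<oplus> (y \<oplus> y') = (x \<odot> b \<oplus> y) \<oplus> (x' \<odot> b \<oplus> y')"
        using b sc[OF y(1)] sc[OF y(3)] by (simp add: smult_l_distr a_ac)
      then show "x + x' \<in> {r. \<exists>y\<in>lspan M bs. r \<odot> b \<oplus> y \<in> P}" 
        using p(3)[OF y(2,4)] s(3)[OF y(1,3)] by (intro CollectI bexI[of _ "y \<oplus> y'"]) simp_all
    qed
  qed
  obtain G where G: "finite G" "{r. \<exists>y\<in>lspan M bs. r \<odot> b \<oplus> y \<in> N} = left_ideal hull G"
    using noeth ideal[OF Cons.prems(2)] unfolding left_noetherian_def by blast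
  have "\<forall>g\<in>G. \<exists>y\<in>lspan M bs. g \<odot> b \<oplus> y \<in> N" using G(2) hull_subset[of G left_ideal] by blast
  then obtain \<eta> where \<eta>: "\<And>g. g \<in> G \<Longrightarrow> \<eta> g \<in> lspan M bs \<and> g \<odot> b \<oplus> \<eta> g \<in> N" by metis
  have sub': "left_submodule M (N \<inter> lspan M bs)"
    using Cons.prems(2) S unfolding left_submodule_def by blast
  obtain B' where B': "finite B'" "B' \<subseteq> N \<inter> lspan M bs" "N \<inter> lspan M bs = left_submodule M hull B'"
    using Cons.IH[OF bs sub'] by blast
  let ?B = "B' \<union> (\<lambda>g. g \<odot> b \<oplus> \<eta> g) ` G"
  let ?H = "left_submodule M hull ?B"
  have BN: "?B \<subseteq> N" using B'(2) \<eta> by auto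
  have BM: "?B \<subseteq> carrier M" using BN n(1) by blast
  note H = hull_submodule[OF BM] and h = left_submoduleD[OF hull_submodule[OF BM]]
  have HN: "?H \<subseteq> N" using hull_sub[OF Cons.prems(2) BN] .
  have "G \<subseteq> {r. \<exists>y\<in>lspan M bs. r \<odot> b \<oplus> y \<in> ?H}" using \<eta> hull_subset[of ?B "left_submodule M"] by fast
  then have I: "{r. \<exists>y\<in>lspan M bs. r \<odot> b \<oplus> y \<in> N} \<subseteq> {r. \<exists>y\<in>lspan M bs. r \<odot> b \<oplus> y \<in> ?H}"
    unfolding G(2) using ideal[OF H] by (intro hull_minimal)
  have "N \<subseteq> ?H"
  proof
    fix x assume x: "x \<in> N"
    then obtain r y where xy: "x = r \<odot> b \<oplus> y" "y \<in> lspan M bs" using Cons.prems(3) unfolding lspan_Cons by blast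
    then obtain y' where y': "y' \<in> lspan M bs" "r \<odot> b \<oplus> y' \<in> ?H" using I x by blast
    let ?m = "r \<odot> b \<oplus> y'"
    have "x \<ominus> ?m = y \<ominus> y'" unfolding xy using b sc[OF xy(2)] sc[OF y'(1)]
      by (simp add: a_minus_def minus_add a_ac r_neg r_neg1 r_neg2)
    then have "x \<ominus> ?m \<in> N \<inter> lspan M bs"
      using submodule_minus[OF Cons.prems(2) x, of ?m] submodule_minus[OF S xy(2) y'(1)] y'(2) HN by auto
    also have "\<dots> \<subseteq> ?H" unfolding B'(3) by (rule hull_mono) blast
    finally have "(x \<ominus> ?m) \<oplus> ?m \<in> ?H" using h(3) y'(2) by blast
    moreover have "(x \<ominus> ?m) \<oplus> ?m = x" using x n(1) b sc[OF y'(1)] by (auto simp: a_minus_def a_assoc l_neg)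
    ultimately show "x \<in> ?H" by simp
  qed
  then show ?case using HN B'(1) G(1) BN by (intro exI[of _ ?B]) auto
qed

lemma submodule_fg:
  assumes noeth: "left_noetherian TYPE('r)" and M: "fg_module M" and N: "left_submodule M N"
  shows "fg_module (M\<lparr>carrier := N\<rparr>)"
proof -
  obtain bs where bs: "set bs \<subseteq> carrier M" "lspan M bs = carrier M" using fg_lspan[OF M] .
  then obtain B where B: "finite B" "B \<subseteq> N" "N = left_submodule M hull B"
    using submodule_of_lspan_fg[OF noeth bs(1) N] left_submoduleD(1)[OF N] by auto
  then show ?thesis unfolding fg_module_def
    using submodule_left_module[OF N] hull_submodule_eq[OF N B(2)] by auto
qed

end

subsection \<open>Homomorphisms\<close>

lemma module_homsD:
  assumes "f \<in> module_homs M N"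
  shows "f \<in> extensional (carrier M)" "\<And>x. x \<in> carrier M \<Longrightarrow> f x \<in> carrier N"
    "\<And>x y. x \<in> carrier M \<Longrightarrow> y \<in> carrier M \<Longrightarrow> f (x \<oplus>\<^bsub>M\<^esub> y) = f x \<oplus>\<^bsub>N\<^esub> f y"
    "\<And>x r. x \<in> carrier M \<Longrightarrow> f (r \<odot>\<^bsub>M\<^esub> x) = r \<odot>\<^bsub>N\<^esub> f x"
  using assms unfolding module_homs_def PiE_def by auto

lemma module_homsI:
  assumes "f \<in> extensional (carrier M)" "\<And>x. x \<in> carrier M \<Longrightarrow> f x \<in> carrier N"
    "\<And>x y. x \<in> carrier M \<Longrightarrow> y \<in> carrier M \<Longrightarrow> f (x \<oplus>\<^bsub>M\<^esub> y) = f x \<oplus>\<^bsub>N\<^esub> f y"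
    "\<And>x r. x \<in> carrier M \<Longrightarrow> f (r \<odot>\<^bsub>M\<^esub> x) = r \<odot>\<^bsub>N\<^esub> f x"
  shows "f \<in> module_homs M N"
  using assms unfolding module_homs_def PiE_def by auto

lemma module_hom_zero:
  assumes "lmod M" "lmod N" "f \<in> module_homs M N" shows "f \<zero>\<^bsub>M\<^esub> = \<zero>\<^bsub>N\<^esub>"
proof -
  interpret M: lmod M by fact
  interpret N: lmod N by fact
  show ?thesis using module_homsD(2)[OF assms(3) M.zero_closed] module_homsD(4)[OF assms(3) M.zero_closed, of 0] by simp
qed

lemma module_hom_minus:
  assumes "lmod M" "lmod N" "f \<in> module_homs M N" "x \<in> carrier M" "y \<in> carrier M"
  shows "f (x \<ominus>\<^bsub>M\<^esub> y) = f x \<ominus>\<^bsub>N\<^esub> f y"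
proof -
  interpret M: lmod M by fact
  interpret N: lmod N by fact
  note f = module_homsD(2-4)[OF assms(3)]
  have "f (x \<ominus>\<^bsub>M\<^esub> y) = f x \<oplus>\<^bsub>N\<^esub> f ((-1) \<odot>\<^bsub>M\<^esub> y)"
    using assms(4,5) by (simp add: a_minus_def M.minus_one_smult f(2))
  also have "f ((-1) \<odot>\<^bsub>M\<^esub> y) = \<ominus>\<^bsub>N\<^esub> f y" using f(1,3) assms(5) by (simp add: N.minus_one_smult)
  finally show ?thesis by (simp add: a_minus_def)
qed

lemma image_submodule:
  assumes "lmod M" "lmod N" "f \<in> module_homs M N" "left_submodule M P" shows "left_submodule N (f ` P)"
  unfolding left_submodule_def
proof (intro conjI ballI allI)
  note f = module_homsD[OF assms(3)] and p = left_submoduleD[OF assms(4)]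
  have pc: "x \<in> P \<Longrightarrow> x \<in> carrier M" for x using p(1) by blast
  show "f ` P \<subseteq> carrier N" using f(2) pc by blast
  show "\<zero>\<^bsub>N\<^esub> \<in> f ` P" using module_hom_zero[OF assms(1-3)] p(2) by (metis imageI)
  show "x \<oplus>\<^bsub>N\<^esub> y \<in> f ` P" if "x \<in> f ` P" "y \<in> f ` P" for x y
    using that f(3) pc p(3) by (smt (verit) image_iff)
  show "r \<odot>\<^bsub>N\<^esub> x \<in> f ` P" if "x \<in> f ` P" for x r
    using that f(4) pc p(4) by (smt (verit) image_iff)
qed

lemma vimage_submodule:
  assumes "lmod M" "lmod N" "f \<in> module_homs M N" "left_submodule N P"
  shows "left_submodule M {x \<in> carrier M. f x \<in> P}"
proof -
  interpret M: lmod M by fact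
  show ?thesis unfolding left_submodule_def
    using module_homsD[OF assms(3)] left_submoduleD[OF assms(4)] module_hom_zero[OF assms(1-3)] by auto
qed

lemma surjective_image_fg:
  assumes M: "fg_module M" and N: "left_module N" and f: "f \<in> module_homs M N" and s: "f ` carrier M = carrier N"
  shows "fg_module N"
proof -
  obtain B where B: "B \<subseteq> carrier M" "finite B" "left_submodule M hull B = carrier M"
    using M unfolding fg_module_def by blast
  have M': "lmod M" and N': "lmod N" using M N unfolding fg_module_def left_module_iff by auto
  have fB: "f ` B \<subseteq> carrier N" using B(1) s by blast
  have "carrier N \<subseteq> left_submodule N hull (f ` B)"
  proof -
    let ?P = "{x \<in> carrier M. f x \<in> left_submodule N hull (f ` B)}"
    have P: "left_submodule M ?P"
      using vimage_submodule[OF M' N' f lmod.hull_submodule[OF N' fB]] .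
    have "f ` B \<subseteq> left_submodule N hull (f ` B)" by (rule hull_subset)
    then have "B \<subseteq> ?P" using B(1) by auto
    then have "carrier M \<subseteq> ?P" using hull_minimal[of B ?P "left_submodule M"] P unfolding B(3) by blast
    then have "f ` carrier M \<subseteq> left_submodule N hull (f ` B)" by auto
    then show ?thesis unfolding s .
  qed
  moreover have "left_submodule N hull (f ` B) \<subseteq> carrier N"
    using left_submoduleD(1)[OF lmod.hull_submodule[OF N' fB]] .
  ultimately show ?thesis unfolding fg_module_def using N fB B(2) by (intro conjI exI[of _ "f ` B"]) auto
qed

subsection \<open>Transport of structure, products and quotients\<close>

text \<open>The copy of \<open>M\<close> on the image of an injection \<open>e\<close>. It moves modules that live on pairs or on the ring itself into the
  type of elements of the category.\<close>

definition transport :: "('x \<Rightarrow> 'm) \<Rightarrow> ('r, 'x) module \<Rightarrow> ('r, 'm) module" where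
  "transport e M = (let d = inv_into (carrier M) e in
     \<lparr>carrier = e ` carrier M, monoid.mult = undefined, one = undefined, zero = e \<zero>\<^bsub>M\<^esub>,
      add = (\<lambda>x y. e (d x \<oplus>\<^bsub>M\<^esub> d y)), smult = (\<lambda>r x. e (r \<odot>\<^bsub>M\<^esub> d x))\<rparr>)"

context
  fixes M :: "('r::ring_1, 'x) module" and e :: "'x \<Rightarrow> 'm"
  assumes M: "lmod M" and e: "inj_on e (carrier M)"
begin

interpretation M: lmod M by (rule M)

lemma transport_simps [simp]:
  "carrier (transport e M) = e ` carrier M" "zero (transport e M) = e \<zero>\<^bsub>M\<^esub>"
  "x \<in> carrier M \<Longrightarrow> y \<in> carrier M \<Longrightarrow> e x \<oplus>\<^bsub>transport e M\<^esub> e y = e (x \<oplus>\<^bsub>M\<^esub> y)"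
  "x \<in> carrier M \<Longrightarrow> r \<odot>\<^bsub>transport e M\<^esub> e x = e (r \<odot>\<^bsub>M\<^esub> x)"
  using e by (simp_all add: transport_def Let_def)

lemma transport_left_module: "left_module (transport e M)"
  by (rule left_moduleI) (auto simp: M.a_ac M.smult_l_distr M.smult_r_distr M.smult_assoc)

lemma transport_fg:
  assumes B: "B \<subseteq> carrier M" "finite B" "left_submodule M hull B = carrier M"
  shows "fg_module (transport e M)"
proof -
  have eB: "e ` B \<subseteq> carrier (transport e M)" using B(1) by auto
  have T: "lmod (transport e M)" using transport_left_module left_module_iff by blast
  define H where "H = left_submodule (transport e M) hull (e ` B)"
  note h = left_submoduleD[OF lmod.hull_submodule[OF T eB], folded H_def]
  have BH: "e ` B \<subseteq> H" unfolding H_def by (rule hull_subset)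
  have "e (x \<oplus>\<^bsub>M\<^esub> y) \<in> H" if "x \<in> carrier M" "y \<in> carrier M" "e x \<in> H" "e y \<in> H" for x y
    using h(3)[of "e x" "e y"] that by simp
  moreover have "e (r \<odot>\<^bsub>M\<^esub> x) \<in> H" if "x \<in> carrier M" "e x \<in> H" for x r
    using h(4)[of "e x"] that by simp
  ultimately have P: "left_submodule M {x \<in> carrier M. e x \<in> H}"
    unfolding left_submodule_def using h(2) by auto
  have "B \<subseteq> {x \<in> carrier M. e x \<in> H}" using B(1) BH by auto
  then have "carrier M \<subseteq> {x \<in> carrier M. e x \<in> H}"
    using hull_minimal[of B _ "left_submodule M"] P unfolding B(3) by blast
  then have "carrier (transport e M) = H" using h(1) by auto
  then show ?thesis unfolding fg_module_def using transport_left_module eB B(2)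
    by (intro conjI exI[of _ "e ` B"]) (simp_all add: H_def)
qed

end

definition prod_module :: "('r, 'm) module \<Rightarrow> ('r, 'n) module \<Rightarrow> ('r, 'm \<times> 'n) module" where
  "prod_module M N = \<lparr>carrier = carrier M \<times> carrier N, monoid.mult = undefined, one = undefined, zero = (\<zero>\<^bsub>M\<^esub>, \<zero>\<^bsub>N\<^esub>),
      add = (\<lambda>x y. (fst x \<oplus>\<^bsub>M\<^esub> fst y, snd x \<oplus>\<^bsub>N\<^esub> snd y)), smult = (\<lambda>r x. (r \<odot>\<^bsub>M\<^esub> fst x, r \<odot>\<^bsub>N\<^esub> snd x))\<rparr>"

lemma prod_module_simps [simp]:
  "carrier (prod_module M N) = carrier M \<times> carrier N" "zero (prod_module M N) = (\<zero>\<^bsub>M\<^esub>, \<zero>\<^bsub>N\<^esub>)"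
  "x \<oplus>\<^bsub>prod_module M N\<^esub> y = (fst x \<oplus>\<^bsub>M\<^esub> fst y, snd x \<oplus>\<^bsub>N\<^esub> snd y)"
  "r \<odot>\<^bsub>prod_module M N\<^esub> x = (r \<odot>\<^bsub>M\<^esub> fst x, r \<odot>\<^bsub>N\<^esub> snd x)"
  by (simp_all add: prod_module_def)

lemma prod_module_left_module:
  assumes "lmod M" "lmod N" shows "left_module (prod_module M N)"
proof -
  interpret M: lmod M by fact
  interpret N: lmod N by fact
  show ?thesis
    by (rule left_moduleI) (auto simp: M.a_ac M.smult_l_distr M.smult_r_distr M.smult_assoc
      N.a_ac N.smult_l_distr N.smult_r_distr N.smult_assoc)
qed

lemma prod_module_fg:
  assumes M: "fg_module M" and N: "fg_module N" shows "fg_module (prod_module M N)"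
proof -
  obtain B where B: "B \<subseteq> carrier M" "finite B" "left_submodule M hull B = carrier M"
    using M unfolding fg_module_def by blast
  obtain D where D: "D \<subseteq> carrier N" "finite D" "left_submodule N hull D = carrier N"
    using N unfolding fg_module_def by blast
  have M': "lmod M" and N': "lmod N" using M N unfolding fg_module_def left_module_iff by auto
  interpret M: lmod M by fact
  interpret N: lmod N by fact
  have P: "left_module (prod_module M N)" using prod_module_left_module[OF M' N'] .
  then have P': "lmod (prod_module M N)" using left_module_iff by blast
  let ?E = "(\<lambda>x. (x, \<zero>\<^bsub>N\<^esub>)) ` B \<union> (\<lambda>y. (\<zero>\<^bsub>M\<^esub>, y)) ` D"
  define H where "H = left_submodule (prod_module M N) hull ?E"
  have E: "?E \<subseteq> carrier (prod_module M N)" using B(1) D(1) by auto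
  note h = left_submoduleD[OF lmod.hull_submodule[OF P' E], folded H_def]
  have EH: "?E \<subseteq> H" unfolding H_def by (rule hull_subset)
  have P1: "left_submodule M {x \<in> carrier M. (x, \<zero>\<^bsub>N\<^esub>) \<in> H}"
    unfolding left_submodule_def using h(2) h(3)[of "(_, \<zero>\<^bsub>N\<^esub>)" "(_, \<zero>\<^bsub>N\<^esub>)"] h(4)[of "(_, \<zero>\<^bsub>N\<^esub>)"] by auto
  have "B \<subseteq> {x \<in> carrier M. (x, \<zero>\<^bsub>N\<^esub>) \<in> H}" using B(1) EH by auto
  then have "carrier M \<subseteq> {x \<in> carrier M. (x, \<zero>\<^bsub>N\<^esub>) \<in> H}"
    using hull_minimal[of B _ "left_submodule M"] P1 unfolding B(3) by blast
  then have 1: "(x, \<zero>\<^bsub>N\<^esub>) \<in> H" if "x \<in> carrier M" for x using that by blast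
  have P2: "left_submodule N {y \<in> carrier N. (\<zero>\<^bsub>M\<^esub>, y) \<in> H}"
    unfolding left_submodule_def using h(2) h(3)[of "(\<zero>\<^bsub>M\<^esub>, _)" "(\<zero>\<^bsub>M\<^esub>, _)"] h(4)[of "(\<zero>\<^bsub>M\<^esub>, _)"] by auto
  have "D \<subseteq> {y \<in> carrier N. (\<zero>\<^bsub>M\<^esub>, y) \<in> H}" using D(1) EH by auto
  then have "carrier N \<subseteq> {y \<in> carrier N. (\<zero>\<^bsub>M\<^esub>, y) \<in> H}"
    using hull_minimal[of D _ "left_submodule N"] P2 unfolding D(3) by blast
  then have 2: "(\<zero>\<^bsub>M\<^esub>, y) \<in> H" if "y \<in> carrier N" for y using that by blast
  have "carrier (prod_module M N) \<subseteq> H"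
  proof
    fix z assume "z \<in> carrier (prod_module M N)"
    then obtain x y where z: "z = (x, y)" "x \<in> carrier M" "y \<in> carrier N" by auto
    have "(x, \<zero>\<^bsub>N\<^esub>) \<oplus>\<^bsub>prod_module M N\<^esub> (\<zero>\<^bsub>M\<^esub>, y) \<in> H" using h(3) 1 2 z(2,3) by blast
    then show "z \<in> H" using z by simp
  qed
  then have "carrier (prod_module M N) = H" using h(1) by blast
  then show ?thesis unfolding fg_module_def using P E B(2) D(2)
    by (intro conjI exI[of _ ?E]) (simp_all add: H_def)
qed

text \<open>The quotient is realised on a set of representatives of the cosets, so that its elements have the same type
  as those of \<open>Y\<close>.\<close>

lemma quotient_module:
  fixes Y :: "('r::ring_1, 'm) module"
  assumes Y: "lmod Y" and I: "left_submodule Y I"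
  obtains Q q where "left_module Q" "q \<in> module_homs Y Q" "q ` carrier Y = carrier Q"
    "carrier Q \<subseteq> carrier Y" "\<And>y. y \<in> carrier Y \<Longrightarrow> q y = \<zero>\<^bsub>Q\<^esub> \<longleftrightarrow> y \<in> I"
    "\<And>y. y \<in> carrier Y \<Longrightarrow> y \<ominus>\<^bsub>Y\<^esub> q y \<in> I"
proof -
  interpret Y: lmod Y by fact
  note i = left_submoduleD[OF I]
  have ic: "x \<in> I \<Longrightarrow> x \<in> carrier Y" for x using i(1) by blast
  \<comment> \<open>The chosen element depends on the coset of \<open>y\<close> only, see \<open>rep_eq\<close>.\<close>
  define rep where "rep y = (SOME z. z \<in> carrier Y \<and> y \<ominus>\<^bsub>Y\<^esub> z \<in> I)" for y
  have rep: "rep y \<in> carrier Y" "y \<ominus>\<^bsub>Y\<^esub> rep y \<in> I" if "y \<in> carrier Y" for y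
  proof -
    have "y \<ominus>\<^bsub>Y\<^esub> y \<in> I" using that i(2) by (simp add: a_minus_def Y.r_neg)
    then have "\<exists>z. z \<in> carrier Y \<and> y \<ominus>\<^bsub>Y\<^esub> z \<in> I" using that by blast
    from someI_ex[OF this] show "rep y \<in> carrier Y" "y \<ominus>\<^bsub>Y\<^esub> rep y \<in> I" unfolding rep_def by blast+
  qed
  have rep_eq: "rep x = rep y" if "x \<in> carrier Y" "y \<in> carrier Y" "x \<ominus>\<^bsub>Y\<^esub> y \<in> I" for x y
  proof -
    have yx: "y \<ominus>\<^bsub>Y\<^esub> x \<in> I"
    proof -
      have "y \<ominus>\<^bsub>Y\<^esub> x = (-1) \<odot>\<^bsub>Y\<^esub> (x \<ominus>\<^bsub>Y\<^esub> y)" using that(1,2)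
        by (simp add: Y.minus_one_smult a_minus_def Y.minus_add Y.a_comm)
      then show ?thesis using i(4)[OF that(3)] by simp
    qed
    have "(x \<ominus>\<^bsub>Y\<^esub> z \<in> I) = (y \<ominus>\<^bsub>Y\<^esub> z \<in> I)" if z: "z \<in> carrier Y" for z
    proof
      assume "x \<ominus>\<^bsub>Y\<^esub> z \<in> I"
      then have "(y \<ominus>\<^bsub>Y\<^esub> x) \<oplus>\<^bsub>Y\<^esub> (x \<ominus>\<^bsub>Y\<^esub> z) \<in> I" using yx i(3) by blast
      then show "y \<ominus>\<^bsub>Y\<^esub> z \<in> I" using z \<open>x \<in> carrier Y\<close> \<open>y \<in> carrier Y\<close> by (simp add: a_minus_def Y.a_assoc Y.r_neg1)
    next
      assume "y \<ominus>\<^bsub>Y\<^esub> z \<in> I"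
      then have "(x \<ominus>\<^bsub>Y\<^esub> y) \<oplus>\<^bsub>Y\<^esub> (y \<ominus>\<^bsub>Y\<^esub> z) \<in> I" using \<open>x \<ominus>\<^bsub>Y\<^esub> y \<in> I\<close> i(3) by blast
      then show "x \<ominus>\<^bsub>Y\<^esub> z \<in> I" using z \<open>x \<in> carrier Y\<close> \<open>y \<in> carrier Y\<close> by (simp add: a_minus_def Y.a_assoc Y.r_neg1)
    qed
    then show ?thesis unfolding rep_def by metis
  qed
  have rep_add: "rep (rep x \<oplus>\<^bsub>Y\<^esub> rep y) = rep (x \<oplus>\<^bsub>Y\<^esub> y)" if "x \<in> carrier Y" "y \<in> carrier Y" for x y
  proof (rule rep_eq[symmetric])
    have "(x \<oplus>\<^bsub>Y\<^esub> y) \<ominus>\<^bsub>Y\<^esub> (rep x \<oplus>\<^bsub>Y\<^esub> rep y) = (x \<ominus>\<^bsub>Y\<^esub> rep x) \<oplus>\<^bsub>Y\<^esub> (y \<ominus>\<^bsub>Y\<^esub> rep y)"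
      using that rep(1) by (simp add: a_minus_def Y.minus_add Y.a_ac)
    then show "(x \<oplus>\<^bsub>Y\<^esub> y) \<ominus>\<^bsub>Y\<^esub> (rep x \<oplus>\<^bsub>Y\<^esub> rep y) \<in> I" using i(3) rep(2) that by simp
  qed (use that rep in auto)
  have rep_smult: "rep (r \<odot>\<^bsub>Y\<^esub> rep x) = rep (r \<odot>\<^bsub>Y\<^esub> x)" if "x \<in> carrier Y" for x r
  proof (rule rep_eq[symmetric])
    have "r \<odot>\<^bsub>Y\<^esub> x \<ominus>\<^bsub>Y\<^esub> r \<odot>\<^bsub>Y\<^esub> rep x = r \<odot>\<^bsub>Y\<^esub> (x \<ominus>\<^bsub>Y\<^esub> rep x)"
      using that rep(1) by (simp add: a_minus_def Y.smult_r_distr Y.smult_minus)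
    then show "r \<odot>\<^bsub>Y\<^esub> x \<ominus>\<^bsub>Y\<^esub> r \<odot>\<^bsub>Y\<^esub> rep x \<in> I" using i(4) rep(2) that by simp
  qed (use that rep in auto)
  have rep_rep: "rep (rep x) = rep x" if "x \<in> carrier Y" for x
    by (rule rep_eq[symmetric]) (use that rep in auto)
  define Q :: "('r, 'm) module" where "Q = \<lparr>carrier = rep ` carrier Y, monoid.mult = undefined, one = undefined, zero = rep \<zero>\<^bsub>Y\<^esub>,
    add = (\<lambda>x y. rep (x \<oplus>\<^bsub>Y\<^esub> y)), smult = (\<lambda>r x. rep (r \<odot>\<^bsub>Y\<^esub> x))\<rparr>"
  have Qs [simp]: "carrier Q = rep ` carrier Y" "\<zero>\<^bsub>Q\<^esub> = rep \<zero>\<^bsub>Y\<^esub>"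
    "\<And>x y. x \<oplus>\<^bsub>Q\<^esub> y = rep (x \<oplus>\<^bsub>Y\<^esub> y)" "\<And>r x. r \<odot>\<^bsub>Q\<^esub> x = rep (r \<odot>\<^bsub>Y\<^esub> x)" unfolding Q_def by simp_all
  have l: "rep (rep x \<oplus>\<^bsub>Y\<^esub> y) = rep (x \<oplus>\<^bsub>Y\<^esub> y)" "rep (y \<oplus>\<^bsub>Y\<^esub> rep x) = rep (y \<oplus>\<^bsub>Y\<^esub> x)"
    if "x \<in> carrier Y" "y \<in> carrier Y" for x y
    using rep_add[of "rep x" y] rep_add[of y "rep x"] rep_add[of x y] rep_add[of y x] rep_rep that rep(1) by metis+
  have Q: "left_module Q"
    by (rule left_moduleI)
      (auto simp: rep(1) l rep_smult rep_rep,
        auto simp: Y.a_ac Y.smult_l_distr Y.smult_r_distr Y.smult_assoc)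
  have q: "(\<lambda>y\<in>carrier Y. rep y) \<in> module_homs Y Q"
    by (rule module_homsI) (auto simp: l rep_smult rep(1))
  show ?thesis
  proof (rule that[OF Q q])
    show "restrict rep (carrier Y) ` carrier Y = carrier Q" by auto
    show "carrier Q \<subseteq> carrier Y" using rep(1) by auto
    show "y \<ominus>\<^bsub>Y\<^esub> restrict rep (carrier Y) y \<in> I" if "y \<in> carrier Y" for y using rep(2) that by simp
    show "restrict rep (carrier Y) y = \<zero>\<^bsub>Q\<^esub> \<longleftrightarrow> y \<in> I" if y: "y \<in> carrier Y" for y
    proof
      assume "restrict rep (carrier Y) y = \<zero>\<^bsub>Q\<^esub>"
      then have e: "rep y = rep \<zero>\<^bsub>Y\<^esub>" using y by simp
      have "\<zero>\<^bsub>Y\<^esub> \<ominus>\<^bsub>Y\<^esub> rep y \<in> I" unfolding e using rep(2) by simp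
      then have "(y \<ominus>\<^bsub>Y\<^esub> rep y) \<ominus>\<^bsub>Y\<^esub> (\<zero>\<^bsub>Y\<^esub> \<ominus>\<^bsub>Y\<^esub> rep y) \<in> I"
        by (rule Y.submodule_minus[OF I rep(2)[OF y]])
      moreover have "(y \<ominus>\<^bsub>Y\<^esub> rep y) \<ominus>\<^bsub>Y\<^esub> (\<zero>\<^bsub>Y\<^esub> \<ominus>\<^bsub>Y\<^esub> rep y) = y"
        using y rep(1)[OF y] by (simp add: a_minus_def Y.a_assoc Y.l_neg)
      ultimately show "y \<in> I" by simp
    next
      assume "y \<in> I"
      then have "y \<ominus>\<^bsub>Y\<^esub> \<zero>\<^bsub>Y\<^esub> \<in> I" using Y.submodule_minus[OF I _ i(2)] by blast
      then have "rep y = rep \<zero>\<^bsub>Y\<^esub>" using y by (intro rep_eq) simp_all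
      then show "restrict rep (carrier Y) y = \<zero>\<^bsub>Q\<^esub>" using y by simp
    qed
  qed
qed



subsection \<open>The category of finitely generated modules\<close>

lemma fg_Ob [simp]: "M \<in> Ob fg_modules \<longleftrightarrow> fg_module M"
  and fg_Hom: "\<phi> \<in> Hom fg_modules M N \<longleftrightarrow> (\<exists>f. \<phi> = (M, N, f) \<and> fg_module M \<and> fg_module N \<and> f \<in> module_homs M N)"
  and fg_Idn [simp]: "Idn fg_modules M = (M, M, \<lambda>x\<in>carrier M. x)"
  and fg_Cmp [simp]: "(N', P, g) \<cdot>\<^bsub>fg_modules\<^esub> (M, N, f) = (M, P, compose (carrier M) g f)"
  and fg_Add [simp]: "(M', N', f) \<boxplus>\<^bsub>fg_modules\<^esub> (M, N, g) = (M, N, \<lambda>x\<in>carrier M. f x \<oplus>\<^bsub>N\<^esub> g x)"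
  and fg_Nul [simp]: "Nul fg_modules M N = (M, N, \<lambda>x\<in>carrier M. \<zero>\<^bsub>N\<^esub>)"
  by (simp_all add: fg_modules_def)

lemma fg_lmod: "fg_module M \<Longrightarrow> lmod M"
  by (simp add: fg_module_def left_module_iff)

lemma module_homs_eqI:
  assumes "f \<in> module_homs M N" "g \<in> module_homs M N'" "\<And>x. x \<in> carrier M \<Longrightarrow> f x = g x" shows "f = g"
  using module_homsD(1)[OF assms(1)] module_homsD(1)[OF assms(2)] assms(3) by (rule extensionalityI)

lemma compose_homs: "f \<in> module_homs M N \<Longrightarrow> g \<in> module_homs N P \<Longrightarrow> compose (carrier M) g f \<in> module_homs M P"
  if "lmod M"
proof -
  interpret M: lmod M by fact
  assume f: "f \<in> module_homs M N" and g: "g \<in> module_homs N P"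
  show ?thesis
    by (rule module_homsI) (use module_homsD[OF f] module_homsD[OF g] in \<open>auto simp: compose_def\<close>)
qed

lemma id_homs: "lmod M \<Longrightarrow> (\<lambda>x\<in>carrier M. x) \<in> module_homs M M"
proof -
  assume "lmod M" then interpret M: lmod M .
  show ?thesis by (rule module_homsI) auto
qed

lemma zero_homs: "lmod M \<Longrightarrow> lmod N \<Longrightarrow> (\<lambda>x\<in>carrier M. \<zero>\<^bsub>N\<^esub>) \<in> module_homs M N"
proof -
  assume "lmod M" "lmod N" then interpret M: lmod M + N: lmod N .
  show ?thesis by (rule module_homsI) auto
qed

lemma add_homs:
  assumes "lmod M" "lmod N" and f: "f \<in> module_homs M N" and g: "g \<in> module_homs M N"
  shows "(\<lambda>x\<in>carrier M. f x \<oplus>\<^bsub>N\<^esub> g x) \<in> module_homs M N"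
proof -
  interpret M: lmod M + N: lmod N by fact+
  show ?thesis by (rule module_homsI)
      (use module_homsD(2-4)[OF f] module_homsD(2-4)[OF g] in \<open>auto simp: N.a_ac N.smult_r_distr\<close>)
qed

lemma minus_homs:
  assumes "lmod M" "lmod N" and f: "f \<in> module_homs M N"
  shows "(\<lambda>x\<in>carrier M. \<ominus>\<^bsub>N\<^esub> f x) \<in> module_homs M N"
proof -
  interpret M: lmod M + N: lmod N by fact+
  show ?thesis by (rule module_homsI)
      (use module_homsD(2-4)[OF f] in \<open>auto simp: N.smult_minus N.minus_add\<close>)
qed

lemma fg_hom_comm_group:
  fixes M N :: "('r::ring_1, 'm) module"
  assumes fg: "fg_module M" "fg_module N" shows "comm_group (hom_group fg_modules M N)"
proof -
  let ?C = "fg_modules :: (('r, 'm) module, ('r, 'm) module_arr) cat"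
  have M: "lmod M" and N: "lmod N" using fg fg_lmod by auto
  interpret M: lmod M + N: lmod N by fact+
  have hom: "(M, N, f) \<in> Hom ?C M N \<longleftrightarrow> f \<in> module_homs M N" for f using fg by (simp add: fg_Hom)
  show "comm_group (hom_group ?C M N)"
  proof (rule comm_groupI)
    have elem: "\<exists>f. x = (M, N, f) \<and> f \<in> module_homs M N" if "x \<in> carrier (hom_group ?C M N)" for x
      using that by (auto simp: hom_group_def fg_Hom)
    fix x y assume "x \<in> carrier (hom_group ?C M N)" "y \<in> carrier (hom_group ?C M N)"
    then obtain f g where xy: "x = (M, N, f)" "y = (M, N, g)"
      and f: "f \<in> module_homs M N" and g: "g \<in> module_homs M N" using elem by blast
    note a = module_homsD(2)[OF f] module_homsD(2)[OF g]
    show "x \<otimes>\<^bsub>hom_group ?C M N\<^esub> y \<in> carrier (hom_group ?C M N)"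
      using add_homs[OF M N f g] by (simp add: hom_group_def xy hom)
    show "x \<otimes>\<^bsub>hom_group ?C M N\<^esub> y = y \<otimes>\<^bsub>hom_group ?C M N\<^esub> x"
      using a by (auto simp: hom_group_def xy fun_eq_iff N.a_comm)
    fix z assume "z \<in> carrier (hom_group ?C M N)"
    then obtain h where z: "z = (M, N, h)" and h: "h \<in> module_homs M N" using elem by blast
    show "x \<otimes>\<^bsub>hom_group ?C M N\<^esub> y \<otimes>\<^bsub>hom_group ?C M N\<^esub> z = x \<otimes>\<^bsub>hom_group ?C M N\<^esub> (y \<otimes>\<^bsub>hom_group ?C M N\<^esub> z)"
      using a module_homsD(2)[OF h] by (auto simp: hom_group_def xy z fun_eq_iff N.a_assoc)
  next
    show "\<one>\<^bsub>hom_group ?C M N\<^esub> \<in> carrier (hom_group ?C M N)" using zero_homs[OF M N] by (simp add: hom_group_def hom)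
    fix x assume "x \<in> carrier (hom_group ?C M N)"
    then obtain f where x: "x = (M, N, f)" and f: "f \<in> module_homs M N" by (auto simp: hom_group_def fg_Hom)
    note f' = module_homsD(1,2)[OF f]
    show "\<one>\<^bsub>hom_group ?C M N\<^esub> \<otimes>\<^bsub>hom_group ?C M N\<^esub> x = x"
      using f' by (auto simp: hom_group_def x fun_eq_iff extensional_def)
    have "(M, N, \<lambda>x\<in>carrier M. \<ominus>\<^bsub>N\<^esub> f x) \<in> carrier (hom_group ?C M N)"
      using minus_homs[OF M N f] by (simp add: hom_group_def hom)
    moreover have "(M, N, \<lambda>x\<in>carrier M. \<ominus>\<^bsub>N\<^esub> f x) \<otimes>\<^bsub>hom_group ?C M N\<^esub> x = \<one>\<^bsub>hom_group ?C M N\<^esub>"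
      using f' by (auto simp: hom_group_def x fun_eq_iff N.l_neg)
    ultimately show "\<exists>y\<in>carrier (hom_group ?C M N). y \<otimes>\<^bsub>hom_group ?C M N\<^esub> x = \<one>\<^bsub>hom_group ?C M N\<^esub>" by blast
  qed
qed

lemma fg_category: "category (fg_modules :: (('r::ring_1, 'm) module, ('r, 'm) module_arr) cat)"
proof
  let ?C = "fg_modules :: (('r, 'm) module, ('r, 'm) module_arr) cat"
  fix \<phi> M N assume p: "\<phi> \<in> Hom ?C M N"
  show "M \<in> Ob ?C \<and> N \<in> Ob ?C" using p by (auto simp: fg_Hom)
  show "M = M' \<and> N = N'" if "\<phi> \<in> Hom ?C M' N'" for M' N' using p that by (auto simp: fg_Hom)
  obtain f where f: "\<phi> = (M, N, f)" "fg_module M" "fg_module N" "f \<in> module_homs M N" using p fg_Hom by blast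
  have M: "lmod M" and N: "lmod N" using f fg_lmod by auto
  note f' = module_homsD[OF f(4)]
  show "\<phi> \<cdot>\<^bsub>?C\<^esub> Idn ?C M = \<phi>" "Idn ?C N \<cdot>\<^bsub>?C\<^esub> \<phi> = \<phi>"
    using f' by (auto simp: f(1) compose_def fun_eq_iff extensional_def)
  fix \<psi> P assume q: "\<psi> \<in> Hom ?C N P"
  obtain g where g: "\<psi> = (N, P, g)" "fg_module P" "g \<in> module_homs N P" using q fg_Hom by blast
  have P: "lmod P" using g fg_lmod by auto
  note g' = module_homsD[OF g(3)]
  show "\<psi> \<cdot>\<^bsub>?C\<^esub> \<phi> \<in> Hom ?C M P" unfolding f(1) g(1) fg_Hom using f g compose_homs[OF M f(4) g(3)] by simp
  show "(\<chi> \<cdot>\<^bsub>?C\<^esub> \<psi>) \<cdot>\<^bsub>?C\<^esub> \<phi> = \<chi> \<cdot>\<^bsub>?C\<^esub> (\<psi> \<cdot>\<^bsub>?C\<^esub> \<phi>)" if "\<chi> \<in> Hom ?C P Q" for \<chi> Q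
    using that f' by (auto simp: fg_Hom f(1) g(1) compose_def fun_eq_iff)
next
  let ?C = "fg_modules :: (('r, 'm) module, ('r, 'm) module_arr) cat"
  fix M assume "M \<in> Ob ?C"
  then have "fg_module M" by simp
  then show "Idn ?C M \<in> Hom ?C M M" using id_homs[OF fg_lmod] by (auto simp: fg_Hom)
qed

lemma fg_preadditive: "preadditive_category (fg_modules :: (('r::ring_1, 'm) module, ('r, 'm) module_arr) cat)"
proof (intro preadditive_category.intro preadditive_category_axioms.intro fg_category)
  let ?C = "fg_modules :: (('r, 'm) module, ('r, 'm) module_arr) cat"
  show "comm_group (hom_group ?C M N)" if "M \<in> Ob ?C" "N \<in> Ob ?C" for M N
    using that by (simp add: fg_hom_comm_group)
  fix \<phi> \<psi> M N P assume p: "\<phi> \<in> Hom ?C M N" and q: "\<psi> \<in> Hom ?C N P"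
  obtain f where f: "\<phi> = (M, N, f)" "f \<in> module_homs M N" using p fg_Hom by blast
  obtain g where g: "\<psi> = (N, P, g)" "g \<in> module_homs N P" using q fg_Hom by blast
  note f' = module_homsD[OF f(2)] and g' = module_homsD[OF g(2)]
  show "(\<psi> \<boxplus>\<^bsub>?C\<^esub> \<psi>') \<cdot>\<^bsub>?C\<^esub> \<phi> = \<psi> \<cdot>\<^bsub>?C\<^esub> \<phi> \<boxplus>\<^bsub>?C\<^esub> \<psi>' \<cdot>\<^bsub>?C\<^esub> \<phi>" if "\<psi>' \<in> Hom ?C N P" for \<psi>'
    using that f' by (auto simp: fg_Hom f(1) g(1) compose_def fun_eq_iff)
  show "\<psi> \<cdot>\<^bsub>?C\<^esub> (\<phi> \<boxplus>\<^bsub>?C\<^esub> \<phi>') = \<psi> \<cdot>\<^bsub>?C\<^esub> \<phi> \<boxplus>\<^bsub>?C\<^esub> \<psi> \<cdot>\<^bsub>?C\<^esub> \<phi>'" if p': "\<phi>' \<in> Hom ?C M N" for \<phi>'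
  proof -
    obtain f2 where f2: "\<phi>' = (M, N, f2)" "f2 \<in> module_homs M N" using p' fg_Hom by blast
    show ?thesis using module_homsD(2)[OF f2(2)] f'(2) g'(3) by (auto simp: f(1) f2(1) g(1) compose_def fun_eq_iff)
  qed
qed

lemma fg_kernelI:
  assumes fg: "fg_module K" "fg_module X" "fg_module Y" and f: "f \<in> module_homs X Y" and k: "k \<in> module_homs K X"
    and inj: "inj_on k (carrier K)" and im: "k ` carrier K = {x \<in> carrier X. f x = \<zero>\<^bsub>Y\<^esub>}"
  shows "is_kernel fg_modules X Y (X, Y, f) K (K, X, k)"
  unfolding is_kernel_def
proof (intro conjI allI ballI impI)
  have K: "lmod K" and X: "lmod X" and Y: "lmod Y" using fg fg_lmod by auto
  interpret K: lmod K by fact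
  note k' = module_homsD[OF k]
  show "(K, X, k) \<in> Hom fg_modules K X" using fg k by (simp add: fg_Hom)
  show "(X, Y, f) \<cdot>\<^bsub>fg_modules\<^esub> (K, X, k) = Nul fg_modules K Y" using im by (auto simp: compose_def fun_eq_iff)
  fix W \<gamma> assume g: "\<gamma> \<in> Hom fg_modules W X" "(X, Y, f) \<cdot>\<^bsub>fg_modules\<^esub> \<gamma> = Nul fg_modules W Y"
  obtain g where g: "\<gamma> = (W, X, g)" "fg_module W" "g \<in> module_homs W X" and fg0: "(X, Y, f) \<cdot>\<^bsub>fg_modules\<^esub> (W, X, g) = Nul fg_modules W Y"
    using g fg_Hom by metis
  note g' = module_homsD[OF g(3)]
  interpret W: lmod W using g(2) fg_lmod by blast
  have z: "f (g w) = \<zero>\<^bsub>Y\<^esub>" if "w \<in> carrier W" for w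
    using fg0 that by (auto simp: compose_def fun_eq_iff) metis
  have im': "g w \<in> k ` carrier K" if "w \<in> carrier W" for w unfolding im using z[OF that] g'(2)[OF that] by blast
  define h where "h = (\<lambda>w\<in>carrier W. inv_into (carrier K) k (g w))"
  have h: "h w \<in> carrier K" "k (h w) = g w" if "w \<in> carrier W" for w
    using im'[OF that] inv_into_into[of "g w" k "carrier K"] f_inv_into_f[of "g w" k "carrier K"] that by (simp_all add: h_def)
  have hh: "h \<in> module_homs W K"
  proof (rule module_homsI)
    show "h \<in> extensional (carrier W)" by (simp add: h_def)
    show "h x \<in> carrier K" if "x \<in> carrier W" for x using h that by blast
    show "h (x \<oplus>\<^bsub>W\<^esub> y) = h x \<oplus>\<^bsub>K\<^esub> h y" if "x \<in> carrier W" "y \<in> carrier W" for x y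
      by (rule inj_onD[OF inj]) (use that h k' g' in simp_all)
    show "h (r \<odot>\<^bsub>W\<^esub> x) = r \<odot>\<^bsub>K\<^esub> h x" if "x \<in> carrier W" for x r
      by (rule inj_onD[OF inj]) (use that h k' g' in simp_all)
  qed
  show "\<exists>!h. h \<in> Hom fg_modules W K \<and> (K, X, k) \<cdot>\<^bsub>fg_modules\<^esub> h = \<gamma>"
  proof (rule ex1I)
    have "compose (carrier W) k h = g"
      using g'(1) h by (auto simp: compose_def fun_eq_iff extensional_def)
    then show "(W, K, h) \<in> Hom fg_modules W K \<and> (K, X, k) \<cdot>\<^bsub>fg_modules\<^esub> (W, K, h) = \<gamma>"
      using hh g fg by (simp add: fg_Hom)
    fix \<eta> assume e: "\<eta> \<in> Hom fg_modules W K \<and> (K, X, k) \<cdot>\<^bsub>fg_modules\<^esub> \<eta> = \<gamma>"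
    then obtain h2 where h2: "\<eta> = (W, K, h2)" "h2 \<in> module_homs W K" using fg_Hom by metis
    have c: "compose (carrier W) k h2 = g" using e unfolding h2(1) g(1) by simp
    have "h2 = h"
    proof (rule module_homs_eqI[OF h2(2) hh])
      fix w assume w: "w \<in> carrier W"
      have "k (h2 w) = g w" using c w by (auto simp: compose_def)
      then show "h2 w = h w" using inj_onD[OF inj, of "h2 w" "h w"] h[OF w] module_homsD(2)[OF h2(2) w] by simp
    qed
    then show "\<eta> = (W, K, h)" using h2(1) by simp
  qed
qed

text \<open>An arrow \<open>g\<close> that vanishes on the image of \<open>f\<close> takes equal values on elements with the same image under \<open>q\<close>, so it
  descends along any section of \<open>q\<close>.\<close>

lemma fg_cokernelI:
  assumes fg: "fg_module X" "fg_module Y" "fg_module Q" and f: "f \<in> module_homs X Y" and q: "q \<in> module_homs Y Q"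
    and surj: "q ` carrier Y = carrier Q" and ker: "\<And>y. y \<in> carrier Y \<Longrightarrow> q y = \<zero>\<^bsub>Q\<^esub> \<longleftrightarrow> y \<in> f ` carrier X"
  shows "is_cokernel fg_modules X Y (X, Y, f) Q (Y, Q, q)"
  unfolding is_cokernel_def
proof (intro conjI allI ballI impI)
  have X: "lmod X" and Y: "lmod Y" and Q: "lmod Q" using fg fg_lmod by auto
  interpret Y: lmod Y by fact
  interpret Q: lmod Q by fact
  note q' = module_homsD[OF q] and f' = module_homsD[OF f]
  show "(Y, Q, q) \<in> Hom fg_modules Y Q" using fg q by (simp add: fg_Hom)
  show "(Y, Q, q) \<cdot>\<^bsub>fg_modules\<^esub> (X, Y, f) = Nul fg_modules X Q" using ker f' by (auto simp: compose_def fun_eq_iff)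
  fix W \<gamma> assume g: "\<gamma> \<in> Hom fg_modules Y W" "\<gamma> \<cdot>\<^bsub>fg_modules\<^esub> (X, Y, f) = Nul fg_modules X W"
  obtain g where g: "\<gamma> = (Y, W, g)" "fg_module W" "g \<in> module_homs Y W" and fg0: "(Y, W, g) \<cdot>\<^bsub>fg_modules\<^esub> (X, Y, f) = Nul fg_modules X W"
    using g fg_Hom by metis
  note g' = module_homsD[OF g(3)]
  have W: "lmod W" using g(2) fg_lmod by blast
  interpret W: lmod W by fact
  have z: "g (f x) = \<zero>\<^bsub>W\<^esub>" if "x \<in> carrier X" for x
    using fg0 that by (auto simp: compose_def fun_eq_iff) metis
  have cong: "g y = g y'" if y: "y \<in> carrier Y" "y' \<in> carrier Y" "q y = q y'" for y y'
  proof -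
    have "q (y \<ominus>\<^bsub>Y\<^esub> y') = \<zero>\<^bsub>Q\<^esub>" unfolding module_hom_minus[OF Y Q q y(1,2)] y(3) using q'(2)[OF y(2)] by (simp add: a_minus_def Q.r_neg)
    then obtain x where x: "x \<in> carrier X" "y \<ominus>\<^bsub>Y\<^esub> y' = f x" using ker[of "y \<ominus>\<^bsub>Y\<^esub> y'"] y by auto
    have "g y \<ominus>\<^bsub>W\<^esub> g y' = \<zero>\<^bsub>W\<^esub>" unfolding module_hom_minus[OF Y W g(3) y(1,2), symmetric] x(2) using z[OF x(1)] .
    then show ?thesis using g'(2)[OF y(1)] g'(2)[OF y(2)] W.minus_equality[of "g y" "\<ominus>\<^bsub>W\<^esub> g y'"] by (simp add: a_minus_def)
  qed
  define h where "h = (\<lambda>a\<in>carrier Q. g (inv_into (carrier Y) q a))"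
  have hq: "h (q y) = g y" if y: "y \<in> carrier Y" for y
  proof -
    have a: "q y \<in> q ` carrier Y" using y by blast
    have "h (q y) = g (inv_into (carrier Y) q (q y))" using q'(2)[OF y] by (simp add: h_def)
    also have "\<dots> = g y" using inv_into_into[OF a] f_inv_into_f[OF a] y by (intro cong) simp_all
    finally show ?thesis .
  qed
  have hh: "h \<in> module_homs Q W"
  proof (rule module_homsI)
    show "h \<in> extensional (carrier Q)" by (simp add: h_def)
    show "h x \<in> carrier W" if "x \<in> carrier Q" for x using that hq g'(2) unfolding surj[symmetric] by auto
    show "h (x \<oplus>\<^bsub>Q\<^esub> y) = h x \<oplus>\<^bsub>W\<^esub> h y" if "x \<in> carrier Q" "y \<in> carrier Q" for x y
    proof -
      obtain u v where "u \<in> carrier Y" "v \<in> carrier Y" "x = q u" "y = q v" using \<open>x \<in> carrier Q\<close> \<open>y \<in> carrier Q\<close> unfolding surj[symmetric] by blast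
      then show ?thesis using q'(3)[of u v] hq[of "u \<oplus>\<^bsub>Y\<^esub> v"] hq[of u] hq[of v] g'(3)[of u v] by simp
    qed
    show "h (r \<odot>\<^bsub>Q\<^esub> x) = r \<odot>\<^bsub>W\<^esub> h x" if xQ: "x \<in> carrier Q" for x r
    proof -
      obtain u where u: "u \<in> carrier Y" and x: "x = q u" using xQ unfolding surj[symmetric] by blast
      have "h (r \<odot>\<^bsub>Q\<^esub> q u) = h (q (r \<odot>\<^bsub>Y\<^esub> u))" by (simp only: q'(4)[OF u])
      also have "\<dots> = r \<odot>\<^bsub>W\<^esub> g u" using hq[of "r \<odot>\<^bsub>Y\<^esub> u"] g'(4)[OF u] u by simp
      finally show ?thesis unfolding x hq[OF u] .
    qed
  qed
  show "\<exists>!h. h \<in> Hom fg_modules Q W \<and> h \<cdot>\<^bsub>fg_modules\<^esub> (Y, Q, q) = \<gamma>"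
  proof (rule ex1I)
    have "compose (carrier Y) h q = g"
      using g'(1) hq by (auto simp: compose_def fun_eq_iff extensional_def)
    then show "(Q, W, h) \<in> Hom fg_modules Q W \<and> (Q, W, h) \<cdot>\<^bsub>fg_modules\<^esub> (Y, Q, q) = \<gamma>"
      using hh g fg by (simp add: fg_Hom)
    fix \<eta> assume e: "\<eta> \<in> Hom fg_modules Q W \<and> \<eta> \<cdot>\<^bsub>fg_modules\<^esub> (Y, Q, q) = \<gamma>"
    then obtain h2 where h2: "\<eta> = (Q, W, h2)" "h2 \<in> module_homs Q W" using fg_Hom by metis
    have c: "compose (carrier Y) h2 q = g" using e unfolding h2(1) g(1) by simp
    have "h2 = h"
    proof (rule module_homs_eqI[OF h2(2) hh])
      fix a assume "a \<in> carrier Q"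
      then obtain y where y: "y \<in> carrier Y" "a = q y" unfolding surj[symmetric] by blast
      have "h2 (q y) = g y" using c y by (auto simp: compose_def)
      then show "h2 a = h a" using hq y by simp
    qed
    then show "\<eta> = (Q, W, h)" using h2(1) by simp
  qed
qed

lemma kernel_submodule:
  assumes "lmod X" "lmod Y" "f \<in> module_homs X Y" shows "left_submodule X {x \<in> carrier X. f x = \<zero>\<^bsub>Y\<^esub>}"
proof -
  interpret Y: lmod Y by fact
  have "left_submodule Y {\<zero>\<^bsub>Y\<^esub>}" unfolding left_submodule_def by simp
  from vimage_submodule[OF assms this] show ?thesis by simp
qed

lemma inclusion_homs:
  assumes "lmod X" "left_submodule X P" shows "(\<lambda>x\<in>P. x) \<in> module_homs (X\<lparr>carrier := P\<rparr>) X"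
  by (rule module_homsI) (use left_submoduleD[OF assms(2)] in auto)

lemma fg_kernel:
  fixes X Y :: "('r::ring_1, 'm) module"
  assumes noeth: "left_noetherian TYPE('r)" and fg: "fg_module X" "fg_module Y"
    and f: "f \<in> module_homs X Y"
  defines "K \<equiv> X\<lparr>carrier := {x \<in> carrier X. f x = \<zero>\<^bsub>Y\<^esub>}\<rparr>"
  shows "fg_module K" "(\<lambda>x\<in>carrier K. x) \<in> module_homs K X"
    "is_kernel fg_modules X Y (X, Y, f) K (K, X, \<lambda>x\<in>carrier K. x)"
proof -
  have X: "lmod X" and Y: "lmod Y" using fg fg_lmod by auto
  note s = kernel_submodule[OF X Y f]
  show K: "fg_module K" unfolding K_def by (rule lmod.submodule_fg[OF X noeth fg(1) s])
  show k: "(\<lambda>x\<in>carrier K. x) \<in> module_homs K X" using inclusion_homs[OF X s] unfolding K_def by simp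
  show "is_kernel fg_modules X Y (X, Y, f) K (K, X, \<lambda>x\<in>carrier K. x)"
    by (rule fg_kernelI[OF K fg f k]) (auto simp: K_def inj_on_def)
qed

lemma fg_cokernel:
  assumes fg: "fg_module X" "fg_module Y" and f: "f \<in> module_homs X Y"
  obtains Q q where "fg_module Q" "q \<in> module_homs Y Q" "q ` carrier Y = carrier Q"
    "\<And>y. y \<in> carrier Y \<Longrightarrow> q y = \<zero>\<^bsub>Q\<^esub> \<longleftrightarrow> y \<in> f ` carrier X"
    "is_cokernel fg_modules X Y (X, Y, f) Q (Y, Q, q)"
proof -
  have X: "lmod X" and Y: "lmod Y" using fg fg_lmod by auto
  obtain Q q where q: "left_module Q" "q \<in> module_homs Y Q" "q ` carrier Y = carrier Q"
    "\<And>y. y \<in> carrier Y \<Longrightarrow> q y = \<zero>\<^bsub>Q\<^esub> \<longleftrightarrow> y \<in> f ` carrier X"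
    using quotient_module[OF Y image_submodule[OF X Y f lmod.carrier_submodule[OF X]]] by metis
  have Q: "fg_module Q" by (rule surjective_image_fg[OF fg(2) q(1-3)])
  show ?thesis using that[OF Q q(2,3)] q(4) fg_cokernelI[OF fg Q f q(2-4)] by blast
qed

text \<open>The inclusion of the kernel is annihilated by \<open>m\<close>, as the zero arrow is; hence the kernel is zero.\<close>

lemma fg_mono_inj:
  fixes X Y :: "('r::ring_1, 'm) module"
  assumes noeth: "left_noetherian TYPE('r)" and m: "is_mono fg_modules X Y (X, Y, m)"
  shows "inj_on m (carrier X)"
proof (rule inj_onI)
  have fg: "fg_module X" "fg_module Y" and m': "m \<in> module_homs X Y" using m by (auto simp: is_mono_def fg_Hom)
  have X: "lmod X" and Y: "lmod Y" using fg fg_lmod by auto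
  interpret X: lmod X by fact
  interpret Y: lmod Y by fact
  let ?K = "X\<lparr>carrier := {x \<in> carrier X. m x = \<zero>\<^bsub>Y\<^esub>}\<rparr>"
  note k = fg_kernel[OF noeth fg m']
  have h: "(?K, X, \<lambda>x\<in>carrier ?K. x) \<in> Hom fg_modules ?K X" using k(1,2) fg by (simp add: fg_Hom)
  have n: "Nul fg_modules ?K X \<in> Hom fg_modules ?K X" using zero_homs[OF fg_lmod[OF k(1)] X] k(1) fg by (simp add: fg_Hom)
  have "(X, Y, m) \<cdot>\<^bsub>fg_modules\<^esub> (?K, X, \<lambda>x\<in>carrier ?K. x) = (X, Y, m) \<cdot>\<^bsub>fg_modules\<^esub> Nul fg_modules ?K X"
    using module_hom_zero[OF X Y m'] by (auto simp: compose_def fun_eq_iff)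
  then have "(?K, X, \<lambda>x\<in>carrier ?K. x) = Nul fg_modules ?K X" using m h n unfolding is_mono_def by blast
  then have z: "x = \<zero>\<^bsub>X\<^esub>" if "x \<in> carrier X" "m x = \<zero>\<^bsub>Y\<^esub>" for x using that by (auto simp: fun_eq_iff) metis
  fix x y assume xy: "x \<in> carrier X" "y \<in> carrier X" "m x = m y"
  have "m (x \<ominus>\<^bsub>X\<^esub> y) = \<zero>\<^bsub>Y\<^esub>" unfolding module_hom_minus[OF X Y m' xy(1,2)] xy(3)
    using module_homsD(2)[OF m' xy(2)] by (simp add: a_minus_def Y.r_neg)
  then have "x \<ominus>\<^bsub>X\<^esub> y = \<zero>\<^bsub>X\<^esub>" using z xy(1,2) by simp
  then show "x = y" using X.minus_equality[of x "\<ominus>\<^bsub>X\<^esub> y"] xy(1,2) by (simp add: a_minus_def)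
qed

text \<open>The projection to the cokernel annihilates \<open>e\<close>, hence is zero.\<close>

lemma fg_epi_surj:
  assumes e: "is_epi fg_modules X Y (X, Y, e)"
  shows "e ` carrier X = carrier Y"
proof
  have fg: "fg_module X" "fg_module Y" and e': "e \<in> module_homs X Y" using e by (auto simp: is_epi_def fg_Hom)
  show "e ` carrier X \<subseteq> carrier Y" using module_homsD(2)[OF e'] by blast
  obtain Q q where Q: "fg_module Q" "q \<in> module_homs Y Q" "q ` carrier Y = carrier Q"
    "\<And>y. y \<in> carrier Y \<Longrightarrow> q y = \<zero>\<^bsub>Q\<^esub> \<longleftrightarrow> y \<in> e ` carrier X" using fg_cokernel[OF fg e'] by metis
  have h: "(Y, Q, q) \<in> Hom fg_modules Y Q" using Q fg by (simp add: fg_Hom)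
  have n: "Nul fg_modules Y Q \<in> Hom fg_modules Y Q" using zero_homs[OF fg_lmod[OF fg(2)] fg_lmod[OF Q(1)]] Q(1) fg by (simp add: fg_Hom)
  have "(Y, Q, q) \<cdot>\<^bsub>fg_modules\<^esub> (X, Y, e) = Nul fg_modules Y Q \<cdot>\<^bsub>fg_modules\<^esub> (X, Y, e)"
    using Q(4) module_homsD(2)[OF e'] by (auto simp: compose_def fun_eq_iff)
  then have "(Y, Q, q) = Nul fg_modules Y Q" using e h n unfolding is_epi_def by blast
  then have "q y = \<zero>\<^bsub>Q\<^esub>" if "y \<in> carrier Y" for y using that by simp
  then show "carrier Y \<subseteq> e ` carrier X" using Q(4) by blast
qed

text \<open>The single element of the zero module is an arbitrary value of the type.\<close>

lemma zero_module:
  obtains Z :: "('r::ring_1, 'm) module" where "fg_module Z" "carrier Z = {\<zero>\<^bsub>Z\<^esub>}"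
proof -
  define Z :: "('r, 'm) module" where "Z = \<lparr>carrier = {undefined}, monoid.mult = undefined, one = undefined,
    zero = undefined, add = (\<lambda>_ _. undefined), smult = (\<lambda>_ _. undefined)\<rparr>"
  have Z: "left_module Z" by (rule left_moduleI) (simp_all add: Z_def)
  then have Z': "lmod Z" using left_module_iff by blast
  have "left_submodule Z hull (carrier Z) = carrier Z" by (rule hull_same) (rule lmod.carrier_submodule[OF Z'])
  then have "fg_module Z" unfolding fg_module_def using Z by (intro conjI exI[of _ "carrier Z"]) (simp_all add: Z_def)
  then show ?thesis by (rule that) (simp add: Z_def)
qed

lemma fg_zero_object:
  fixes Z :: "('r::ring_1, 'm) module"
  assumes Z: "fg_module Z" "carrier Z = {\<zero>\<^bsub>Z\<^esub>}" shows "zero_object fg_modules Z"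
  unfolding zero_object_def
proof (intro conjI ballI)
  show "Z \<in> Ob fg_modules" using Z by simp
  fix X :: "('r, 'm) module" assume "X \<in> Ob fg_modules"
  then have X: "fg_module X" by simp
  note l = fg_lmod[OF X] fg_lmod[OF Z(1)]
  have n: "Nul fg_modules X Z \<in> Hom fg_modules X Z" using zero_homs[OF l] X Z by (simp add: fg_Hom)
  have n': "Nul fg_modules Z X \<in> Hom fg_modules Z X" using zero_homs[OF l(2,1)] X Z by (simp add: fg_Hom)
  have "\<phi> = Nul fg_modules X Z" if p: "\<phi> \<in> Hom fg_modules X Z" for \<phi>
  proof -
    obtain f where f: "\<phi> = (X, Z, f)" "f \<in> module_homs X Z" using p fg_Hom by blast
    have "f = (\<lambda>x\<in>carrier X. \<zero>\<^bsub>Z\<^esub>)"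
      by (rule module_homs_eqI[OF f(2) zero_homs[OF l]]) (use module_homsD(2)[OF f(2)] Z(2) in auto)
    then show ?thesis using f(1) by simp
  qed
  then show "\<exists>!f. f \<in> Hom fg_modules X Z" using n by blast
  have "\<phi> = Nul fg_modules Z X" if p: "\<phi> \<in> Hom fg_modules Z X" for \<phi>
  proof -
    obtain f where f: "\<phi> = (Z, X, f)" "f \<in> module_homs Z X" using p fg_Hom by blast
    have "f = (\<lambda>x\<in>carrier Z. \<zero>\<^bsub>X\<^esub>)"
      by (rule module_homs_eqI[OF f(2) zero_homs[OF l(2,1)]]) (use module_hom_zero[OF l(2,1) f(2)] Z(2) in auto)
    then show ?thesis using f(1) by simp
  qed
  then show "\<exists>!f. f \<in> Hom fg_modules Z X" using n' by blast
qed

text \<open>The product module lives on pairs. The concatenated coordinate lists embed it into the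
  type of elements.\<close>

lemma fg_biproduct:
  fixes X Y :: "('r::ring_1, 'm) module"
  assumes large: "large_enough TYPE('r) TYPE('m)" and fg: "fg_module X" "fg_module Y"
  shows "\<exists>W i1 i2 p1 p2. is_biproduct fg_modules X Y W i1 i2 p1 p2"
proof -
  have X: "lmod X" and Y: "lmod Y" using fg fg_lmod by auto
  interpret X: lmod X by fact
  interpret Y: lmod Y by fact
  obtain \<epsilon> :: "'r list \<Rightarrow> 'm" where \<epsilon>: "inj \<epsilon>" using large unfolding large_enough_def by blast
  obtain n and \<phi> :: "'m \<Rightarrow> 'r list" where \<phi>: "\<And>x. x \<in> carrier X \<Longrightarrow> length (\<phi> x) = n" "inj_on \<phi> (carrier X)"
    using X.fg_coordinates[OF fg(1)] by metis
  obtain k and \<psi> :: "'m \<Rightarrow> 'r list" where \<psi>: "\<And>x. x \<in> carrier Y \<Longrightarrow> length (\<psi> x) = k" "inj_on \<psi> (carrier Y)"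
    using Y.fg_coordinates[OF fg(2)] by metis
  define e where "e = (\<lambda>(x, y). \<epsilon> (\<phi> x @ \<psi> y))"
  let ?P = "prod_module X Y"
  have e: "inj_on e (carrier ?P)"
    by (rule inj_onI) (use \<phi> \<psi> \<epsilon> in \<open>auto simp: e_def inj_eq inj_on_eq_iff\<close>)
  have P: "fg_module ?P" by (rule prod_module_fg[OF fg])
  have P': "lmod ?P" using P fg_lmod by blast
  define W where "W = transport e ?P"
  have W: "fg_module W" using transport_fg[OF P' e] P unfolding fg_module_def W_def by metis
  have Ws: "carrier W = e ` (carrier X \<times> carrier Y)"
    "\<And>x y x' y'. x \<in> carrier X \<Longrightarrow> y \<in> carrier Y \<Longrightarrow> x' \<in> carrier X \<Longrightarrow> y' \<in> carrier Y \<Longrightarrow>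
      e (x, y) \<oplus>\<^bsub>W\<^esub> e (x', y') = e (x \<oplus>\<^bsub>X\<^esub> x', y \<oplus>\<^bsub>Y\<^esub> y')"
    "\<And>x y r. x \<in> carrier X \<Longrightarrow> y \<in> carrier Y \<Longrightarrow> r \<odot>\<^bsub>W\<^esub> e (x, y) = e (r \<odot>\<^bsub>X\<^esub> x, r \<odot>\<^bsub>Y\<^esub> y)"
    unfolding W_def using transport_simps[OF P' e] by simp_all
  define d where "d = inv_into (carrier X \<times> carrier Y) e"
  have d: "d (e (x, y)) = (x, y)" if "x \<in> carrier X" "y \<in> carrier Y" for x y
    unfolding d_def using e that by (intro inv_into_f_f) simp_all
  define i1 i2 p1 p2 where "i1 = (\<lambda>x\<in>carrier X. e (x, \<zero>\<^bsub>Y\<^esub>))" and "i2 = (\<lambda>y\<in>carrier Y. e (\<zero>\<^bsub>X\<^esub>, y))"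
    and "p1 = (\<lambda>w\<in>carrier W. fst (d w))" and "p2 = (\<lambda>w\<in>carrier W. snd (d w))"
  have eW: "e (x, y) \<in> carrier W" if "x \<in> carrier X" "y \<in> carrier Y" for x y using that Ws(1) by blast
  have v: "x \<in> carrier X \<Longrightarrow> i1 x = e (x, \<zero>\<^bsub>Y\<^esub>)" "y \<in> carrier Y \<Longrightarrow> i2 y = e (\<zero>\<^bsub>X\<^esub>, y)"
    "x \<in> carrier X \<Longrightarrow> y \<in> carrier Y \<Longrightarrow> p1 (e (x, y)) = x"
    "x \<in> carrier X \<Longrightarrow> y \<in> carrier Y \<Longrightarrow> p2 (e (x, y)) = y" for x y
    unfolding i1_def i2_def p1_def p2_def using d eW by simp_all
  have elim: "\<exists>x y. x \<in> carrier X \<and> y \<in> carrier Y \<and> w = e (x, y)" if "w \<in> carrier W" for w using that Ws(1) by auto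
  have "i1 \<in> module_homs X W"
    by (rule module_homsI) (auto simp: v eW Ws, simp add: i1_def)
  moreover have "i2 \<in> module_homs Y W"
    by (rule module_homsI) (auto simp: v eW Ws, simp add: i2_def)
  moreover have "p1 \<in> module_homs W X"
    by (rule module_homsI) (auto dest!: elim simp: v eW Ws(2,3), simp add: p1_def)
  moreover have "p2 \<in> module_homs W Y"
    by (rule module_homsI) (auto dest!: elim simp: v eW Ws(2,3), simp add: p2_def)
  moreover have "compose (carrier X) p1 i1 = (\<lambda>x\<in>carrier X. x)" "compose (carrier Y) p2 i2 = (\<lambda>x\<in>carrier Y. x)"
    "compose (carrier Y) p1 i2 = (\<lambda>x\<in>carrier Y. \<zero>\<^bsub>X\<^esub>)" "compose (carrier X) p2 i1 = (\<lambda>x\<in>carrier X. \<zero>\<^bsub>Y\<^esub>)"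
    by (auto simp: compose_def fun_eq_iff v)
  moreover have "(\<lambda>w\<in>carrier W. compose (carrier W) i1 p1 w \<oplus>\<^bsub>W\<^esub> compose (carrier W) i2 p2 w) = (\<lambda>w\<in>carrier W. w)"
    by (rule restrict_ext) (auto dest!: elim simp: compose_def v eW Ws(2))
  ultimately have "is_biproduct fg_modules X Y W (X, W, i1) (Y, W, i2) (W, X, p1) (W, Y, p2)"
    unfolding is_biproduct_def using fg W by (simp add: fg_Hom)
  then show ?thesis by blast
qed

theorem fg_modules_abelian:
  assumes noeth: "left_noetherian TYPE('r)" and large: "large_enough TYPE('r) TYPE('m)"
  shows "abelian_category (fg_modules :: (('r::ring_1, 'm) module, ('r, 'm) module_arr) cat)"
proof -
  let ?C = "fg_modules :: (('r, 'm) module, ('r, 'm) module_arr) cat"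
  interpret preadditive_category ?C by (rule fg_preadditive)
  show ?thesis
  proof
    show "\<exists>Z. zero_object ?C Z" using zero_module fg_zero_object by metis
    show "\<exists>W i1 i2 p1 p2. is_biproduct ?C X Y W i1 i2 p1 p2" if "X \<in> Ob ?C" "Y \<in> Ob ?C" for X Y
      using fg_biproduct[OF large] that by simp
    show "\<exists>K k. is_kernel ?C X Y \<phi> K k" if p: "\<phi> \<in> Hom ?C X Y" for \<phi> X Y
    proof -
      obtain f where f: "\<phi> = (X, Y, f)" "fg_module X" "fg_module Y" "f \<in> module_homs X Y"
        using p fg_Hom by blast
      show ?thesis unfolding f(1) using fg_kernel(3)[OF noeth f(2-4)] by blast
    qed
    show "\<exists>Q q. is_cokernel ?C X Y \<phi> Q q" if p: "\<phi> \<in> Hom ?C X Y" for \<phi> X Y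
    proof -
      obtain f where f: "\<phi> = (X, Y, f)" "fg_module X" "fg_module Y" "f \<in> module_homs X Y"
        using p fg_Hom by blast
      show ?thesis unfolding f(1) using fg_cokernel[OF f(2-4)] by metis
    qed
  next
    fix X Y \<mu> assume m: "is_mono ?C X Y \<mu>"
    then obtain f where f: "\<mu> = (X, Y, f)" "fg_module X" "fg_module Y" "f \<in> module_homs X Y"
      unfolding is_mono_def fg_Hom by blast
    obtain Q q where Q: "fg_module Q" "q \<in> module_homs Y Q" "\<And>y. y \<in> carrier Y \<Longrightarrow> q y = \<zero>\<^bsub>Q\<^esub> \<longleftrightarrow> y \<in> f ` carrier X"
      using fg_cokernel[OF f(2-4)] by metis
    have "f ` carrier X = {y \<in> carrier Y. q y = \<zero>\<^bsub>Q\<^esub>}" using Q(3) module_homsD(2)[OF f(4)] by blast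
    then have "is_kernel ?C Y Q (Y, Q, q) X \<mu>" unfolding f(1)
      using fg_mono_inj[OF noeth m[unfolded f(1)]] by (intro fg_kernelI[OF f(2,3) Q(1,2) f(4)])
    moreover have "(Y, Q, q) \<in> Hom ?C Y Q" using Q f by (simp add: fg_Hom)
    ultimately show "\<exists>Z. \<exists>f\<in>Hom ?C Y Z. is_kernel ?C Y Z f X \<mu>" by blast
  next
    fix X Y \<mu> assume m: "is_epi ?C X Y \<mu>"
    then obtain f where f: "\<mu> = (X, Y, f)" "fg_module X" "fg_module Y" "f \<in> module_homs X Y"
      unfolding is_epi_def fg_Hom by blast
    let ?K = "X\<lparr>carrier := {x \<in> carrier X. f x = \<zero>\<^bsub>Y\<^esub>}\<rparr>"
    note k = fg_kernel[OF noeth f(2-4)]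
    have "is_cokernel ?C ?K X (?K, X, \<lambda>x\<in>carrier ?K. x) Y \<mu>" unfolding f(1)
      by (rule fg_cokernelI[OF k(1) f(2,3) k(2) f(4) fg_epi_surj[OF m[unfolded f(1)]]]) auto
    moreover have "(?K, X, \<lambda>x\<in>carrier ?K. x) \<in> Hom ?C ?K X" using k f by (simp add: fg_Hom)
    ultimately show "\<exists>W. \<exists>f\<in>Hom ?C W X. is_cokernel ?C W X f Y \<mu>" by blast
  qed
qed

subsection \<open>A monomorphism that is not an isomorphism\<close>

definition regular_module :: "('r::ring_1, 'r) module" where
  "regular_module = \<lparr>carrier = UNIV, monoid.mult = undefined, one = undefined, zero = 0, add = (+), smult = (*)\<rparr>"

lemma regular_module_simps [simp]:
  "carrier regular_module = UNIV" "\<zero>\<^bsub>regular_module\<^esub> = 0" "x \<oplus>\<^bsub>regular_module\<^esub> y = x + y"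
  "r \<odot>\<^bsub>regular_module\<^esub> x = r * x"
  by (simp_all add: regular_module_def)

lemma regular_module_left_module: "left_module (regular_module :: ('r::ring_1, 'r) module)"
  by (rule left_moduleI) (simp_all add: algebra_simps)

lemma regular_module_generated: "left_submodule (regular_module :: ('r::ring_1, 'r) module) hull {1} = UNIV"
proof -
  have "lmod (regular_module :: ('r, 'r) module)" using regular_module_left_module left_module_iff by blast
  note h = left_submoduleD[OF lmod.hull_submodule[OF this, of "{1}"], simplified]
  have "1 \<in> left_submodule (regular_module :: ('r, 'r) module) hull {1}" using hull_subset[of "{1}"] by blast
  then have "r * 1 \<in> left_submodule (regular_module :: ('r, 'r) module) hull {1}" for r :: 'r using h(4)[of 1 r] by simp
  then show ?thesis by auto
qed

text \<open>Let \<open>u b\<close> be the inverse of \<open>b \<noteq> 0\<close> in the algebra. If all these inverses existed, \<open>a / b \<mapsto> a u(b)\<close> would embed the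
  field of fractions; it is injective because the algebra is torsion-free.\<close>

lemma ex_non_invertible_scalar:
  fixes scale :: "'k::idom \<Rightarrow> 'r::ring_1 \<Rightarrow> 'r"
  assumes alg: "algebra_over scale" and tf: "torsion_free scale" and nf: "\<not> contains_fraction_field scale"
  obtains k where "k \<noteq> 0" "1 \<notin> range (scale k)"
proof (rule ccontr)
  assume "\<not> thesis"
  then have inv: "\<And>k. k \<noteq> 0 \<Longrightarrow> 1 \<in> range (scale k)" using that by blast
  interpret S: Modules.module scale using alg unfolding algebra_over_def by blast
  have sm: "scale k (x * y) = scale k x * y" "scale k (x * y) = x * scale k y" for k x y
    using alg unfolding algebra_over_def by blast+
  have inj: "scale k x = scale k y \<Longrightarrow> k \<noteq> 0 \<Longrightarrow> x = y" for k x y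
    using tf S.scale_right_diff_distrib[of k x y] unfolding torsion_free_def by force
  define u where "u k = (SOME x. scale k x = 1)" for k
  have u: "scale k (u k) = 1" if "k \<noteq> 0" for k
  proof -
    have "\<exists>x. scale k x = 1" using inv[OF that] by (metis imageE)
    then show ?thesis unfolding u_def by (rule someI_ex)
  qed
  have cancel: "scale a (u b) = scale c (u d)" if "b \<noteq> 0" "d \<noteq> 0" "a * d = c * b" for a b c d
  proof (rule inj[of "b * d"])
    have "scale (b * d) (scale a (u b)) = scale (a * d) (scale b (u b))" by (simp add: ac_simps)
    also have "\<dots> = scale (c * b) (scale d (u d))" using that u by simp
    also have "\<dots> = scale (b * d) (scale c (u d))" by (simp add: ac_simps)
    finally show "scale (b * d) (scale a (u b)) = scale (b * d) (scale c (u d))" .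
    show "b * d \<noteq> 0" using that by simp
  qed
  have umul: "u (b * d) = u b * u d" if "b \<noteq> 0" "d \<noteq> 0" for b d
  proof (rule inj[of "b * d"])
    have "scale (b * d) (u b * u d) = scale b (scale d (u b * u d))" by simp
    also have "\<dots> = scale b (u b * scale d (u d))" by (simp only: sm(2)[of d "u b" "u d"])
    also have "\<dots> = scale b (u b) * scale d (u d)" by (rule sm(1))
    finally show "scale (b * d) (u (b * d)) = scale (b * d) (u b * u d)" using u that by simp
    show "b * d \<noteq> 0" using that by simp
  qed
  \<comment> \<open>A fraction is evaluated on an arbitrary one of its representations; \<open>cancel\<close> shows that they all agree.\<close>
  define \<phi> where "\<phi> q = scale (fst (SOME p. q = Fract (fst p) (snd p) \<and> snd p \<noteq> 0)) (u (snd (SOME p. q = Fract (fst p) (snd p) \<and> snd p \<noteq> 0)))" for q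
  have \<phi>: "\<phi> (Fract a b) = scale a (u b)" if b: "b \<noteq> 0" for a b
  proof -
    let ?p = "SOME p. Fract a b = Fract (fst p) (snd p) \<and> snd p \<noteq> 0"
    have "\<exists>p. Fract a b = Fract (fst p) (snd p) \<and> snd p \<noteq> 0" using b by (intro exI[of _ "(a, b)"]) simp
    from someI_ex[OF this] have p: "Fract a b = Fract (fst ?p) (snd ?p)" "snd ?p \<noteq> 0" by blast+
    then have "a * snd ?p = fst ?p * b" using b by (simp add: eq_fract)
    then show ?thesis unfolding \<phi>_def by (rule cancel[OF b p(2), symmetric])
  qed
  have "contains_fraction_field scale" unfolding contains_fraction_field_def
  proof (intro exI[of _ \<phi>] conjI allI)
    show "inj \<phi>"
    proof (rule injI)
      fix x y assume xy: "\<phi> x = \<phi> y"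
      obtain a b where x: "x = Fract a b" "b \<noteq> 0" by (cases x rule: Fract_cases) auto
      obtain c d where y: "y = Fract c d" "d \<noteq> 0" by (cases y rule: Fract_cases) auto
      have "scale a (u b) = scale c (u d)" using xy x y \<phi> by simp
      then have "scale (b * d) (scale a (u b)) = scale (b * d) (scale c (u d))" by simp
      moreover have "scale (b * d) (scale a (u b)) = scale (a * d) (scale b (u b))" by (simp add: ac_simps)
      moreover have "scale (b * d) (scale c (u d)) = scale (c * b) (scale d (u d))" by (simp add: ac_simps)
      ultimately have "scale (a * d) 1 = scale (c * b) 1" using u x y by simp
      then have "scale (a * d - c * b) 1 = 0" using S.scale_left_diff_distrib[of "a * d" "c * b" 1] by simp
      then have "a * d = c * b" using tf unfolding torsion_free_def by (metis eq_iff_diff_eq_0 zero_neq_one)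
      then show "x = y" using x y by (simp add: eq_fract)
    qed
    have u1: "u 1 = 1" using u[of 1] by simp
    show "\<phi> 1 = 1" using \<phi>[of 1 1] u1 by (simp add: One_fract_def)
    fix x y :: "'k fract"
    obtain a b where x: "x = Fract a b" "b \<noteq> 0" by (cases x rule: Fract_cases) auto
    obtain c d where y: "y = Fract c d" "d \<noteq> 0" by (cases y rule: Fract_cases) auto
    have ab: "scale a (u b) = scale (a * d) (u (b * d))" "scale c (u d) = scale (c * b) (u (b * d))"
      using x y by (intro cancel; simp add: ac_simps)+
    show "\<phi> (x + y) = \<phi> x + \<phi> y" using x y by (simp add: \<phi> ab S.scale_left_distrib)
    show "\<phi> (x * y) = \<phi> x * \<phi> y"
    proof -
      have "scale a (u b) * scale c (u d) = scale a (scale c (u b * u d))"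
        using sm(1)[of a "u b" "scale c (u d)"] sm(2)[of c "u b" "u d"] by simp
      then show ?thesis using x y umul by (simp add: \<phi>)
    qed
    fix k
    show "\<phi> (Fract k 1 * x) = scale k (\<phi> x)" using x by (simp add: \<phi>)
  qed
  then show False using nf by contradiction
qed

text \<open>Multiplication by a scalar \<open>k\<close> as above on the regular module is injective because the algebra is
  torsion-free, and \<open>1\<close> is not in its image.\<close>

theorem fg_modules_mono_not_iso:
  fixes scale :: "'k::idom \<Rightarrow> 'r::ring_1 \<Rightarrow> 'r"
  assumes alg: "algebra_over scale" and tf: "torsion_free scale" and nf: "\<not> contains_fraction_field scale"
    and large: "large_enough TYPE('r) TYPE('m)"
  shows "\<exists>M\<in>Ob (fg_modules :: (('r, 'm) module, ('r, 'm) module_arr) cat).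
    \<exists>f. is_mono fg_modules M M f \<and> \<not> is_isomorphism fg_modules M M f"
proof -
  obtain k where k: "k \<noteq> 0" "1 \<notin> range (scale k)" using ex_non_invertible_scalar[OF alg tf nf] .
  interpret S: Modules.module scale using alg unfolding algebra_over_def by blast
  have sm: "scale k (x * y) = x * scale k y" for x y using alg unfolding algebra_over_def by blast
  have kinj: "scale k x = scale k y \<Longrightarrow> x = y" for x y
    using tf S.scale_right_diff_distrib[of k x y] k(1) unfolding torsion_free_def by force
  obtain \<epsilon> :: "'r list \<Rightarrow> 'm" where \<epsilon>: "inj \<epsilon>" using large unfolding large_enough_def by blast
  define e where "e x = \<epsilon> [x]" for x
  have e: "inj e" unfolding e_def by (auto intro!: injI dest: injD[OF \<epsilon>])
  have R: "lmod (regular_module :: ('r, 'r) module)" using regular_module_left_module left_module_iff by blast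
  have e': "inj_on e (carrier regular_module)" using e by simp
  define M where "M = transport e regular_module"
  have M: "fg_module M" unfolding M_def by (rule transport_fg[OF R e', of "{1}"]) (simp_all add: regular_module_generated)
  have Ms: "carrier M = range e" "\<And>x y. e x \<oplus>\<^bsub>M\<^esub> e y = e (x + y)" "\<And>r x. r \<odot>\<^bsub>M\<^esub> e x = e (r * x)"
    unfolding M_def using transport_simps[OF R e'] by simp_all
  define f where "f = (\<lambda>m\<in>carrier M. e (scale k (inv_into UNIV e m)))"
  have f: "f (e x) = e (scale k x)" for x unfolding f_def using Ms(1) e by simp
  have fh: "f \<in> module_homs M M"
  proof (rule module_homsI)
    show "f \<in> extensional (carrier M)" by (simp add: f_def)
  qed (auto simp: Ms f S.scale_right_distrib sm)
  have finj: "inj_on f (carrier M)" unfolding Ms(1) by (rule inj_onI) (auto simp: f inj_eq[OF e] dest: kinj)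
  have "is_mono fg_modules M M (M, M, f)" unfolding is_mono_def
  proof (intro conjI allI ballI impI)
    show "(M, M, f) \<in> Hom fg_modules M M" using M fh by (simp add: fg_Hom)
    fix W \<gamma> \<eta> assume a: "\<gamma> \<in> Hom fg_modules W M" "\<eta> \<in> Hom fg_modules W M" "(M, M, f) \<cdot>\<^bsub>fg_modules\<^esub> \<gamma> = (M, M, f) \<cdot>\<^bsub>fg_modules\<^esub> \<eta>"
    obtain g where g: "\<gamma> = (W, M, g)" "g \<in> module_homs W M" using a(1) fg_Hom by blast
    obtain h where h: "\<eta> = (W, M, h)" "h \<in> module_homs W M" using a(2) fg_Hom by blast
    have c: "compose (carrier W) f g = compose (carrier W) f h" using a(3) unfolding g(1) h(1) by simp
    have "g = h"
    proof (rule module_homs_eqI[OF g(2) h(2)])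
      fix w assume w: "w \<in> carrier W"
      have "f (g w) = f (h w)" using fun_cong[OF c, of w] w by (simp add: compose_def)
      then show "g w = h w" using inj_onD[OF finj] module_homsD(2)[OF g(2) w] module_homsD(2)[OF h(2) w] by blast
    qed
    then show "\<gamma> = \<eta>" using g h by simp
  qed
  moreover have "\<not> is_isomorphism fg_modules M M (M, M, f)"
  proof
    assume "is_isomorphism fg_modules M M (M, M, f)"
    then obtain \<gamma> where \<gamma>: "\<gamma> \<in> Hom fg_modules M M" "(M, M, f) \<cdot>\<^bsub>fg_modules\<^esub> \<gamma> = Idn fg_modules M"
      unfolding is_isomorphism_def by blast
    obtain g where "\<gamma> = (M, M, g)" using \<gamma>(1) fg_Hom by blast
    with \<gamma> have g: "(M, M, g) \<in> Hom fg_modules M M" "(M, M, f) \<cdot>\<^bsub>fg_modules\<^esub> (M, M, g) = Idn fg_modules M"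
      by simp_all
    have "g \<in> module_homs M M" using g(1) by (simp add: fg_Hom)
    then have gm: "g (e 1) \<in> carrier M" by (rule module_homsD(2)) (simp add: Ms(1))
    then obtain x where x: "g (e 1) = e x" unfolding Ms(1) by blast
    have c: "compose (carrier M) f g = (\<lambda>x\<in>carrier M. x)" using g(2) by simp
    have "f (g (e 1)) = e 1" using fun_cong[OF c, of "e 1"] Ms(1) by (simp add: compose_def)
    then have "scale k x = 1" unfolding x f using inj_eq[OF e] by simp
    then show False using k(2) by (metis rangeI)
  qed
  ultimately show ?thesis using M by (intro bexI[of _ M]) auto
qed

section \<open>Degenerations in bounded derived categories\<close>

theorem proposition25:
  fixes A :: "('o, 'a) cat"
    and scale :: "'k::idom \<Rightarrow> 'r::ring_1 \<Rightarrow> 'r"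
    and RM :: "(('r, 'm) module, ('r, 'm) module_arr) cat"
  assumes RM: "RM = fg_modules"
  shows
    "(abelian_category A \<longrightarrow>
        (\<forall>X Y. le_Delta_nil (Db A) Y X \<and> X \<in> heart A \<longrightarrow> Y \<in> heart A) \<and>
        ((\<exists>M\<in>Ob A. \<exists>f. is_mono A M M f \<and> \<not> is_isomorphism A M M f) \<longrightarrow>
           (\<exists>N X. zero_object (Db A) N \<and> X \<in> Ob (Db A) \<and>
              le_Delta (Db A) N X \<and> K0_class (Db A) X = \<one>\<^bsub>K0 (Db A)\<^esub> \<and>
              \<not> prec_Delta_nil (Db A) N X))) \<and>
     (algebra_over scale \<and> left_noetherian TYPE('r) \<and> torsion_free scale \<and>
      \<not> contains_fraction_field scale \<and> large_enough TYPE('r) TYPE('m) \<longrightarrow>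
        abelian_category RM \<and>
        (\<exists>M\<in>Ob RM. \<exists>f. is_mono RM M M f \<and> \<not> is_isomorphism RM M M f) \<and>
        (\<exists>N X. zero_object (Db RM) N \<and> X \<in> Ob (Db RM) \<and>
           le_Delta (Db RM) N X \<and> K0_class (Db RM) X = \<one>\<^bsub>K0 (Db RM)\<^esub> \<and>
           \<not> prec_Delta_nil (Db RM) N X))"
proof (intro conjI impI allI)
  assume A: "abelian_category A"
  then interpret abcat A by (rule abcat.intro)
  show "Y \<in> heart A" if "le_Delta_nil (Db A) Y X \<and> X \<in> heart A" for X Y
    using heart_closed_le_Delta_nil that by blast
  show "\<exists>N X. zero_object (Db A) N \<and> X \<in> Ob (Db A) \<and>
              le_Delta (Db A) N X \<and> K0_class (Db A) X = \<one>\<^bsub>K0 (Db A)\<^esub> \<and>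
              \<not> prec_Delta_nil (Db A) N X"
    if "\<exists>M\<in>Ob A. \<exists>f. is_mono A M M f \<and> \<not> is_isomorphism A M M f"
    using that ex_le_Delta_not_prec by blast
next
  assume a: "algebra_over scale \<and> left_noetherian TYPE('r) \<and> torsion_free scale \<and>
      \<not> contains_fraction_field scale \<and> large_enough TYPE('r) TYPE('m)"
  show ab: "abelian_category RM" unfolding RM using fg_modules_abelian a by blast
  then interpret abcat RM by (rule abcat.intro)
  show ex: "\<exists>M\<in>Ob RM. \<exists>f. is_mono RM M M f \<and> \<not> is_isomorphism RM M M f"
    unfolding RM using fg_modules_mono_not_iso a by blast
  show "\<exists>N X. zero_object (Db RM) N \<and> X \<in> Ob (Db RM) \<and>
           le_Delta (Db RM) N X \<and> K0_class (Db RM) X = \<one>\<^bsub>K0 (Db RM)\<^esub> \<and>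
           \<not> prec_Delta_nil (Db RM) N X"
    using ex ex_le_Delta_not_prec by blast
qed

end
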